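(* Let $d\ge 2$, let $W=W_1+W_2$ be a radial potential satisfying the assumptions (1)--(4) listed in the context, and suppose that for some $l\in\mathbb{N}\cup\{0\}$ $$\gamma>\bigl(l+\tfrac d2-1\bigr)^2 .$$ Let $\sigma=\sqrt{\gamma-(l+\frac d2-1)^2}$, and let $\sigma_l^{\mathrm{phy}}(\lambda)$ and $\sigma^{\mathrm{per}}$ be the phase shift and the periodic function defined in the context. The phase shift $\sigma_l^{\mathrm{phy}}(\lambda)$ can be chosen continuous in $\lambda\in\,]0,\infty[$, and for any such choice there exist $C_1,C_2\in\mathbb{R}$ such that $$\sigma_l^{\mathrm{phy}}(\lambda)+\sigma\ln\sqrt\lambda-\sigma^{\mathrm{per}}\bigl(\sigma\ln\sqrt\lambda+C_1\bigr)\to C_2\qquad\text{as }\lambda\downarrow 0 .$$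
   Context: Cutoff: $\chi(r>1)$ denotes a fixed real-valued $C^\infty$ function on $\mathbb{R}_+=]0,\infty[$ equal to $0$ for $r\le 1$ and $1$ for $r\ge 2$, chosen such that there is a real-valued smooth function $\chi(r<1)$ with $\chi(r>1)^2+\chi(r<1)^2=1$. Assumptions on $W$: (1) $W(r)=W_1(r)+W_2(r)$ with $W_1(r)=-\frac{\gamma}{r^2}\chi(r>1)$ for some $\gamma>0$; (2) $W_2\in C(]0,\infty[,\mathbb{R})$; (3) there are $\epsilon_1,c_1>0$ with $|W_2(r)|\le c_1r^{-2-\epsilon_1}$ for $r>1$; (4) there are $\epsilon_2,c_2>0$ with $|W_2(r)|\le c_2r^{\epsilon_2-2}$ for $r\le 1$. The operator $H=-\Delta+W(|x|)$ on $L^2(\mathbb{R}^d)$ is self-adjoint, defined via the Dirichlet form on $H^1(\mathbb{R}^d)$. $H_l$ is its reduced operator on $L^2(\mathbb{R}_+)$ corresponding to the eigenvalue $l(l+d-2)$ of the Laplace--Beltrami operator on $S^{d-1}$; it is the Friedrichs extension from $C_c^\infty(\mathbb{R}_+)$ of $$H_lu=-u''+(V_\infty+V)u,$$ $$V_\infty(r)=\tfrac{\nu^2-1/4}{r^2}\chi(r>1),\quad \nu^2=(l+\tfrac d2-1)^2-\gamma,\qquad V(r)=W_2(r)+\tfrac{(l+\frac d2-1)^2-1/4}{r^2}\bigl(1-\chi(r>1)\bigr).$$ For $\lambda>0$, a solution $u$ of $-u''+(V_\infty+V)u=\lambda u$ on $\mathbb{R}_+$ is regular if $r\mapsto\chi(r<1)u(r)$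 belongs to the domain $\mathcal D(H_l)$. A nonzero regular solution exists, is unique up to a constant factor, and can be taken real-valued. Phase shift: let $u_l$ be a nonzero real-valued regular solution of $-u''+(V_\infty+V)u=\lambda u$. There are real $C=C(\lambda)\neq0$ and $D_l=D_l(\lambda)\in\mathbb{R}$ with $$\lim_{r\to\infty}\bigl(u_l(r)-C\sin(\sqrt\lambda\, r+D_l)\bigr)=0 .$$ The phase shift is $\sigma_l^{\mathrm{phy}}(\lambda)=D_l+\frac{d-3+2l}{4}\pi$; it is a choice, for each $\lambda$, of a real number within the ambiguity of $D_l$. $\sigma^{\mathrm{per}}=\sigma^{\mathrm{per}}(t)$ is the continuous real-valued $2\pi$-periodic function determined by $\sigma^{\mathrm{per}}(0)=0$ and $$\mathrm{e}^{\pi\sigma}\mathrm{e}^{-\mathrm{i}t}-\mathrm{e}^{\mathrm{i}t}=r(t)\,\mathrm{e}^{\mathrm{i}(\sigma^{\mathrm{per}}(t)-t)},\qquad r(t)>0,\ t\in\mathbb{R}.$$ *)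

theory Defs
  imports "HOL-Analysis.Analysis"
begin

section \<open>Smooth functions\<close>

text \<open>\<open>C\<^sup>\<infinity>\<close> on an open set of reals: all iterated derivatives exist there.\<close>

definition smooth_on :: "real set \<Rightarrow> (real \<Rightarrow> 'a::real_normed_vector) \<Rightarrow> bool" where
  "smooth_on S f \<longleftrightarrow>
     (\<forall>n. \<forall>x\<in>S. ((\<lambda>g t. vector_derivative g (at t)) ^^ n) f differentiable (at x))"

definition test_functions :: "(real \<Rightarrow> complex) set" where
  "test_functions =
     {\<phi>. smooth_on UNIV \<phi> \<and> (\<exists>K. compact K \<and> K \<subseteq> {0<..} \<and> (\<forall>x. x \<notin> K \<longrightarrow> \<phi> x = 0))}"

section \<open>Square integrable functions and Friedrichs extensions\<close>

text \<open>
  Elements of \<open>L\<^sup>2(M)\<close> are represented by functions, not by classes modulo null sets;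
  the inner product is linear in its second argument.
\<close>

definition L2 :: "'a measure \<Rightarrow> ('a \<Rightarrow> complex) set" where
  "L2 M = {f. f \<in> borel_measurable M \<and> integrable M (\<lambda>x. (cmod (f x))\<^sup>2)}"

definition L2_inner :: "'a measure \<Rightarrow> ('a \<Rightarrow> complex) \<Rightarrow> ('a \<Rightarrow> complex) \<Rightarrow> complex" where
  "L2_inner M f g = (LINT x|M. cnj (f x) * g x)"

definition L2_norm :: "'a measure \<Rightarrow> ('a \<Rightarrow> complex) \<Rightarrow> real" where
  "L2_norm M f = sqrt (LINT x|M. (cmod (f x))\<^sup>2)"

text \<open>
  In the following, \<open>S\<close> is a symmetric operator on \<open>L\<^sup>2(M)\<close> that is bounded from below, with
  domain \<open>D\<close>. Its quadratic form is \<open>q(\<phi>, \<psi>) = \<langle>\<phi>, S \<psi>\<rangle>\<close> on \<open>D\<close>. Being semibounded, \<open>q\<close> is closable,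
  and the domain of the closure consists of the \<open>L\<^sup>2\<close>-limits of sequences in \<open>D\<close> that are
  \<open>q\<close>-Cauchy. Such sequences are described by \<open>form_converges\<close>.
\<close>

definition form_converges ::
    "'a measure \<Rightarrow> ('a \<Rightarrow> complex) set \<Rightarrow> (('a \<Rightarrow> complex) \<Rightarrow> ('a \<Rightarrow> complex))
      \<Rightarrow> (nat \<Rightarrow> 'a \<Rightarrow> complex) \<Rightarrow> ('a \<Rightarrow> complex) \<Rightarrow> bool" where
  "form_converges M D S \<phi> u \<longleftrightarrow>
     (\<forall>n. \<phi> n \<in> D) \<and>
     (\<lambda>n. L2_norm M (\<lambda>x. \<phi> n x - u x)) \<longlonglongrightarrow> 0 \<and>
     (\<forall>e>0. \<exists>N. \<forall>m\<ge>N. \<forall>n\<ge>N.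
        cmod (L2_inner M (\<lambda>x. \<phi> m x - \<phi> n x) (S (\<lambda>x. \<phi> m x - \<phi> n x))) < e)"

definition form_domain ::
    "'a measure \<Rightarrow> ('a \<Rightarrow> complex) set \<Rightarrow> (('a \<Rightarrow> complex) \<Rightarrow> ('a \<Rightarrow> complex))
      \<Rightarrow> ('a \<Rightarrow> complex) set" where
  "form_domain M D S = {u \<in> L2 M. \<exists>\<phi>. form_converges M D S \<phi> u}"

definition closed_form ::
    "'a measure \<Rightarrow> ('a \<Rightarrow> complex) set \<Rightarrow> (('a \<Rightarrow> complex) \<Rightarrow> ('a \<Rightarrow> complex))
      \<Rightarrow> ('a \<Rightarrow> complex) \<Rightarrow> ('a \<Rightarrow> complex) \<Rightarrow> complex" where
  "closed_form M D S u v =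
     (THE z. \<forall>\<phi> \<psi>. form_converges M D S \<phi> u \<longrightarrow> form_converges M D S \<psi> v
                 \<longrightarrow> (\<lambda>n. L2_inner M (\<phi> n) (S (\<psi> n))) \<longlonglongrightarrow> z)"

text \<open>
  The graph of the Friedrichs extension, i.e. of the self-adjoint operator associated with the
  closed form.
\<close>

definition friedrichs_extension ::
    "'a measure \<Rightarrow> ('a \<Rightarrow> complex) set \<Rightarrow> (('a \<Rightarrow> complex) \<Rightarrow> ('a \<Rightarrow> complex))
      \<Rightarrow> (('a \<Rightarrow> complex) \<times> ('a \<Rightarrow> complex)) set" where
  "friedrichs_extension M D S =
     {(u, f). u \<in> form_domain M D S \<and> f \<in> L2 M \<and>
              (\<forall>v\<in>form_domain M D S. closed_form M D S v u = L2_inner M v f)}"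

section \<open>The potential and the reduced operator\<close>

text \<open>
  \<open>chi\<close> and \<open>chi'\<close> stand for \<open>\<chi>(r>1)\<close> and \<open>\<chi>(r<1)\<close>. Throughout, only the values
  of functions on \<open>{0<..}\<close> are relevant.
\<close>

definition cutoff_pair :: "(real \<Rightarrow> real) \<Rightarrow> (real \<Rightarrow> real) \<Rightarrow> bool" where
  "cutoff_pair chi chi' \<longleftrightarrow>
     smooth_on {0<..} chi \<and> smooth_on {0<..} chi' \<and>
     (\<forall>r. 0 < r \<and> r \<le> 1 \<longrightarrow> chi r = 0) \<and>
     (\<forall>r\<ge>2. chi r = 1) \<and>
     (\<forall>r>0. (chi r)\<^sup>2 + (chi' r)\<^sup>2 = 1)"

definition W1 :: "real \<Rightarrow> (real \<Rightarrow> real) \<Rightarrow> real \<Rightarrow> real" where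
  "W1 \<gamma> chi r = - (\<gamma> / r\<^sup>2) * chi r"

definition admissible_potential ::
    "real \<Rightarrow> (real \<Rightarrow> real) \<Rightarrow> (real \<Rightarrow> real) \<Rightarrow> (real \<Rightarrow> real) \<Rightarrow> bool" where
  "admissible_potential \<gamma> chi W W2 \<longleftrightarrow>
     \<gamma> > 0 \<and> (\<forall>r>0. W r = W1 \<gamma> chi r + W2 r) \<and>
     continuous_on {0<..} W2 \<and>
     (\<exists>\<epsilon>\<^sub>1>0. \<exists>c\<^sub>1>0. \<forall>r>1. \<bar>W2 r\<bar> \<le> c\<^sub>1 * r powr (- 2 - \<epsilon>\<^sub>1)) \<and>
     (\<exists>\<epsilon>\<^sub>2>0. \<exists>c\<^sub>2>0. \<forall>r. 0 < r \<and> r \<le> 1 \<longrightarrow> \<bar>W2 r\<bar> \<le> c\<^sub>2 * r powr (\<epsilon>\<^sub>2 - 2))"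

definition ang :: "nat \<Rightarrow> nat \<Rightarrow> real" where
  "ang d l = real l + real d / 2 - 1"

definition nu_sq :: "nat \<Rightarrow> nat \<Rightarrow> real \<Rightarrow> real" where
  "nu_sq d l \<gamma> = (ang d l)\<^sup>2 - \<gamma>"

definition V_inf :: "nat \<Rightarrow> nat \<Rightarrow> real \<Rightarrow> (real \<Rightarrow> real) \<Rightarrow> real \<Rightarrow> real" where
  "V_inf d l \<gamma> chi r = (nu_sq d l \<gamma> - 1 / 4) / r\<^sup>2 * chi r"

definition V_rem :: "nat \<Rightarrow> nat \<Rightarrow> (real \<Rightarrow> real) \<Rightarrow> (real \<Rightarrow> real) \<Rightarrow> real \<Rightarrow> real" where
  "V_rem d l chi W2 r = W2 r + ((ang d l)\<^sup>2 - 1 / 4) / r\<^sup>2 * (1 - chi r)"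

lemma effective_potential_eq:
  assumes "admissible_potential \<gamma> chi W W2" and "r > 0"
  shows "V_inf d l \<gamma> chi r + V_rem d l chi W2 r = W r + ((ang d l)\<^sup>2 - 1 / 4) / r\<^sup>2"
proof -
  have "W r = W1 \<gamma> chi r + W2 r"
    using assms by (simp add: admissible_potential_def)
  then show ?thesis
    using \<open>r > 0\<close>
    by (simp add: V_inf_def V_rem_def nu_sq_def W1_def diff_divide_distrib add_divide_distrib algebra_simps)
qed

definition H_expr ::
    "nat \<Rightarrow> nat \<Rightarrow> real \<Rightarrow> (real \<Rightarrow> real) \<Rightarrow> (real \<Rightarrow> real) \<Rightarrow> (real \<Rightarrow> complex) \<Rightarrow> real \<Rightarrow> complex" where
  "H_expr d l \<gamma> chi W2 \<phi> r =
     - vector_derivative (\<lambda>t. vector_derivative \<phi> (at t)) (at r)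
     + of_real (V_inf d l \<gamma> chi r + V_rem d l chi W2 r) * \<phi> r"

definition H_op ::
    "nat \<Rightarrow> nat \<Rightarrow> real \<Rightarrow> (real \<Rightarrow> real) \<Rightarrow> (real \<Rightarrow> real)
      \<Rightarrow> ((real \<Rightarrow> complex) \<times> (real \<Rightarrow> complex)) set" where
  "H_op d l \<gamma> chi W2 =
     friedrichs_extension (lebesgue_on {0<..}) test_functions (H_expr d l \<gamma> chi W2)"

section \<open>Regular solutions and the phase shift\<close>

definition radial_solution ::
    "nat \<Rightarrow> nat \<Rightarrow> real \<Rightarrow> (real \<Rightarrow> real) \<Rightarrow> (real \<Rightarrow> real) \<Rightarrow> real \<Rightarrow> (real \<Rightarrow> real) \<Rightarrow> bool" where
  "radial_solution d l \<gamma> chi W2 E u \<longleftrightarrow>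
     (\<forall>r>0. u differentiable (at r) \<and> deriv u differentiable (at r) \<and>
        - deriv (deriv u) r + (V_inf d l \<gamma> chi r + V_rem d l chi W2 r) * u r = E * u r)"

definition regular_solution ::
    "nat \<Rightarrow> nat \<Rightarrow> real \<Rightarrow> (real \<Rightarrow> real) \<Rightarrow> (real \<Rightarrow> real) \<Rightarrow> (real \<Rightarrow> real)
      \<Rightarrow> real \<Rightarrow> (real \<Rightarrow> real) \<Rightarrow> bool" where
  "regular_solution d l \<gamma> chi chi' W2 E u \<longleftrightarrow>
     radial_solution d l \<gamma> chi W2 E u \<and>
     (\<lambda>r. complex_of_real (chi' r * u r)) \<in> Domain (H_op d l \<gamma> chi W2)"

text \<open>
  A real number \<open>s\<close> is an admissible value of the phase shift at energy \<open>E\<close>; admissible values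
  differ by integer multiples of \<open>\<pi>\<close>. As the regular solution is unique up to a constant
  factor, the set of admissible values does not depend on \<open>u\<close>.
\<close>

definition phase_shift_value ::
    "nat \<Rightarrow> nat \<Rightarrow> real \<Rightarrow> (real \<Rightarrow> real) \<Rightarrow> (real \<Rightarrow> real) \<Rightarrow> (real \<Rightarrow> real)
      \<Rightarrow> real \<Rightarrow> real \<Rightarrow> bool" where
  "phase_shift_value d l \<gamma> chi chi' W2 E s \<longleftrightarrow>
     (\<exists>u C D. regular_solution d l \<gamma> chi chi' W2 E u \<and> (\<exists>r>0. u r \<noteq> 0) \<and> C \<noteq> 0 \<and>
        ((\<lambda>r. u r - C * sin (sqrt E * r + D)) \<longlongrightarrow> 0) at_top \<and>
        s = D + (real d - 3 + 2 * real l) / 4 * pi)"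

definition phase_shift ::
    "nat \<Rightarrow> nat \<Rightarrow> real \<Rightarrow> (real \<Rightarrow> real) \<Rightarrow> (real \<Rightarrow> real) \<Rightarrow> (real \<Rightarrow> real)
      \<Rightarrow> (real \<Rightarrow> real) \<Rightarrow> bool" where
  "phase_shift d l \<gamma> chi chi' W2 \<sigma>phy \<longleftrightarrow>
     (\<forall>E>0. phase_shift_value d l \<gamma> chi chi' W2 E (\<sigma>phy E))"

definition sigma_per :: "real \<Rightarrow> real \<Rightarrow> real" where
  "sigma_per \<sigma> =
     (THE p. continuous_on UNIV p \<and> (\<forall>t. p (t + 2 * pi) = p t) \<and> p 0 = 0 \<and>
        (\<exists>\<rho>::real \<Rightarrow> real. \<forall>t. \<rho> t > 0 \<and>
           exp (of_real (pi * \<sigma>)) * exp (- \<i> * of_real t) - exp (\<i> * of_real t)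
             = of_real (\<rho> t) * exp (\<i> * of_real (p t - t))))"

end

theory Submission
  imports Defs "HOL-Real_Asymp.Real_Asymp"
begin

text \<open>
  Write \<open>k = sqrt E\<close>, \<open>\<mu> = l + d/2 - 1\<close>, and pass to the logarithmic variable \<open>t = ln r\<close> with
  \<open>u(r) = sqrt r * v(ln r)\<close>. The radial equation becomes \<open>v'' = (P(t) - E exp(2t)) v\<close>, where \<open>P\<close>
  tends to \<open>\<mu>\<^sup>2\<close> at minus infinity and to \<open>- \<sigma>\<^sup>2\<close> at plus infinity, both exponentially fast
  (\<open>log_potential_bounds\<close>). The energy enters only through \<open>E exp(2t)\<close>, so for small \<open>E\<close> there is a
  long intermediate range in which every solution oscillates like \<open>cos(\<sigma> t + const)\<close>, until
  \<open>k r\<close> is of order one. This range is the source of the logarithm in the statement.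

  Near \<open>r = 0\<close> a Volterra equation gives, for each \<open>E \<ge> 0\<close>, a solution \<open>v\<^sub>E\<close> that behaves like
  \<open>exp(\<mu> t)\<close> and depends continuously on \<open>E\<close> down to \<open>E = 0\<close> (\<open>regular_solution_family\<close>).

  For large \<open>t\<close> the comparison equation is \<open>j'' + (\<sigma>\<^sup>2 + E exp(2t)) j = 0\<close>, a Bessel equation of
  imaginary order. Let \<open>j\<^sub>E\<close> be its solution with \<open>j\<^sub>E(t) \<sim> exp(i \<sigma> t)\<close> at minus infinity. Variation of
  constants writes \<open>v\<^sub>E = 2 Re (b(t) j\<^sub>E)\<close>, and \<open>b(t)\<close> converges to a limit \<open>b(E) \<noteq> 0\<close> that is
  continuous on \<open>E \<ge> 0\<close> (\<open>amplitude_limit\<close>, \<open>amplitude_limit_continuous\<close>). The model scales: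
  \<open>j\<^sub>E(t) = exp(- i \<sigma> ln k) j\<^sub>1(t + ln k)\<close>. At infinity \<open>exp(s/2) j\<^sub>1(s)\<close> approaches
  \<open>A exp(i exp s) + B exp(- i exp s)\<close> with \<open>A = - i exp(\<pi>\<sigma>) B\<close> (\<open>jost_connection\<close>). So \<open>u\<^sub>E(r)\<close> is
  asymptotic to \<open>(2 / sqrt k) Re (z exp(i k r))\<close> with
  \<open>z = X - i exp(- \<pi>\<sigma>) cnj X\<close> and \<open>X = b(E) A exp(- i \<sigma> ln k)\<close>
  (\<open>solution_asymptotics\<close>, \<open>far_amplitude_alt\<close>), and up to a constant the phase shift is the argument
  of \<open>z\<close>. As \<open>z\<close> is continuous and has no zero, it has a continuous argument. If \<open>b(E)\<close> is
  replaced by \<open>b(0)\<close>, the argument becomes explicit: \<open>z\<close> is then a positive multiple of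
  \<open>exp(i\<pi>/4) (exp(- i \<tau>) - exp(- \<pi>\<sigma>) exp(i \<tau>))\<close> with \<open>\<tau> = \<sigma> ln k + C\<^sub>1\<close>, whose argument is
  \<open>\<pi>/4 + sigma_per \<sigma> \<tau> - \<tau>\<close> (\<open>far_amplitude_oscillation\<close>). The relative error of this replacement
  tends to zero with \<open>E\<close> (\<open>far_amplitude_ratio\<close>), so the expression in the theorem has a limit
  modulo \<open>\<pi>\<close>, and by continuity it has a limit (\<open>continuous_phase_converges\<close>).

  It remains to know that the \<open>u\<^sub>E\<close> are the regular solutions, i.e. those that lie locally in the
  domain of the Friedrichs extension. The point is the case \<open>\<mu> = 0\<close>, where all solutions are square
  integrable near \<open>0\<close>. That \<open>u\<^sub>E\<close>, which is \<open>O(sqrt r)\<close>, belongs to the domain is shown by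
  approximating it in energy with logarithmic cutoffs (\<open>bounded_solution_in_friedrichs_domain\<close>).
  Any other regular solution has vanishing Wronskian with it, by symmetry of the
  operator (\<open>wronskian_vanishes\<close>), hence a proportional amplitude.
\<close>

section \<open>Increments, primitives and Gronwall estimates\<close>

text \<open>
  The mean value inequality against a scalar majorant. Throughout, differential inequalities replace
  integrals: a function is controlled by exhibiting a primitive of a bound for its derivative.
\<close>

lemma increment_le_of_derivative_le:
  fixes F :: "real \<Rightarrow> 'a::real_normed_vector" and g :: "real \<Rightarrow> real"
  assumes "s \<le> t"
    and F: "\<And>x. s \<le> x \<Longrightarrow> x \<le> t \<Longrightarrow> (F has_vector_derivative f x) (at x)"
    and g: "\<And>x. s \<le> x \<Longrightarrow> x \<le> t \<Longrightarrow> (g has_real_derivative g' x) (at x)"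
    and le: "\<And>x. s \<le> x \<Longrightarrow> x \<le> t \<Longrightarrow> norm (f x) \<le> g' x"
  shows "norm (F t - F s) \<le> g t - g s"
proof (cases "s = t")
  case False
  with \<open>s \<le> t\<close> have "s < t" by simp
  then show ?thesis
  proof (rule differentiable_bound_general[where f' = f and \<phi>' = g'])
    show "continuous_on {s..t} F"
      using F by (intro continuous_at_imp_continuous_on ballI) (auto intro: has_vector_derivative_continuous)
    show "continuous_on {s..t} g"
      using g by (intro continuous_at_imp_continuous_on ballI) (auto intro: DERIV_isCont)
  qed (use F g le in \<open>auto simp: has_real_derivative_iff_has_vector_derivative\<close>)
qed simp

lemma converges_at_top_if_dominated:
  fixes h :: "real \<Rightarrow> 'a::banach" and g :: "real \<Rightarrow> real"
  assumes dom: "\<And>s t. T \<le> s \<Longrightarrow> s \<le> t \<Longrightarrow> norm (h t - h s) \<le> g t - g s"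
    and g: "(g \<longlongrightarrow> L) at_top"
  obtains l where "(h \<longlongrightarrow> l) at_top" "\<And>s. T \<le> s \<Longrightarrow> norm (l - h s) \<le> L - g s"
proof -
  define x where "x = (\<lambda>n::nat. T + real n)"
  have x: "filterlim x at_top sequentially"
    unfolding x_def by (intro filterlim_tendsto_add_at_top[OF tendsto_const] filterlim_real_sequentially)
  have gx: "(\<lambda>n. g (x n)) \<longlonglongrightarrow> L"
    using filterlim_compose[OF g x] by simp
  have "Cauchy (\<lambda>n. h (x n))"
  proof (rule metric_CauchyI)
    fix e :: real assume "e > 0"
    then obtain N where N: "\<And>m n. m \<ge> N \<Longrightarrow> n \<ge> N \<Longrightarrow> dist (g (x m)) (g (x n)) < e"
      using LIMSEQ_imp_Cauchy[OF gx] unfolding Cauchy_def by blast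
    have aux: "dist (h (x m)) (h (x n)) < e" if "m \<ge> N" "n \<ge> N" "m \<le> n" for m n
    proof -
      have "norm (h (x n) - h (x m)) \<le> g (x n) - g (x m)"
        by (rule dom) (use that in \<open>auto simp: x_def\<close>)
      also have "\<dots> < e"
        using N[of n m] that by (simp add: dist_real_def)
      finally show ?thesis by (simp add: dist_norm norm_minus_commute)
    qed
    then show "\<exists>M. \<forall>m\<ge>M. \<forall>n\<ge>M. dist (h (x m)) (h (x n)) < e"
      by (intro exI[of _ N]) (metis dist_commute nle_le)
  qed
  then obtain l where l: "(\<lambda>n. h (x n)) \<longlonglongrightarrow> l"
    using Cauchy_convergent convergent_def by blast
  have bound: "norm (l - h s) \<le> L - g s" if "T \<le> s" for s
  proof (rule tendsto_le[OF _ tendsto_diff[OF gx tendsto_const] tendsto_norm[OF tendsto_diff[OF l tendsto_const]]])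
    have "eventually (\<lambda>n. x n \<ge> s) sequentially"
      using x by (simp add: filterlim_at_top)
    then show "\<forall>\<^sub>F n in sequentially. norm (h (x n) - h s) \<le> g (x n) - g s"
      by eventually_elim (use dom that in auto)
  qed auto
  have "((\<lambda>s. norm (h s - l)) \<longlongrightarrow> 0) at_top"
  proof (rule tendsto_sandwich[OF _ _ tendsto_const])
    show "\<forall>\<^sub>F s in at_top. norm (h s - l) \<le> L - g s"
      using eventually_ge_at_top[of T] by eventually_elim (metis bound norm_minus_commute)
    show "((\<lambda>s. L - g s) \<longlongrightarrow> 0) at_top"
      using tendsto_diff[OF tendsto_const g, of L] by simp
  qed auto
  then have "(h \<longlongrightarrow> l) at_top"
    by (rule LIM_zero_cancel[OF tendsto_norm_zero_cancel])
  with bound show ?thesis using that by blast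
qed

lemma bounded_by_primitive_from_minus_infinity:
  fixes F :: "real \<Rightarrow> 'a::real_normed_vector" and g :: "real \<Rightarrow> real"
  assumes F: "\<And>x. (F has_vector_derivative f x) (at x)"
    and g: "\<And>x. (g has_real_derivative g' x) (at x)"
    and le: "\<And>x. norm (f x) \<le> g' x"
    and F0: "(F \<longlongrightarrow> 0) at_bot" and g0: "(g \<longlongrightarrow> 0) at_bot"
  shows "norm (F t) \<le> g t"
proof -
  have "norm (F t - 0) \<le> g t - 0"
  proof (rule tendsto_le[OF _ tendsto_diff[OF tendsto_const g0] tendsto_norm[OF tendsto_diff[OF tendsto_const F0]]])
    show "\<forall>\<^sub>F s in at_bot. norm (F t - F s) \<le> g t - g s"
      using eventually_le_at_bot[of t]
      by eventually_elim (rule increment_le_of_derivative_le, use F g le in auto)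
  qed auto
  then show ?thesis by simp
qed

text \<open>
  An improper integral from minus infinity: the majorant \<open>g\<close> makes an arbitrary primitive converge at
  minus infinity, and the limit is subtracted.
\<close>

lemma primitive_from_minus_infinity:
  fixes f :: "real \<Rightarrow> real" and g :: "real \<Rightarrow> real"
  assumes f: "continuous_on UNIV f"
    and g: "\<And>x. (g has_real_derivative g' x) (at x)"
    and le: "\<And>x. \<bar>f x\<bar> \<le> g' x"
    and g0: "(g \<longlongrightarrow> 0) at_bot"
  obtains F where "\<And>x. (F has_real_derivative f x) (at x)" "(F \<longlongrightarrow> 0) at_bot"
proof -
  have "\<exists>F. \<forall>x. (-\<infinity>::ereal) < ereal x \<longrightarrow> ereal x < \<infinity> \<longrightarrow> (F has_vector_derivative f x) (at x)"
    by (rule einterval_antiderivative) (use f in \<open>auto simp: continuous_on_eq_continuous_at\<close>)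
  then obtain F where F: "\<And>x. (F has_vector_derivative f x) (at x)" by auto
  obtain L where L: "((\<lambda>x. F (- x)) \<longlongrightarrow> L) at_top"
  proof (rule converges_at_top_if_dominated[where T = 0 and h = "\<lambda>x. F (- x)" and g = "\<lambda>x. - g (- x)"])
    fix s t :: real assume "0 \<le> s" "s \<le> t"
    then have "norm (F (- s) - F (- t)) \<le> g (- s) - g (- t)"
      by (intro increment_le_of_derivative_le[OF _ F g]) (use le in auto)
    then show "norm (F (- t) - F (- s)) \<le> - g (- t) - - g (- s)"
      by (simp add: norm_minus_commute)
  next
    show "((\<lambda>x. - g (- x)) \<longlongrightarrow> 0) at_top"
      using tendsto_minus[OF filterlim_compose[OF g0 filterlim_uminus_at_bot_at_top]] by simp
  qed
  have "(F \<longlongrightarrow> L) at_bot"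
    using L by (simp add: filterlim_at_bot_mirror)
  then have "((\<lambda>x. F x - L) \<longlongrightarrow> 0) at_bot"
    by (rule LIM_zero)
  moreover have "((\<lambda>x. F x - L) has_real_derivative f x) (at x)" for x
    using F[of x] by (auto simp: has_real_derivative_iff_has_vector_derivative intro!: derivative_eq_intros)
  ultimately show ?thesis using that by blast
qed

text \<open>
  The product \<open>\<Phi> exp(- k)\<close> is monotone.
\<close>

lemma gronwall_upper:
  fixes \<Phi> k :: "real \<Rightarrow> real"
  assumes "s \<le> t"
    and \<Phi>: "\<And>x. s \<le> x \<Longrightarrow> x \<le> t \<Longrightarrow> (\<Phi> has_real_derivative \<Phi>' x) (at x)"
    and k: "\<And>x. s \<le> x \<Longrightarrow> x \<le> t \<Longrightarrow> (k has_real_derivative k' x) (at x)"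
    and le: "\<And>x. s \<le> x \<Longrightarrow> x \<le> t \<Longrightarrow> \<Phi>' x \<le> k' x * \<Phi> x"
  shows "\<Phi> t \<le> \<Phi> s * exp (k t - k s)"
proof -
  have "\<Phi> t * exp (- k t) \<le> \<Phi> s * exp (- k s)"
  proof (rule DERIV_nonpos_imp_nonincreasing[OF \<open>s \<le> t\<close>])
    fix x assume x: "s \<le> x" "x \<le> t"
    have "((\<lambda>x. \<Phi> x * exp (- k x)) has_real_derivative (\<Phi>' x - k' x * \<Phi> x) * exp (- k x)) (at x)"
      by (auto intro!: derivative_eq_intros \<Phi>[OF x] k[OF x] simp: algebra_simps)
    moreover have "(\<Phi>' x - k' x * \<Phi> x) * exp (- k x) \<le> 0"
      using le[OF x] by (simp add: mult_le_0_iff)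
    ultimately show "\<exists>y. ((\<lambda>x. \<Phi> x * exp (- k x)) has_real_derivative y) (at x) \<and> y \<le> 0" by blast
  qed
  then have "\<Phi> t * exp (- k t) * exp (k t) \<le> \<Phi> s * exp (- k s) * exp (k t)"
    by (intro mult_right_mono) auto
  then show ?thesis by (simp add: mult.assoc exp_diff exp_minus field_simps flip: exp_add)
qed

lemma gronwall_lower:
  fixes \<Phi> k :: "real \<Rightarrow> real"
  assumes "s \<le> t"
    and \<Phi>: "\<And>x. s \<le> x \<Longrightarrow> x \<le> t \<Longrightarrow> (\<Phi> has_real_derivative \<Phi>' x) (at x)"
    and k: "\<And>x. s \<le> x \<Longrightarrow> x \<le> t \<Longrightarrow> (k has_real_derivative k' x) (at x)"
    and le: "\<And>x. s \<le> x \<Longrightarrow> x \<le> t \<Longrightarrow> - (k' x * \<Phi> x) \<le> \<Phi>' x"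
  shows "\<Phi> s \<le> \<Phi> t * exp (k t - k s)"
proof -
  have "- \<Phi> t \<le> - \<Phi> s * exp (- k t - - k s)"
  proof (rule gronwall_upper[where \<Phi> = "\<lambda>x. - \<Phi> x" and k = "\<lambda>x. - k x" and \<Phi>' = "\<lambda>x. - \<Phi>' x"
        and k' = "\<lambda>x. - k' x", OF assms(1) DERIV_minus[OF \<Phi>] DERIV_minus[OF k]])
    show "- \<Phi>' x \<le> - k' x * - \<Phi> x" if "s \<le> x" "x \<le> t" for x
      using le[OF that] by simp
  qed
  then have "\<Phi> s * exp (k s - k t) \<le> \<Phi> t" by simp
  then have "\<Phi> s * exp (k s - k t) * exp (k t - k s) \<le> \<Phi> t * exp (k t - k s)"
    by (intro mult_right_mono) auto
  then show ?thesis by (simp add: mult.assoc flip: exp_add)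
qed

lemma has_real_derivative_cmod_power2:
  assumes "(h has_vector_derivative h') (at x)"
  shows "((\<lambda>x. (cmod (h x))\<^sup>2) has_real_derivative 2 * Re (cnj (h x) * h')) (at x)"
proof -
  have 1: "((\<lambda>x. Re (h x)) has_real_derivative Re h') (at x)" "((\<lambda>x. Im (h x)) has_real_derivative Im h') (at x)"
    using assms by (auto simp: has_real_derivative_iff_has_vector_derivative
        intro: bounded_linear.has_vector_derivative[OF bounded_linear_Re] bounded_linear.has_vector_derivative[OF bounded_linear_Im])
  show ?thesis
    unfolding cmod_power2 using DERIV_add[OF DERIV_power[OF 1(1), of 2] DERIV_power[OF 1(2), of 2]]
    by (simp add: algebra_simps)
qed

section \<open>Solutions that are regular at minus infinity\<close>

definition weight_rate :: "real \<Rightarrow> real \<Rightarrow> real \<Rightarrow> real" where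
  "weight_rate b \<epsilon> t = b * (exp (\<epsilon> * t) + exp (2 * t))"

text \<open>
  The fixed point argument below uses the norm \<open>sup \<bar>y\<bar> / weight\<close>. The logarithmic derivative
  \<open>weight_rate\<close> of this weight has derivative \<open>weight_accel\<close>, which for large \<open>b\<close> dominates the coefficient
  \<open>P - \<mu>\<^sup>2 - E exp(2t)\<close>. Such a weight turns the Volterra operator into a contraction on the whole line.
\<close>

definition weight :: "real \<Rightarrow> real \<Rightarrow> real \<Rightarrow> real" where
  "weight b \<epsilon> t = exp (b * (exp (\<epsilon> * t) / \<epsilon> + exp (2 * t) / 2))"

definition weight_accel :: "real \<Rightarrow> real \<Rightarrow> real \<Rightarrow> real" where
  "weight_accel b \<epsilon> t = b * (\<epsilon> * exp (\<epsilon> * t) + 2 * exp (2 * t))"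

lemma weight_facts:
  assumes "b > 0" "\<epsilon> > 0"
  shows "weight b \<epsilon> t \<ge> 1" "weight_rate b \<epsilon> t > 0" "weight_accel b \<epsilon> t > 0"
    "(weight b \<epsilon> has_real_derivative weight_rate b \<epsilon> t * weight b \<epsilon> t) (at t)"
    "(weight_rate b \<epsilon> has_real_derivative weight_accel b \<epsilon> t) (at t)"
    "((\<lambda>t. weight b \<epsilon> t - 1) \<longlongrightarrow> 0) at_bot"
    "((\<lambda>t. weight_rate b \<epsilon> t * weight b \<epsilon> t) \<longlongrightarrow> 0) at_bot"
proof -
  show "weight b \<epsilon> t \<ge> 1" "weight_rate b \<epsilon> t > 0" "weight_accel b \<epsilon> t > 0"
    using assms by (auto simp: weight_def weight_rate_def weight_accel_def intro!: mult_pos_pos add_pos_pos add_nonneg_nonneg)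
  show "(weight b \<epsilon> has_real_derivative weight_rate b \<epsilon> t * weight b \<epsilon> t) (at t)"
    unfolding weight_def[abs_def] weight_rate_def using assms
    by (auto intro!: derivative_eq_intros simp: field_simps)
  show "(weight_rate b \<epsilon> has_real_derivative weight_accel b \<epsilon> t) (at t)"
    unfolding weight_rate_def[abs_def] weight_accel_def
    by (auto intro!: derivative_eq_intros simp: field_simps)
  have e: "((\<lambda>t. exp (c * t)) \<longlongrightarrow> 0) at_bot" if "c > 0" for c :: real
    by (rule filterlim_compose[OF exp_at_bot])
       (use that in \<open>auto intro!: filterlim_tendsto_pos_mult_at_bot[OF tendsto_const] filterlim_ident\<close>)
  have "((\<lambda>t. weight b \<epsilon> t) \<longlongrightarrow> exp (b * (0 / \<epsilon> + 0 / 2))) at_bot"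
    unfolding weight_def using assms by (intro tendsto_intros e) auto
  then have 1: "((\<lambda>t. weight b \<epsilon> t) \<longlongrightarrow> 1) at_bot" by simp
  show "((\<lambda>t. weight b \<epsilon> t - 1) \<longlongrightarrow> 0) at_bot"
    using tendsto_diff[OF 1 tendsto_const, of 1] by simp
  have "((\<lambda>t. weight_rate b \<epsilon> t * weight b \<epsilon> t) \<longlongrightarrow> (b * (0 + 0)) * 1) at_bot"
    unfolding weight_rate_def using assms by (intro tendsto_intros e 1) auto
  then show "((\<lambda>t. weight_rate b \<epsilon> t * weight b \<epsilon> t) \<longlongrightarrow> 0) at_bot"
    by simp
qed

lemma exp_mult_tendsto_0_at_bot:
  fixes g :: "real \<Rightarrow> real"
  assumes "\<mu> \<ge> 0" "(g \<longlongrightarrow> 0) at_bot"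
  shows "((\<lambda>t. exp (\<mu> * t) * g t) \<longlongrightarrow> 0) at_bot"
proof (rule tendsto_0_le[OF assms(2), where K = 1])
  show "\<forall>\<^sub>F x in at_bot. norm (exp (\<mu> * x) * g x) \<le> norm (g x) * 1"
    using eventually_le_at_bot[of 0]
    by eventually_elim (use assms(1) in \<open>auto simp: abs_mult mult_nonneg_nonpos intro!: mult_left_le_one_le\<close>)
qed

text \<open>
  A function \<open>R\<close> of size \<open>weight_accel * weight\<close> stays below the derivative of \<open>weight_rate * weight\<close>. This
  remains true after multiplication by the integrating factor \<open>exp(2\<mu>t)\<close>, which only increases the derivative.
\<close>

lemma weighted_majorant:
  fixes R :: "real \<Rightarrow> real"
  assumes "b > 0" "\<epsilon> > 0" "\<mu> \<ge> 0" "a \<ge> 0"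
  defines "g \<equiv> \<lambda>t. a * (exp (2 * \<mu> * t) * (weight_rate b \<epsilon> t * weight b \<epsilon> t))"
    and "g' \<equiv> \<lambda>x. a * (2 * \<mu> * exp (2 * \<mu> * x) * (weight_rate b \<epsilon> x * weight b \<epsilon> x)
          + exp (2 * \<mu> * x) * (weight_accel b \<epsilon> x * weight b \<epsilon> x
          + weight_rate b \<epsilon> x * (weight_rate b \<epsilon> x * weight b \<epsilon> x)))"
  shows "(g has_real_derivative g' x) (at x)" "(g \<longlongrightarrow> 0) at_bot"
    "\<bar>R x\<bar> \<le> a * weight_accel b \<epsilon> x * weight b \<epsilon> x \<Longrightarrow> \<bar>exp (2 * \<mu> * x) * R x\<bar> \<le> g' x"
proof -
  note W = weight_facts[OF assms(1,2)]
  show "(g has_real_derivative g' x) (at x)"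
    unfolding g_def g'_def by (auto intro!: derivative_eq_intros W(4,5) simp: algebra_simps)
  show "(g \<longlongrightarrow> 0) at_bot"
    unfolding g_def
    using tendsto_mult_left[OF exp_mult_tendsto_0_at_bot[OF _ W(7), of "2 * \<mu>"], of a] assms(3) by simp
  assume R: "\<bar>R x\<bar> \<le> a * weight_accel b \<epsilon> x * weight b \<epsilon> x"
  have "\<bar>exp (2 * \<mu> * x) * R x\<bar> \<le> exp (2 * \<mu> * x) * (a * weight_accel b \<epsilon> x * weight b \<epsilon> x)"
    using R by (simp add: abs_mult)
  also have "\<dots> = a * (0 + exp (2 * \<mu> * x) * (weight_accel b \<epsilon> x * weight b \<epsilon> x + 0))"
    by simp
  also have "\<dots> \<le> g' x"
    unfolding g'_def using W(1-3)[of x] assms(3,4)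
    by (intro mult_left_mono add_mono mult_nonneg_nonneg) (auto intro: less_imp_le)
  finally show "\<bar>exp (2 * \<mu> * x) * R x\<bar> \<le> g' x" .
qed

lemma weighted_apriori_bound:
  fixes z w R :: "real \<Rightarrow> real"
  assumes "b > 0" "\<epsilon> > 0" "\<mu> \<ge> 0" "a \<ge> 0"
    and z: "\<And>t. (z has_real_derivative w t) (at t)"
    and w: "\<And>t. ((\<lambda>t. exp (2 * \<mu> * t) * w t) has_real_derivative exp (2 * \<mu> * t) * R t) (at t)"
    and R: "\<And>t. \<bar>R t\<bar> \<le> a * weight_accel b \<epsilon> t * weight b \<epsilon> t"
    and w0: "((\<lambda>t. exp (2 * \<mu> * t) * w t) \<longlongrightarrow> 0) at_bot" and z0: "(z \<longlongrightarrow> 0) at_bot"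
  shows "\<bar>w t\<bar> \<le> a * weight_rate b \<epsilon> t * weight b \<epsilon> t" "\<bar>z t\<bar> \<le> a * weight b \<epsilon> t"
proof -
  note W = weight_facts[OF assms(1,2)]
  have w_bound: "\<bar>w t\<bar> \<le> a * (weight_rate b \<epsilon> t * weight b \<epsilon> t)" for t
  proof -
    let ?g = "\<lambda>t. a * (exp (2 * \<mu> * t) * (weight_rate b \<epsilon> t * weight b \<epsilon> t))"
    have "norm (exp (2 * \<mu> * t) * w t) \<le> ?g t"
    proof (rule bounded_by_primitive_from_minus_infinity[where f = "\<lambda>x. exp (2 * \<mu> * x) * R x"
          and F = "\<lambda>t. exp (2 * \<mu> * t) * w t" and g = ?g])
      show "((\<lambda>t. exp (2 * \<mu> * t) * w t) has_vector_derivative exp (2 * \<mu> * x) * R x) (at x)" for x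
        using w by (simp add: has_real_derivative_iff_has_vector_derivative)
      show "norm (exp (2 * \<mu> * x) * R x) \<le> a * (2 * \<mu> * exp (2 * \<mu> * x) * (weight_rate b \<epsilon> x * weight b \<epsilon> x)
          + exp (2 * \<mu> * x) * (weight_accel b \<epsilon> x * weight b \<epsilon> x
          + weight_rate b \<epsilon> x * (weight_rate b \<epsilon> x * weight b \<epsilon> x)))" for x
        unfolding real_norm_def by (rule weighted_majorant(3)[OF assms(1-4) R])
      show "(?g has_real_derivative a * (2 * \<mu> * exp (2 * \<mu> * x) * (weight_rate b \<epsilon> x * weight b \<epsilon> x)
          + exp (2 * \<mu> * x) * (weight_accel b \<epsilon> x * weight b \<epsilon> x
          + weight_rate b \<epsilon> x * (weight_rate b \<epsilon> x * weight b \<epsilon> x)))) (at x)" for x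
        by (rule weighted_majorant(1)[OF assms(1-4)])
      show "(?g \<longlongrightarrow> 0) at_bot"
        by (rule weighted_majorant(2)[OF assms(1-4)])
    qed (use w0 in auto)
    then show ?thesis by (simp add: abs_mult algebra_simps)
  qed
  show "\<bar>w t\<bar> \<le> a * weight_rate b \<epsilon> t * weight b \<epsilon> t"
    using w_bound[of t] by (simp add: algebra_simps)
  have "norm (z t) \<le> a * (weight b \<epsilon> t - 1)"
  proof (rule bounded_by_primitive_from_minus_infinity[where f = w and F = z and g = "\<lambda>t. a * (weight b \<epsilon> t - 1)"])
    show "(z has_vector_derivative w x) (at x)" for x
      using z by (simp add: has_real_derivative_iff_has_vector_derivative)
    show "((\<lambda>t. a * (weight b \<epsilon> t - 1)) has_real_derivative a * (weight_rate b \<epsilon> x * weight b \<epsilon> x)) (at x)" for x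
      by (auto intro!: derivative_eq_intros W(4))
    show "((\<lambda>t. a * (weight b \<epsilon> t - 1)) \<longlongrightarrow> 0) at_bot"
      using tendsto_mult_left[OF W(6), of a] by simp
  qed (use w_bound z0 in auto)
  also have "\<dots> \<le> a * weight b \<epsilon> t"
    using assms by (simp add: mult_left_mono)
  finally show "\<bar>z t\<bar> \<le> a * weight b \<epsilon> t" by simp
qed

text \<open>
  The solution of \<open>z'' + 2\<mu> z' = R\<close> with \<open>z\<close> vanishing at minus infinity, written as a system with
  \<open>w = z'\<close> and the integrating factor \<open>exp(2\<mu>t)\<close>. If \<open>v = exp(\<mu>t) y\<close>, the equation \<open>v'' = (\<mu>\<^sup>2 + Q) v\<close>
  is \<open>y'' + 2\<mu> y' = Q y\<close>. The form is free of divisions by \<open>\<mu>\<close>, so that \<open>\<mu> = 0\<close> needs no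
  separate treatment.
\<close>

definition integrates :: "real \<Rightarrow> (real \<Rightarrow> real) \<Rightarrow> (real \<Rightarrow> real) \<Rightarrow> (real \<Rightarrow> real) \<Rightarrow> bool" where
  "integrates \<mu> R z w \<longleftrightarrow>
     (\<forall>t. (z has_real_derivative w t) (at t)) \<and>
     (\<forall>t. ((\<lambda>t. exp (2 * \<mu> * t) * w t) has_real_derivative exp (2 * \<mu> * t) * R t) (at t)) \<and>
     ((\<lambda>t. exp (2 * \<mu> * t) * w t) \<longlongrightarrow> 0) at_bot \<and> (z \<longlongrightarrow> 0) at_bot"

lemma weighted_integration:
  fixes R :: "real \<Rightarrow> real"
  assumes "b > 0" "\<epsilon> > 0" "\<mu> \<ge> 0" "a \<ge> 0" and cont: "continuous_on UNIV R"
    and R: "\<And>t. \<bar>R t\<bar> \<le> a * weight_accel b \<epsilon> t * weight b \<epsilon> t"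
  shows "\<exists>z w. integrates \<mu> R z w"
proof -
  note W = weight_facts[OF assms(1,2)]
  let ?g = "\<lambda>t. a * (exp (2 * \<mu> * t) * (weight_rate b \<epsilon> t * weight b \<epsilon> t))"
  note g = weighted_majorant(1)[OF assms(1-4)]
  note g0 = weighted_majorant(2)[OF assms(1-4)]
  note le = weighted_majorant(3)[OF assms(1-4), where R = R, OF R]
  have "continuous_on UNIV (\<lambda>x. exp (2 * \<mu> * x) * R x)"
    by (intro continuous_intros cont)
  then obtain F where F: "\<And>x. (F has_real_derivative exp (2 * \<mu> * x) * R x) (at x)" "(F \<longlongrightarrow> 0) at_bot"
    using primitive_from_minus_infinity[OF _ g le g0] by blast
  define w where "w = (\<lambda>t. exp (- (2 * \<mu> * t)) * F t)"
  have wF: "(\<lambda>t. exp (2 * \<mu> * t) * w t) = F"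
    by (simp add: w_def mult_exp_exp flip: mult.assoc exp_add)
  have Fb: "\<bar>F t\<bar> \<le> ?g t" for t
    using bounded_by_primitive_from_minus_infinity[where F = F and f = "\<lambda>x. exp (2 * \<mu> * x) * R x", OF _ g _ F(2) g0]
      F(1) le by (simp add: has_real_derivative_iff_has_vector_derivative)
  have wb: "\<bar>w t\<bar> \<le> a * (weight_rate b \<epsilon> t * weight b \<epsilon> t)" for t
  proof -
    have "\<bar>w t\<bar> \<le> exp (- (2 * \<mu> * t)) * ?g t"
      unfolding w_def abs_mult using Fb[of t] by simp
    also have "\<dots> = a * (weight_rate b \<epsilon> t * weight b \<epsilon> t)"
      by (simp add: exp_minus field_simps)
    finally show ?thesis .
  qed
  have wc: "continuous_on UNIV w"
    unfolding w_def using F(1)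
    by (intro continuous_intros) (auto intro: DERIV_isCont continuous_at_imp_continuous_on)
  have "((\<lambda>t. a * (weight b \<epsilon> t - 1)) has_real_derivative a * (weight_rate b \<epsilon> x * weight b \<epsilon> x)) (at x)" for x
    by (auto intro!: derivative_eq_intros W(4))
  moreover have "((\<lambda>t. a * (weight b \<epsilon> t - 1)) \<longlongrightarrow> 0) at_bot"
    using tendsto_mult_left[OF W(6), of a] by simp
  ultimately obtain z where "\<And>x. (z has_real_derivative w x) (at x)" "(z \<longlongrightarrow> 0) at_bot"
    using primitive_from_minus_infinity[OF wc _ wb] by blast
  then have "integrates \<mu> R z w"
    using F by (simp add: wF integrates_def)
  then show ?thesis by blast
qed

lemma integrates_combine:
  assumes "integrates \<mu> R1 z1 w1" "integrates \<mu> R2 z2 w2"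
  shows "integrates \<mu> (\<lambda>t. R1 t - R2 t) (\<lambda>t. z1 t - z2 t) (\<lambda>t. w1 t - w2 t)"
  unfolding integrates_def
proof (intro conjI allI)
  show "((\<lambda>t. z1 t - z2 t) has_real_derivative w1 t - w2 t) (at t)" for t
    using assms by (auto simp: integrates_def intro!: derivative_intros)
  have "((\<lambda>t. exp (2 * \<mu> * t) * w1 t - exp (2 * \<mu> * t) * w2 t)
      has_real_derivative exp (2 * \<mu> * t) * R1 t - exp (2 * \<mu> * t) * R2 t) (at t)" for t
    using assms by (auto simp: integrates_def intro!: DERIV_diff)
  then show "((\<lambda>t. exp (2 * \<mu> * t) * (w1 t - w2 t)) has_real_derivative exp (2 * \<mu> * t) * (R1 t - R2 t)) (at t)" for t
    by (simp add: right_diff_distrib)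
  have "((\<lambda>t. exp (2 * \<mu> * t) * w1 t - exp (2 * \<mu> * t) * w2 t) \<longlongrightarrow> 0 - 0) at_bot"
    using assms unfolding integrates_def by (intro tendsto_diff) auto
  then show "((\<lambda>t. exp (2 * \<mu> * t) * (w1 t - w2 t)) \<longlongrightarrow> 0) at_bot"
    by (simp add: right_diff_distrib)
  have "((\<lambda>t. z1 t - z2 t) \<longlongrightarrow> 0 - 0) at_bot"
    using assms unfolding integrates_def by (intro tendsto_diff) auto
  then show "((\<lambda>t. z1 t - z2 t) \<longlongrightarrow> 0) at_bot" by simp
qed

lemma integrates_bound:
  assumes "b > 0" "\<epsilon> > 0" "\<mu> \<ge> 0" "a \<ge> 0" "integrates \<mu> R z w"
    and "\<And>t. \<bar>R t\<bar> \<le> a * weight_accel b \<epsilon> t * weight b \<epsilon> t"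
  shows "\<bar>w t\<bar> \<le> a * weight_rate b \<epsilon> t * weight b \<epsilon> t" "\<bar>z t\<bar> \<le> a * weight b \<epsilon> t"
  using weighted_apriori_bound[OF assms(1-4), of z w R] assms(5,6) unfolding integrates_def by auto

text \<open>
  Banach's fixed point theorem for \<open>y \<mapsto> 1 + z\<close>, where \<open>z'' + 2\<mu> z' = Q y\<close>, in the space of
  functions \<open>weight * g\<close> with \<open>g\<close> bounded and continuous. The bound on \<open>Q\<close> gives the contraction factor \<open>1/4\<close>.
\<close>

lemma volterra_solution_exists:
  fixes Q :: "real \<Rightarrow> real"
  assumes "b > 0" "\<epsilon> > 0" "\<mu> \<ge> 0" and cont: "continuous_on UNIV Q"
    and Q: "\<And>t. \<bar>Q t\<bar> \<le> weight_accel b \<epsilon> t / 4"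
  obtains y w N where "integrates \<mu> (\<lambda>t. Q t * y t) (\<lambda>t. y t - 1) w" "N \<ge> 0" "\<And>t. \<bar>y t\<bar> \<le> N * weight b \<epsilon> t"
proof -
  note W = weight_facts[OF assms(1,2)]
  have contw: "continuous_on UNIV (weight b \<epsilon>)"
    using W(4) by (auto intro: DERIV_isCont continuous_at_imp_continuous_on)
  define R where "R = (\<lambda>g :: real \<Rightarrow>\<^sub>C real. \<lambda>t. Q t * (weight b \<epsilon> t * apply_bcontfun g t))"
  have Rb: "\<bar>Q t * (weight b \<epsilon> t * h)\<bar> \<le> a / 4 * weight_accel b \<epsilon> t * weight b \<epsilon> t"
    if "\<bar>h\<bar> \<le> a" for h t a :: real
  proof -
    have "\<bar>Q t * (weight b \<epsilon> t * h)\<bar> = \<bar>Q t\<bar> * (weight b \<epsilon> t * \<bar>h\<bar>)"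
      using W(1)[of t] by (simp add: abs_mult)
    also have "\<dots> \<le> weight_accel b \<epsilon> t / 4 * (weight b \<epsilon> t * a)"
      using W(1,3)[of t] that Q[of t] by (intro mult_mono mult_nonneg_nonneg) auto
    finally show ?thesis by (simp add: algebra_simps)
  qed
  have "\<exists>z w. integrates \<mu> (R g) z w" for g
  proof -
    have 1: "continuous_on UNIV (R g)"
      unfolding R_def by (intro continuous_intros cont contw continuous_on_apply_bcontfun)
    have 2: "\<bar>R g t\<bar> \<le> norm g / 4 * weight_accel b \<epsilon> t * weight b \<epsilon> t" for t
      unfolding R_def using Rb norm_bounded[of g t] by simp
    show ?thesis
      by (rule weighted_integration[OF assms(1-3) _ 1 2]) simp
  qed
  then obtain Z V where ZV: "\<And>g. integrates \<mu> (R g) (Z g) (V g)" by metis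
  have Zbound: "\<bar>Z g t\<bar> \<le> norm g / 4 * weight b \<epsilon> t" for g t
    by (rule integrates_bound(2)[OF assms(1-3) _ ZV])
       (use Rb norm_bounded[of g] in \<open>auto simp: R_def\<close>)
  define \<Phi> where "\<Phi> = (\<lambda>g. Bcontfun (\<lambda>t. (1 + Z g t) / weight b \<epsilon> t))"
  have \<Phi>: "apply_bcontfun (\<Phi> g) t = (1 + Z g t) / weight b \<epsilon> t" for g t
  proof -
    have "(\<lambda>t. (1 + Z g t) / weight b \<epsilon> t) \<in> bcontfun"
    proof (rule bcontfun_normI)
      have "continuous_on UNIV (Z g)"
        using ZV[of g] unfolding integrates_def by (auto intro: DERIV_isCont continuous_at_imp_continuous_on)
      then show "continuous_on UNIV (\<lambda>t. (1 + Z g t) / weight b \<epsilon> t)"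
        by (intro continuous_intros contw) (auto, metis W(1) not_one_le_zero)
      fix t
      have "\<bar>1 + Z g t\<bar> \<le> weight b \<epsilon> t + norm g / 4 * weight b \<epsilon> t"
        using Zbound[of g t] W(1)[of t] by linarith
      then show "norm ((1 + Z g t) / weight b \<epsilon> t) \<le> 1 + norm g / 4"
        using W(1)[of t] by (simp add: abs_mult field_simps)
    qed
    then show ?thesis unfolding \<Phi>_def by (simp add: Bcontfun_inverse)
  qed
  have "\<exists>!g. \<Phi> g = g"
  proof (rule banach_fix_type[where c = "1/4"])
    show "\<forall>g h. dist (\<Phi> g) (\<Phi> h) \<le> 1 / 4 * dist g h"
    proof (intro allI dist_bound)
      fix g h t
      have "\<bar>Z g t - Z h t\<bar> \<le> dist g h / 4 * weight b \<epsilon> t"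
      proof (rule integrates_bound(2)[OF assms(1-3) _ integrates_combine[OF ZV ZV]])
        fix t
        have "\<bar>apply_bcontfun g t - apply_bcontfun h t\<bar> \<le> dist g h"
          using dist_bounded[of g t h] by (simp add: dist_real_def)
        from Rb[OF this, of t] show "\<bar>R g t - R h t\<bar> \<le> dist g h / 4 * weight_accel b \<epsilon> t * weight b \<epsilon> t"
          by (simp add: R_def algebra_simps)
      qed auto
      then have "\<bar>(Z g t - Z h t) / weight b \<epsilon> t\<bar> \<le> dist g h / 4"
        using W(1)[of t] by (simp add: field_simps)
      then show "dist (apply_bcontfun (\<Phi> g) t) (apply_bcontfun (\<Phi> h) t) \<le> 1 / 4 * dist g h"
        by (simp add: \<Phi> dist_real_def diff_divide_distrib add_divide_distrib)
    qed
  qed auto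
  then obtain g where g: "\<Phi> g = g" by blast
  define y where "y = (\<lambda>t. weight b \<epsilon> t * apply_bcontfun g t)"
  have "y t = 1 + Z g t" for t
    using \<Phi>[of g t] W(1)[of t] unfolding y_def g by simp
  then have "Z g = (\<lambda>t. y t - 1)" by auto
  moreover have "R g = (\<lambda>t. Q t * y t)" by (simp add: R_def y_def)
  ultimately have "integrates \<mu> (\<lambda>t. Q t * y t) (\<lambda>t. y t - 1) (V g)"
    using ZV[of g] by simp
  moreover have "\<bar>y t\<bar> \<le> norm g * weight b \<epsilon> t" for t
    using norm_bounded[of g t] W(1)[of t] by (simp add: y_def abs_mult mult.commute mult_right_mono)
  ultimately show ?thesis using that norm_ge_zero by blast
qed

text \<open>
  The difference \<open>d\<close> of the two solutions is itself an integral of \<open>Q1 d + (Q1 - Q2) y2\<close>. With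
  \<open>S\<close> the weighted supremum of \<open>\<bar>d\<bar>\<close> this yields \<open>S \<le> S / 4 + a N2\<close>, whence \<open>S \<le> 2 a N2\<close>.
\<close>

lemma volterra_solution_stability:
  fixes Q1 Q2 :: "real \<Rightarrow> real"
  assumes b: "b > 0" "\<epsilon> > 0" "\<mu> \<ge> 0" "a \<ge> 0"
    and 1: "integrates \<mu> (\<lambda>t. Q1 t * y1 t) (\<lambda>t. y1 t - 1) w1"
    and 2: "integrates \<mu> (\<lambda>t. Q2 t * y2 t) (\<lambda>t. y2 t - 1) w2"
    and Q1: "\<And>t. \<bar>Q1 t\<bar> \<le> weight_accel b \<epsilon> t / 4"
    and Q2: "\<And>t. \<bar>Q1 t - Q2 t\<bar> \<le> a * weight_accel b \<epsilon> t"
    and y1: "\<And>t. \<bar>y1 t\<bar> \<le> N1 * weight b \<epsilon> t"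
    and y2: "\<And>t. \<bar>y2 t\<bar> \<le> N2 * weight b \<epsilon> t" and "N2 \<ge> 0"
  shows "\<bar>y1 t - y2 t\<bar> \<le> 2 * a * N2 * weight b \<epsilon> t"
    "\<bar>w1 t - w2 t\<bar> \<le> 2 * a * N2 * weight_rate b \<epsilon> t * weight b \<epsilon> t"
proof -
  note W = weight_facts[OF b(1,2)]
  define d where "d = (\<lambda>t. y1 t - y2 t)"
  have I: "integrates \<mu> (\<lambda>t. Q1 t * d t + (Q1 t - Q2 t) * y2 t) d (\<lambda>t. w1 t - w2 t)"
    using integrates_combine[OF 1 2] by (simp add: d_def algebra_simps)
  have R: "\<bar>Q1 t * d t + (Q1 t - Q2 t) * y2 t\<bar> \<le> (M / 4 + a * N2) * weight_accel b \<epsilon> t * weight b \<epsilon> t"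
    if "\<bar>d t\<bar> \<le> M * weight b \<epsilon> t" for t M
  proof -
    have "\<bar>Q1 t * d t + (Q1 t - Q2 t) * y2 t\<bar> \<le> \<bar>Q1 t\<bar> * \<bar>d t\<bar> + \<bar>Q1 t - Q2 t\<bar> * \<bar>y2 t\<bar>"
      by (metis abs_mult abs_triangle_ineq)
    also have "\<dots> \<le> weight_accel b \<epsilon> t / 4 * (M * weight b \<epsilon> t) + a * weight_accel b \<epsilon> t * (N2 * weight b \<epsilon> t)"
      using that W(3)[of t] b Q1[of t] Q2[of t] y2[of t] by (intro add_mono mult_mono) auto
    finally show ?thesis by (simp add: algebra_simps)
  qed
  define S where "S = (SUP t. \<bar>d t\<bar> / weight b \<epsilon> t)"
  have "\<bar>d t\<bar> / weight b \<epsilon> t \<le> N1 + N2" for t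
  proof -
    have "\<bar>d t\<bar> \<le> N1 * weight b \<epsilon> t + N2 * weight b \<epsilon> t"
      unfolding d_def using y1[of t] y2[of t] by linarith
    then show ?thesis using W(1)[of t] by (simp add: field_simps)
  qed
  then have bdd: "bdd_above (range (\<lambda>t. \<bar>d t\<bar> / weight b \<epsilon> t))"
    by (meson bdd_aboveI2)
  have dS: "\<bar>d t\<bar> \<le> S * weight b \<epsilon> t" for t
    using cSUP_upper[OF _ bdd, of t] W(1)[of t] by (simp add: S_def field_simps)
  have "S \<ge> 0"
    using cSUP_upper2[OF bdd, of 0 0] W(1)[of 0] by (simp add: S_def)
  then have nn: "S / 4 + a * N2 \<ge> 0" using \<open>N2 \<ge> 0\<close> b by simp
  note B = integrates_bound[OF b(1-3) nn I R[OF dS]]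
  have "S \<le> S / 4 + a * N2"
    unfolding S_def
  proof (rule cSUP_least)
    fix t show "\<bar>d t\<bar> / weight b \<epsilon> t \<le> (SUP t. \<bar>d t\<bar> / weight b \<epsilon> t) / 4 + a * N2"
      using B(2)[of t] W(1)[of t] by (simp add: field_simps flip: S_def)
  qed simp
  then have le: "S / 4 + a * N2 \<le> 2 * a * N2" using mult_nonneg_nonneg[OF b(4) \<open>N2 \<ge> 0\<close>] by linarith
  have "\<bar>d t\<bar> \<le> (S / 4 + a * N2) * weight b \<epsilon> t" by (rule B(2))
  also have "\<dots> \<le> 2 * a * N2 * weight b \<epsilon> t"
    using le W(1)[of t] by (intro mult_right_mono) auto
  finally show "\<bar>y1 t - y2 t\<bar> \<le> 2 * a * N2 * weight b \<epsilon> t" by (simp add: d_def)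
  have "\<bar>w1 t - w2 t\<bar> \<le> (S / 4 + a * N2) * weight_rate b \<epsilon> t * weight b \<epsilon> t" by (rule B(1))
  also have "\<dots> \<le> 2 * a * N2 * weight_rate b \<epsilon> t * weight b \<epsilon> t"
    using le W(1,2)[of t] by (intro mult_right_mono) auto
  finally show "\<bar>w1 t - w2 t\<bar> \<le> 2 * a * N2 * weight_rate b \<epsilon> t * weight b \<epsilon> t" .
qed

text \<open>
  The solution is \<open>v = exp(\<mu>t) y\<close>, where \<open>y\<close> tends to 1 at minus infinity. It is locally Lipschitz in \<open>E\<close>
  by the stability estimate, up to and including \<open>E = 0\<close>.
\<close>

lemma regular_solution_family:
  fixes P :: "real \<Rightarrow> real"
  assumes "\<mu> \<ge> 0" "0 < \<epsilon>" "\<epsilon> \<le> 2" "c \<ge> 0" and cont: "continuous_on UNIV P"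
    and P: "\<And>t. \<bar>P t - \<mu>\<^sup>2\<bar> \<le> c * (exp (\<epsilon> * t) + exp (2 * t))"
  obtains v v' :: "real \<Rightarrow> real \<Rightarrow> real" where
    "\<And>E t. E \<ge> 0 \<Longrightarrow> (v E has_real_derivative v' E t) (at t)"
    "\<And>E t. E \<ge> 0 \<Longrightarrow> (v' E has_real_derivative (P t - E * exp (2 * t)) * v E t) (at t)"
    "\<And>E. E \<ge> 0 \<Longrightarrow> \<exists>M. \<forall>t\<le>0. \<bar>v E t\<bar> \<le> M"
    "\<And>E. E \<ge> 0 \<Longrightarrow> \<exists>t. v E t \<noteq> 0"
    "\<And>t. continuous_on {0..} (\<lambda>E. v E t)" "\<And>t. continuous_on {0..} (\<lambda>E. v' E t)"
proof -
  define Q where "Q = (\<lambda>E t. P t - \<mu>\<^sup>2 - E * exp (2 * t))"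
  (* large enough for weight_accel / 4 to dominate Q E; the summand 1 keeps it positive *)
  define bb where "bb = (\<lambda>E. 4 * (c + E + 1) / \<epsilon>)"
  have bb: "bb E > 0" if "E \<ge> 0" for E
    using that assms by (simp add: bb_def)
  have Qc: "continuous_on UNIV (Q E)" for E
    unfolding Q_def by (intro continuous_intros cont)
  have Qb: "\<bar>Q E t\<bar> \<le> weight_accel (bb F) \<epsilon> t / 4" if "0 \<le> E" "E \<le> F" for E F t
  proof -
    define x1 where "x1 = exp (\<epsilon> * t)"
    define x2 where "x2 = exp (2 * t)"
    have x: "x1 > 0" "x2 > 0" by (simp_all add: x1_def x2_def)
    have "\<bar>Q E t\<bar> \<le> \<bar>P t - \<mu>\<^sup>2\<bar> + \<bar>E * x2\<bar>"
      unfolding Q_def x2_def by (rule abs_triangle_ineq4)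
    also have "\<dots> \<le> c * (x1 + x2) + E * x2"
      using P[of t] that x by (simp add: x1_def x2_def)
    also have "\<dots> \<le> (c + E + 1) * (x1 + x2)"
      using that x mult_nonneg_nonneg[of E x1] by (simp add: ring_distribs)
    also have "\<dots> \<le> (c + F + 1) * (x1 + (2 / \<epsilon>) * x2)"
    proof (intro mult_mono add_mono)
      have "1 \<le> 2 / \<epsilon>" using assms by simp
      then show "x2 \<le> (2 / \<epsilon>) * x2" using x by (metis mult_right_mono mult_1 less_imp_le)
    qed (use that x assms in auto)
    also have "\<dots> = weight_accel (bb F) \<epsilon> t / 4"
      using assms unfolding weight_accel_def bb_def x1_def[symmetric] x2_def[symmetric]
      by (simp add: field_simps)
    finally show ?thesis .
  qed
  define sol where "sol = (\<lambda>E (y, w, N). integrates \<mu> (\<lambda>t. Q E t * y t) (\<lambda>t. y t - 1) w \<and> N \<ge> 0 \<and>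
      (\<forall>t. \<bar>y t\<bar> \<le> N * weight (bb E) \<epsilon> t))"
  have "\<exists>p. sol E p" if E: "E \<ge> 0" for E
    by (rule volterra_solution_exists[OF bb[OF E] assms(2,1) Qc Qb[OF E order_refl]])
       (auto simp: sol_def)
  then have "\<forall>E\<in>{0..}. \<exists>p. sol E p" by auto
  then obtain p where p: "\<And>E. E \<ge> 0 \<Longrightarrow> sol E (p E)" by (metis atLeast_iff)
  define y where "y = (\<lambda>E. fst (p E))"
  define w where "w = (\<lambda>E. fst (snd (p E)))"
  define N where "N = (\<lambda>E. snd (snd (p E)))"
  have I: "integrates \<mu> (\<lambda>t. Q E t * y E t) (\<lambda>t. y E t - 1) (w E)" if "E \<ge> 0" for E
    using p[OF that] by (auto simp: sol_def y_def w_def split: prod.splits)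
  have N: "N E \<ge> 0" if "E \<ge> 0" for E
    using p[OF that] by (auto simp: sol_def N_def split: prod.splits)
  have y: "\<bar>y E t\<bar> \<le> N E * weight (bb E) \<epsilon> t" if "E \<ge> 0" for E t
    using p[OF that] by (auto simp: sol_def y_def N_def split: prod.splits)
  have dy: "(y E has_real_derivative w E t) (at t)" if "E \<ge> 0" for E t
  proof -
    have "((\<lambda>t. (y E t - 1) + 1) has_real_derivative w E t + 0) (at t)"
      using I[OF that] unfolding integrates_def by (intro DERIV_add) auto
    then show ?thesis by simp
  qed
  have dw: "(w E has_real_derivative - 2 * \<mu> * w E t + Q E t * y E t) (at t)" if "E \<ge> 0" for E t
  proof -
    have 1: "((\<lambda>t. exp (- 2 * \<mu> * t)) has_real_derivative - 2 * \<mu> * exp (- 2 * \<mu> * t)) (at t)"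
      by (auto intro!: derivative_eq_intros)
    have 2: "((\<lambda>t. exp (2 * \<mu> * t) * w E t) has_real_derivative exp (2 * \<mu> * t) * (Q E t * y E t)) (at t)"
      using I[OF that] unfolding integrates_def by blast
    have e: "exp (- 2 * \<mu> * t) * exp (2 * \<mu> * t) = 1"
      by (simp flip: exp_add)
    have "- 2 * \<mu> * exp (- 2 * \<mu> * t) * (exp (2 * \<mu> * t) * w E t) +
        exp (2 * \<mu> * t) * (Q E t * y E t) * exp (- 2 * \<mu> * t) =
        (exp (- 2 * \<mu> * t) * exp (2 * \<mu> * t)) * (- 2 * \<mu> * w E t + Q E t * y E t)"
      by (simp only: ring_distribs mult_ac)
    then have "((\<lambda>t. exp (- 2 * \<mu> * t) * (exp (2 * \<mu> * t) * w E t)) has_real_derivative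
        - 2 * \<mu> * w E t + Q E t * y E t) (at t)"
      using DERIV_mult[OF 1 2] unfolding e by simp
    moreover have "(\<lambda>t. exp (- 2 * \<mu> * t) * (exp (2 * \<mu> * t) * w E t)) = w E"
      by (rule ext) (simp add: mult.assoc[symmetric] flip: exp_add)
    ultimately show ?thesis by simp
  qed
  have bb_mono: "bb E \<le> bb F" if "E \<le> F" for E F
    unfolding bb_def using that assms by (intro divide_right_mono mult_left_mono) auto
  have mono: "weight (bb E) \<epsilon> t \<le> weight (bb F) \<epsilon> t" if "E \<le> F" for E F t
    unfolding weight_def using bb_mono[OF that] assms(2)
    by (intro iffD2[OF exp_le_cancel_iff] mult_right_mono) (auto intro!: add_nonneg_nonneg)
  have stab: "\<exists>K. \<forall>E\<in>{0..E0 + 1}. \<bar>y E t - y E0 t\<bar> \<le> K * \<bar>E - E0\<bar> \<and> \<bar>w E t - w E0 t\<bar> \<le> K * \<bar>E - E0\<bar>"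
    if E0: "E0 \<ge> 0" for E0 t
  proof -
    (* one weight for all energies up to E0 + 1, so that the stability estimate is uniform there *)
    let ?b = "bb (E0 + 1)"
    have b: "?b > 0" using bb E0 by simp
    note W = weight_facts[OF b assms(2)]
    have b2: "?b \<ge> 1"
      using E0 assms by (simp add: bb_def field_simps)
    show ?thesis
    proof (intro exI[of _ "2 * N E0 * weight ?b \<epsilon> t * (1 + weight_rate ?b \<epsilon> t)"] ballI)
      fix E assume E: "E \<in> {0..E0 + 1}"
      have *: "\<bar>Q E t - Q E0 t\<bar> \<le> \<bar>E - E0\<bar> * weight_accel ?b \<epsilon> t" for t
      proof -
        have "\<bar>Q E t - Q E0 t\<bar> = \<bar>E - E0\<bar> * exp (2 * t)"
          by (simp add: Q_def flip: left_diff_distrib) (simp add: abs_mult abs_minus_commute)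
        also have "exp (2 * t) \<le> weight_accel ?b \<epsilon> t"
        proof -
          have "1 * exp (2 * t) \<le> ?b * (\<epsilon> * exp (\<epsilon> * t) + 2 * exp (2 * t))"
            using b2 assms by (intro mult_mono) (auto intro: add_increasing)
          then show ?thesis by (simp add: weight_accel_def)
        qed
        finally show ?thesis by (simp add: mult_left_mono)
      qed
      have y1: "\<bar>y E t\<bar> \<le> N E * weight ?b \<epsilon> t" for t
        using y[of E t] mult_left_mono[OF mono[of E "E0 + 1" t] N[of E]] E by force
      have y2: "\<bar>y E0 t\<bar> \<le> N E0 * weight ?b \<epsilon> t" for t
        using y[of E0 t] mult_left_mono[OF mono[of E0 "E0 + 1" t] N[of E0]] E0 by force
      have S: "\<bar>y E t - y E0 t\<bar> \<le> 2 * \<bar>E - E0\<bar> * N E0 * weight ?b \<epsilon> t"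
        "\<bar>w E t - w E0 t\<bar> \<le> 2 * \<bar>E - E0\<bar> * N E0 * weight_rate ?b \<epsilon> t * weight ?b \<epsilon> t"
        using volterra_solution_stability[OF b assms(2,1) _ I I Qb * y1 y2 N] E E0 by auto
      have nn: "2 * \<bar>E - E0\<bar> * N E0 * weight ?b \<epsilon> t \<ge> 0"
        "2 * \<bar>E - E0\<bar> * N E0 * weight_rate ?b \<epsilon> t * weight ?b \<epsilon> t \<ge> 0"
        using N[OF E0] W(1,2)[of t] by auto
      have eq: "2 * N E0 * weight ?b \<epsilon> t * (1 + weight_rate ?b \<epsilon> t) * \<bar>E - E0\<bar> =
        2 * \<bar>E - E0\<bar> * N E0 * weight ?b \<epsilon> t + 2 * \<bar>E - E0\<bar> * N E0 * weight_rate ?b \<epsilon> t * weight ?b \<epsilon> t"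
        by (simp add: algebra_simps)
      show "\<bar>y E t - y E0 t\<bar> \<le> 2 * N E0 * weight ?b \<epsilon> t * (1 + weight_rate ?b \<epsilon> t) * \<bar>E - E0\<bar> \<and>
        \<bar>w E t - w E0 t\<bar> \<le> 2 * N E0 * weight ?b \<epsilon> t * (1 + weight_rate ?b \<epsilon> t) * \<bar>E - E0\<bar>"
        unfolding eq using S nn by linarith
    qed
  qed
  have lipcont: "continuous_on {0..} f"
    if "\<And>E0. E0 \<ge> 0 \<Longrightarrow> \<exists>K. \<forall>E\<in>{0..E0 + 1}. \<bar>f E - f E0\<bar> \<le> K * \<bar>E - E0\<bar>" for f :: "real \<Rightarrow> real"
    unfolding continuous_on_def
  proof
    fix E0 :: real assume "E0 \<in> {0..}"
    then have "\<exists>K. \<forall>E\<in>{0..E0 + 1}. \<bar>f E - f E0\<bar> \<le> K * \<bar>E - E0\<bar>" by (intro that) simp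
    then obtain K where K: "\<forall>E\<in>{0..E0 + 1}. \<bar>f E - f E0\<bar> \<le> K * \<bar>E - E0\<bar>" ..
    have "((\<lambda>E. f E - f E0) \<longlongrightarrow> 0) (at E0 within {0..})"
    proof (rule Lim_null_comparison)
      have "((\<lambda>E. K * \<bar>E - E0\<bar>) \<longlongrightarrow> K * \<bar>E0 - E0\<bar>) (at E0 within {0..})"
        by (intro tendsto_intros)
      then show "((\<lambda>E. K * \<bar>E - E0\<bar>) \<longlongrightarrow> 0) (at E0 within {0..})" by simp
      have "\<forall>\<^sub>F E in at E0 within {0..}. E < E0 + 1"
        by (rule order_tendstoD[OF tendsto_ident_at]) simp
      moreover have "\<forall>\<^sub>F E in at E0 within {0..}. E \<in> {0..}"
        by (simp add: eventually_at_filter)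
      ultimately show "\<forall>\<^sub>F E in at E0 within {0..}. norm (f E - f E0) \<le> K * \<bar>E - E0\<bar>"
        by eventually_elim (use K in auto)
    qed
    then show "(f \<longlongrightarrow> f E0) (at E0 within {0..})" by (rule LIM_zero_cancel)
  qed
  have cy: "continuous_on {0..} (\<lambda>E. y E t)" for t
    by (rule lipcont) (use stab in meson)
  have cw: "continuous_on {0..} (\<lambda>E. w E t)" for t
    by (rule lipcont) (use stab in meson)
  define v where "v = (\<lambda>E t. exp (\<mu> * t) * y E t)"
  define v' where "v' = (\<lambda>E t. exp (\<mu> * t) * (\<mu> * y E t + w E t))"
  show ?thesis
  proof (rule that[of v v'])
    fix E t :: real assume E: "E \<ge> 0"
    show "(v E has_real_derivative v' E t) (at t)"
      unfolding v_def v'_def using dy[OF E, of t] by (auto intro!: derivative_eq_intros simp: algebra_simps)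
    show "(v' E has_real_derivative (P t - E * exp (2 * t)) * v E t) (at t)"
      unfolding v_def v'_def using dy[OF E, of t] dw[OF E, of t]
      by (auto intro!: derivative_eq_intros simp: algebra_simps Q_def power2_eq_square)
  next
    fix E :: real assume E: "E \<ge> 0"
    show "\<exists>M. \<forall>t\<le>0. \<bar>v E t\<bar> \<le> M"
    proof (intro exI allI impI)
      fix t :: real assume "t \<le> 0"
      have "exp (\<mu> * t) \<le> 1" using assms(1) \<open>t \<le> 0\<close> by (simp add: mult_nonneg_nonpos)
      moreover have "weight (bb E) \<epsilon> t \<le> weight (bb E) \<epsilon> 0"
        unfolding weight_def using \<open>t \<le> 0\<close> assms(2) bb[OF E]
        by (auto intro!: mult_left_mono add_mono divide_right_mono simp: mult_nonneg_nonpos)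
      then have "\<bar>y E t\<bar> \<le> N E * weight (bb E) \<epsilon> 0"
        using y[OF E, of t] mult_left_mono[OF _ N[OF E]] by force
      ultimately have "exp (\<mu> * t) * \<bar>y E t\<bar> \<le> 1 * (N E * weight (bb E) \<epsilon> 0)"
        by (intro mult_mono) auto
      then show "\<bar>v E t\<bar> \<le> N E * weight (bb E) \<epsilon> 0"
        by (simp add: v_def abs_mult)
    qed
    have "((\<lambda>t. y E t - 1) \<longlongrightarrow> 0) at_bot" using I[OF E] by (simp add: integrates_def)
    then have "(y E \<longlongrightarrow> 1) at_bot" by (rule LIM_zero_cancel)
    then have "\<forall>\<^sub>F t in at_bot. y E t > 0" by (rule order_tendstoD) simp
    then obtain t where "y E t > 0" using eventually_happens'[OF trivial_limit_at_bot_linorder] by blast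
    then show "\<exists>t. v E t \<noteq> 0" unfolding v_def by (intro exI[of _ t]) simp
  next
    show "continuous_on {0..} (\<lambda>E. v E t)" "continuous_on {0..} (\<lambda>E. v' E t)" for t
      unfolding v_def v'_def by (intro continuous_intros cy cw)+
  qed
qed

section \<open>The Bessel model equation\<close>

text \<open>
  The normalized Bessel series of order \<open>i\<sigma>\<close>: up to a constant factor, \<open>bessel_series \<sigma> (x\<^sup>2)\<close> is
  \<open>J\<^sub>i\<^sub>\<sigma>(x)\<close> divided by \<open>exp(i \<sigma> ln x)\<close>. Being entire in \<open>x\<^sup>2\<close>, it can be evaluated at energy zero.
\<close>

fun bessel_coeff :: "real \<Rightarrow> nat \<Rightarrow> complex" where
  "bessel_coeff \<sigma> 0 = 1"
| "bessel_coeff \<sigma> (Suc n) = - bessel_coeff \<sigma> n / (4 * of_nat (Suc n) * (of_nat (Suc n) + \<i> * of_real \<sigma>))"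

definition bessel_series :: "real \<Rightarrow> complex \<Rightarrow> complex" where
  "bessel_series \<sigma> w = (\<Sum>n. bessel_coeff \<sigma> n * w ^ n)"

definition bessel_series' :: "real \<Rightarrow> complex \<Rightarrow> complex" where
  "bessel_series' \<sigma> w = (\<Sum>n. diffs (bessel_coeff \<sigma>) n * w ^ n)"

definition bessel_series'' :: "real \<Rightarrow> complex \<Rightarrow> complex" where
  "bessel_series'' \<sigma> w = (\<Sum>n. diffs (diffs (bessel_coeff \<sigma>)) n * w ^ n)"

lemma bessel_denominator_bound: "cmod (4 * of_nat (Suc n) * (of_nat (Suc n) + \<i> * of_real \<sigma>)) \<ge> real (Suc n)"
proof -
  have "1 * real (Suc n) \<le> (4 * real (Suc n)) * cmod (of_nat (Suc n) + \<i> * of_real \<sigma>)"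
  proof (rule mult_mono)
    have "real (Suc n) = Re (of_nat (Suc n) + \<i> * of_real \<sigma>)" by simp
    also have "\<dots> \<le> cmod (of_nat (Suc n) + \<i> * of_real \<sigma>)" by (rule complex_Re_le_cmod)
    finally show "real (Suc n) \<le> cmod (of_nat (Suc n) + \<i> * of_real \<sigma>)" .
  qed auto
  moreover have "cmod (4 * of_nat (Suc n)) = 4 * real (Suc n)"
    by (simp only: norm_mult norm_of_nat) simp
  ultimately show ?thesis by (simp only: norm_mult) simp
qed

lemma bessel_coeff_bound: "cmod (bessel_coeff \<sigma> n) \<le> 1 / fact n"
proof (induction n)
  case (Suc n)
  have "cmod (bessel_coeff \<sigma> (Suc n)) = cmod (bessel_coeff \<sigma> n) / cmod (4 * of_nat (Suc n) * (of_nat (Suc n) + \<i> * of_real \<sigma>))"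
    by (simp only: bessel_coeff.simps norm_divide norm_minus_cancel)
  also have "\<dots> \<le> (1 / fact n) / real (Suc n)"
    by (intro frac_le Suc bessel_denominator_bound) auto
  finally show ?case by (simp add: field_simps)
qed simp

lemma summable_bessel: "summable (\<lambda>n. bessel_coeff \<sigma> n * w ^ n)"
proof (rule summable_comparison_test')
  show "summable (\<lambda>n. inverse (fact n) * (cmod w) ^ n)" by (rule summable_exp)
  show "norm (bessel_coeff \<sigma> n * w ^ n) \<le> inverse (fact n) * (cmod w) ^ n" for n
    using mult_right_mono[OF bessel_coeff_bound[of \<sigma> n], of "cmod w ^ n"]
    by (simp add: norm_mult norm_power inverse_eq_divide)
qed

lemma summable_bessel': "summable (\<lambda>n. diffs (bessel_coeff \<sigma>) n * w ^ n)"
  by (rule termdiff_converges_all) (rule summable_bessel)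

lemma summable_bessel'': "summable (\<lambda>n. diffs (diffs (bessel_coeff \<sigma>)) n * w ^ n)"
  by (rule termdiff_converges_all) (rule summable_bessel')

lemma bessel_series_deriv: "(bessel_series \<sigma> has_field_derivative bessel_series' \<sigma> w) (at w)"
  unfolding bessel_series_def[abs_def] bessel_series'_def
  by (rule termdiffs_strong_converges_everywhere) (rule summable_bessel)

lemma bessel_series'_deriv: "(bessel_series' \<sigma> has_field_derivative bessel_series'' \<sigma> w) (at w)"
  unfolding bessel_series'_def[abs_def] bessel_series''_def
  by (rule termdiffs_strong_converges_everywhere) (rule summable_bessel')

lemma bessel_series_0: "bessel_series \<sigma> 0 = 1"
  unfolding bessel_series_def by (simp add: powser_zero[of "bessel_coeff \<sigma>", simplified])

lemma bessel_series_ode: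
  "4 * w * bessel_series'' \<sigma> w + 4 * (1 + \<i> * of_real \<sigma>) * bessel_series' \<sigma> w + bessel_series \<sigma> w = 0"
proof -
  let ?c = "bessel_coeff \<sigma>"
  have "(\<lambda>n. diffs (diffs ?c) n * w ^ n * w) sums (bessel_series'' \<sigma> w * w)"
    unfolding bessel_series''_def by (intro sums_mult2 summable_sums summable_bessel'')
  moreover have "diffs (diffs ?c) n * w ^ n * w = of_nat (Suc n) * diffs ?c (Suc n) * w ^ (Suc n)" for n
    by (simp add: diffs_def)
  ultimately have "(\<lambda>n. of_nat (Suc n) * diffs ?c (Suc n) * w ^ (Suc n)) sums (bessel_series'' \<sigma> w * w)"
    by simp
  then have s2: "(\<lambda>n. of_nat n * diffs ?c n * w ^ n) sums (bessel_series'' \<sigma> w * w)"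
    by (subst (asm) sums_Suc_iff) simp
  have s1: "(\<lambda>n. diffs ?c n * w ^ n) sums bessel_series' \<sigma> w"
    unfolding bessel_series'_def by (intro summable_sums summable_bessel')
  have s0: "(\<lambda>n. ?c n * w ^ n) sums bessel_series \<sigma> w"
    unfolding bessel_series_def by (intro summable_sums summable_bessel)
  have "(\<lambda>n. 4 * (of_nat n * diffs ?c n * w ^ n) + 4 * (1 + \<i> * of_real \<sigma>) * (diffs ?c n * w ^ n) + ?c n * w ^ n)
    sums (4 * (bessel_series'' \<sigma> w * w) + 4 * (1 + \<i> * of_real \<sigma>) * bessel_series' \<sigma> w + bessel_series \<sigma> w)"
    by (intro sums_add sums_mult s0 s1 s2)
  moreover have "4 * (of_nat n * diffs ?c n * w ^ n) + 4 * (1 + \<i> * of_real \<sigma>) * (diffs ?c n * w ^ n) + ?c n * w ^ n = 0" for n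
  proof -
    have nz: "4 * of_nat (Suc n) * (of_nat (Suc n) + \<i> * of_real \<sigma>) \<noteq> 0"
    proof
      assume "4 * of_nat (Suc n) * (of_nat (Suc n) + \<i> * of_real \<sigma>) = 0"
      with bessel_denominator_bound[of n \<sigma>] show False by (metis norm_zero of_nat_0_less_iff not_le zero_less_Suc)
    qed
    have "diffs ?c n * (4 * (of_nat (Suc n) + \<i> * of_real \<sigma>)) = - ?c n"
      using nz by (simp add: diffs_def field_simps del: of_nat_Suc)
    moreover have "4 * (of_nat n * diffs ?c n * w ^ n) + 4 * (1 + \<i> * of_real \<sigma>) * (diffs ?c n * w ^ n) + ?c n * w ^ n
      = (diffs ?c n * (4 * (of_nat (Suc n) + \<i> * of_real \<sigma>)) + ?c n) * w ^ n"
      by (simp add: algebra_simps)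
    ultimately show ?thesis by simp
  qed
  ultimately have "(\<lambda>n. 0) sums (4 * (bessel_series'' \<sigma> w * w) + 4 * (1 + \<i> * of_real \<sigma>) * bessel_series' \<sigma> w + bessel_series \<sigma> w)"
    by simp
  then have "0 = 4 * (bessel_series'' \<sigma> w * w) + 4 * (1 + \<i> * of_real \<sigma>) * bessel_series' \<sigma> w + bessel_series \<sigma> w"
    using sums_zero sums_unique2 by blast
  then show ?thesis by (simp add: mult_ac)
qed

lemma bessel_coeff_cnj: "bessel_coeff (- \<sigma>) n = cnj (bessel_coeff \<sigma> n)"
  by (induction n) auto

lemma bessel_series_cnj: "bessel_series (- \<sigma>) w = cnj (bessel_series \<sigma> (cnj w))"
proof -
  have "(\<lambda>n. cnj (bessel_coeff \<sigma> n * cnj w ^ n)) sums cnj (bessel_series \<sigma> (cnj w))"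
    unfolding bessel_series_def sums_cnj by (intro summable_sums summable_bessel)
  then have "(\<lambda>n. bessel_coeff (- \<sigma>) n * w ^ n) sums cnj (bessel_series \<sigma> (cnj w))"
    by (simp add: bessel_coeff_cnj)
  from sums_unique[OF this] show ?thesis unfolding bessel_series_def[of "- \<sigma>"] by simp
qed

lemma bessel_series'_cnj: "bessel_series' (- \<sigma>) w = cnj (bessel_series' \<sigma> (cnj w))"
proof -
  have "diffs (bessel_coeff (- \<sigma>)) n = cnj (diffs (bessel_coeff \<sigma>) n)" for n
    by (simp add: diffs_def bessel_coeff_cnj del: bessel_coeff.simps)
  moreover have "(\<lambda>n. cnj (diffs (bessel_coeff \<sigma>) n * cnj w ^ n)) sums cnj (bessel_series' \<sigma> (cnj w))"
    unfolding bessel_series'_def sums_cnj by (intro summable_sums summable_bessel')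
  ultimately have "(\<lambda>n. diffs (bessel_coeff (- \<sigma>)) n * w ^ n) sums cnj (bessel_series' \<sigma> (cnj w))"
    by simp
  from sums_unique[OF this] show ?thesis unfolding bessel_series'_def[of "- \<sigma>"] by simp
qed

text \<open>
  The solution of \<open>j'' + (\<sigma>\<^sup>2 + E exp(2\<zeta>)) j = 0\<close> that behaves like \<open>exp(i \<sigma> \<zeta>)\<close> at minus infinity. The
  variable is complex because the connection formula is obtained by moving off the real line.
\<close>

definition model :: "real \<Rightarrow> real \<Rightarrow> complex \<Rightarrow> complex" where
  "model \<sigma> E \<zeta> = exp (\<i> * of_real \<sigma> * \<zeta>) * bessel_series \<sigma> (of_real E * exp (2 * \<zeta>))"

definition model' :: "real \<Rightarrow> real \<Rightarrow> complex \<Rightarrow> complex" where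
  "model' \<sigma> E \<zeta> = exp (\<i> * of_real \<sigma> * \<zeta>) * (\<i> * of_real \<sigma> * bessel_series \<sigma> (of_real E * exp (2 * \<zeta>))
     + 2 * (of_real E * exp (2 * \<zeta>)) * bessel_series' \<sigma> (of_real E * exp (2 * \<zeta>)))"

lemma model_deriv: "(model \<sigma> E has_field_derivative model' \<sigma> E \<zeta>) (at \<zeta>)"
proof -
  have 1: "((\<lambda>\<zeta>. of_real E * exp (2 * \<zeta>)) has_field_derivative 2 * (of_real E * exp (2 * \<zeta>))) (at \<zeta>)"
    by (auto intro!: derivative_eq_intros)
  note 2 = DERIV_chain2[OF bessel_series_deriv[of \<sigma>] 1]
  have 3: "((\<lambda>\<zeta>. exp (\<i> * of_real \<sigma> * \<zeta>)) has_field_derivative exp (\<i> * of_real \<sigma> * \<zeta>) * (\<i> * of_real \<sigma>)) (at \<zeta>)"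
    by (auto intro!: derivative_eq_intros)
  show ?thesis
    unfolding model_def[abs_def] model'_def using DERIV_mult[OF 3 2] by (simp add: algebra_simps)
qed

lemma model'_deriv:
  "(model' \<sigma> E has_field_derivative - (of_real (\<sigma>\<^sup>2) + of_real E * exp (2 * \<zeta>)) * model \<sigma> E \<zeta>) (at \<zeta>)"
proof -
  define w where "w = of_real E * exp (2 * \<zeta>)"
  define e where "e = exp (\<i> * of_real \<sigma> * \<zeta>)"
  define g g' g'' where "g = bessel_series \<sigma> w" and "g' = bessel_series' \<sigma> w" and "g'' = bessel_series'' \<sigma> w"
  have 1: "((\<lambda>\<zeta>. of_real E * exp (2 * \<zeta>)) has_field_derivative 2 * w) (at \<zeta>)"
    by (auto intro!: derivative_eq_intros simp: w_def)
  have 2: "((\<lambda>\<zeta>. bessel_series \<sigma> (of_real E * exp (2 * \<zeta>))) has_field_derivative g' * (2 * w)) (at \<zeta>)"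
    using DERIV_chain2[OF bessel_series_deriv[of \<sigma>] 1] by (simp add: g'_def w_def)
  have d2: "((\<lambda>\<zeta>. bessel_series' \<sigma> (of_real E * exp (2 * \<zeta>))) has_field_derivative g'' * (2 * w)) (at \<zeta>)"
    using DERIV_chain2[OF bessel_series'_deriv[of \<sigma>] 1] by (simp add: g''_def w_def)
  have 3: "((\<lambda>\<zeta>. exp (\<i> * of_real \<sigma> * \<zeta>)) has_field_derivative e * (\<i> * of_real \<sigma>)) (at \<zeta>)"
    by (auto intro!: derivative_eq_intros simp: e_def)
  have "(model' \<sigma> E has_field_derivative
      e * (\<i> * of_real \<sigma>) * (\<i> * of_real \<sigma> * g + 2 * w * g') +
      (\<i> * of_real \<sigma> * (g' * (2 * w)) + (2 * (2 * w) * g' + g'' * (2 * w) * (2 * w))) * e) (at \<zeta>)"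
    unfolding model'_def[abs_def]
    using DERIV_mult[OF 3 DERIV_add[OF DERIV_cmult[OF 2, of "\<i> * of_real \<sigma>"] DERIV_mult[OF DERIV_cmult[OF 1, of 2] d2]]]
    by (simp add: e_def w_def g_def g'_def)
  moreover have "e * (\<i> * of_real \<sigma>) * (\<i> * of_real \<sigma> * g + 2 * w * g') +
      (\<i> * of_real \<sigma> * (g' * (2 * w)) + (2 * (2 * w) * g' + g'' * (2 * w) * (2 * w))) * e
    = e * w * (4 * w * g'' + 4 * (1 + \<i> * of_real \<sigma>) * g' + g) + (\<i> * \<i> * of_real \<sigma> * of_real \<sigma> - w) * (e * g)"
    by (simp only: ring_distribs mult_ac) (simp add: algebra_simps)
  moreover have "4 * w * g'' + 4 * (1 + \<i> * of_real \<sigma>) * g' + g = 0"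
    unfolding g_def g'_def g''_def by (rule bessel_series_ode)
  moreover have "(\<i> * \<i> * of_real \<sigma> * of_real \<sigma> - w) * (e * g) = - (of_real (\<sigma>\<^sup>2) + w) * (e * g)"
    by (simp add: power2_eq_square)
  moreover have "e * g = model \<sigma> E \<zeta>" by (simp add: model_def e_def g_def w_def)
  ultimately show ?thesis by (simp add: w_def power2_eq_square)
qed

lemma model_cnj: "model (- \<sigma>) E \<zeta> = cnj (model \<sigma> E (cnj \<zeta>))" "model' (- \<sigma>) E \<zeta> = cnj (model' \<sigma> E (cnj \<zeta>))"
  by (simp_all add: model_def model'_def bessel_series_cnj bessel_series'_cnj exp_cnj)

text \<open>
  The series depends on \<open>exp(2\<zeta>)\<close> only, so a translation by \<open>i\<pi>\<close> acts just on the factor \<open>exp(i \<sigma> \<zeta>)\<close>. All the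
  global information needed about Bessel functions is in this identity.
\<close>

lemma model_rotate:
  "model \<sigma> E (\<zeta> + \<i> * of_real pi) = exp (- of_real (pi * \<sigma>)) * model \<sigma> E \<zeta>"
  "model' \<sigma> E (\<zeta> + \<i> * of_real pi) = exp (- of_real (pi * \<sigma>)) * model' \<sigma> E \<zeta>"
proof -
  have 1: "exp (\<i> * of_real \<sigma> * (\<zeta> + \<i> * of_real pi)) = exp (- of_real (pi * \<sigma>)) * exp (\<i> * of_real \<sigma> * \<zeta>)"
    by (simp add: algebra_simps flip: exp_add)
  have "exp (2 * (\<zeta> + \<i> * of_real pi)) = exp (2 * \<zeta>) * exp (2 * of_real pi * \<i>)"
  proof -
    have "2 * (\<zeta> + \<i> * of_real pi) = 2 * \<zeta> + 2 * of_real pi * \<i>" by (simp add: algebra_simps)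
    then show ?thesis by (simp only: exp_add)
  qed
  also have "\<dots> = exp (2 * \<zeta>)" by (simp only: exp_two_pi_i mult_1_right)
  finally have 2: "exp (2 * (\<zeta> + \<i> * of_real pi)) = exp (2 * \<zeta>)" .
  show "model \<sigma> E (\<zeta> + \<i> * of_real pi) = exp (- of_real (pi * \<sigma>)) * model \<sigma> E \<zeta>"
    "model' \<sigma> E (\<zeta> + \<i> * of_real pi) = exp (- of_real (pi * \<sigma>)) * model' \<sigma> E \<zeta>"
    unfolding model_def model'_def 1 2 by (simp_all add: mult.assoc)
qed

lemma model_scaling:
  assumes "E > 0"
  shows "model \<sigma> E (of_real t) = exp (- \<i> * of_real (\<sigma> * ln (sqrt E))) * model \<sigma> 1 (of_real (t + ln (sqrt E)))"
proof -
  have "exp (2 * (t + ln (sqrt E))) = E * exp (2 * t)"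
    using assms by (simp add: ring_distribs exp_add ln_sqrt)
  then have "of_real E * exp (2 * of_real t) = (exp (2 * of_real (t + ln (sqrt E))) :: complex)"
    by (metis exp_of_real of_real_mult of_real_numeral)
  moreover have "exp (\<i> * of_real \<sigma> * of_real t) =
     exp (- \<i> * of_real (\<sigma> * ln (sqrt E))) * exp (\<i> * of_real \<sigma> * of_real (t + ln (sqrt E)))"
    by (simp add: algebra_simps flip: exp_add)
  ultimately show ?thesis by (simp add: model_def)
qed

lemma model_vector_deriv:
  "((\<lambda>t. model \<sigma> E (of_real t)) has_vector_derivative model' \<sigma> E (of_real t)) (at t)"
  "((\<lambda>t. model' \<sigma> E (of_real t)) has_vector_derivative
     - of_real (\<sigma>\<^sup>2 + E * exp (2 * t)) * model \<sigma> E (of_real t)) (at t)"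
  using has_vector_derivative_real_field[OF model_deriv[of \<sigma> E "of_real t"]]
    has_vector_derivative_real_field[OF model'_deriv[of \<sigma> E "of_real t"]]
  by (simp_all flip: exp_of_real)

text \<open>
  The Wronskian of \<open>model\<close> and its conjugate is constant, and its value is read off at minus infinity.
\<close>

lemma model_wronskian: "Im (model' \<sigma> E (of_real t) * cnj (model \<sigma> E (of_real t))) = \<sigma>"
proof -
  define h where "h = (\<lambda>t. Im (model' \<sigma> E (of_real t) * cnj (model \<sigma> E (of_real t))))"
  have "(h has_real_derivative 0) (at t)" for t
  proof -
    have "((\<lambda>t. model' \<sigma> E (of_real t) * cnj (model \<sigma> E (of_real t))) has_vector_derivative
        model' \<sigma> E (of_real t) * cnj (model' \<sigma> E (of_real t)) +
        - of_real (\<sigma>\<^sup>2 + E * exp (2 * t)) * model \<sigma> E (of_real t) * cnj (model \<sigma> E (of_real t))) (at t)"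
      by (intro has_vector_derivative_mult model_vector_deriv has_vector_derivative_cnj)
    from bounded_linear.has_vector_derivative[OF bounded_linear_Im this]
    have "(h has_vector_derivative 0) (at t)"
      unfolding h_def by (simp add: mult.assoc complex_mult_cnj)
    then show ?thesis by (simp add: has_real_derivative_iff_has_vector_derivative)
  qed
  then have const: "h t = h s" for s t
    using DERIV_isconst_all by blast
  have "((\<lambda>t::real. exp (2 * t)) \<longlongrightarrow> 0) at_bot"
    by (rule filterlim_compose[OF exp_at_bot])
       (auto intro!: filterlim_tendsto_pos_mult_at_bot[OF tendsto_const] filterlim_ident)
  from tendsto_mult_left[OF this, of E] have l: "((\<lambda>t. E * exp (2 * t)) \<longlongrightarrow> 0) at_bot" by simp
  have g: "((\<lambda>t. bessel_series \<sigma> (of_real (E * exp (2 * t)))) \<longlongrightarrow> bessel_series \<sigma> (of_real 0)) at_bot"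
    by (rule isCont_tendsto_compose[OF DERIV_isCont[OF bessel_series_deriv]]) (intro tendsto_intros l)
  have g': "((\<lambda>t. bessel_series' \<sigma> (of_real (E * exp (2 * t)))) \<longlongrightarrow> bessel_series' \<sigma> (of_real 0)) at_bot"
    by (rule isCont_tendsto_compose[OF DERIV_isCont[OF bessel_series'_deriv]]) (intro tendsto_intros l)
  have lim: "((\<lambda>t. Im ((\<i> * of_real \<sigma> * bessel_series \<sigma> (of_real (E * exp (2 * t)))
     + 2 * (of_real (E * exp (2 * t))) * bessel_series' \<sigma> (of_real (E * exp (2 * t))))
     * cnj (bessel_series \<sigma> (of_real (E * exp (2 * t)))))) \<longlongrightarrow>
     Im ((\<i> * of_real \<sigma> * bessel_series \<sigma> (of_real 0) + 2 * of_real 0 * bessel_series' \<sigma> (of_real 0))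
       * cnj (bessel_series \<sigma> (of_real 0)))) at_bot"
    by (intro tendsto_intros l g g')
  have ht: "h t = Im ((\<i> * of_real \<sigma> * bessel_series \<sigma> (of_real (E * exp (2 * t)))
     + 2 * (of_real (E * exp (2 * t))) * bessel_series' \<sigma> (of_real (E * exp (2 * t))))
     * cnj (bessel_series \<sigma> (of_real (E * exp (2 * t)))))" for t
  proof -
    have e: "exp (\<i> * of_real \<sigma> * of_real t) * cnj (exp (\<i> * of_real \<sigma> * of_real t)) = 1"
      by (simp add: exp_cnj flip: exp_add)
    have aux: "e * X * cnj (e * Y) = X * cnj Y" if "e * cnj e = 1" for e X Y :: complex
    proof -
      have "e * X * cnj (e * Y) = (e * cnj e) * (X * cnj Y)" by (simp add: mult_ac)
      then show ?thesis using that by simp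
    qed
    have "of_real (E * exp (2 * t)) = of_real E * (exp (2 * of_real t) :: complex)"
      by (simp flip: exp_of_real)
    then show ?thesis
      unfolding h_def model_def model'_def by (simp only: aux[OF e])
  qed
  have "(h \<longlongrightarrow> \<sigma>) at_bot"
    using lim unfolding ht[symmetric] by (simp add: bessel_series_0)
  moreover have "h = (\<lambda>_. h t)" using const by blast
  ultimately have "h t = \<sigma>"
    by (metis tendsto_const_iff trivial_limit_at_bot_linorder)
  then show ?thesis by (simp add: h_def)
qed

section \<open>Incoming and outgoing amplitudes of the model solution\<close>

text \<open>
  An energy estimate for the pair of outgoing and incoming amplitudes. A diagonal term \<open>\<omega>\<close> with
  nonpositive real part can be dropped. On the real line it is purely oscillatory, and on the quarter arc into the
  upper half plane it is damping, so the same estimate serves both directions.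
\<close>

lemma two_component_growth:
  fixes y \<beta> \<kappa> \<omega> :: "real \<Rightarrow> complex"
  assumes "s \<le> t"
    and \<beta>: "\<And>x. s \<le> x \<Longrightarrow> x \<le> t \<Longrightarrow> (\<beta> has_vector_derivative \<kappa> x * (y x + \<beta> x)) (at x)"
    and y: "\<And>x. s \<le> x \<Longrightarrow> x \<le> t \<Longrightarrow> (y has_vector_derivative - \<kappa> x * (y x + \<beta> x) + \<omega> x * y x) (at x)"
    and \<omega>: "\<And>x. s \<le> x \<Longrightarrow> x \<le> t \<Longrightarrow> Re (\<omega> x) \<le> 0"
    and k: "\<And>x. s \<le> x \<Longrightarrow> x \<le> t \<Longrightarrow> (k has_real_derivative k' x) (at x)"
    and \<kappa>: "\<And>x. s \<le> x \<Longrightarrow> x \<le> t \<Longrightarrow> 4 * cmod (\<kappa> x) \<le> k' x"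
  shows "(cmod (y t))\<^sup>2 + (cmod (\<beta> t))\<^sup>2 \<le> ((cmod (y s))\<^sup>2 + (cmod (\<beta> s))\<^sup>2) * exp (k t - k s)"
proof (rule gronwall_upper[OF \<open>s \<le> t\<close> _ k, where \<Phi> = "\<lambda>x. (cmod (y x))\<^sup>2 + (cmod (\<beta> x))\<^sup>2"])
  fix x assume x: "s \<le> x" "x \<le> t"
  let ?d = "2 * Re (cnj (y x) * (- \<kappa> x * (y x + \<beta> x) + \<omega> x * y x)) + 2 * Re (cnj (\<beta> x) * (\<kappa> x * (y x + \<beta> x)))"
  show "((\<lambda>x. (cmod (y x))\<^sup>2 + (cmod (\<beta> x))\<^sup>2) has_real_derivative ?d) (at x)"
    by (intro DERIV_add has_real_derivative_cmod_power2 y \<beta> x)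
  let ?s = "cmod (y x) + cmod (\<beta> x)"
  have 1: "cmod (\<kappa> x * (y x + \<beta> x)) \<le> cmod (\<kappa> x) * ?s"
    unfolding norm_mult by (intro mult_left_mono norm_triangle_ineq) auto
  have b: "Re (cnj a * z) \<le> cmod a * (cmod (\<kappa> x) * ?s)" if "cmod z \<le> cmod (\<kappa> x) * ?s" for a z
  proof -
    have "Re (cnj a * z) \<le> cmod (cnj a * z)" by (rule complex_Re_le_cmod)
    also have "\<dots> \<le> cmod a * (cmod (\<kappa> x) * ?s)"
      unfolding norm_mult complex_mod_cnj by (intro mult_left_mono that) auto
    finally show ?thesis .
  qed
  have "Re (cnj (y x) * (\<omega> x * y x)) = Re (\<omega> x) * (cmod (y x))\<^sup>2"
  proof -
    have "cnj (y x) * (\<omega> x * y x) = \<omega> x * of_real ((cmod (y x))\<^sup>2)"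
      by (simp only: complex_norm_square mult_ac)
    then show ?thesis
      by (simp only: times_complex.simps Re_complex_of_real Im_complex_of_real mult_zero_right diff_zero)
  qed
  also have "\<dots> \<le> 0" using \<omega>[OF x] by (simp add: mult_le_0_iff)
  finally have 2: "Re (cnj (y x) * (\<omega> x * y x)) \<le> 0" .
  have "?d = 2 * (Re (cnj (y x) * (- (\<kappa> x * (y x + \<beta> x)))) + Re (cnj (y x) * (\<omega> x * y x)) + Re (cnj (\<beta> x) * (\<kappa> x * (y x + \<beta> x))))"
    by (simp add: algebra_simps)
  also have "\<dots> \<le> 2 * (cmod (y x) * (cmod (\<kappa> x) * ?s) + 0 + cmod (\<beta> x) * (cmod (\<kappa> x) * ?s))"
    using 1 by (intro mult_left_mono add_mono b 2) (auto simp: norm_minus_cancel)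
  also have "\<dots> = cmod (\<kappa> x) * (2 * ?s\<^sup>2)" by (simp add: algebra_simps power2_eq_square)
  also have "\<dots> \<le> cmod (\<kappa> x) * (4 * ((cmod (y x))\<^sup>2 + (cmod (\<beta> x))\<^sup>2))"
    using sum_squares_bound[of "cmod (y x)" "cmod (\<beta> x)"]
    by (intro mult_left_mono) (auto simp: power2_sum)
  also have "\<dots> \<le> k' x * ((cmod (y x))\<^sup>2 + (cmod (\<beta> x))\<^sup>2)"
    using mult_right_mono[OF \<kappa>[OF x], of "(cmod (y x))\<^sup>2 + (cmod (\<beta> x))\<^sup>2"] by (simp add: algebra_simps)
  finally show "?d \<le> k' x * ((cmod (y x))\<^sup>2 + (cmod (\<beta> x))\<^sup>2)" .
qed

text \<open>
  In the variable \<open>z = exp \<zeta>\<close>, the function \<open>f = sqrt z * j\<close> satisfies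
  \<open>f'' = - (1 + (\<sigma>\<^sup>2 + 1/4) / z\<^sup>2) f\<close>, a perturbation of the free equation that is integrable at infinity.
  Here \<open>jost_fz\<close> is the derivative of \<open>f\<close> with respect to \<open>z\<close>.
\<close>

definition jost_f :: "real \<Rightarrow> complex \<Rightarrow> complex" where
  "jost_f \<sigma> \<zeta> = exp (\<zeta> / 2) * model \<sigma> 1 \<zeta>"

definition jost_fz :: "real \<Rightarrow> complex \<Rightarrow> complex" where
  "jost_fz \<sigma> \<zeta> = exp (- \<zeta> / 2) * (model' \<sigma> 1 \<zeta> + model \<sigma> 1 \<zeta> / 2)"

text \<open>
  If \<open>f = a exp(iz) + b exp(- iz)\<close> and \<open>f' = i a exp(iz) - i b exp(- iz)\<close>, then \<open>jost_in\<close> is \<open>b\<close> and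
  \<open>jost_out\<close> is \<open>a exp(2iz)\<close>. The exponential is kept in \<open>jost_out\<close> because it decays in the upper
  half plane, where \<open>a\<close> alone would be uncontrolled.
\<close>

definition jost_in :: "real \<Rightarrow> complex \<Rightarrow> complex" where
  "jost_in \<sigma> \<zeta> = (\<i> * jost_f \<sigma> \<zeta> - jost_fz \<sigma> \<zeta>) * exp (\<i> * exp \<zeta>) / (2 * \<i>)"

definition jost_out :: "real \<Rightarrow> complex \<Rightarrow> complex" where
  "jost_out \<sigma> \<zeta> = (jost_fz \<sigma> \<zeta> + \<i> * jost_f \<sigma> \<zeta>) * exp (\<i> * exp \<zeta>) / (2 * \<i>)"

lemma jost_sum: "jost_out \<sigma> \<zeta> + jost_in \<sigma> \<zeta> = jost_f \<sigma> \<zeta> * exp (\<i> * exp \<zeta>)"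
  by (simp add: jost_in_def jost_out_def field_simps)

definition jost_coupling :: "real \<Rightarrow> complex \<Rightarrow> complex" where
  "jost_coupling \<sigma> \<zeta> = of_real (\<sigma>\<^sup>2 + 1 / 4) * exp (- \<zeta>) / (2 * \<i>)"

lemma jost_f_deriv: "(jost_f \<sigma> has_field_derivative exp \<zeta> * jost_fz \<sigma> \<zeta>) (at \<zeta>)"
proof -
  have e: "exp \<zeta> * exp (- \<zeta> / 2) = exp (\<zeta> / 2)"
    by (simp add: field_simps flip: exp_add)
  have "((\<lambda>\<zeta>. exp (\<zeta> / 2)) has_field_derivative exp (\<zeta> / 2) * (1 / 2)) (at \<zeta>)"
    by (auto intro!: derivative_eq_intros)
  from DERIV_mult[OF this model_deriv[of \<sigma> 1]]
  show ?thesis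
    unfolding jost_f_def[abs_def] jost_fz_def by (simp add: algebra_simps flip: e mult.assoc)
qed

lemma jost_fz_deriv:
  "(jost_fz \<sigma> has_field_derivative - (of_real (\<sigma>\<^sup>2 + 1 / 4) * exp (- \<zeta>) + exp \<zeta>) * jost_f \<sigma> \<zeta>) (at \<zeta>)"
proof -
  have e1: "exp (- \<zeta>) * exp (\<zeta> / 2) = exp (- \<zeta> / 2)"
    by (simp add: field_simps flip: exp_add)
  have e2: "exp (2 * \<zeta>) * exp (- \<zeta> / 2) = exp \<zeta> * exp (\<zeta> / 2)"
    by (simp add: field_simps flip: exp_add)
  have "((\<lambda>\<zeta>. exp (- \<zeta> / 2)) has_field_derivative exp (- \<zeta> / 2) * (- 1 / 2)) (at \<zeta>)"
    by (auto intro!: derivative_eq_intros)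
  from DERIV_mult[OF this DERIV_add[OF model'_deriv[of \<sigma> 1] DERIV_cmult[OF model_deriv[of \<sigma> 1], of "1 / 2"]]]
  have "(jost_fz \<sigma> has_field_derivative
      exp (- \<zeta> / 2) * (- 1 / 2) * (model' \<sigma> 1 \<zeta> + 1 / 2 * model \<sigma> 1 \<zeta>) +
      (- (of_real (\<sigma>\<^sup>2) + of_real 1 * exp (2 * \<zeta>)) * model \<sigma> 1 \<zeta> + 1 / 2 * model' \<sigma> 1 \<zeta>) * exp (- \<zeta> / 2)) (at \<zeta>)"
    unfolding jost_fz_def[abs_def] by simp
  also have "exp (- \<zeta> / 2) * (- 1 / 2) * (model' \<sigma> 1 \<zeta> + 1 / 2 * model \<sigma> 1 \<zeta>) +
      (- (of_real (\<sigma>\<^sup>2) + of_real 1 * exp (2 * \<zeta>)) * model \<sigma> 1 \<zeta> + 1 / 2 * model' \<sigma> 1 \<zeta>) * exp (- \<zeta> / 2)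
    = - (of_real (\<sigma>\<^sup>2 + 1 / 4) * exp (- \<zeta> / 2) + exp (2 * \<zeta>) * exp (- \<zeta> / 2)) * model \<sigma> 1 \<zeta>"
    by (simp add: algebra_simps)
  also have "\<dots> = - (of_real (\<sigma>\<^sup>2 + 1 / 4) * exp (- \<zeta>) + exp \<zeta>) * jost_f \<sigma> \<zeta>"
    unfolding e2 unfolding jost_f_def e1[symmetric] by (simp only: ring_distribs mult_ac mult_minus_left mult_minus_right)
  finally show ?thesis .
qed

lemma jost_in_deriv:
  "(jost_in \<sigma> has_field_derivative jost_coupling \<sigma> \<zeta> * (jost_out \<sigma> \<zeta> + jost_in \<sigma> \<zeta>)) (at \<zeta>)"
proof -
  define f fz Z e c where "f = jost_f \<sigma> \<zeta>" and "fz = jost_fz \<sigma> \<zeta>" and "Z = exp \<zeta>"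
    and "e = exp (\<i> * exp \<zeta>)" and "c = of_real (\<sigma>\<^sup>2 + 1 / 4) * exp (- \<zeta>)"
  have 1: "((\<lambda>\<zeta>. exp (\<i> * exp \<zeta>)) has_field_derivative e * (\<i> * Z)) (at \<zeta>)"
    by (auto intro!: derivative_eq_intros simp: e_def Z_def)
  have "((\<lambda>\<zeta>. \<i> * jost_f \<sigma> \<zeta> - jost_fz \<sigma> \<zeta>) has_field_derivative \<i> * (Z * fz) - - (c + Z) * f) (at \<zeta>)"
    using DERIV_diff[OF DERIV_cmult[OF jost_f_deriv, of \<i>] jost_fz_deriv]
    by (simp add: f_def fz_def Z_def c_def)
  from DERIV_cdivide[OF DERIV_mult[OF this 1], of "2 * \<i>"]
  have "(jost_in \<sigma> has_field_derivative
      ((\<i> * (Z * fz) - - (c + Z) * f) * e + e * (\<i> * Z) * (\<i> * f - fz)) / (2 * \<i>)) (at \<zeta>)"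
    unfolding jost_in_def[abs_def] by (simp add: f_def fz_def e_def)
  also have "(\<i> * (Z * fz) - - (c + Z) * f) * e + e * (\<i> * Z) * (\<i> * f - fz) = c * (f * e)"
    by (simp add: algebra_simps)
  finally show ?thesis
    unfolding jost_sum jost_coupling_def f_def[symmetric] e_def[symmetric] c_def[symmetric]
    by (simp only: times_divide_eq_left)
qed

lemma jost_out_deriv:
  "(jost_out \<sigma> has_field_derivative
     - jost_coupling \<sigma> \<zeta> * (jost_out \<sigma> \<zeta> + jost_in \<sigma> \<zeta>) + 2 * \<i> * exp \<zeta> * jost_out \<sigma> \<zeta>) (at \<zeta>)"
proof -
  define f fz Z e c where "f = jost_f \<sigma> \<zeta>" and "fz = jost_fz \<sigma> \<zeta>" and "Z = exp \<zeta>"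
    and "e = exp (\<i> * exp \<zeta>)" and "c = of_real (\<sigma>\<^sup>2 + 1 / 4) * exp (- \<zeta>)"
  have distr: "(- a * x + b * z) / d = - (a / d) * x + b * (z / d)" for a b d x z :: complex
    by (simp add: add_divide_distrib diff_divide_distrib)
  have 1: "((\<lambda>\<zeta>. exp (\<i> * exp \<zeta>)) has_field_derivative e * (\<i> * Z)) (at \<zeta>)"
    by (auto intro!: derivative_eq_intros simp: e_def Z_def)
  have "((\<lambda>\<zeta>. jost_fz \<sigma> \<zeta> + \<i> * jost_f \<sigma> \<zeta>) has_field_derivative - (c + Z) * f + \<i> * (Z * fz)) (at \<zeta>)"
    using DERIV_add[OF jost_fz_deriv DERIV_cmult[OF jost_f_deriv, of \<i>]]
    by (simp add: f_def fz_def Z_def c_def)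
  from DERIV_cdivide[OF DERIV_mult[OF this 1], of "2 * \<i>"]
  have "(jost_out \<sigma> has_field_derivative
      ((- (c + Z) * f + \<i> * (Z * fz)) * e + e * (\<i> * Z) * (fz + \<i> * f)) / (2 * \<i>)) (at \<zeta>)"
    unfolding jost_out_def[abs_def] by (simp add: f_def fz_def e_def)
  also have "(- (c + Z) * f + \<i> * (Z * fz)) * e + e * (\<i> * Z) * (fz + \<i> * f)
     = - c * (f * e) + 2 * \<i> * Z * ((fz + \<i> * f) * e)"
    by (simp add: algebra_simps)
  also have "(- c * (f * e) + 2 * \<i> * Z * ((fz + \<i> * f) * e)) / (2 * \<i>)
     = - (c / (2 * \<i>)) * (f * e) + 2 * \<i> * Z * ((fz + \<i> * f) * e / (2 * \<i>))"
    by (rule distr)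
  finally show ?thesis
    unfolding jost_sum jost_coupling_def unfolding jost_out_def f_def fz_def e_def Z_def c_def .
qed

lemma jost_coupling_norm:
  "cmod (jost_coupling \<sigma> \<zeta>) = (\<sigma>\<^sup>2 + 1 / 4) / 2 * exp (- Re \<zeta>)"
  unfolding jost_coupling_def by (simp add: norm_mult norm_divide del: of_real_add of_real_divide of_real_power)

lemma jost_real_line:
  "((\<lambda>s. jost_in \<sigma> (of_real s)) has_vector_derivative
     jost_coupling \<sigma> (of_real s) * (jost_out \<sigma> (of_real s) + jost_in \<sigma> (of_real s))) (at s)"
  "((\<lambda>s. jost_out \<sigma> (of_real s)) has_vector_derivative
     - jost_coupling \<sigma> (of_real s) * (jost_out \<sigma> (of_real s) + jost_in \<sigma> (of_real s))
     + (2 * \<i> * of_real (exp s)) * jost_out \<sigma> (of_real s)) (at s)"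
  using has_vector_derivative_real_field[OF jost_in_deriv[of \<sigma> "of_real s"]]
    has_vector_derivative_real_field[OF jost_out_deriv[of \<sigma> "of_real s"]]
  by (simp_all add: exp_of_real)

lemma jost_bounded:
  obtains M where "M \<ge> 0" "\<And>s. s \<ge> 0 \<Longrightarrow> (cmod (jost_out \<sigma> (of_real s)))\<^sup>2 + (cmod (jost_in \<sigma> (of_real s)))\<^sup>2 \<le> M\<^sup>2"
proof -
  define q where "q = \<sigma>\<^sup>2 + 1 / 4"
  have q: "q \<ge> 0" by (simp add: q_def)
  define \<Phi> where "\<Phi> = (\<lambda>s::real. (cmod (jost_out \<sigma> (of_real s)))\<^sup>2 + (cmod (jost_in \<sigma> (of_real s)))\<^sup>2)"
  have "\<Phi> s \<le> \<Phi> 0 * exp (2 * q)" if "s \<ge> 0" for s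
  proof -
    have "\<Phi> s \<le> \<Phi> 0 * exp (- (2 * q * exp (- s)) - - (2 * q * exp (- 0)))"
      unfolding \<Phi>_def
    proof (rule two_component_growth[OF that, where \<kappa> = "\<lambda>s. jost_coupling \<sigma> (of_real s)"
            and \<omega> = "\<lambda>s. 2 * \<i> * of_real (exp s)" and k' = "\<lambda>x. 2 * q * exp (- x)"])
      show "((\<lambda>s. - (2 * q * exp (- s))) has_real_derivative 2 * q * exp (- x)) (at x)" for x
        by (auto intro!: derivative_eq_intros)
      show "4 * cmod (jost_coupling \<sigma> (of_real x)) \<le> 2 * q * exp (- x)" for x
        by (simp add: jost_coupling_norm q_def)
    qed (use jost_real_line in auto)
    also have "\<dots> \<le> \<Phi> 0 * exp (2 * q)"
      using q by (intro mult_left_mono) (auto simp: \<Phi>_def)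
    finally show ?thesis .
  qed
  moreover have "(sqrt (\<Phi> 0 * exp (2 * q)))\<^sup>2 = \<Phi> 0 * exp (2 * q)"
    by (simp add: \<Phi>_def)
  ultimately show ?thesis
    using that[of "sqrt (\<Phi> 0 * exp (2 * q))"] by (simp add: \<Phi>_def)
qed

lemma cmod_add_le_of_squares:
  assumes "(cmod a)\<^sup>2 + (cmod b)\<^sup>2 \<le> M\<^sup>2" "M \<ge> 0"
  shows "cmod a \<le> M" "cmod b \<le> M" "cmod (a + b) \<le> 2 * M"
proof -
  show 1: "cmod a \<le> M" "cmod b \<le> M"
    by (rule power2_le_imp_le; use assms in \<open>smt (verit) zero_le_power2\<close>)+
  show "cmod (a + b) \<le> 2 * M"
    using norm_triangle_ineq[of a b] 1 by linarith
qed

text \<open>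
  An exponentially decaying derivative is majorized by that of \<open>- (c / \<epsilon>) exp(- \<epsilon> s)\<close>.
\<close>

lemma converges_if_derivative_exp_decay:
  fixes h :: "real \<Rightarrow> 'a::banach"
  assumes "\<And>s. s \<ge> T \<Longrightarrow> (h has_vector_derivative h' s) (at s)"
    and "\<And>s. s \<ge> T \<Longrightarrow> norm (h' s) \<le> c * exp (- \<epsilon> * s)" and "\<epsilon> > 0"
  obtains l where "(h \<longlongrightarrow> l) at_top" "\<And>s. s \<ge> T \<Longrightarrow> norm (l - h s) \<le> c / \<epsilon> * exp (- \<epsilon> * s)"
proof -
  have "norm (h t - h s) \<le> - (c / \<epsilon> * exp (- \<epsilon> * t)) - - (c / \<epsilon> * exp (- \<epsilon> * s))" if "T \<le> s" "s \<le> t" for s t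
    by (rule increment_le_of_derivative_le[OF \<open>s \<le> t\<close>, where f = h' and g' = "\<lambda>x. c * exp (- \<epsilon> * x)"])
       (use assms that in \<open>auto intro!: derivative_eq_intros\<close>)
  moreover have "((\<lambda>s. - (c / \<epsilon> * exp (- \<epsilon> * s))) \<longlongrightarrow> - (c / \<epsilon> * 0)) at_top"
    by (intro tendsto_intros filterlim_compose[OF exp_at_bot] filterlim_tendsto_neg_mult_at_bot[OF tendsto_const] filterlim_ident)
       (use \<open>\<epsilon> > 0\<close> in auto)
  ultimately show ?thesis
    using that by (elim converges_at_top_if_dominated[where T = T]) auto
qed

definition jost_A :: "real \<Rightarrow> complex" where
  "jost_A \<sigma> = Lim at_top (\<lambda>s::real. jost_out \<sigma> (of_real s) * exp (- 2 * \<i> * of_real (exp s)))"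

definition jost_B :: "real \<Rightarrow> complex" where
  "jost_B \<sigma> = Lim at_top (\<lambda>s::real. jost_in \<sigma> (of_real s))"

lemma jost_B_limit: "((\<lambda>s::real. jost_in \<sigma> (of_real s)) \<longlongrightarrow> jost_B \<sigma>) at_top"
proof -
  obtain M where M: "M \<ge> 0" "\<And>s. s \<ge> 0 \<Longrightarrow> (cmod (jost_out \<sigma> (of_real s)))\<^sup>2 + (cmod (jost_in \<sigma> (of_real s)))\<^sup>2 \<le> M\<^sup>2"
    using jost_bounded by blast
  obtain l where "((\<lambda>s::real. jost_in \<sigma> (of_real s)) \<longlongrightarrow> l) at_top"
  proof (rule converges_if_derivative_exp_decay[where T = 0, OF jost_real_line(1)])
    fix s :: real assume "s \<ge> 0"
    have "cmod (jost_coupling \<sigma> (of_real s) * (jost_out \<sigma> (of_real s) + jost_in \<sigma> (of_real s)))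
      \<le> (\<sigma>\<^sup>2 + 1 / 4) / 2 * exp (- s) * (2 * M)"
      unfolding norm_mult jost_coupling_norm
      using cmod_add_le_of_squares(3)[OF M(2)[OF \<open>s \<ge> 0\<close>] M(1)] by (intro mult_mono) auto
    then show "cmod (jost_coupling \<sigma> (of_real s) * (jost_out \<sigma> (of_real s) + jost_in \<sigma> (of_real s)))
      \<le> (\<sigma>\<^sup>2 + 1 / 4) / 2 * (2 * M) * exp (- 1 * s)" by (simp add: mult_ac)
  qed auto
  then show ?thesis unfolding jost_B_def by (simp add: tendsto_Lim)
qed

lemma jost_A_limit:
  "((\<lambda>s::real. jost_out \<sigma> (of_real s) * exp (- 2 * \<i> * of_real (exp s))) \<longlongrightarrow> jost_A \<sigma>) at_top"
proof -
  obtain M where M: "M \<ge> 0" "\<And>s. s \<ge> 0 \<Longrightarrow> (cmod (jost_out \<sigma> (of_real s)))\<^sup>2 + (cmod (jost_in \<sigma> (of_real s)))\<^sup>2 \<le> M\<^sup>2"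
    using jost_bounded by blast
  obtain l where "((\<lambda>s::real. jost_out \<sigma> (of_real s) * exp (- 2 * \<i> * of_real (exp s))) \<longlongrightarrow> l) at_top"
  proof (rule converges_if_derivative_exp_decay[where T = 0 and h' = "\<lambda>s. - jost_coupling \<sigma> (of_real s) * (jost_out \<sigma> (of_real s) + jost_in \<sigma> (of_real s))
       * exp (- 2 * \<i> * of_real (exp s))"])
    fix s :: real
    have "((\<lambda>s. exp (- 2 * \<i> * of_real (exp s))) has_vector_derivative
       exp (- 2 * \<i> * of_real (exp s)) * (- 2 * \<i> * of_real (exp s))) (at s)"
    proof -
      have "((\<lambda>z. exp (- 2 * \<i> * exp z)) has_field_derivative
         exp (- 2 * \<i> * exp (of_real s)) * (- 2 * \<i> * exp (of_real s))) (at (of_real s :: complex))"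
        by (auto intro!: derivative_eq_intros)
      from has_vector_derivative_real_field[OF this] show ?thesis by (simp add: exp_of_real)
    qed
    from has_vector_derivative_mult[OF jost_real_line(2) this, of \<sigma>]
    show "((\<lambda>s. jost_out \<sigma> (of_real s) * exp (- 2 * \<i> * of_real (exp s))) has_vector_derivative
      - jost_coupling \<sigma> (of_real s) * (jost_out \<sigma> (of_real s) + jost_in \<sigma> (of_real s))
       * exp (- 2 * \<i> * of_real (exp s))) (at s)"
      by (simp add: algebra_simps)
  next
    fix s :: real assume "s \<ge> 0"
    have e: "cmod (exp (- 2 * \<i> * of_real (exp s))) = 1" by simp
    have "cmod (- jost_coupling \<sigma> (of_real s) * (jost_out \<sigma> (of_real s) + jost_in \<sigma> (of_real s)) * exp (- 2 * \<i> * of_real (exp s)))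
      \<le> (\<sigma>\<^sup>2 + 1 / 4) / 2 * exp (- s) * (2 * M)"
      unfolding norm_mult norm_minus_cancel jost_coupling_norm e mult_1_right
      using cmod_add_le_of_squares(3)[OF M(2)[OF \<open>s \<ge> 0\<close>] M(1)] by (intro mult_mono) auto
    then show "cmod (- jost_coupling \<sigma> (of_real s) * (jost_out \<sigma> (of_real s) + jost_in \<sigma> (of_real s)) * exp (- 2 * \<i> * of_real (exp s)))
      \<le> (\<sigma>\<^sup>2 + 1 / 4) / 2 * (2 * M) * exp (- 1 * s)" by (simp only: mult_ac) simp
  qed auto
  then show ?thesis unfolding jost_A_def by (simp add: tendsto_Lim)
qed

lemma model_asymptotics:
  "((\<lambda>s::real. of_real (exp (s / 2)) * model \<sigma> 1 (of_real s) -
     (jost_A \<sigma> * exp (\<i> * of_real (exp s)) + jost_B \<sigma> * exp (- \<i> * of_real (exp s)))) \<longlongrightarrow> 0) at_top"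
proof -
  let ?a = "\<lambda>s::real. jost_out \<sigma> (of_real s) * exp (- 2 * \<i> * of_real (exp s))"
  let ?b = "\<lambda>s::real. jost_in \<sigma> (of_real s)"
  have lim: "((\<lambda>s. cmod (?a s - jost_A \<sigma>) + cmod (?b s - jost_B \<sigma>)) \<longlongrightarrow> 0 + 0) at_top"
    by (intro tendsto_add tendsto_norm_zero LIM_zero jost_A_limit jost_B_limit)
  have le: "cmod (of_real (exp (s / 2)) * model \<sigma> 1 (of_real s) -
     (jost_A \<sigma> * exp (\<i> * of_real (exp s)) + jost_B \<sigma> * exp (- \<i> * of_real (exp s))))
     \<le> cmod (?a s - jost_A \<sigma>) + cmod (?b s - jost_B \<sigma>)" for s :: real
  proof -
    let ?e = "exp (\<i> * of_real (exp s))" and ?d = "exp (- \<i> * of_real (exp s))"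
    have e: "?d * ?e = 1" "?d = exp (- 2 * \<i> * of_real (exp s)) * ?e"
      by (simp_all flip: exp_add)
    have "of_real (exp (s / 2)) * model \<sigma> 1 (of_real s) = jost_f \<sigma> (of_real s)"
      by (simp add: jost_f_def flip: exp_of_real)
    also have "\<dots> = (jost_f \<sigma> (of_real s) * ?e) * ?d"
      using e(1) by (simp add: mult_ac)
    also have "jost_f \<sigma> (of_real s) * ?e = jost_out \<sigma> (of_real s) + jost_in \<sigma> (of_real s)"
      by (simp only: jost_sum exp_of_real)
    also have "(jost_out \<sigma> (of_real s) + jost_in \<sigma> (of_real s)) * ?d = ?a s * ?e + ?b s * ?d"
      using e(2) by (simp only: ring_distribs mult.assoc)
    finally have "of_real (exp (s / 2)) * model \<sigma> 1 (of_real s) - (jost_A \<sigma> * ?e + jost_B \<sigma> * ?d)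
       = (?a s - jost_A \<sigma>) * ?e + (?b s - jost_B \<sigma>) * ?d"
      by (simp add: algebra_simps)
    moreover have "cmod ((?a s - jost_A \<sigma>) * ?e + (?b s - jost_B \<sigma>) * ?d) \<le>
       cmod (?a s - jost_A \<sigma>) * cmod ?e + cmod (?b s - jost_B \<sigma>) * cmod ?d"
      unfolding norm_mult[symmetric] by (rule norm_triangle_ineq)
    moreover have "cmod ?e = 1" "cmod ?d = 1" by simp_all
    ultimately show ?thesis by simp
  qed
  show ?thesis
    by (rule Lim_null_comparison[OF always_eventually[OF allI[OF le]]]) (use lim in simp)
qed

text \<open>
  The model Wronskian evaluated at infinity.
\<close>

lemma jost_flux: "(cmod (jost_A \<sigma>))\<^sup>2 - (cmod (jost_B \<sigma>))\<^sup>2 = \<sigma>"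
proof -
  have "(cmod (jost_out \<sigma> (of_real s) * exp (- 2 * \<i> * of_real (exp s))))\<^sup>2 - (cmod (jost_in \<sigma> (of_real s)))\<^sup>2 = \<sigma>" for s :: real
  proof -
    define f fz where "f = jost_f \<sigma> (of_real s)" and "fz = jost_fz \<sigma> (of_real s)"
    have 1: "cmod (exp (- 2 * \<i> * of_real (exp s))) = 1" "cmod (exp (\<i> * exp (of_real s))) = 1"
      by (simp_all add: exp_of_real)
    have "(cmod (jost_out \<sigma> (of_real s) * exp (- 2 * \<i> * of_real (exp s))))\<^sup>2 - (cmod (jost_in \<sigma> (of_real s)))\<^sup>2
      = (cmod (fz + \<i> * f) / 2)\<^sup>2 - (cmod (\<i> * f - fz) / 2)\<^sup>2"
      unfolding jost_out_def jost_in_def norm_mult norm_divide 1 by (simp add: f_def fz_def)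
    also have "\<dots> = Im (fz * cnj f)"
      unfolding power_divide cmod_power2 by (simp add: power2_eq_square field_simps)
    also have "fz * cnj f = (exp (- of_real s / 2) * cnj (exp (of_real s / 2))) * (model' \<sigma> 1 (of_real s) * cnj (model \<sigma> 1 (of_real s))
        + (model \<sigma> 1 (of_real s) * cnj (model \<sigma> 1 (of_real s))) / 2)"
      unfolding f_def fz_def jost_f_def jost_fz_def complex_cnj_mult by (simp only: ring_distribs mult_ac times_divide_eq_left times_divide_eq_right)
    also have "exp (- of_real s / 2) * cnj (exp (of_real s / 2)) = (1::complex)"
      by (simp add: exp_cnj flip: exp_add)
    finally show ?thesis
      using model_wronskian[of \<sigma> 1 s] by (simp add: complex_mult_cnj)
  qed
  moreover have "((\<lambda>s::real. (cmod (jost_out \<sigma> (of_real s) * exp (- 2 * \<i> * of_real (exp s))))\<^sup>2 - (cmod (jost_in \<sigma> (of_real s)))\<^sup>2)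
     \<longlongrightarrow> (cmod (jost_A \<sigma>))\<^sup>2 - (cmod (jost_B \<sigma>))\<^sup>2) at_top"
    by (intro tendsto_intros jost_A_limit jost_B_limit)
  ultimately show ?thesis by (simp add: tendsto_const_iff)
qed

text \<open>
  Along the arc from \<open>s\<close> to \<open>s + i\<pi>/2\<close>, i.e. from \<open>exp s\<close> to \<open>i exp s\<close> in the \<open>z\<close>-plane, the two
  amplitudes stay bounded while the coupling is \<open>O(exp(- s))\<close>. So the incoming coefficient may be computed on
  the imaginary \<open>z\<close>-axis.
\<close>

lemma jost_arc:
  "((\<lambda>s::real. jost_in \<sigma> (of_real s + \<i> * of_real (pi / 2)) - jost_in \<sigma> (of_real s)) \<longlongrightarrow> 0) at_top"
proof -
  obtain M where M: "M \<ge> 0" "\<And>s. s \<ge> 0 \<Longrightarrow> (cmod (jost_out \<sigma> (of_real s)))\<^sup>2 + (cmod (jost_in \<sigma> (of_real s)))\<^sup>2 \<le> M\<^sup>2"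
    using jost_bounded by blast
  define q where "q = \<sigma>\<^sup>2 + 1 / 4"
  have q: "q \<ge> 0" by (simp add: q_def)
  define N where "N = M * exp (pi * q)"
  have N: "N \<ge> 0" using M by (simp add: N_def)
  have bound: "cmod (jost_in \<sigma> (of_real s + \<i> * of_real (pi / 2)) - jost_in \<sigma> (of_real s)) \<le> q * N * (pi / 2) * exp (- s)"
    if s: "s \<ge> 0" for s :: real
  proof -
    define \<zeta> where "\<zeta> = (\<lambda>\<theta>::real. of_real s + \<i> * of_real \<theta>)"
    define y where "y = (\<lambda>\<theta>. jost_out \<sigma> (\<zeta> \<theta>))"
    define \<beta> where "\<beta> = (\<lambda>\<theta>. jost_in \<sigma> (\<zeta> \<theta>))"
    define \<kappa> where "\<kappa> = (\<lambda>\<theta>. \<i> * jost_coupling \<sigma> (\<zeta> \<theta>))"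
    define \<omega> where "\<omega> = (\<lambda>\<theta>. - 2 * exp (\<zeta> \<theta>))"
    have Re\<zeta>: "Re (\<zeta> \<theta>) = s" for \<theta> by (simp add: \<zeta>_def)
    have \<zeta>: "(\<zeta> has_vector_derivative \<i>) (at \<theta>)" for \<theta>
      unfolding \<zeta>_def has_vector_derivative_def
      by (auto intro!: derivative_eq_intros simp: scaleR_conv_of_real mult.commute)
    have d\<beta>: "(\<beta> has_vector_derivative \<kappa> \<theta> * (y \<theta> + \<beta> \<theta>)) (at \<theta>)" for \<theta>
      using field_vector_diff_chain_at[OF \<zeta> jost_in_deriv[of \<sigma> "\<zeta> \<theta>"]]
      unfolding \<beta>_def y_def \<kappa>_def o_def by (simp add: mult.assoc)
    have dy: "(y has_vector_derivative - \<kappa> \<theta> * (y \<theta> + \<beta> \<theta>) + \<omega> \<theta> * y \<theta>) (at \<theta>)" for \<theta>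
      using field_vector_diff_chain_at[OF \<zeta> jost_out_deriv[of \<sigma> "\<zeta> \<theta>"]]
      unfolding \<beta>_def y_def \<kappa>_def \<omega>_def o_def
      by (rule has_vector_derivative_eq_rhs) (simp add: algebra_simps)
    have \<kappa>: "cmod (\<kappa> \<theta>) = q / 2 * exp (- s)" for \<theta>
      by (simp add: \<kappa>_def norm_mult jost_coupling_norm Re\<zeta> q_def)
    have est: "(cmod (y \<theta>))\<^sup>2 + (cmod (\<beta> \<theta>))\<^sup>2 \<le> N\<^sup>2" if \<theta>: "0 \<le> \<theta>" "\<theta> \<le> pi / 2" for \<theta>
    proof -
      have "(cmod (y \<theta>))\<^sup>2 + (cmod (\<beta> \<theta>))\<^sup>2
          \<le> ((cmod (y 0))\<^sup>2 + (cmod (\<beta> 0))\<^sup>2) * exp (2 * q * exp (- s) * \<theta> - 2 * q * exp (- s) * 0)"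
      proof (rule two_component_growth[OF \<theta>(1) d\<beta> dy, where k' = "\<lambda>_. 2 * q * exp (- s)"])
        show "Re (\<omega> x) \<le> 0" if "0 \<le> x" "x \<le> \<theta>" for x
          using that \<theta> cos_ge_zero[of x] by (simp add: \<omega>_def Re_exp \<zeta>_def)
        show "4 * cmod (\<kappa> x) \<le> 2 * q * exp (- s)" for x by (simp add: \<kappa>)
      qed (auto intro!: derivative_eq_intros)
      also have "\<dots> \<le> M\<^sup>2 * exp (2 * q * 1 * (pi / 2))"
      proof (rule mult_mono)
        show "(cmod (y 0))\<^sup>2 + (cmod (\<beta> 0))\<^sup>2 \<le> M\<^sup>2"
          using M(2)[OF s] by (simp add: y_def \<beta>_def \<zeta>_def)
        have "2 * q * exp (- s) * \<theta> \<le> 2 * q * 1 * (pi / 2)"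
          using q s \<theta> by (intro mult_mono) auto
        then show "exp (2 * q * exp (- s) * \<theta> - 2 * q * exp (- s) * 0) \<le> exp (2 * q * 1 * (pi / 2))" by simp
      qed auto
      also have "\<dots> = N\<^sup>2 * exp (- (pi * q))"
        by (simp add: N_def power_mult_distrib power2_eq_square exp_minus field_simps flip: exp_add)
      also have "\<dots> \<le> N\<^sup>2 * 1" using q by (intro mult_left_mono) auto
      finally show ?thesis by simp
    qed
    have "norm (\<beta> (pi / 2) - \<beta> 0) \<le> q * N * exp (- s) * (pi / 2) - q * N * exp (- s) * 0"
    proof (rule increment_le_of_derivative_le[OF _ d\<beta>, where g' = "\<lambda>_. q * N * exp (- s)"])
      fix x :: real assume x: "0 \<le> x" "x \<le> pi / 2"
      have "norm (\<kappa> x * (y x + \<beta> x)) \<le> q / 2 * exp (- s) * (2 * N)"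
        unfolding norm_mult \<kappa> using cmod_add_le_of_squares(3)[OF est[OF x] N] q by (intro mult_left_mono) auto
      then show "norm (\<kappa> x * (y x + \<beta> x)) \<le> q * N * exp (- s)" by (simp add: mult_ac)
    qed (auto intro!: derivative_eq_intros)
    then show ?thesis by (simp add: \<beta>_def \<zeta>_def mult_ac)
  qed
  show ?thesis
  proof (rule Lim_null_comparison)
    show "\<forall>\<^sub>F s in at_top. norm (jost_in \<sigma> (of_real s + \<i> * of_real (pi / 2)) - jost_in \<sigma> (of_real s)) \<le> q * N * (pi / 2) * exp (- s)"
      using eventually_ge_at_top[of 0] by eventually_elim (rule bound)
    have "((\<lambda>s::real. exp (- s)) \<longlongrightarrow> 0) at_top"
      by (rule filterlim_compose[OF exp_at_bot filterlim_uminus_at_bot_at_top])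
    from tendsto_mult_left[OF this, of "q * N * (pi / 2)"]
    show "((\<lambda>s. q * N * (pi / 2) * exp (- s)) \<longlongrightarrow> 0) at_top" by simp
  qed
qed

text \<open>
  On the line \<open>Im \<zeta> = \<pi>/2\<close>, complex conjugation is the translation by \<open>- i\<pi>\<close>, and conjugating the
  model solution replaces \<open>\<sigma>\<close> by \<open>- \<sigma>\<close>.
\<close>

lemma jost_in_reflection:
  fixes s :: real
  defines "\<zeta> \<equiv> of_real s + \<i> * of_real (pi / 2)"
  shows "jost_in (- \<sigma>) \<zeta> = \<i> * of_real (exp (pi * \<sigma>)) * cnj (jost_in \<sigma> \<zeta>)"
proof -
  let ?c = "of_real (exp (pi * \<sigma>)) :: complex"
  have \<zeta>: "cnj \<zeta> + \<i> * of_real pi = \<zeta>"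
    by (simp add: \<zeta>_def complex_eq_iff)
  have c: "?c * exp (- of_real (pi * \<sigma>)) = 1"
    by (simp flip: exp_of_real exp_add)
  have m: "model (- \<sigma>) 1 \<zeta> = ?c * cnj (model \<sigma> 1 \<zeta>)" "model' (- \<sigma>) 1 \<zeta> = ?c * cnj (model' \<sigma> 1 \<zeta>)"
  proof -
    have "model \<sigma> 1 (cnj \<zeta>) = ?c * model \<sigma> 1 \<zeta>" "model' \<sigma> 1 (cnj \<zeta>) = ?c * model' \<sigma> 1 \<zeta>"
      using model_rotate[of \<sigma> 1 "cnj \<zeta>"] c unfolding \<zeta> by (simp_all flip: mult.assoc)
    then show "model (- \<sigma>) 1 \<zeta> = ?c * cnj (model \<sigma> 1 \<zeta>)" "model' (- \<sigma>) 1 \<zeta> = ?c * cnj (model' \<sigma> 1 \<zeta>)"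
      unfolding model_cnj by simp_all
  qed
  have e: "exp (\<zeta> / 2) = \<i> * cnj (exp (\<zeta> / 2))" "exp (- \<zeta> / 2) = - \<i> * cnj (exp (- \<zeta> / 2))"
  proof -
    have hp: "exp (\<i> * of_real pi / 2) = \<i>" "exp (- (\<i> * of_real pi / 2)) = - \<i>"
      using cis_conv_exp[of "pi / 2"] by (simp_all add: exp_minus)
    have "\<i> * cnj (exp (\<zeta> / 2)) = exp (\<i> * of_real pi / 2) * exp (cnj \<zeta> / 2)"
      by (simp only: hp) (simp add: exp_cnj)
    also have "\<dots> = exp ((cnj \<zeta> + \<i> * of_real pi) / 2)"
      by (simp add: add_divide_distrib add.commute flip: exp_add)
    finally show "exp (\<zeta> / 2) = \<i> * cnj (exp (\<zeta> / 2))" unfolding \<zeta> ..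
    have "- \<i> * cnj (exp (- \<zeta> / 2)) = exp (- (\<i> * of_real pi / 2)) * exp (- cnj \<zeta> / 2)"
      by (simp only: hp) (simp add: exp_cnj)
    also have "\<dots> = exp (- (cnj \<zeta> + \<i> * of_real pi) / 2)"
      by (simp add: add_divide_distrib diff_divide_distrib add.commute flip: exp_add)
    finally show "exp (- \<zeta> / 2) = - \<i> * cnj (exp (- \<zeta> / 2))" unfolding \<zeta> ..
  qed
  have Z: "cnj (exp (\<i> * exp \<zeta>)) = exp (\<i> * exp \<zeta>)"
  proof -
    have "exp (\<i> * of_real (pi / 2)) = \<i>" using cis_conv_exp[of "pi / 2"] by simp
    then have "exp \<zeta> = of_real (exp s) * \<i>" by (simp only: \<zeta>_def exp_add exp_of_real)
    then have "\<i> * exp \<zeta> = of_real (- exp s)" by (simp only:) (simp add: complex_eq_iff)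
    then have "exp (\<i> * exp \<zeta>) = of_real (exp (- exp s))" by (simp only: exp_of_real)
    then show ?thesis by (simp only: complex_cnj_complex_of_real)
  qed
  have f: "jost_f (- \<sigma>) \<zeta> = \<i> * ?c * cnj (jost_f \<sigma> \<zeta>)"
    unfolding jost_f_def m by (subst e(1)) (simp add: mult_ac)
  have fz: "jost_fz (- \<sigma>) \<zeta> = - \<i> * ?c * cnj (jost_fz \<sigma> \<zeta>)"
    unfolding jost_fz_def m by (subst e(2)) (simp add: algebra_simps)
  have aux: "(\<i> * (\<i> * c * F) - - \<i> * c * G) * e / (2 * \<i>) = \<i> * c * ((- \<i> * F - G) * e / (2 * - \<i>))"
    for c F G e :: complex
    by (simp add: field_simps)
  show ?thesis
    unfolding jost_in_def f fz complex_cnj_divide complex_cnj_mult complex_cnj_diff complex_cnj_i complex_cnj_numeral Z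
    by (rule aux)
qed

text \<open>
  On the real line conjugation exchanges incoming and outgoing waves.
\<close>

lemma jost_B_reflected: "jost_B (- \<sigma>) = cnj (jost_A \<sigma>)"
proof -
  have "jost_in (- \<sigma>) (of_real s) = cnj (jost_out \<sigma> (of_real s) * exp (- 2 * \<i> * of_real (exp s)))" for s :: real
  proof -
    have f: "jost_f (- \<sigma>) (of_real s) = cnj (jost_f \<sigma> (of_real s))" "jost_fz (- \<sigma>) (of_real s) = cnj (jost_fz \<sigma> (of_real s))"
      by (simp_all add: jost_f_def jost_fz_def model_cnj exp_cnj)
    have e: "exp (\<i> * exp (of_real s)) * exp (- 2 * \<i> * of_real (exp s)) = exp (- \<i> * of_real (exp s))"
      by (simp add: exp_of_real flip: exp_add)
    have flip: "(a - b) * c / (- 2 * \<i>) = (b - a) * c / (2 * \<i>)" for a b c :: complex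
      by (simp add: field_simps)
    have assoc: "a * b / d * c = a * (b * c) / d" for a b c d :: complex by simp
    have "jost_out \<sigma> (of_real s) * exp (- 2 * \<i> * of_real (exp s)) =
      (jost_fz \<sigma> (of_real s) + \<i> * jost_f \<sigma> (of_real s)) * exp (- \<i> * of_real (exp s)) / (2 * \<i>)"
      unfolding jost_out_def assoc e ..
    also have "cnj \<dots> = (cnj (jost_fz \<sigma> (of_real s)) - \<i> * cnj (jost_f \<sigma> (of_real s))) * exp (\<i> * of_real (exp s)) / (- 2 * \<i>)"
      by (simp add: exp_cnj)
    also have "\<dots> = jost_in (- \<sigma>) (of_real s)"
      unfolding jost_in_def f exp_of_real by (rule flip)
    finally show ?thesis by simp
  qed
  moreover have "((\<lambda>s::real. cnj (jost_out \<sigma> (of_real s) * exp (- 2 * \<i> * of_real (exp s)))) \<longlongrightarrow> cnj (jost_A \<sigma>)) at_top"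
    by (intro tendsto_cnj jost_A_limit)
  ultimately have "((\<lambda>s::real. jost_in (- \<sigma>) (of_real s)) \<longlongrightarrow> cnj (jost_A \<sigma>)) at_top" by simp
  then show ?thesis
    using tendsto_unique[OF _ jost_B_limit] by (simp add: trivial_limit_at_top_linorder)
qed

text \<open>
  Both expressions for \<open>jost_B (- \<sigma>)\<close>, one from the real line and one from the line \<open>Im \<zeta> = \<pi>/2\<close>, agree.
  The factor \<open>exp(\<pi>\<sigma>)\<close> is the one in the definition of \<open>sigma_per\<close>.
\<close>

lemma jost_connection: "jost_A \<sigma> = - \<i> * of_real (exp (pi * \<sigma>)) * jost_B \<sigma>"
proof -
  let ?\<zeta> = "\<lambda>s::real. of_real s + \<i> * of_real (pi / 2) :: complex"
  have lim: "((\<lambda>s. jost_in \<tau> (?\<zeta> s)) \<longlongrightarrow> jost_B \<tau>) at_top" for \<tau>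
    using tendsto_add[OF jost_arc[of \<tau>] jost_B_limit[of \<tau>]] by simp
  have "((\<lambda>s. \<i> * of_real (exp (pi * \<sigma>)) * cnj (jost_in \<sigma> (?\<zeta> s))) \<longlongrightarrow> \<i> * of_real (exp (pi * \<sigma>)) * cnj (jost_B \<sigma>)) at_top"
    by (intro tendsto_intros lim)
  then have "((\<lambda>s. jost_in (- \<sigma>) (?\<zeta> s)) \<longlongrightarrow> \<i> * of_real (exp (pi * \<sigma>)) * cnj (jost_B \<sigma>)) at_top"
    by (simp only: jost_in_reflection)
  then have "jost_B (- \<sigma>) = \<i> * of_real (exp (pi * \<sigma>)) * cnj (jost_B \<sigma>)"
    using tendsto_unique[OF _ lim] by (simp add: trivial_limit_at_top_linorder)
  then have "cnj (cnj (jost_A \<sigma>)) = cnj (\<i> * of_real (exp (pi * \<sigma>)) * cnj (jost_B \<sigma>))"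
    unfolding jost_B_reflected by simp
  then show ?thesis by simp
qed

text \<open>
  Uniformity in \<open>E\<close> comes from scaling, which reduces the claim to \<open>E = 1\<close>.
\<close>

lemma model_bounded:
  obtains M where "M \<ge> 0" "\<And>E t. E \<ge> 0 \<Longrightarrow> cmod (model \<sigma> E (of_real t)) \<le> M"
proof -
  obtain M where M: "M \<ge> 0" "\<And>s. s \<ge> 0 \<Longrightarrow> (cmod (jost_out \<sigma> (of_real s)))\<^sup>2 + (cmod (jost_in \<sigma> (of_real s)))\<^sup>2 \<le> M\<^sup>2"
    using jost_bounded by blast
  have pos: "cmod (model \<sigma> 1 (of_real s)) \<le> 2 * M" if "s \<ge> 0" for s
  proof -
    have "cmod (jost_f \<sigma> (of_real s) * exp (\<i> * exp (of_real s))) \<le> 2 * M"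
      unfolding jost_sum[symmetric] by (rule cmod_add_le_of_squares(3)[OF M(2)[OF that] M(1)])
    then have 1: "exp (s / 2) * cmod (model \<sigma> 1 (of_real s)) \<le> 2 * M"
      by (simp add: jost_f_def norm_mult exp_of_real)
    have "1 * cmod (model \<sigma> 1 (of_real s)) \<le> exp (s / 2) * cmod (model \<sigma> 1 (of_real s))"
      using that by (intro mult_right_mono) auto
    with 1 show ?thesis by simp
  qed
  have "compact ((\<lambda>x::real. bessel_series \<sigma> (of_real x)) ` {0..1})"
    by (intro compact_continuous_image continuous_at_imp_continuous_on ballI
        isCont_o2[OF continuous_of_real[OF continuous_ident] DERIV_isCont[OF bessel_series_deriv]]) auto
  from compact_imp_bounded[OF this]
  obtain K where "\<forall>y\<in>(\<lambda>x::real. bessel_series \<sigma> (of_real x)) ` {0..1}. norm y \<le> K"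
    unfolding bounded_iff by blast
  then have K: "\<And>x::real. x \<in> {0..1} \<Longrightarrow> cmod (bessel_series \<sigma> (of_real x)) \<le> K" by blast
  have neg: "cmod (model \<sigma> 1 (of_real s)) \<le> K" if "s \<le> 0" for s
  proof -
    have "of_real 1 * exp (2 * of_real s) = (of_real (exp (2 * s)) :: complex)" by (simp flip: exp_of_real)
    then have "cmod (model \<sigma> 1 (of_real s)) = cmod (bessel_series \<sigma> (of_real (exp (2 * s))))"
      by (simp add: model_def norm_mult)
    also have "\<dots> \<le> K" using that by (intro K) auto
    finally show ?thesis .
  qed
  define N where "N = max (2 * M) (max K 1)"
  have one: "cmod (model \<sigma> 1 (of_real s)) \<le> N" for s
    using pos[of s] neg[of s] unfolding N_def by linarith
  have "cmod (model \<sigma> E (of_real t)) \<le> N" if "E \<ge> 0" for E t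
  proof (cases "E = 0")
    case True
    then have "cmod (model \<sigma> E (of_real t)) = 1" by (simp add: model_def bessel_series_0 norm_mult)
    then show ?thesis by (simp add: N_def)
  next
    case False
    with that have "E > 0" by simp
    then show ?thesis unfolding model_scaling[OF \<open>E > 0\<close>] norm_mult using one by (simp del: of_real_add)
  qed
  then show ?thesis using that[of N] by (simp add: N_def)
qed

section \<open>Amplitudes relative to the model\<close>

text \<open>
  Variation of constants: a real function \<open>v\<close> and its derivative are represented as
  \<open>v = 2 Re (a j)\<close> and \<open>v' = 2 Re (a j')\<close> with \<open>j = model \<sigma> E\<close>.
\<close>

definition amplitude :: "real \<Rightarrow> real \<Rightarrow> (real \<Rightarrow> real) \<Rightarrow> (real \<Rightarrow> real) \<Rightarrow> real \<Rightarrow> complex" where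
  "amplitude \<sigma> E v v' t =
     \<i> * (of_real (v t) * cnj (model' \<sigma> E (of_real t)) - of_real (v' t) * cnj (model \<sigma> E (of_real t))) / of_real (2 * \<sigma>)"

lemma amplitude_represents:
  assumes "\<sigma> > 0"
  shows "v t = 2 * Re (amplitude \<sigma> E v v' t * model \<sigma> E (of_real t))"
proof -
  define j j' where "j = model \<sigma> E (of_real t)" and "j' = model' \<sigma> E (of_real t)"
  have w: "Im j' * Re j - Re j' * Im j = \<sigma>"
    using model_wronskian[of \<sigma> E t] by (simp add: j_def j'_def algebra_simps)
  have "2 * Re (amplitude \<sigma> E v v' t * j) = v t * (Im j' * Re j - Re j' * Im j) / \<sigma>"
    unfolding amplitude_def j_def[symmetric] j'_def[symmetric] using assms
    by (simp add: field_simps)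
  then show ?thesis using w assms by (simp add: j_def)
qed

lemma amplitude_wronskian:
  assumes "\<sigma> > 0"
  shows "Im (amplitude \<sigma> E v v' t * cnj (amplitude \<sigma> E w w' t)) = (v t * w' t - v' t * w t) / (4 * \<sigma>)"
proof -
  define j j' where "j = model \<sigma> E (of_real t)" and "j' = model' \<sigma> E (of_real t)"
  have w: "Im j' * Re j - Re j' * Im j = \<sigma>"
    using model_wronskian[of \<sigma> E t] by (simp add: j_def j'_def algebra_simps)
  have "Im (amplitude \<sigma> E v v' t * cnj (amplitude \<sigma> E w w' t)) =
      (v t * w' t - v' t * w t) * (Im j' * Re j - Re j' * Im j) / (4 * \<sigma> * \<sigma>)"
    unfolding amplitude_def j_def[symmetric] j'_def[symmetric] using assms
    by (simp add: field_simps)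
  then show ?thesis using w assms by simp
qed

text \<open>
  If \<open>v\<close> solves the full equation, the amplitude changes only through the deviation \<open>P + \<sigma>\<^sup>2\<close>.
\<close>

lemma amplitude_deriv:
  assumes v: "(v has_real_derivative v' t) (at t)"
    and v': "(v' has_real_derivative (P t - E * exp (2 * t)) * v t) (at t)"
  shows "(amplitude \<sigma> E v v' has_vector_derivative
     - \<i> * of_real (P t + \<sigma>\<^sup>2) * of_real (v t) * cnj (model \<sigma> E (of_real t)) / of_real (2 * \<sigma>)) (at t)"
proof -
  note dv = has_vector_derivative_of_real[OF v]
  note dv' = has_vector_derivative_of_real[OF v']
  have 1: "((\<lambda>t. of_real (v t) * cnj (model' \<sigma> E (of_real t)) - of_real (v' t) * cnj (model \<sigma> E (of_real t)))
     has_vector_derivative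
      (of_real (v t) * cnj (- of_real (\<sigma>\<^sup>2 + E * exp (2 * t)) * model \<sigma> E (of_real t)) + of_real (v' t) * cnj (model' \<sigma> E (of_real t)))
     - (of_real (v' t) * cnj (model' \<sigma> E (of_real t)) + of_real ((P t - E * exp (2 * t)) * v t) * cnj (model \<sigma> E (of_real t)))) (at t)"
    by (intro has_vector_derivative_diff has_vector_derivative_mult has_vector_derivative_cnj model_vector_deriv dv dv')
  have 2: "(of_real (v t) * cnj (- of_real (\<sigma>\<^sup>2 + E * exp (2 * t)) * model \<sigma> E (of_real t)) + of_real (v' t) * cnj (model' \<sigma> E (of_real t)))
     - (of_real (v' t) * cnj (model' \<sigma> E (of_real t)) + of_real ((P t - E * exp (2 * t)) * v t) * cnj (model \<sigma> E (of_real t)))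
    = - (of_real (P t + \<sigma>\<^sup>2) * of_real (v t) * cnj (model \<sigma> E (of_real t)))"
    by (simp add: algebra_simps)
  have "(amplitude \<sigma> E v v' has_vector_derivative
     \<i> * - (of_real (P t + \<sigma>\<^sup>2) * of_real (v t) * cnj (model \<sigma> E (of_real t))) / of_real (2 * \<sigma>)) (at t)"
    unfolding amplitude_def[abs_def]
    by (intro has_vector_derivative_divide has_vector_derivative_mult_right 1[unfolded 2])
  then show ?thesis by (simp add: mult_ac)
qed

definition model_bound :: "real \<Rightarrow> real" where
  "model_bound \<sigma> = (SOME M. M \<ge> 0 \<and> (\<forall>E t. E \<ge> 0 \<longrightarrow> cmod (model \<sigma> E (of_real t)) \<le> M))"

lemma model_bound: "model_bound \<sigma> \<ge> 0" "E \<ge> 0 \<Longrightarrow> cmod (model \<sigma> E (of_real t)) \<le> model_bound \<sigma>"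
proof -
  have "\<exists>M. M \<ge> 0 \<and> (\<forall>E t. E \<ge> 0 \<longrightarrow> cmod (model \<sigma> E (of_real t)) \<le> M)"
    using model_bounded[of \<sigma>] by metis
  from someI_ex[OF this] show "model_bound \<sigma> \<ge> 0" "E \<ge> 0 \<Longrightarrow> cmod (model \<sigma> E (of_real t)) \<le> model_bound \<sigma>"
    unfolding model_bound_def[symmetric] by auto
qed

text \<open>
  The amplitude satisfies \<open>\<bar>a'\<bar> \<le> K exp(- \<epsilon> t) \<bar>a\<bar>\<close>, with \<open>K\<close> independent of \<open>E\<close> because the model is
  uniformly bounded. Gronwall's inequality upwards bounds \<open>a\<close>, so the limit exists, and Gronwall's inequality
  downwards shows that the limit is not zero.
\<close>

lemma amplitude_limit:
  assumes \<sigma>: "\<sigma> > 0" and "E \<ge> 0" and \<epsilon>: "\<epsilon> > 0" and "c \<ge> 0"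
    and v: "\<And>t. (v has_real_derivative v' t) (at t)"
    and v': "\<And>t. (v' has_real_derivative (P t - E * exp (2 * t)) * v t) (at t)"
    and P: "\<And>t. t \<ge> T \<Longrightarrow> \<bar>P t + \<sigma>\<^sup>2\<bar> \<le> c * exp (- \<epsilon> * t)"
  defines "K \<equiv> c * (model_bound \<sigma>)\<^sup>2 / \<sigma>"
  obtains l where "(amplitude \<sigma> E v v' \<longlongrightarrow> l) at_top"
    "\<And>t. t \<ge> T \<Longrightarrow> cmod (l - amplitude \<sigma> E v v' t) \<le>
        K / \<epsilon> * exp (- \<epsilon> * t) * exp (K / \<epsilon> * exp (- \<epsilon> * T)) * cmod (amplitude \<sigma> E v v' T)"
    "v T \<noteq> 0 \<Longrightarrow> l \<noteq> 0"
proof -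
  let ?a = "amplitude \<sigma> E v v'"
  let ?M = "model_bound \<sigma>"
  define a' where "a' = (\<lambda>t. - \<i> * of_real (P t + \<sigma>\<^sup>2) * of_real (v t) * cnj (model \<sigma> E (of_real t)) / of_real (2 * \<sigma>))"
  have a: "(?a has_vector_derivative a' t) (at t)" for t
    unfolding a'_def by (rule amplitude_deriv[OF v v'])
  have K: "K \<ge> 0" using \<sigma> \<open>c \<ge> 0\<close> by (simp add: K_def)
  have a': "cmod (a' t) \<le> K * exp (- \<epsilon> * t) * cmod (?a t)" if t: "t \<ge> T" for t
  proof -
    note M = model_bound(1)[of \<sigma>] model_bound(2)[OF \<open>E \<ge> 0\<close>, of \<sigma> t]
    have "\<bar>v t\<bar> \<le> 2 * (cmod (?a t) * ?M)"
    proof -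
      have "\<bar>Re (?a t * model \<sigma> E (of_real t))\<bar> \<le> cmod (?a t * model \<sigma> E (of_real t))" by (rule abs_Re_le_cmod)
      also have "\<dots> \<le> cmod (?a t) * ?M" unfolding norm_mult by (intro mult_left_mono M) auto
      finally show ?thesis using amplitude_represents[OF \<sigma>, of v t E v'] by simp
    qed
    then have "\<bar>P t + \<sigma>\<^sup>2\<bar> * \<bar>v t\<bar> * cmod (model \<sigma> E (of_real t)) \<le> (c * exp (- \<epsilon> * t)) * (2 * (cmod (?a t) * ?M)) * ?M"
      using P[OF t] M by (intro mult_mono) (auto intro: \<open>c \<ge> 0\<close>)
    then have "\<bar>P t + \<sigma>\<^sup>2\<bar> * \<bar>v t\<bar> * cmod (model \<sigma> E (of_real t)) / (2 * \<sigma>) \<le> (c * exp (- \<epsilon> * t)) * (2 * (cmod (?a t) * ?M)) * ?M / (2 * \<sigma>)"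
      using \<sigma> by (intro divide_right_mono) auto
    also have "\<dots> = K * exp (- \<epsilon> * t) * cmod (?a t)"
      by (simp add: K_def power2_eq_square)
    also have "\<bar>P t + \<sigma>\<^sup>2\<bar> * \<bar>v t\<bar> * cmod (model \<sigma> E (of_real t)) / (2 * \<sigma>) = cmod (a' t)"
      unfolding a'_def norm_mult norm_divide norm_of_real complex_mod_cnj norm_minus_cancel using \<sigma> by simp
    finally show ?thesis .
  qed
  have d: "((\<lambda>t. (cmod (?a t))\<^sup>2) has_real_derivative 2 * Re (cnj (?a t) * a' t)) (at t)" for t
    by (rule has_real_derivative_cmod_power2[OF a])
  have k: "((\<lambda>t. - (2 * K / \<epsilon> * exp (- \<epsilon> * t))) has_real_derivative 2 * K * exp (- \<epsilon> * t)) (at t)" for t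
    using \<epsilon> by (auto intro!: derivative_eq_intros)
  have le: "\<bar>2 * Re (cnj (?a t) * a' t)\<bar> \<le> 2 * K * exp (- \<epsilon> * t) * (cmod (?a t))\<^sup>2" if "t \<ge> T" for t
  proof -
    have "\<bar>Re (cnj (?a t) * a' t)\<bar> \<le> cmod (?a t) * cmod (a' t)"
      by (metis abs_Re_le_cmod complex_mod_cnj norm_mult)
    also have "\<dots> \<le> cmod (?a t) * (K * exp (- \<epsilon> * t) * cmod (?a t))"
      by (intro mult_left_mono a' that) auto
    finally show ?thesis by (simp add: power2_eq_square mult_ac)
  qed
  have le2: "- (2 * K * exp (- \<epsilon> * t) * (cmod (?a t))\<^sup>2) \<le> 2 * Re (cnj (?a t) * a' t)" if "t \<ge> T" for t
    using le[OF that] by linarith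
  define D where "D = exp (K / \<epsilon> * exp (- \<epsilon> * T))"
  have D2: "exp (2 * K / \<epsilon> * exp (- \<epsilon> * T)) = D\<^sup>2"
    by (simp add: D_def power2_eq_square flip: exp_add)
  have up: "cmod (?a t) \<le> D * cmod (?a T)" if t: "t \<ge> T" for t
  proof -
    have "(cmod (?a t))\<^sup>2 \<le> (cmod (?a T))\<^sup>2 * exp (- (2 * K / \<epsilon> * exp (- \<epsilon> * t)) - - (2 * K / \<epsilon> * exp (- \<epsilon> * T)))"
      by (rule gronwall_upper[OF t d k]) (use le in \<open>auto simp: abs_le_iff\<close>)
    also have "\<dots> \<le> (cmod (?a T))\<^sup>2 * exp (2 * K / \<epsilon> * exp (- \<epsilon> * T))"
      using K \<epsilon> by (intro mult_left_mono) auto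
    also have "\<dots> = (D * cmod (?a T))\<^sup>2" unfolding D2 by (simp add: power_mult_distrib)
    finally show ?thesis by (rule power2_le_imp_le) (simp add: D_def)
  qed
  have low: "cmod (?a T) \<le> D * cmod (?a t)" if t: "t \<ge> T" for t
  proof -
    have "(cmod (?a T))\<^sup>2 \<le> (cmod (?a t))\<^sup>2 * exp (- (2 * K / \<epsilon> * exp (- \<epsilon> * t)) - - (2 * K / \<epsilon> * exp (- \<epsilon> * T)))"
      by (rule gronwall_lower[OF t d k]) (rule le2)
    also have "\<dots> \<le> (cmod (?a t))\<^sup>2 * exp (2 * K / \<epsilon> * exp (- \<epsilon> * T))"
      using K \<epsilon> by (intro mult_left_mono) auto
    also have "\<dots> = (D * cmod (?a t))\<^sup>2" unfolding D2 by (simp add: power_mult_distrib)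
    finally show ?thesis by (rule power2_le_imp_le) (simp add: D_def)
  qed
  obtain l where l: "(?a \<longlongrightarrow> l) at_top"
    and lb: "\<And>s. s \<ge> T \<Longrightarrow> norm (l - ?a s) \<le> K * (D * cmod (?a T)) / \<epsilon> * exp (- \<epsilon> * s)"
  proof (rule converges_if_derivative_exp_decay[OF a _ \<epsilon>])
    fix s assume s: "s \<ge> T"
    have "cmod (a' s) \<le> K * exp (- \<epsilon> * s) * cmod (?a s)" by (rule a'[OF s])
    also have "\<dots> \<le> K * exp (- \<epsilon> * s) * (D * cmod (?a T))"
      using K by (intro mult_left_mono up s) auto
    finally show "cmod (a' s) \<le> K * (D * cmod (?a T)) * exp (- \<epsilon> * s)" by (simp add: mult_ac)
  qed blast
  have "cmod (?a T) \<le> D * cmod l"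
  proof (rule tendsto_le[OF _ tendsto_mult_left[OF tendsto_norm[OF l]] tendsto_const])
    show "\<forall>\<^sub>F t in at_top. cmod (?a T) \<le> D * cmod (?a t)"
      using eventually_ge_at_top[of T] by eventually_elim (rule low)
  qed simp
  moreover have "?a T \<noteq> 0" if "v T \<noteq> 0"
    using amplitude_represents[OF \<sigma>, of v T E v'] that by auto
  ultimately have "l \<noteq> 0" if "v T \<noteq> 0" using that by auto
  with l lb show ?thesis
    using that[of l] by (simp add: D_def mult_ac)
qed

text \<open>
  The convergence rate is locally uniform in \<open>E\<close>, and the amplitude at a fixed \<open>t\<close> is continuous in \<open>E\<close>.
\<close>

lemma amplitude_limit_continuous:
  fixes v v' :: "real \<Rightarrow> real \<Rightarrow> real"
  assumes \<sigma>: "\<sigma> > 0" and \<epsilon>: "\<epsilon> > 0" and c: "c \<ge> 0"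
    and v: "\<And>E t. E \<ge> 0 \<Longrightarrow> (v E has_real_derivative v' E t) (at t)"
    and v': "\<And>E t. E \<ge> 0 \<Longrightarrow> (v' E has_real_derivative (P t - E * exp (2 * t)) * v E t) (at t)"
    and P: "\<And>t. t \<ge> 0 \<Longrightarrow> \<bar>P t + \<sigma>\<^sup>2\<bar> \<le> c * exp (- \<epsilon> * t)"
    and cv: "\<And>t. continuous_on {0..} (\<lambda>E. v E t)" and cv': "\<And>t. continuous_on {0..} (\<lambda>E. v' E t)"
    and lim: "\<And>E. E \<ge> 0 \<Longrightarrow> (amplitude \<sigma> E (v E) (v' E) \<longlongrightarrow> b E) at_top"
  shows "continuous_on {0..} b"
proof -
  define K where "K = c * (model_bound \<sigma>)\<^sup>2 / \<sigma>"
  define a where "a = (\<lambda>t E. amplitude \<sigma> E (v E) (v' E) t)"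
  have ca: "continuous_on {0..} (a t)" for t
  proof -
    have 1: "continuous_on {0..} (\<lambda>E. of_real E * exp (2 * of_real t) :: complex)" by (intro continuous_intros)
    have g: "continuous_on UNIV (bessel_series \<sigma>)" "continuous_on UNIV (bessel_series' \<sigma>)"
      using bessel_series_deriv bessel_series'_deriv
      by (auto intro!: continuous_at_imp_continuous_on DERIV_isCont)
    have 2: "continuous_on {0..} (\<lambda>E. bessel_series \<sigma> (of_real E * exp (2 * of_real t)))"
      "continuous_on {0..} (\<lambda>E. bessel_series' \<sigma> (of_real E * exp (2 * of_real t)))"
      by (auto intro!: continuous_on_compose2[OF g(1) 1] continuous_on_compose2[OF g(2) 1])
    show ?thesis
      unfolding a_def amplitude_def model_def model'_def using \<sigma>
      by (intro continuous_intros cv cv' 1 2) auto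
  qed
  have bound: "cmod (b E - a t E) \<le> K / \<epsilon> * exp (- \<epsilon> * t) * exp (K / \<epsilon>) * cmod (a 0 E)" if "E \<ge> 0" "t \<ge> 0" for E t
  proof -
    obtain l where l: "(amplitude \<sigma> E (v E) (v' E) \<longlongrightarrow> l) at_top"
      "\<And>t. t \<ge> 0 \<Longrightarrow> cmod (l - amplitude \<sigma> E (v E) (v' E) t) \<le>
        c * (model_bound \<sigma>)\<^sup>2 / \<sigma> / \<epsilon> * exp (- \<epsilon> * t) * exp (c * (model_bound \<sigma>)\<^sup>2 / \<sigma> / \<epsilon> * exp (- \<epsilon> * 0))
          * cmod (amplitude \<sigma> E (v E) (v' E) 0)"
    proof (rule amplitude_limit[OF \<sigma> \<open>E \<ge> 0\<close> \<epsilon> c v[OF \<open>E \<ge> 0\<close>] v'[OF \<open>E \<ge> 0\<close>] P])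
      fix l assume 1: "(amplitude \<sigma> E (v E) (v' E) \<longlongrightarrow> l) at_top"
        and 2: "\<And>t. t \<ge> 0 \<Longrightarrow> cmod (l - amplitude \<sigma> E (v E) (v' E) t) \<le>
          c * (model_bound \<sigma>)\<^sup>2 / \<sigma> / \<epsilon> * exp (- \<epsilon> * t) * exp (c * (model_bound \<sigma>)\<^sup>2 / \<sigma> / \<epsilon> * exp (- \<epsilon> * 0))
            * cmod (amplitude \<sigma> E (v E) (v' E) 0)"
      show thesis by (rule that[OF 1 2])
    qed
    have "l = b E"
      using tendsto_unique[OF _ l(1) lim[OF \<open>E \<ge> 0\<close>]] by (simp add: trivial_limit_at_top_linorder)
    then show ?thesis using l(2)[OF \<open>t \<ge> 0\<close>] by (simp add: K_def a_def)
  qed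
  have "continuous_on {0..R} b" for R
  proof -
    have "continuous_on {0..R} (a 0)" by (rule continuous_on_subset[OF ca]) auto
    then have "bounded (a 0 ` {0..R})" by (intro compact_imp_bounded compact_continuous_image) auto
    then obtain N where "\<forall>E\<in>{0..R}. cmod (a 0 E) \<le> N" unfolding bounded_iff by auto
    then have N: "\<And>E. E \<in> {0..R} \<Longrightarrow> cmod (a 0 E) \<le> N" by blast
    have K0: "K \<ge> 0" using \<sigma> c by (simp add: K_def)
    show ?thesis
    proof (rule uniform_limit_theorem[where F = at_top and f = a])
      show "\<forall>\<^sub>F t in at_top. continuous_on {0..R} (a t)"
        by (intro always_eventually allI continuous_on_subset[OF ca]) auto
      show "uniform_limit {0..R} a b at_top"
      proof (rule uniform_limitI)
        fix e :: real assume "e > 0"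
        have "((\<lambda>t. K / \<epsilon> * exp (- \<epsilon> * t) * exp (K / \<epsilon>) * N) \<longlongrightarrow> K / \<epsilon> * 0 * exp (K / \<epsilon>) * N) at_top"
          by (intro tendsto_intros filterlim_compose[OF exp_at_bot] filterlim_tendsto_neg_mult_at_bot[OF tendsto_const] filterlim_ident)
             (use \<epsilon> in auto)
        then have "\<forall>\<^sub>F t in at_top. K / \<epsilon> * exp (- \<epsilon> * t) * exp (K / \<epsilon>) * N < e"
          using \<open>e > 0\<close> by (intro order_tendstoD(2)) auto
        then show "\<forall>\<^sub>F t in at_top. \<forall>E\<in>{0..R}. dist (a t E) (b E) < e"
          using eventually_ge_at_top[of 0]
        proof eventually_elim
          case (elim t)
          show ?case
          proof
            fix E assume E: "E \<in> {0..R}"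
            have "dist (a t E) (b E) \<le> K / \<epsilon> * exp (- \<epsilon> * t) * exp (K / \<epsilon>) * cmod (a 0 E)"
              using bound[of E t] E elim by (simp add: dist_norm norm_minus_commute)
            also have "\<dots> \<le> K / \<epsilon> * exp (- \<epsilon> * t) * exp (K / \<epsilon>) * N"
              using K0 \<epsilon> N[OF E] by (intro mult_left_mono) auto
            finally show "dist (a t E) (b E) < e" using elim by simp
          qed
        qed
      qed
    qed simp
  qed
  then show ?thesis
    unfolding continuous_on_def
  proof (intro ballI)
    fix E :: real assume "E \<in> {0..}"
    assume *: "\<And>R. \<forall>E\<in>{0..R}. (b \<longlongrightarrow> b E) (at E within {0..R})"
    have "at E within {0..} = at E within {0..E + 1}"
      by (rule at_within_nhd[of E "{..<E + 1}"]) auto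
    then show "(b \<longlongrightarrow> b E) (at E within {0..})" using *[of "E + 1"] \<open>E \<in> {0..}\<close> by auto
  qed
qed

text \<open>
  The coefficient of \<open>exp(i k r)\<close> in \<open>b exp(- i \<sigma> ln k) (A exp(i k r) + B exp(- i k r))\<close> after taking the real part,
  where \<open>Re (b' exp(- i k r)) = Re (cnj b' exp(i k r))\<close> moves the incoming part into the conjugate.
\<close>

definition far_amplitude :: "real \<Rightarrow> complex \<Rightarrow> real \<Rightarrow> complex" where
  "far_amplitude \<sigma> b E = b * exp (- \<i> * of_real (\<sigma> * ln (sqrt E))) * jost_A \<sigma>
     + cnj (b * exp (- \<i> * of_real (\<sigma> * ln (sqrt E))) * jost_B \<sigma>)"

text \<open>
  Insert the limit of the amplitude and the scaled asymptotics of the model into \<open>v = 2 Re (a j)\<close>.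
\<close>

lemma solution_asymptotics:
  assumes \<sigma>: "\<sigma> > 0" and "E > 0" and lim: "(amplitude \<sigma> E v v' \<longlongrightarrow> b) at_top"
  shows "((\<lambda>r. sqrt r * v (ln r) - 2 / sqrt (sqrt E) * Re (far_amplitude \<sigma> b E * exp (\<i> * of_real (sqrt E * r)))) \<longlongrightarrow> 0) at_top"
proof -
  define k where "k = sqrt E"
  have k: "k > 0" using \<open>E > 0\<close> by (simp add: k_def)
  define \<omega> where "\<omega> = exp (- \<i> * of_real (\<sigma> * ln k))"
  define X where "X = (\<lambda>s::real. of_real (exp (s / 2)) * model \<sigma> 1 (of_real s))"
  define Y where "Y = (\<lambda>s::real. jost_A \<sigma> * exp (\<i> * of_real (exp s)) + jost_B \<sigma> * exp (- \<i> * of_real (exp s)))"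
  define a where "a = amplitude \<sigma> E v v'"
  have XY: "((\<lambda>s. X s - Y s) \<longlongrightarrow> 0) at_top"
    unfolding X_def Y_def by (rule model_asymptotics)
  have Yb: "cmod (Y s) \<le> cmod (jost_A \<sigma>) + cmod (jost_B \<sigma>)" for s
  proof -
    have "cmod (Y s) \<le> cmod (jost_A \<sigma> * exp (\<i> * of_real (exp s))) + cmod (jost_B \<sigma> * exp (- \<i> * of_real (exp s)))"
      unfolding Y_def by (rule norm_triangle_ineq)
    then show ?thesis by (simp add: norm_mult)
  qed
  have shift: "filterlim (\<lambda>t. t + ln k) at_top at_top"
    by (rule filterlim_tendsto_add_at_top[OF tendsto_const, of _ _ "ln k", unfolded add.commute[of "ln k"]]) (rule filterlim_ident)
  have main: "((\<lambda>t. a t * X (t + ln k) - b * Y (t + ln k)) \<longlongrightarrow> 0) at_top"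
  proof -
    have "((\<lambda>t. (a t - b) * Y (t + ln k)) \<longlongrightarrow> 0) at_top"
    proof (rule Lim_null_comparison[OF always_eventually[OF allI]])
      show "norm ((a t - b) * Y (t + ln k)) \<le> cmod (a t - b) * (cmod (jost_A \<sigma>) + cmod (jost_B \<sigma>))" for t
        unfolding norm_mult by (intro mult_left_mono Yb) auto
      show "((\<lambda>t. cmod (a t - b) * (cmod (jost_A \<sigma>) + cmod (jost_B \<sigma>))) \<longlongrightarrow> 0) at_top"
        using tendsto_mult_right[OF tendsto_norm_zero[OF LIM_zero[OF lim]]] by (auto simp: a_def)
    qed
    moreover have "((\<lambda>t. a t * (X (t + ln k) - Y (t + ln k))) \<longlongrightarrow> b * 0) at_top"
      unfolding a_def by (intro tendsto_mult lim filterlim_compose[OF XY shift])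
    ultimately have "((\<lambda>t. a t * (X (t + ln k) - Y (t + ln k)) + (a t - b) * Y (t + ln k)) \<longlongrightarrow> b * 0 + 0) at_top"
      by (intro tendsto_add)
    then show ?thesis by (simp add: algebra_simps)
  qed
  have "((\<lambda>t. 2 / sqrt k * Re (\<omega> * (a t * X (t + ln k) - b * Y (t + ln k)))) \<longlongrightarrow> 2 / sqrt k * Re (\<omega> * 0)) at_top"
    by (intro tendsto_intros main)
  then have *: "((\<lambda>t. 2 / sqrt k * Re (\<omega> * (a t * X (t + ln k) - b * Y (t + ln k)))) \<longlongrightarrow> 0) at_top" by simp
  have eq: "2 / sqrt k * Re (\<omega> * (a (ln r) * X (ln r + ln k) - b * Y (ln r + ln k))) =
     sqrt r * v (ln r) - 2 / sqrt (sqrt E) * Re (far_amplitude \<sigma> b E * exp (\<i> * of_real (sqrt E * r)))" if r: "r > 0" for r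
  proof -
    have er: "exp ((ln r + ln k) / 2) = sqrt r * sqrt k"
    proof -
      have "exp (ln x / 2) = sqrt x" if "x > 0" for x :: real
        unfolding ln_sqrt[OF less_imp_le[OF that], symmetric] using that by simp
      then show ?thesis using r k by (simp add: add_divide_distrib exp_add)
    qed
    have ek: "exp (ln r + ln k) = k * r" using r k by (simp add: exp_add)
    have "\<omega> * (a (ln r) * X (ln r + ln k)) = of_real (sqrt r * sqrt k) * (a (ln r) * model \<sigma> E (of_real (ln r)))"
      unfolding model_scaling[OF \<open>E > 0\<close>] X_def er k_def[symmetric] \<omega>_def by (simp only: mult_ac)
    then have "Re (\<omega> * (a (ln r) * X (ln r + ln k))) = (sqrt r * sqrt k) * Re (a (ln r) * model \<sigma> E (of_real (ln r)))"
      by (simp only: times_complex.simps Re_complex_of_real Im_complex_of_real mult_zero_left diff_zero)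
    also have "Re (a (ln r) * model \<sigma> E (of_real (ln r))) = v (ln r) / 2"
      using amplitude_represents[OF \<sigma>, of v "ln r" E v'] unfolding a_def by linarith
    finally have R: "Re (\<omega> * (a (ln r) * X (ln r + ln k))) = sqrt r * sqrt k * (v (ln r) / 2)" .
    have 1: "2 / sqrt k * Re (\<omega> * (a (ln r) * X (ln r + ln k))) = sqrt r * v (ln r)"
      unfolding R using k by simp
    have "Re (\<omega> * (b * Y (ln r + ln k))) = Re (far_amplitude \<sigma> b E * exp (\<i> * of_real (k * r)))"
    proof -
      let ?e = "exp (\<i> * of_real (k * r))"
      have "\<omega> * (b * Y (ln r + ln k)) = b * \<omega> * jost_A \<sigma> * ?e + b * \<omega> * jost_B \<sigma> * cnj ?e"
        unfolding Y_def ek by (simp add: algebra_simps exp_cnj)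
      moreover have "Re (b * \<omega> * jost_B \<sigma> * cnj ?e) = Re (cnj (b * \<omega> * jost_B \<sigma>) * ?e)"
      proof -
        have "cnj (b * \<omega> * jost_B \<sigma> * cnj ?e) = cnj (b * \<omega> * jost_B \<sigma>) * ?e" by simp
        from arg_cong[OF this, of Re] show ?thesis by (simp only: cnj.simps)
      qed
      moreover have "far_amplitude \<sigma> b E = b * \<omega> * jost_A \<sigma> + cnj (b * \<omega> * jost_B \<sigma>)"
        by (simp add: far_amplitude_def \<omega>_def k_def)
      ultimately show ?thesis by (simp only: distrib_right plus_complex.simps)
    qed
    then show ?thesis using 1 by (simp only: right_diff_distrib minus_complex.simps k_def)
  qed
  from filterlim_compose[OF * ln_at_top]
  show ?thesis
  proof (rule Lim_transform_eventually)
    show "\<forall>\<^sub>F r in at_top. 2 / sqrt k * Re (\<omega> * (a (ln r) * X (ln r + ln k) - b * Y (ln r + ln k))) =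
     sqrt r * v (ln r) - 2 / sqrt (sqrt E) * Re (far_amplitude \<sigma> b E * exp (\<i> * of_real (sqrt E * r)))"
      using eventually_gt_at_top[of 0] by eventually_elim (rule eq)
  qed
qed

text \<open>
  The connection formula eliminates \<open>jost_B\<close>: the far amplitude is a fixed real linear
  image of a point that rotates with \<open>ln k\<close>.
\<close>

lemma far_amplitude_alt:
  "far_amplitude \<sigma> b E = b * exp (- \<i> * of_real (\<sigma> * ln (sqrt E))) * jost_A \<sigma>
     - \<i> * of_real (exp (- pi * \<sigma>)) * cnj (b * exp (- \<i> * of_real (\<sigma> * ln (sqrt E))) * jost_A \<sigma>)"
proof -
  have e: "exp (- pi * \<sigma>) * exp (pi * \<sigma>) = (1::real)" by (simp flip: exp_add)
  have "jost_B \<sigma> = \<i> * of_real (exp (- pi * \<sigma>)) * jost_A \<sigma>"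
  proof -
    have "\<i> * of_real (exp (- pi * \<sigma>)) * jost_A \<sigma> = of_real (exp (- pi * \<sigma>) * exp (pi * \<sigma>)) * jost_B \<sigma>"
      unfolding jost_connection[of \<sigma>] by (simp add: mult_ac)
    then show ?thesis unfolding e by simp
  qed
  then show ?thesis unfolding far_amplitude_def by (simp add: mult_ac)
qed

lemma jost_A_nonzero: "\<sigma> > 0 \<Longrightarrow> jost_A \<sigma> \<noteq> 0"
  using jost_flux[of \<sigma>] by (smt (verit) norm_zero zero_le_power2 zero_power2)

text \<open>
  The two terms have moduli in the ratio \<open>exp(- \<pi>\<sigma>) < 1\<close>.
\<close>

lemma far_amplitude_nonzero:
  assumes "\<sigma> > 0" "b \<noteq> 0"
  shows "far_amplitude \<sigma> b E \<noteq> 0"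
proof
  define X where "X = b * exp (- \<i> * of_real (\<sigma> * ln (sqrt E))) * jost_A \<sigma>"
  have X: "X \<noteq> 0" using assms jost_A_nonzero by (simp add: X_def)
  assume "far_amplitude \<sigma> b E = 0"
  then have "X = \<i> * of_real (exp (- pi * \<sigma>)) * cnj X"
    unfolding far_amplitude_alt X_def[symmetric] by simp
  then have "cmod X = cmod (\<i> * of_real (exp (- pi * \<sigma>)) * cnj X)" by (rule arg_cong)
  also have "\<dots> = exp (- pi * \<sigma>) * cmod X" unfolding norm_mult by simp
  finally have "cmod X = exp (- pi * \<sigma>) * cmod X" .
  then have "exp (- pi * \<sigma>) = 1" using X by simp
  then show False using assms by simp
qed

section \<open>Square integrable functions\<close>

text \<open>
  Stated for a form on a set of functions closed under \<open>x - c y\<close>, so that it applies both to the inner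
  product of \<open>L2\<close> and to the energy form of a semibounded operator, neither of which lives on a type.
\<close>

lemma sesquilinear_cauchy_schwarz:
  fixes h :: "('a \<Rightarrow> complex) \<Rightarrow> ('a \<Rightarrow> complex) \<Rightarrow> complex"
  assumes x: "x \<in> D" and y: "y \<in> D"
    and sub: "\<And>x y c. x \<in> D \<Longrightarrow> y \<in> D \<Longrightarrow> (\<lambda>t. x t - c * y t) \<in> D"
    and expand: "\<And>x y c. x \<in> D \<Longrightarrow> y \<in> D \<Longrightarrow>
      h (\<lambda>t. x t - c * y t) (\<lambda>t. x t - c * y t) = h x x - c * h x y - cnj c * h y x + c * cnj c * h y y"
    and herm: "\<And>x y. x \<in> D \<Longrightarrow> y \<in> D \<Longrightarrow> h y x = cnj (h x y)"
    and pos: "\<And>x. x \<in> D \<Longrightarrow> Re (h x x) \<ge> 0"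
  shows "(cmod (h x y))\<^sup>2 \<le> Re (h x x) * Re (h y y)"
proof -
  define a b w where "a = Re (h x x)" and "b = Re (h y y)" and "w = h x y"
  have ge: "0 \<le> a - 2 * Re (c * w) + (cmod c)\<^sup>2 * b" for c
  proof -
    have "0 \<le> Re (h (\<lambda>t. x t - c * y t) (\<lambda>t. x t - c * y t))" by (intro pos sub x y)
    also have "\<dots> = Re (h x x) - Re (c * w) - Re (cnj (c * w)) + Re (c * cnj c * h y y)"
      unfolding expand[OF x y] herm[OF x y] w_def by simp
    also have "Re (c * cnj c * h y y) = (cmod c)\<^sup>2 * b"
      unfolding complex_norm_square[symmetric] b_def
      by (simp only: times_complex.simps Re_complex_of_real Im_complex_of_real mult_zero_left diff_zero)
    finally show ?thesis by (simp add: a_def)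
  qed
  have b: "b \<ge> 0" unfolding b_def by (rule pos[OF y])
  have cw: "cnj w * w = of_real ((cmod w)\<^sup>2)" by (simp only: complex_norm_square mult.commute)
  have "(cmod w)\<^sup>2 \<le> a * b"
  proof (cases "b = 0")
    case True
    have "w = 0"
    proof (rule ccontr)
      assume "w \<noteq> 0"
      then have p: "(cmod w)\<^sup>2 > 0" by simp
      define s where "s = (a + 1) / (2 * (cmod w)\<^sup>2)"
      have "of_real s * cnj w * w = of_real (s * (cmod w)\<^sup>2)"
        by (simp only: mult.assoc cw of_real_mult)
      then have "0 \<le> a - 2 * (s * (cmod w)\<^sup>2)"
        using ge[of "of_real s * cnj w"] True by (metis Re_complex_of_real add.right_neutral mult_zero_right)
      then show False using p by (simp add: s_def)
    qed
    then show ?thesis using True by simp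
  next
    case False
    with b have "b > 0" by simp
    have "of_real (1 / b) * cnj w * w = of_real (1 / b * (cmod w)\<^sup>2)"
      by (simp only: mult.assoc cw of_real_mult)
    then have "Re (of_real (1 / b) * cnj w * w) = 1 / b * (cmod w)\<^sup>2" by (simp only: Re_complex_of_real)
    moreover have "(cmod (of_real (1 / b) * cnj w))\<^sup>2 * b = 1 / b * (cmod w)\<^sup>2"
      using \<open>b > 0\<close> by (simp add: norm_mult norm_divide power2_eq_square)
    ultimately have "0 \<le> a - 1 / b * (cmod w)\<^sup>2"
      using ge[of "of_real (1 / b) * cnj w"] by linarith
    then show ?thesis using \<open>b > 0\<close> by (simp add: field_simps)
  qed
  then show ?thesis by (simp add: a_def b_def w_def)
qed

lemma L2_inner_integrable:
  assumes "f \<in> L2 M" "g \<in> L2 M"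
  shows "integrable M (\<lambda>x. cnj (f x) * g x)"
proof (rule Bochner_Integration.integrable_bound)
  show "integrable M (\<lambda>x. (cmod (f x))\<^sup>2 + (cmod (g x))\<^sup>2)"
    using assms by (auto simp: L2_def)
  show "(\<lambda>x. cnj (f x) * g x) \<in> borel_measurable M"
    using assms by (auto simp: L2_def intro!: borel_measurable_times borel_measurable_continuous_on[OF continuous_on_cnj[OF continuous_on_id]])
  show "AE x in M. norm (cnj (f x) * g x) \<le> norm ((cmod (f x))\<^sup>2 + (cmod (g x))\<^sup>2)"
  proof (rule AE_I2)
    fix x
    have "2 * (cmod (f x) * cmod (g x)) \<le> (cmod (f x))\<^sup>2 + (cmod (g x))\<^sup>2"
      using sum_squares_bound[of "cmod (f x)" "cmod (g x)"] by simp
    moreover have "0 \<le> cmod (f x) * cmod (g x)" by simp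
    ultimately have "cmod (f x) * cmod (g x) \<le> (cmod (f x))\<^sup>2 + (cmod (g x))\<^sup>2" by linarith
    then show "norm (cnj (f x) * g x) \<le> norm ((cmod (f x))\<^sup>2 + (cmod (g x))\<^sup>2)"
      by (simp add: norm_mult)
  qed
qed

lemma L2_lincomb:
  assumes "f \<in> L2 M" "g \<in> L2 M"
  shows "(\<lambda>x. f x - c * g x) \<in> L2 M"
proof -
  have m: "(\<lambda>x. f x - c * g x) \<in> borel_measurable M" using assms by (auto simp: L2_def)
  have "integrable M (\<lambda>x. (cmod (f x - c * g x))\<^sup>2)"
  proof (rule Bochner_Integration.integrable_bound)
    show "integrable M (\<lambda>x. 2 * (cmod (f x))\<^sup>2 + 2 * (cmod c)\<^sup>2 * (cmod (g x))\<^sup>2)"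
      using assms by (auto simp: L2_def)
    show "(\<lambda>x. (cmod (f x - c * g x))\<^sup>2) \<in> borel_measurable M" using m by measurable
    show "AE x in M. norm ((cmod (f x - c * g x))\<^sup>2) \<le> norm (2 * (cmod (f x))\<^sup>2 + 2 * (cmod c)\<^sup>2 * (cmod (g x))\<^sup>2)"
    proof (rule AE_I2)
      fix x
      have "cmod (f x - c * g x) \<le> cmod (f x) + cmod c * cmod (g x)"
        using norm_triangle_ineq4[of "f x" "c * g x"] by (simp add: norm_mult)
      then have "(cmod (f x - c * g x))\<^sup>2 \<le> (cmod (f x) + cmod c * cmod (g x))\<^sup>2"
        by (intro power_mono) auto
      also have "\<dots> \<le> 2 * (cmod (f x))\<^sup>2 + 2 * (cmod c * cmod (g x))\<^sup>2"
        using sum_squares_bound[of "cmod (f x)" "cmod c * cmod (g x)"] by (simp add: power2_sum)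
      finally show "norm ((cmod (f x - c * g x))\<^sup>2) \<le> norm (2 * (cmod (f x))\<^sup>2 + 2 * (cmod c)\<^sup>2 * (cmod (g x))\<^sup>2)"
        by (simp add: power_mult_distrib)
    qed
  qed
  with m show ?thesis by (simp add: L2_def)
qed

lemma L2_diff: "f \<in> L2 M \<Longrightarrow> g \<in> L2 M \<Longrightarrow> (\<lambda>x. f x - g x) \<in> L2 M"
  using L2_lincomb[of f M g 1] by simp

lemma L2_inner_lincomb_right:
  assumes "f \<in> L2 M" "g \<in> L2 M" "k \<in> L2 M"
  shows "L2_inner M k (\<lambda>x. f x - c * g x) = L2_inner M k f - c * L2_inner M k g"
proof -
  have "L2_inner M k (\<lambda>x. f x - c * g x) = (LINT x|M. cnj (k x) * f x - c * (cnj (k x) * g x))"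
    unfolding L2_inner_def by (simp add: algebra_simps)
  also have "\<dots> = (LINT x|M. cnj (k x) * f x) - (LINT x|M. c * (cnj (k x) * g x))"
    by (intro Bochner_Integration.integral_diff integrable_mult_right L2_inner_integrable assms)
  finally show ?thesis unfolding L2_inner_def by simp
qed

lemma L2_inner_cnj:
  assumes "f \<in> L2 M" "g \<in> L2 M"
  shows "L2_inner M g f = cnj (L2_inner M f g)"
proof -
  have "cnj (L2_inner M f g) = (LINT x|M. cnj (cnj (f x) * g x))"
    unfolding L2_inner_def
    by (rule integral_bounded_linear[OF bounded_linear_cnj L2_inner_integrable[OF assms], symmetric])
  then show ?thesis by (simp add: L2_inner_def mult.commute)
qed

lemma L2_inner_lincomb_left:
  assumes "f \<in> L2 M" "g \<in> L2 M" "k \<in> L2 M"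
  shows "L2_inner M (\<lambda>x. f x - c * g x) k = L2_inner M f k - cnj c * L2_inner M g k"
  using L2_inner_cnj[OF assms(3) L2_lincomb[OF assms(1,2), of c]]
    L2_inner_cnj[OF assms(3,1)] L2_inner_cnj[OF assms(3,2)]
  by (simp add: L2_inner_lincomb_right[OF assms])

lemma L2_norm_nonneg: "L2_norm M f \<ge> 0"
  unfolding L2_norm_def by simp

lemma L2_inner_self: "L2_inner M f f = of_real ((L2_norm M f)\<^sup>2)"
proof -
  have "cnj (f x) * f x = of_real ((cmod (f x))\<^sup>2)" for x
    by (simp only: complex_norm_square mult.commute)
  then have "L2_inner M f f = of_real (LINT x|M. (cmod (f x))\<^sup>2)"
    unfolding L2_inner_def by (simp only: integral_complex_of_real)
  moreover have "(L2_norm M f)\<^sup>2 = (LINT x|M. (cmod (f x))\<^sup>2)"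
    unfolding L2_norm_def by simp
  ultimately show ?thesis by simp
qed

lemma L2_cauchy_schwarz:
  assumes "f \<in> L2 M" "g \<in> L2 M"
  shows "cmod (L2_inner M f g) \<le> L2_norm M f * L2_norm M g"
proof -
  have "(cmod (L2_inner M f g))\<^sup>2 \<le> Re (L2_inner M f f) * Re (L2_inner M g g)"
  proof (rule sesquilinear_cauchy_schwarz[OF assms L2_lincomb])
    fix f g :: "'a \<Rightarrow> complex" and c assume fg: "f \<in> L2 M" "g \<in> L2 M"
    show "L2_inner M (\<lambda>t. f t - c * g t) (\<lambda>t. f t - c * g t) =
       L2_inner M f f - c * L2_inner M f g - cnj c * L2_inner M g f + c * cnj c * L2_inner M g g"
      unfolding L2_inner_lincomb_left[OF fg L2_lincomb[OF fg]] L2_inner_lincomb_right[OF fg fg(1)]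
        L2_inner_lincomb_right[OF fg fg(2)] by (simp add: algebra_simps)
  next
    fix f g :: "'a \<Rightarrow> complex" assume "f \<in> L2 M" "g \<in> L2 M"
    then show "L2_inner M g f = cnj (L2_inner M f g)" by (rule L2_inner_cnj)
  next
    show "0 \<le> Re (L2_inner M f f)" for f by (simp only: L2_inner_self Re_complex_of_real zero_le_power2)
  qed auto
  also have "\<dots> = (L2_norm M f * L2_norm M g)\<^sup>2"
    by (simp only: L2_inner_self Re_complex_of_real power_mult_distrib)
  finally show ?thesis by (rule power2_le_imp_le) (simp add: L2_norm_nonneg)
qed

lemma L2_inner_tendsto:
  assumes f: "\<And>n. f n \<in> L2 M" "g \<in> L2 M" "k \<in> L2 M"
    and lim: "(\<lambda>n. L2_norm M (\<lambda>x. f n x - g x)) \<longlonglongrightarrow> 0"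
  shows "(\<lambda>n. L2_inner M (f n) k) \<longlonglongrightarrow> L2_inner M g k" "(\<lambda>n. L2_inner M k (f n)) \<longlonglongrightarrow> L2_inner M k g"
proof -
  have "(\<lambda>n. L2_inner M (f n) k - L2_inner M g k) \<longlonglongrightarrow> 0"
  proof (rule Lim_null_comparison[OF always_eventually[OF allI]])
    fix n
    have "L2_inner M (f n) k - L2_inner M g k = L2_inner M (\<lambda>x. f n x - g x) k"
      using L2_inner_lincomb_left[OF f(1)[of n] f(2,3), of 1] by simp
    then show "norm (L2_inner M (f n) k - L2_inner M g k) \<le> L2_norm M (\<lambda>x. f n x - g x) * L2_norm M k"
      using L2_cauchy_schwarz[OF L2_diff[OF f(1)[of n] f(2)] f(3)] by simp
  next
    show "(\<lambda>n. L2_norm M (\<lambda>x. f n x - g x) * L2_norm M k) \<longlonglongrightarrow> 0"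
      using tendsto_mult_right[OF lim] by simp
  qed
  then show 1: "(\<lambda>n. L2_inner M (f n) k) \<longlonglongrightarrow> L2_inner M g k" by (rule LIM_zero_cancel)
  have "(\<lambda>n. cnj (L2_inner M (f n) k)) \<longlonglongrightarrow> cnj (L2_inner M g k)" by (intro tendsto_intros 1)
  then show "(\<lambda>n. L2_inner M k (f n)) \<longlonglongrightarrow> L2_inner M k g"
    using L2_inner_cnj[OF f(1) f(3)] L2_inner_cnj[OF f(2,3)] by simp
qed

lemma L2_norm_sq_triangle:
  assumes "f \<in> L2 M" "g \<in> L2 M"
  shows "(L2_norm M (\<lambda>x. f x - g x))\<^sup>2 \<le> 2 * (L2_norm M f)\<^sup>2 + 2 * (L2_norm M g)\<^sup>2"
proof -
  have "Re (L2_inner M (\<lambda>x. f x - g x) (\<lambda>x. f x - g x)) + Re (L2_inner M (\<lambda>x. f x - (- 1) * g x) (\<lambda>x. f x - (- 1) * g x))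
    = 2 * Re (L2_inner M f f) + 2 * Re (L2_inner M g g)"
    using L2_inner_lincomb_left[OF assms L2_lincomb[OF assms], of 1 1] L2_inner_lincomb_left[OF assms L2_lincomb[OF assms], of "-1" "-1"]
      L2_inner_lincomb_right[OF assms assms(1), of 1] L2_inner_lincomb_right[OF assms assms(2), of 1]
      L2_inner_lincomb_right[OF assms assms(1), of "-1"] L2_inner_lincomb_right[OF assms assms(2), of "-1"]
    by simp
  moreover have "Re (L2_inner M f f) = (L2_norm M f)\<^sup>2" for f :: "'a \<Rightarrow> complex"
    by (simp only: L2_inner_self Re_complex_of_real)
  ultimately show ?thesis by (smt (verit) zero_le_power2)
qed

section \<open>Friedrichs extensions of semibounded operators\<close>

text \<open>
  The single closure condition under \<open>\<phi> - c \<psi>\<close> expresses that \<open>D\<close> is a subspace. Linearity of \<open>S\<close>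
  is required only on the underlying space, as its elements represent classes of functions.
\<close>

locale semibounded_operator =
  fixes M :: "'a measure" and D :: "('a \<Rightarrow> complex) set" and S :: "('a \<Rightarrow> complex) \<Rightarrow> 'a \<Rightarrow> complex" and K :: real
  assumes D_L2: "\<phi> \<in> D \<Longrightarrow> \<phi> \<in> L2 M"
    and S_L2: "\<phi> \<in> D \<Longrightarrow> S \<phi> \<in> L2 M"
    and D_lincomb: "\<phi> \<in> D \<Longrightarrow> \<psi> \<in> D \<Longrightarrow> (\<lambda>x. \<phi> x - c * \<psi> x) \<in> D"
    and S_lincomb: "\<phi> \<in> D \<Longrightarrow> \<psi> \<in> D \<Longrightarrow> x \<in> space M \<Longrightarrow> S (\<lambda>x. \<phi> x - c * \<psi> x) x = S \<phi> x - c * S \<psi> x"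
    and symmetric: "\<phi> \<in> D \<Longrightarrow> \<psi> \<in> D \<Longrightarrow> L2_inner M \<phi> (S \<psi>) = L2_inner M (S \<phi>) \<psi>"
    and K: "K \<ge> 0"
    and bounded_below: "\<phi> \<in> D \<Longrightarrow> - K * (L2_norm M \<phi>)\<^sup>2 \<le> Re (L2_inner M \<phi> (S \<phi>))"
begin

definition form :: "('a \<Rightarrow> complex) \<Rightarrow> ('a \<Rightarrow> complex) \<Rightarrow> complex" where
  "form \<phi> \<psi> = L2_inner M \<phi> (S \<psi>)"

text \<open>
  The shift by \<open>K + 1\<close> makes the form an inner product that dominates the one of \<open>L2\<close>.
\<close>

definition shifted_form :: "('a \<Rightarrow> complex) \<Rightarrow> ('a \<Rightarrow> complex) \<Rightarrow> complex" where
  "shifted_form \<phi> \<psi> = form \<phi> \<psi> + of_real (K + 1) * L2_inner M \<phi> \<psi>"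

definition energy_norm :: "('a \<Rightarrow> complex) \<Rightarrow> real" where
  "energy_norm \<phi> = sqrt (Re (shifted_form \<phi> \<phi>))"

lemma D_diff: "\<phi> \<in> D \<Longrightarrow> \<psi> \<in> D \<Longrightarrow> (\<lambda>x. \<phi> x - \<psi> x) \<in> D"
  using D_lincomb[of \<phi> \<psi> 1] by simp

lemma form_lincomb_right:
  assumes "\<eta> \<in> D" "\<phi> \<in> D" "\<psi> \<in> D"
  shows "form \<eta> (\<lambda>x. \<phi> x - c * \<psi> x) = form \<eta> \<phi> - c * form \<eta> \<psi>"
proof -
  have "L2_inner M \<eta> (S (\<lambda>x. \<phi> x - c * \<psi> x)) = L2_inner M \<eta> (\<lambda>x. S \<phi> x - c * S \<psi> x)"
    unfolding L2_inner_def by (intro Bochner_Integration.integral_cong refl) (simp add: S_lincomb assms)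
  then show ?thesis unfolding form_def by (simp add: L2_inner_lincomb_right D_L2 S_L2 assms)
qed

lemma form_cnj: "\<phi> \<in> D \<Longrightarrow> \<psi> \<in> D \<Longrightarrow> form \<psi> \<phi> = cnj (form \<phi> \<psi>)"
  unfolding form_def by (metis symmetric L2_inner_cnj D_L2 S_L2)

lemma form_lincomb_left:
  assumes "\<eta> \<in> D" "\<phi> \<in> D" "\<psi> \<in> D"
  shows "form (\<lambda>x. \<phi> x - c * \<psi> x) \<eta> = form \<phi> \<eta> - cnj c * form \<psi> \<eta>"
  using form_cnj[OF assms(1) D_lincomb[OF assms(2,3), of c]] form_cnj[OF assms(1,2)] form_cnj[OF assms(1,3)]
  by (simp add: form_lincomb_right[OF assms])

lemma shifted_lincomb_right:
  assumes "\<eta> \<in> D" "\<phi> \<in> D" "\<psi> \<in> D"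
  shows "shifted_form \<eta> (\<lambda>x. \<phi> x - c * \<psi> x) = shifted_form \<eta> \<phi> - c * shifted_form \<eta> \<psi>"
  unfolding shifted_form_def form_lincomb_right[OF assms] L2_inner_lincomb_right[OF D_L2 D_L2 D_L2, OF assms(2,3,1)]
  by (simp add: algebra_simps)

lemma shifted_lincomb_left:
  assumes "\<eta> \<in> D" "\<phi> \<in> D" "\<psi> \<in> D"
  shows "shifted_form (\<lambda>x. \<phi> x - c * \<psi> x) \<eta> = shifted_form \<phi> \<eta> - cnj c * shifted_form \<psi> \<eta>"
  unfolding shifted_form_def form_lincomb_left[OF assms] L2_inner_lincomb_left[OF D_L2 D_L2 D_L2, OF assms(2,3,1)]
  by (simp add: algebra_simps)

lemma shifted_cnj: "\<phi> \<in> D \<Longrightarrow> \<psi> \<in> D \<Longrightarrow> shifted_form \<psi> \<phi> = cnj (shifted_form \<phi> \<psi>)"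
  unfolding shifted_form_def using form_cnj[of \<phi> \<psi>] L2_inner_cnj[OF D_L2 D_L2, of \<phi> \<psi>] by simp

lemma shifted_ge: "\<phi> \<in> D \<Longrightarrow> (L2_norm M \<phi>)\<^sup>2 \<le> Re (shifted_form \<phi> \<phi>)"
proof -
  assume "\<phi> \<in> D"
  have "Re (shifted_form \<phi> \<phi>) = Re (form \<phi> \<phi>) + (K + 1) * (L2_norm M \<phi>)\<^sup>2"
    unfolding shifted_form_def L2_inner_self by (simp only: plus_complex.simps Re_complex_of_real flip: of_real_mult)
  then show ?thesis
    using bounded_below[OF \<open>\<phi> \<in> D\<close>] unfolding form_def by (simp add: algebra_simps)
qed

lemma energy_norm_sq: "\<phi> \<in> D \<Longrightarrow> (energy_norm \<phi>)\<^sup>2 = Re (shifted_form \<phi> \<phi>)"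
  unfolding energy_norm_def using shifted_ge[of \<phi>] by (simp add: order_trans[OF zero_le_power2])

lemma energy_norm_nonneg: "\<phi> \<in> D \<Longrightarrow> energy_norm \<phi> \<ge> 0"
  unfolding energy_norm_def using shifted_ge[of \<phi>] by (simp add: order_trans[OF zero_le_power2])

lemma L2_norm_le_energy: "\<phi> \<in> D \<Longrightarrow> L2_norm M \<phi> \<le> energy_norm \<phi>"
  by (rule power2_le_imp_le) (simp_all add: energy_norm_sq shifted_ge energy_norm_nonneg)

lemma shifted_expand:
  assumes "\<phi> \<in> D" "\<psi> \<in> D"
  shows "shifted_form (\<lambda>x. \<phi> x - c * \<psi> x) (\<lambda>x. \<phi> x - c * \<psi> x) =
    shifted_form \<phi> \<phi> - c * shifted_form \<phi> \<psi> - cnj c * shifted_form \<psi> \<phi> + c * cnj c * shifted_form \<psi> \<psi>"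
  unfolding shifted_lincomb_left[OF D_lincomb[OF assms] assms] shifted_lincomb_right[OF assms(1) assms]
    shifted_lincomb_right[OF assms(2) assms] by (simp add: algebra_simps)

lemma shifted_cauchy_schwarz:
  assumes "\<phi> \<in> D" "\<psi> \<in> D"
  shows "cmod (shifted_form \<phi> \<psi>) \<le> energy_norm \<phi> * energy_norm \<psi>"
proof -
  have "(cmod (shifted_form \<phi> \<psi>))\<^sup>2 \<le> Re (shifted_form \<phi> \<phi>) * Re (shifted_form \<psi> \<psi>)"
    by (rule sesquilinear_cauchy_schwarz[OF assms D_lincomb shifted_expand shifted_cnj])
       (auto intro: order_trans[OF zero_le_power2 shifted_ge])
  also have "\<dots> = (energy_norm \<phi> * energy_norm \<psi>)\<^sup>2"
    by (simp add: power_mult_distrib energy_norm_sq assms)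
  finally show ?thesis
    by (rule power2_le_imp_le) (simp add: energy_norm_nonneg assms)
qed

lemma form_bound:
  assumes "\<phi> \<in> D" "\<psi> \<in> D"
  shows "cmod (form \<phi> \<psi>) \<le> (K + 2) * energy_norm \<phi> * energy_norm \<psi>"
proof -
  have "cmod (form \<phi> \<psi>) = cmod (shifted_form \<phi> \<psi> - of_real (K + 1) * L2_inner M \<phi> \<psi>)"
    by (simp add: shifted_form_def)
  also have "\<dots> \<le> cmod (shifted_form \<phi> \<psi>) + cmod (of_real (K + 1) * L2_inner M \<phi> \<psi>)"
    by (rule norm_triangle_ineq4)
  also have "\<dots> \<le> energy_norm \<phi> * energy_norm \<psi> + (K + 1) * (energy_norm \<phi> * energy_norm \<psi>)"
  proof (intro add_mono shifted_cauchy_schwarz assms)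
    have "cmod (L2_inner M \<phi> \<psi>) \<le> L2_norm M \<phi> * L2_norm M \<psi>" by (intro L2_cauchy_schwarz D_L2 assms)
    also have "\<dots> \<le> energy_norm \<phi> * energy_norm \<psi>"
      by (intro mult_mono L2_norm_le_energy energy_norm_nonneg L2_norm_nonneg assms)
    finally show "cmod (of_real (K + 1) * L2_inner M \<phi> \<psi>) \<le> (K + 1) * (energy_norm \<phi> * energy_norm \<psi>)"
      using K unfolding norm_mult norm_of_real by (intro mult_mono) auto
  qed
  finally show ?thesis by (simp add: algebra_simps)
qed

lemma energy_norm_triangle:
  assumes "\<phi> \<in> D" "\<psi> \<in> D"
  shows "energy_norm \<phi> \<le> 2 * energy_norm (\<lambda>x. \<phi> x - \<psi> x) + 2 * energy_norm \<psi>"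
proof -
  have "Re (shifted_form (\<lambda>x. \<phi> x - 2 * \<psi> x) (\<lambda>x. \<phi> x - 2 * \<psi> x)) \<ge> 0"
    using shifted_ge[OF D_lincomb[OF assms, of 2]] order_trans[OF zero_le_power2] by blast
  then have "(energy_norm \<phi>)\<^sup>2 \<le> 2 * (energy_norm (\<lambda>x. \<phi> x - \<psi> x))\<^sup>2 + 2 * (energy_norm \<psi>)\<^sup>2"
    using shifted_expand[OF assms, of 2] shifted_expand[OF assms, of 1] assms
    by (simp add: energy_norm_sq D_diff)
  also have "\<dots> \<le> (2 * energy_norm (\<lambda>x. \<phi> x - \<psi> x) + 2 * energy_norm \<psi>)\<^sup>2"
    using energy_norm_nonneg[OF D_diff[OF assms]] energy_norm_nonneg[OF assms(2)]
    by (simp add: power2_sum power_mult_distrib)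
  finally show ?thesis
    by (rule power2_le_imp_le) (use energy_norm_nonneg[OF D_diff[OF assms]] energy_norm_nonneg[OF assms(2)] in auto)
qed

abbreviation converges where "converges \<equiv> form_converges M D S"

lemma converges_in_D: "converges \<phi> u \<Longrightarrow> \<phi> n \<in> D"
  by (simp add: form_converges_def)

lemma converges_L2: "converges \<phi> u \<Longrightarrow> (\<lambda>n. L2_norm M (\<lambda>x. \<phi> n x - u x)) \<longlonglongrightarrow> 0"
  by (simp add: form_converges_def)

lemma converges_energy_cauchy:
  assumes u: "u \<in> L2 M" and \<phi>: "converges \<phi> u" and "e > 0"
  shows "\<exists>N. \<forall>m\<ge>N. \<forall>n\<ge>N. energy_norm (\<lambda>x. \<phi> m x - \<phi> n x) < e"
proof -
  have D: "\<phi> n \<in> D" for n by (rule converges_in_D[OF \<phi>])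
  define d where "d = e\<^sup>2 / (4 * K + 6)"
  have d: "d > 0" using \<open>e > 0\<close> K by (simp add: d_def)
  obtain N1 where N1: "\<forall>m\<ge>N1. \<forall>n\<ge>N1. cmod (form (\<lambda>x. \<phi> m x - \<phi> n x) (\<lambda>x. \<phi> m x - \<phi> n x)) < d"
    using \<phi> d unfolding form_converges_def form_def by blast
  have "(\<lambda>n. (L2_norm M (\<lambda>x. \<phi> n x - u x))\<^sup>2) \<longlonglongrightarrow> 0\<^sup>2"
    by (intro tendsto_intros converges_L2[OF \<phi>])
  then have "\<forall>\<^sub>F n in sequentially. (L2_norm M (\<lambda>x. \<phi> n x - u x))\<^sup>2 < d"
    using d by (intro order_tendstoD(2)) auto
  then obtain N2 where N2: "\<forall>n\<ge>N2. (L2_norm M (\<lambda>x. \<phi> n x - u x))\<^sup>2 < d"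
    by (auto simp: eventually_sequentially)
  show ?thesis
  proof (intro exI[of _ "max N1 N2"] allI impI)
    fix m n assume mn: "max N1 N2 \<le> m" "max N1 N2 \<le> n"
    let ?f = "\<lambda>x. \<phi> m x - \<phi> n x"
    have "?f = (\<lambda>x. (\<phi> m x - u x) - (\<phi> n x - u x))" by auto
    then have "(L2_norm M ?f)\<^sup>2 \<le> 2 * (L2_norm M (\<lambda>x. \<phi> m x - u x))\<^sup>2 + 2 * (L2_norm M (\<lambda>x. \<phi> n x - u x))\<^sup>2"
      using L2_norm_sq_triangle[OF L2_diff[OF D_L2[OF D[of m]] u] L2_diff[OF D_L2[OF D[of n]] u]] by simp
    also have "\<dots> < 4 * d" using N2[rule_format, of m] N2[rule_format, of n] mn by simp
    finally have L: "(L2_norm M ?f)\<^sup>2 \<le> 4 * d" by simp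
    have "(energy_norm ?f)\<^sup>2 = Re (form ?f ?f) + (K + 1) * (L2_norm M ?f)\<^sup>2"
      unfolding energy_norm_sq[OF D_diff[OF D D]] shifted_form_def L2_inner_self
      by (simp only: plus_complex.simps Re_complex_of_real flip: of_real_mult)
    also have "\<dots> < d + (K + 1) * (4 * d)"
    proof (rule add_less_le_mono)
      show "Re (form ?f ?f) < d" using complex_Re_le_cmod[of "form ?f ?f"] N1[rule_format, of m n] mn by simp
      show "(K + 1) * (L2_norm M ?f)\<^sup>2 \<le> (K + 1) * (4 * d)" using L K by (intro mult_left_mono) auto
    qed
    also have "\<dots> = (4 * K + 5) * d" by (simp add: algebra_simps)
    also have "\<dots> \<le> (4 * K + 6) * d" using d by (intro mult_right_mono) auto
    also have "\<dots> = e\<^sup>2" using K by (simp add: d_def)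
    finally show "energy_norm ?f < e" by (rule power_less_imp_less_base) (use \<open>e > 0\<close> in simp)
  qed
qed

lemma converges_energy_bounded:
  assumes u: "u \<in> L2 M" and \<phi>: "converges \<phi> u"
  obtains B where "B > 0" "\<And>n. energy_norm (\<phi> n) \<le> B"
proof -
  have D: "\<phi> n \<in> D" for n by (rule converges_in_D[OF \<phi>])
  obtain N where N: "\<forall>m\<ge>N. \<forall>n\<ge>N. energy_norm (\<lambda>x. \<phi> m x - \<phi> n x) < 1"
    using converges_energy_cauchy[OF assms, of 1] by auto
  define B where "B = Max ((\<lambda>n. energy_norm (\<phi> n)) ` {..N}) + (3 + 2 * energy_norm (\<phi> N))"
  have M: "energy_norm (\<phi> n) \<le> Max ((\<lambda>n. energy_norm (\<phi> n)) ` {..N})" if "n \<le> N" for n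
    using that by (intro Max_ge) auto
  have Mn: "0 \<le> Max ((\<lambda>n. energy_norm (\<phi> n)) ` {..N})"
    using order_trans[OF energy_norm_nonneg[OF D[of 0]] M[of 0]] by simp
  have "energy_norm (\<phi> n) \<le> B" for n
  proof (cases "n \<le> N")
    case True
    then show ?thesis using M[OF True] energy_norm_nonneg[OF D[of N]] unfolding B_def by linarith
  next
    case False
    then have "energy_norm (\<lambda>x. \<phi> n x - \<phi> N x) < 1" using N by simp
    then show ?thesis using energy_norm_triangle[OF D[of n] D[of N]] Mn by (simp add: B_def)
  qed
  moreover have "B > 0" using Mn energy_norm_nonneg[OF D[of N]] by (simp add: B_def)
  ultimately show ?thesis using that by blast
qed

end

context semibounded_operator
begin

text \<open>
  Closability of the form. The differences \<open>\<eta>\<^sub>n\<close> tend to zero in \<open>L2\<close> and are Cauchy in energy. For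
  fixed \<open>m\<close> the form \<open>(\<eta>\<^sub>n, \<eta>\<^sub>m) = (\<eta>\<^sub>n, S \<eta>\<^sub>m)\<close> tends to zero, and replacing \<open>\<eta>\<^sub>m\<close> by \<open>\<eta>\<^sub>n\<close> costs an
  arbitrarily small amount.
\<close>

lemma converges_diff:
  assumes u: "u \<in> L2 M" and \<phi>: "converges \<phi> u" and \<psi>: "converges \<psi> u"
  shows "(\<lambda>n. energy_norm (\<lambda>x. \<phi> n x - \<psi> n x)) \<longlonglongrightarrow> 0"
proof -
  have D\<phi>: "\<phi> n \<in> D" and D\<psi>: "\<psi> n \<in> D" for n
    by (rule converges_in_D[OF \<phi>], rule converges_in_D[OF \<psi>])
  define \<eta> where "\<eta> = (\<lambda>n x. \<phi> n x - \<psi> n x)"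
  have D: "\<eta> n \<in> D" for n unfolding \<eta>_def by (rule D_diff[OF D\<phi> D\<psi>])
  obtain B1 where B1: "B1 > 0" "\<And>n. energy_norm (\<phi> n) \<le> B1" using converges_energy_bounded[OF u \<phi>] by blast
  obtain B2 where B2: "B2 > 0" "\<And>n. energy_norm (\<psi> n) \<le> B2" using converges_energy_bounded[OF u \<psi>] by blast
  define B where "B = 2 * B1 + 2 * B2"
  (* a triangle inequality with the factor 2 is enough; it is applied to f - g and - g *)
  have tri: "energy_norm (\<lambda>x. f x - g x) \<le> 2 * energy_norm f + 2 * energy_norm g" if "f \<in> D" "g \<in> D" for f g
  proof -
    have z: "(\<lambda>x. g x - 1 * g x) \<in> D" by (rule D_lincomb[OF that(2) that(2)])
    have g: "(\<lambda>x. (g x - 1 * g x) - 1 * g x) \<in> D" by (rule D_lincomb[OF z that(2)])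
    have "(\<lambda>x. (f x - g x) - ((g x - 1 * g x) - 1 * g x)) = f" by auto
    moreover have "energy_norm (\<lambda>x. (g x - 1 * g x) - 1 * g x) = energy_norm g"
    proof -
      have "(\<lambda>x. (g x - 1 * g x) - 1 * g x) = (\<lambda>x. g x - 2 * g x)" by auto
      moreover have "Re (shifted_form (\<lambda>x. g x - 2 * g x) (\<lambda>x. g x - 2 * g x)) = Re (shifted_form g g)"
        unfolding shifted_expand[OF that(2) that(2)] by simp
      ultimately show ?thesis unfolding energy_norm_def by simp
    qed
    ultimately show ?thesis using energy_norm_triangle[OF D_diff[OF that] g] by simp
  qed
  have B: "energy_norm (\<eta> n) \<le> B" for n
    unfolding \<eta>_def B_def using tri[OF D\<phi>[of n] D\<psi>[of n]] B1(2)[of n] B2(2)[of n] by linarith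
  have Bpos: "B > 0" using B1 B2 by (simp add: B_def)
  have L2\<eta>: "(\<lambda>n. L2_norm M (\<lambda>x. \<eta> n x - 0)) \<longlonglongrightarrow> 0"
  proof (rule Lim_null_comparison[OF always_eventually[OF allI]])
    fix n
    let ?s = "2 * L2_norm M (\<lambda>x. \<phi> n x - u x) + 2 * L2_norm M (\<lambda>x. \<psi> n x - u x)"
    have "(\<lambda>x. \<eta> n x - 0) = (\<lambda>x. (\<phi> n x - u x) - (\<psi> n x - u x))" by (auto simp: \<eta>_def)
    then have "(L2_norm M (\<lambda>x. \<eta> n x - 0))\<^sup>2 \<le> 2 * (L2_norm M (\<lambda>x. \<phi> n x - u x))\<^sup>2 + 2 * (L2_norm M (\<lambda>x. \<psi> n x - u x))\<^sup>2"
      using L2_norm_sq_triangle[OF L2_diff[OF D_L2[OF D\<phi>[of n]] u] L2_diff[OF D_L2[OF D\<psi>[of n]] u]] by simp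
    also have "\<dots> \<le> ?s\<^sup>2"
      using L2_norm_nonneg[of M "\<lambda>x. \<phi> n x - u x"] L2_norm_nonneg[of M "\<lambda>x. \<psi> n x - u x"]
      by (simp add: power2_sum power_mult_distrib)
    finally have "L2_norm M (\<lambda>x. \<eta> n x - 0) \<le> ?s"
      by (rule power2_le_imp_le) (simp add: L2_norm_nonneg)
    then show "norm (L2_norm M (\<lambda>x. \<eta> n x - 0)) \<le> ?s" by (simp add: L2_norm_nonneg)
  next
    have "(\<lambda>n. 2 * L2_norm M (\<lambda>x. \<phi> n x - u x) + 2 * L2_norm M (\<lambda>x. \<psi> n x - u x)) \<longlonglongrightarrow> 2 * 0 + 2 * 0"
      by (intro tendsto_intros converges_L2[OF \<phi>] converges_L2[OF \<psi>])
    then show "(\<lambda>n. 2 * L2_norm M (\<lambda>x. \<phi> n x - u x) + 2 * L2_norm M (\<lambda>x. \<psi> n x - u x)) \<longlonglongrightarrow> 0" by simp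
  qed
  have zero_L2: "(\<lambda>x. 0) \<in> L2 M" by (simp add: L2_def)
  have fixed: "(\<lambda>n. shifted_form (\<eta> n) (\<eta> m)) \<longlonglongrightarrow> 0" for m
  proof -
    have "(\<lambda>n. L2_inner M (\<eta> n) (S (\<eta> m)) + of_real (K + 1) * L2_inner M (\<eta> n) (\<eta> m)) \<longlonglongrightarrow>
      L2_inner M (\<lambda>x. 0) (S (\<eta> m)) + of_real (K + 1) * L2_inner M (\<lambda>x. 0) (\<eta> m)"
      by (intro tendsto_intros L2_inner_tendsto D_L2[OF D] S_L2[OF D] zero_L2 L2\<eta>)
    then show ?thesis unfolding shifted_form_def form_def by (simp add: L2_inner_def)
  qed
  have "(\<lambda>n. (energy_norm (\<eta> n))\<^sup>2) \<longlonglongrightarrow> 0"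
  proof (rule LIMSEQ_I)
    fix e :: real assume e: "e > 0"
    (* the Cauchy part contributes 4 B d = e / 2 *)
    define d where "d = e / (8 * B)"
    have d: "d > 0" using e Bpos by (simp add: d_def)
    obtain N1 where N1: "\<forall>m\<ge>N1. \<forall>n\<ge>N1. energy_norm (\<lambda>x. \<phi> m x - \<phi> n x) < d"
      using converges_energy_cauchy[OF u \<phi> d] by blast
    obtain N2 where N2: "\<forall>m\<ge>N2. \<forall>n\<ge>N2. energy_norm (\<lambda>x. \<psi> m x - \<psi> n x) < d"
      using converges_energy_cauchy[OF u \<psi> d] by blast
    define N where "N = max N1 N2"
    obtain N3 where N3: "\<And>n. n \<ge> N3 \<Longrightarrow> cmod (shifted_form (\<eta> n) (\<eta> N)) < e / 2"
      using LIMSEQ_D[OF fixed[of N], of "e / 2"] e by auto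
    show "\<exists>n0. \<forall>n\<ge>n0. norm ((energy_norm (\<eta> n))\<^sup>2 - 0) < e"
    proof (intro exI[of _ "max N N3"] allI impI)
      fix n assume n: "max N N3 \<le> n"
      have c: "energy_norm (\<lambda>x. \<eta> n x - \<eta> N x) \<le> 4 * d"
      proof -
        have "(\<lambda>x. \<eta> n x - \<eta> N x) = (\<lambda>x. (\<phi> n x - \<phi> N x) - (\<psi> n x - \<psi> N x))" by (auto simp: \<eta>_def)
        then have "energy_norm (\<lambda>x. \<eta> n x - \<eta> N x) \<le> 2 * energy_norm (\<lambda>x. \<phi> n x - \<phi> N x) + 2 * energy_norm (\<lambda>x. \<psi> n x - \<psi> N x)"
          using tri[OF D_diff[OF D\<phi> D\<phi>] D_diff[OF D\<psi> D\<psi>], of n N n N] by simp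
        also have "\<dots> \<le> 4 * d"
          using N1[rule_format, of n N] N2[rule_format, of n N] n by (simp add: N_def)
        finally show ?thesis .
      qed
      have "shifted_form (\<eta> n) (\<lambda>x. \<eta> n x - \<eta> N x) = shifted_form (\<eta> n) (\<eta> n) - shifted_form (\<eta> n) (\<eta> N)"
        using shifted_lincomb_right[OF D D D, of n n 1 N] by simp
      then have "(energy_norm (\<eta> n))\<^sup>2 = Re (shifted_form (\<eta> n) (\<lambda>x. \<eta> n x - \<eta> N x)) + Re (shifted_form (\<eta> n) (\<eta> N))"
        by (simp add: energy_norm_sq[OF D])
      also have "\<dots> \<le> cmod (shifted_form (\<eta> n) (\<lambda>x. \<eta> n x - \<eta> N x)) + cmod (shifted_form (\<eta> n) (\<eta> N))"
        by (intro add_mono complex_Re_le_cmod)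
      also have "\<dots> < B * (4 * d) + e / 2"
      proof (rule add_le_less_mono)
        have "cmod (shifted_form (\<eta> n) (\<lambda>x. \<eta> n x - \<eta> N x)) \<le> energy_norm (\<eta> n) * energy_norm (\<lambda>x. \<eta> n x - \<eta> N x)"
          by (intro shifted_cauchy_schwarz D D_diff)
        also have "\<dots> \<le> B * (4 * d)"
          using B c Bpos energy_norm_nonneg[OF D_diff[OF D D]] by (intro mult_mono) auto
        finally show "cmod (shifted_form (\<eta> n) (\<lambda>x. \<eta> n x - \<eta> N x)) \<le> B * (4 * d)" .
      qed (use N3 n in auto)
      also have "\<dots> = e" using Bpos by (simp add: d_def)
      finally show "norm ((energy_norm (\<eta> n))\<^sup>2 - 0) < e" by simp
    qed
  qed
  from tendsto_real_sqrt[OF this] show ?thesis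
    using energy_norm_nonneg[OF D] by (simp add: \<eta>_def)
qed

lemma form_difference_bound:
  assumes "\<phi>1 \<in> D" "\<phi>2 \<in> D" "\<psi>1 \<in> D" "\<psi>2 \<in> D"
  shows "cmod (form \<phi>1 \<psi>1 - form \<phi>2 \<psi>2) \<le>
    (K + 2) * energy_norm (\<lambda>x. \<phi>1 x - \<phi>2 x) * energy_norm \<psi>1 + (K + 2) * energy_norm \<phi>2 * energy_norm (\<lambda>x. \<psi>1 x - \<psi>2 x)"
proof -
  have "form \<phi>1 \<psi>1 - form \<phi>2 \<psi>2 = form (\<lambda>x. \<phi>1 x - \<phi>2 x) \<psi>1 + form \<phi>2 (\<lambda>x. \<psi>1 x - \<psi>2 x)"
    using form_lincomb_left[OF assms(3,1,2), of 1] form_lincomb_right[OF assms(2,3,4), of 1] by simp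
  then have "cmod (form \<phi>1 \<psi>1 - form \<phi>2 \<psi>2) \<le> cmod (form (\<lambda>x. \<phi>1 x - \<phi>2 x) \<psi>1) + cmod (form \<phi>2 (\<lambda>x. \<psi>1 x - \<psi>2 x))"
    by (simp add: norm_triangle_ineq)
  also have "\<dots> \<le> (K + 2) * energy_norm (\<lambda>x. \<phi>1 x - \<phi>2 x) * energy_norm \<psi>1 + (K + 2) * energy_norm \<phi>2 * energy_norm (\<lambda>x. \<psi>1 x - \<psi>2 x)"
    by (intro add_mono form_bound D_diff assms)
  finally show ?thesis .
qed

text \<open>
  By closability the limit of the form does not depend on the approximating sequences, which makes the
  description in the definition of \<open>closed_form\<close> unique.
\<close>

lemma form_converges_limit:
  assumes u: "u \<in> L2 M" and v: "v \<in> L2 M" and \<phi>: "converges \<phi> u" and \<psi>: "converges \<psi> v"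
  shows "(\<lambda>n. form (\<phi> n) (\<psi> n)) \<longlonglongrightarrow> closed_form M D S u v"
proof -
  have D: "\<phi> n \<in> D" "\<psi> n \<in> D" for n
    by (rule converges_in_D[OF \<phi>], rule converges_in_D[OF \<psi>])
  obtain B1 where B1: "B1 > 0" "\<And>n. energy_norm (\<phi> n) \<le> B1" using converges_energy_bounded[OF u \<phi>] by blast
  obtain B2 where B2: "B2 > 0" "\<And>n. energy_norm (\<psi> n) \<le> B2" using converges_energy_bounded[OF v \<psi>] by blast
  have "Cauchy (\<lambda>n. form (\<phi> n) (\<psi> n))"
  proof (rule CauchyI)
    fix e :: real assume e: "e > 0"
    define d where "d = e / ((K + 2) * (B1 + B2))"
    have d: "d > 0" using e K B1 B2 by (simp add: d_def)
    obtain N1 where N1: "\<forall>m\<ge>N1. \<forall>n\<ge>N1. energy_norm (\<lambda>x. \<phi> m x - \<phi> n x) < d"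
      using converges_energy_cauchy[OF u \<phi> d] by blast
    obtain N2 where N2: "\<forall>m\<ge>N2. \<forall>n\<ge>N2. energy_norm (\<lambda>x. \<psi> m x - \<psi> n x) < d"
      using converges_energy_cauchy[OF v \<psi> d] by blast
    show "\<exists>N. \<forall>m\<ge>N. \<forall>n\<ge>N. norm (form (\<phi> m) (\<psi> m) - form (\<phi> n) (\<psi> n)) < e"
    proof (intro exI[of _ "max N1 N2"] allI impI)
      fix m n assume mn: "max N1 N2 \<le> m" "max N1 N2 \<le> n"
      have "cmod (form (\<phi> m) (\<psi> m) - form (\<phi> n) (\<psi> n)) \<le>
        (K + 2) * energy_norm (\<lambda>x. \<phi> m x - \<phi> n x) * energy_norm (\<psi> m) + (K + 2) * energy_norm (\<phi> n) * energy_norm (\<lambda>x. \<psi> m x - \<psi> n x)"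
        by (intro form_difference_bound D)
      also have "\<dots> \<le> (K + 2) * energy_norm (\<lambda>x. \<phi> m x - \<phi> n x) * B2 + (K + 2) * B1 * energy_norm (\<lambda>x. \<psi> m x - \<psi> n x)"
        using K B1 B2 energy_norm_nonneg D D_diff
        by (intro add_mono mult_left_mono mult_right_mono) auto
      also have "\<dots> < (K + 2) * d * B2 + (K + 2) * B1 * d"
        using K B1 B2 N1[rule_format, of m n] N2[rule_format, of m n] mn
        by (intro add_strict_mono mult_strict_left_mono mult_strict_right_mono) auto
      also have "\<dots> = e"
      proof -
        have "(K + 2) * (B1 + B2) > 0" using K B1 B2 by simp
        then have "d * ((K + 2) * (B1 + B2)) = e"
          using d_def by (intro nonzero_eq_divide_eq[THEN iffD1]) auto
        moreover have "(K + 2) * d * B2 + (K + 2) * B1 * d = d * ((K + 2) * (B1 + B2))" by (simp only: ring_distribs mult_ac)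
        ultimately show ?thesis by simp
      qed
      finally show "norm (form (\<phi> m) (\<psi> m) - form (\<phi> n) (\<psi> n)) < e" .
    qed
  qed
  then obtain z where z: "(\<lambda>n. form (\<phi> n) (\<psi> n)) \<longlonglongrightarrow> z" using Cauchy_convergent convergent_def by blast
  have indep: "(\<lambda>n. form (\<phi>2 n) (\<psi>2 n)) \<longlonglongrightarrow> z" if \<phi>2: "converges \<phi>2 u" and \<psi>2: "converges \<psi>2 v" for \<phi>2 \<psi>2
  proof -
    have D2: "\<phi>2 n \<in> D" "\<psi>2 n \<in> D" for n
      by (rule converges_in_D[OF \<phi>2], rule converges_in_D[OF \<psi>2])
    have "(\<lambda>n. form (\<phi>2 n) (\<psi>2 n) - form (\<phi> n) (\<psi> n)) \<longlonglongrightarrow> 0"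
    proof -
      obtain B3 where B3: "B3 > 0" "\<And>n. energy_norm (\<psi>2 n) \<le> B3" using converges_energy_bounded[OF v \<psi>2] by blast
      show ?thesis
      proof (rule Lim_null_comparison[OF always_eventually[OF allI]])
        fix n
        have "cmod (form (\<phi>2 n) (\<psi>2 n) - form (\<phi> n) (\<psi> n)) \<le>
          (K + 2) * energy_norm (\<lambda>x. \<phi>2 n x - \<phi> n x) * energy_norm (\<psi>2 n) + (K + 2) * energy_norm (\<phi> n) * energy_norm (\<lambda>x. \<psi>2 n x - \<psi> n x)"
          by (intro form_difference_bound D D2)
        also have "\<dots> \<le> (K + 2) * energy_norm (\<lambda>x. \<phi>2 n x - \<phi> n x) * B3 + (K + 2) * B1 * energy_norm (\<lambda>x. \<psi>2 n x - \<psi> n x)"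
          using K B1 B3 energy_norm_nonneg D D2 D_diff
          by (intro add_mono mult_left_mono mult_right_mono) auto
        finally show "norm (form (\<phi>2 n) (\<psi>2 n) - form (\<phi> n) (\<psi> n)) \<le>
          (K + 2) * energy_norm (\<lambda>x. \<phi>2 n x - \<phi> n x) * B3 + (K + 2) * B1 * energy_norm (\<lambda>x. \<psi>2 n x - \<psi> n x)" .
      next
        have "(\<lambda>n. (K + 2) * energy_norm (\<lambda>x. \<phi>2 n x - \<phi> n x) * B3 + (K + 2) * B1 * energy_norm (\<lambda>x. \<psi>2 n x - \<psi> n x))
          \<longlonglongrightarrow> (K + 2) * 0 * B3 + (K + 2) * B1 * 0"
          by (intro tendsto_intros converges_diff[OF u \<phi>2 \<phi>] converges_diff[OF v \<psi>2 \<psi>])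
        then show "(\<lambda>n. (K + 2) * energy_norm (\<lambda>x. \<phi>2 n x - \<phi> n x) * B3 + (K + 2) * B1 * energy_norm (\<lambda>x. \<psi>2 n x - \<psi> n x))
          \<longlonglongrightarrow> 0" by simp
      qed
    qed
    from tendsto_add[OF this z] show ?thesis by simp
  qed
  have "closed_form M D S u v = z"
    unfolding closed_form_def
  proof (rule the_equality)
    show "\<forall>\<phi> \<psi>. converges \<phi> u \<longrightarrow> converges \<psi> v \<longrightarrow> (\<lambda>n. L2_inner M (\<phi> n) (S (\<psi> n))) \<longlonglongrightarrow> z"
      using indep unfolding form_def by blast
  next
    fix z' assume "\<forall>\<phi> \<psi>. converges \<phi> u \<longrightarrow> converges \<psi> v \<longrightarrow> (\<lambda>n. L2_inner M (\<phi> n) (S (\<psi> n))) \<longlonglongrightarrow> z'"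
    then have "(\<lambda>n. form (\<phi> n) (\<psi> n)) \<longlonglongrightarrow> z'" using \<phi> \<psi> unfolding form_def by blast
    then show "z' = z" using z LIMSEQ_unique by blast
  qed
  with z show ?thesis by simp
qed

lemma form_domain_L2: "u \<in> form_domain M D S \<Longrightarrow> u \<in> L2 M"
  by (simp add: form_domain_def)

lemma closed_form_cnj:
  assumes "u \<in> form_domain M D S" "v \<in> form_domain M D S"
  shows "closed_form M D S v u = cnj (closed_form M D S u v)"
proof -
  obtain \<phi> \<psi> where \<phi>: "converges \<phi> u" and \<psi>: "converges \<psi> v"
    using assms unfolding form_domain_def by blast
  note L = form_domain_L2[OF assms(1)] form_domain_L2[OF assms(2)]
  have "(\<lambda>n. cnj (form (\<phi> n) (\<psi> n))) \<longlonglongrightarrow> cnj (closed_form M D S u v)"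
    by (intro tendsto_intros form_converges_limit L \<phi> \<psi>)
  then have "(\<lambda>n. form (\<psi> n) (\<phi> n)) \<longlonglongrightarrow> cnj (closed_form M D S u v)"
    using form_cnj[OF converges_in_D[OF \<phi>] converges_in_D[OF \<psi>]] by simp
  moreover have "(\<lambda>n. form (\<psi> n) (\<phi> n)) \<longlonglongrightarrow> closed_form M D S v u"
    by (intro form_converges_limit L \<phi> \<psi>)
  ultimately show ?thesis using LIMSEQ_unique by blast
qed

lemma zero_norm: "L2_norm M (\<lambda>x. 0) = 0"
  by (simp add: L2_norm_def)

lemma zero_inner: "L2_inner M (\<lambda>x. 0) f = 0"
  by (simp add: L2_inner_def)

lemma converges_const:
  assumes "w \<in> D"
  shows "converges (\<lambda>_. w) w"
  using assms unfolding form_converges_def by (auto simp: zero_norm zero_inner)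

lemma D_form_domain: "w \<in> D \<Longrightarrow> w \<in> form_domain M D S"
  unfolding form_domain_def using converges_const D_L2 by blast

lemma closed_form_test:
  assumes "w \<in> D" "u \<in> form_domain M D S"
  shows "closed_form M D S w u = L2_inner M (S w) u"
proof -
  obtain \<phi> where \<phi>: "converges \<phi> u" using assms unfolding form_domain_def by blast
  have "(\<lambda>n. form w (\<phi> n)) \<longlonglongrightarrow> closed_form M D S w u"
    by (rule form_converges_limit[OF D_L2[OF assms(1)] form_domain_L2[OF assms(2)] converges_const[OF assms(1)] \<phi>])
  moreover have "form w (\<phi> n) = L2_inner M (S w) (\<phi> n)" for n
    unfolding form_def by (rule symmetric[OF assms(1) converges_in_D[OF \<phi>]])
  moreover have "(\<lambda>n. L2_inner M (S w) (\<phi> n)) \<longlonglongrightarrow> L2_inner M (S w) u"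
    by (rule L2_inner_tendsto(2)[OF D_L2[OF converges_in_D[OF \<phi>]] form_domain_L2[OF assms(2)] S_L2[OF assms(1)] converges_L2[OF \<phi>]])
  ultimately show ?thesis using LIMSEQ_unique by simp
qed

lemma friedrichs_weak:
  assumes "(u, f) \<in> friedrichs_extension M D S" "w \<in> D"
  shows "L2_inner M (S w) u = L2_inner M w f"
  using assms closed_form_test[OF assms(2)] D_form_domain[OF assms(2)] unfolding friedrichs_extension_def by auto

lemma friedrichs_symmetric:
  assumes "(u, f) \<in> friedrichs_extension M D S" "(v, g) \<in> friedrichs_extension M D S"
  shows "L2_inner M u g = L2_inner M f v"
proof -
  have *: "u \<in> form_domain M D S" "v \<in> form_domain M D S" "f \<in> L2 M" "g \<in> L2 M"
    "closed_form M D S u v = L2_inner M u g" "closed_form M D S v u = L2_inner M v f"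
    using assms unfolding friedrichs_extension_def by auto
  have "L2_inner M u g = cnj (L2_inner M v f)"
    using closed_form_cnj[OF *(2,1)] *(5,6) by simp
  also have "\<dots> = L2_inner M f v"
    using L2_inner_cnj[OF form_domain_L2[OF *(2)] *(3)] by simp
  finally show ?thesis .
qed

text \<open>
  For an element of the form domain, the weak equation against \<open>D\<close> already implies membership, because
  \<open>D\<close> is dense in the form domain with respect to the energy norm.
\<close>

lemma friedrichsI:
  assumes u: "u \<in> form_domain M D S" and f: "f \<in> L2 M"
    and weak: "\<And>w. w \<in> D \<Longrightarrow> L2_inner M (S w) u = L2_inner M w f"
  shows "(u, f) \<in> friedrichs_extension M D S"
proof -
  have "closed_form M D S v u = L2_inner M v f" if v: "v \<in> form_domain M D S" for v
  proof -
    obtain \<phi> \<psi> where \<phi>: "converges \<phi> u" and \<psi>: "converges \<psi> v"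
      using u v unfolding form_domain_def by blast
    note D = converges_in_D[OF \<phi>] converges_in_D[OF \<psi>]
    note uL = form_domain_L2[OF u] and vL = form_domain_L2[OF v]
    obtain B where B: "B > 0" "\<And>n. energy_norm (\<psi> n) \<le> B" using converges_energy_bounded[OF vL \<psi>] by blast
    have "(\<lambda>n. form (\<psi> n) (\<phi> n) - L2_inner M (\<psi> n) f) \<longlonglongrightarrow> 0"
    proof (rule LIMSEQ_I)
      fix e :: real assume e: "e > 0"
      define d where "d = e / (2 * (K + 2) * B)"
      have KB: "2 * (K + 2) * B > 0" using K B by simp
      then have d: "d > 0" using e by (simp add: d_def)
      obtain N where N: "\<forall>m\<ge>N. \<forall>n\<ge>N. energy_norm (\<lambda>x. \<phi> m x - \<phi> n x) < d"
        using converges_energy_cauchy[OF uL \<phi> d] by blast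
      show "\<exists>n0. \<forall>n\<ge>n0. norm (form (\<psi> n) (\<phi> n) - L2_inner M (\<psi> n) f - 0) < e"
      proof (intro exI[of _ N] allI impI)
        fix n assume n: "N \<le> n"
        have lim: "(\<lambda>m. form (\<psi> n) (\<phi> m)) \<longlonglongrightarrow> L2_inner M (\<psi> n) f"
        proof -
          have "(\<lambda>m. L2_inner M (S (\<psi> n)) (\<phi> m)) \<longlonglongrightarrow> L2_inner M (S (\<psi> n)) u"
            by (rule L2_inner_tendsto(2)[OF D_L2[OF D(1)] uL S_L2[OF D(2)] converges_L2[OF \<phi>]])
          then show ?thesis
            unfolding form_def symmetric[OF D(2) D(1)] weak[OF D(2), symmetric] .
        qed
        have "cmod (form (\<psi> n) (\<phi> n) - L2_inner M (\<psi> n) f) \<le> e / 2"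
        proof (rule tendsto_upperbound[OF tendsto_norm[OF tendsto_diff[OF tendsto_const lim]]])
          show "\<forall>\<^sub>F m in sequentially. norm (form (\<psi> n) (\<phi> n) - form (\<psi> n) (\<phi> m)) \<le> e / 2"
            using eventually_ge_at_top[of N]
          proof eventually_elim
            case (elim m)
            have "form (\<psi> n) (\<phi> n) - form (\<psi> n) (\<phi> m) = form (\<psi> n) (\<lambda>x. \<phi> n x - \<phi> m x)"
              using form_lincomb_right[OF D(2) D(1) D(1), of n n 1 m] by simp
            then have "cmod (form (\<psi> n) (\<phi> n) - form (\<psi> n) (\<phi> m)) \<le> (K + 2) * energy_norm (\<psi> n) * energy_norm (\<lambda>x. \<phi> n x - \<phi> m x)"
              using form_bound[OF D(2)[of n] D_diff[OF D(1)[of n] D(1)[of m]]] by simp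
            also have "\<dots> \<le> (K + 2) * B * d"
              using K B N[rule_format, of n m] n elim energy_norm_nonneg[OF D(2)] energy_norm_nonneg[OF D_diff[OF D(1) D(1)]] d
              by (intro mult_mono) (auto intro: less_imp_le)
            also have "\<dots> = e / 2"
            proof -
              have "d * (2 * (K + 2) * B) = e"
                using d_def KB by (intro nonzero_eq_divide_eq[THEN iffD1]) auto
              then show ?thesis by (simp add: algebra_simps)
            qed
            finally show ?case .
          qed
        qed simp
        then show "norm (form (\<psi> n) (\<phi> n) - L2_inner M (\<psi> n) f - 0) < e" using e by simp
      qed
    qed
    moreover have "(\<lambda>n. L2_inner M (\<psi> n) f) \<longlonglongrightarrow> L2_inner M v f"
      by (rule L2_inner_tendsto(1)[OF D_L2[OF D(2)] vL f converges_L2[OF \<psi>]])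
    ultimately have "(\<lambda>n. form (\<psi> n) (\<phi> n) - L2_inner M (\<psi> n) f + L2_inner M (\<psi> n) f) \<longlonglongrightarrow> 0 + L2_inner M v f"
      by (rule tendsto_add)
    then have "(\<lambda>n. form (\<psi> n) (\<phi> n)) \<longlonglongrightarrow> L2_inner M v f" by simp
    moreover have "(\<lambda>n. form (\<psi> n) (\<phi> n)) \<longlonglongrightarrow> closed_form M D S v u"
      by (rule form_converges_limit[OF vL uL \<psi> \<phi>])
    ultimately show ?thesis using LIMSEQ_unique by blast
  qed
  then show ?thesis using u f unfolding friedrichs_extension_def by auto
qed

end

section \<open>Smooth functions and approximation by test functions\<close>

abbreviation vderiv :: "(real \<Rightarrow> 'a::real_normed_vector) \<Rightarrow> real \<Rightarrow> 'a" where
  "vderiv f \<equiv> \<lambda>t. vector_derivative f (at t)"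

text \<open>
  Smoothness is coinductive: a family of functions in which every member has a derivative in the family
  consists of smooth functions. Each closure property below is an application with a suitable family.
\<close>

lemma smooth_on_coinduct:
  assumes "open S" and f: "f \<in> C"
    and step: "\<And>g. g \<in> C \<Longrightarrow> \<exists>g'\<in>C. \<forall>x\<in>S. (g has_vector_derivative g' x) (at x)"
  shows "smooth_on S f"
proof -
  have agree: "\<exists>g\<in>C. \<forall>x\<in>S. ((vderiv ^^ n) f) x = g x" for n
  proof (induction n)
    case 0
    then show ?case using f by auto
  next
    case (Suc n)
    then obtain g where g: "g \<in> C" "\<forall>x\<in>S. ((vderiv ^^ n) f) x = g x" by blast
    obtain g' where g': "g' \<in> C" "\<forall>x\<in>S. (g has_vector_derivative g' x) (at x)" using step[OF g(1)] by blast
    have "((vderiv ^^ Suc n) f) x = g' x" if "x \<in> S" for x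
    proof -
      have "((vderiv ^^ n) f has_vector_derivative g' x) (at x)"
        by (rule has_vector_derivative_transform_within_open[OF _ \<open>open S\<close> that]) (use g g' that in auto)
      then show ?thesis by (simp add: vector_derivative_at)
    qed
    with g'(1) show ?case by blast
  qed
  show ?thesis
    unfolding smooth_on_def
  proof (intro allI ballI)
    fix n x assume x: "x \<in> S"
    obtain g where g: "g \<in> C" "\<forall>x\<in>S. ((vderiv ^^ n) f) x = g x" using agree by blast
    obtain g' where g': "\<forall>x\<in>S. (g has_vector_derivative g' x) (at x)" using step[OF g(1)] by blast
    have "((vderiv ^^ n) f has_vector_derivative g' x) (at x)"
      by (rule has_vector_derivative_transform_within_open[OF _ \<open>open S\<close> x]) (use g g' x in auto)
    then show "(vderiv ^^ n) f differentiable at x" by (rule differentiableI_vector)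
  qed
qed

lemma smooth_on_has_derivative:
  assumes "smooth_on S f" "x \<in> S"
  shows "(f has_vector_derivative vderiv f x) (at x)"
  using assms unfolding smooth_on_def by (auto dest!: spec[of _ 0] simp: vector_derivative_works)

lemma smooth_on_vderiv:
  assumes "smooth_on S f"
  shows "smooth_on S (vderiv f)"
  unfolding smooth_on_def
proof (intro allI ballI)
  fix n x assume "x \<in> S"
  have "(vderiv ^^ n) (vderiv f) = (vderiv ^^ Suc n) f" by (simp only: funpow_Suc_right o_def)
  then show "(vderiv ^^ n) (vderiv f) differentiable at x"
    using assms \<open>x \<in> S\<close> unfolding smooth_on_def by metis
qed

lemma smooth_on_continuous:
  assumes "smooth_on S f"
  shows "continuous_on S f"
  using smooth_on_has_derivative[OF assms]
  by (intro continuous_at_imp_continuous_on ballI) (auto intro: has_vector_derivative_continuous)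

text \<open>
  The family used for sums and products. It absorbs the growing number of terms in the iterated product rule.
\<close>

inductive_set smooth_algebra :: "real set \<Rightarrow> (real \<Rightarrow> 'a::real_normed_algebra) set" for S where
  base: "smooth_on S f \<Longrightarrow> f \<in> smooth_algebra S"
| add: "f \<in> smooth_algebra S \<Longrightarrow> g \<in> smooth_algebra S \<Longrightarrow> (\<lambda>x. f x + g x) \<in> smooth_algebra S"
| mult: "f \<in> smooth_algebra S \<Longrightarrow> g \<in> smooth_algebra S \<Longrightarrow> (\<lambda>x. f x * g x) \<in> smooth_algebra S"

lemma smooth_algebra_smooth:
  assumes "open S" "f \<in> smooth_algebra S"
  shows "smooth_on S f"
proof (rule smooth_on_coinduct[OF assms])
  fix g :: "real \<Rightarrow> 'a" assume "g \<in> smooth_algebra S"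
  then show "\<exists>g'\<in>smooth_algebra S. \<forall>x\<in>S. (g has_vector_derivative g' x) (at x)"
  proof induction
    case (base f)
    show ?case
      by (rule bexI[OF _ smooth_algebra.base[OF smooth_on_vderiv[OF base]]])
         (simp add: smooth_on_has_derivative[OF base])
  next
    case (add f g)
    then obtain f' g' where "f' \<in> smooth_algebra S" "\<forall>x\<in>S. (f has_vector_derivative f' x) (at x)"
      "g' \<in> smooth_algebra S" "\<forall>x\<in>S. (g has_vector_derivative g' x) (at x)" by blast
    then show ?case
      by (intro bexI[OF _ smooth_algebra.add[of f' S g']]) (auto intro: has_vector_derivative_add)
  next
    case (mult f g)
    then obtain f' g' where fg: "f' \<in> smooth_algebra S" "\<forall>x\<in>S. (f has_vector_derivative f' x) (at x)"
      "g' \<in> smooth_algebra S" "\<forall>x\<in>S. (g has_vector_derivative g' x) (at x)" by blast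
    show ?case
    proof (rule bexI[of _ "\<lambda>x. f x * g' x + f' x * g x"])
      show "\<forall>x\<in>S. ((\<lambda>x. f x * g x) has_vector_derivative f x * g' x + f' x * g x) (at x)"
        using fg by (auto intro: has_vector_derivative_mult)
      show "(\<lambda>x. f x * g' x + f' x * g x) \<in> smooth_algebra S"
        by (intro smooth_algebra.add[of "\<lambda>x. f x * g' x"] smooth_algebra.mult mult.hyps fg)
    qed
  qed
qed

lemma smooth_on_add:
  fixes f g :: "real \<Rightarrow> 'a::real_normed_algebra"
  shows "open S \<Longrightarrow> smooth_on S f \<Longrightarrow> smooth_on S g \<Longrightarrow> smooth_on S (\<lambda>x. f x + g x)"
  by (rule smooth_algebra_smooth[OF _ smooth_algebra.add[OF smooth_algebra.base smooth_algebra.base]])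

lemma smooth_on_mult:
  fixes f g :: "real \<Rightarrow> 'a::real_normed_algebra"
  shows "open S \<Longrightarrow> smooth_on S f \<Longrightarrow> smooth_on S g \<Longrightarrow> smooth_on S (\<lambda>x. f x * g x)"
  by (rule smooth_algebra_smooth[OF _ smooth_algebra.mult[OF smooth_algebra.base smooth_algebra.base]])

lemma smooth_on_const: "open S \<Longrightarrow> smooth_on S (\<lambda>_. c)"
  by (rule smooth_on_coinduct[where C = "range (\<lambda>c _. c)"]) (auto intro!: exI[of _ 0])

lemma smooth_on_lincomb:
  fixes f g :: "real \<Rightarrow> 'a::real_normed_algebra_1"
  assumes "open S" "smooth_on S f" "smooth_on S g"
  shows "smooth_on S (\<lambda>x. f x - c * g x)"
proof -
  have "smooth_on S (\<lambda>x. f x + (- c) * g x)"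
    by (rule smooth_on_add[OF assms(1,2) smooth_on_mult[OF assms(1) smooth_on_const[OF assms(1)] assms(3)]])
  then show ?thesis by simp
qed

lemma smooth_on_of_real:
  fixes f :: "real \<Rightarrow> real"
  assumes "open S" "smooth_on S f"
  shows "smooth_on S (\<lambda>x. complex_of_real (f x))"
proof (rule smooth_on_coinduct[OF \<open>open S\<close>, where C = "{\<lambda>x. complex_of_real (g x) |g. smooth_on S g}"])
  fix h assume "h \<in> {\<lambda>x. complex_of_real (g x) |g. smooth_on S g}"
  then obtain g where g: "smooth_on S g" "h = (\<lambda>x. complex_of_real (g x))" by blast
  have "(h has_vector_derivative complex_of_real (vderiv g x)) (at x)" if "x \<in> S" for x
    unfolding g(2) using smooth_on_has_derivative[OF g(1) that]
    by (intro has_vector_derivative_of_real) (simp add: has_real_derivative_iff_has_vector_derivative)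
  then show "\<exists>g'\<in>{\<lambda>x. complex_of_real (g x) |g. smooth_on S g}. \<forall>x\<in>S. (h has_vector_derivative g' x) (at x)"
    using smooth_on_vderiv[OF g(1)] by (intro bexI[of _ "\<lambda>x. complex_of_real (vderiv g x)"]) auto
qed (use assms in auto)

lemma smooth_on_scale:
  fixes f :: "real \<Rightarrow> real"
  assumes "smooth_on {0<..} f" "c > 0"
  shows "smooth_on {0<..} (\<lambda>x. f (c * x))"
proof (rule smooth_on_coinduct[where C = "{\<lambda>x::real. (k::real) * (g::real \<Rightarrow> real) (c * x) |g k. smooth_on {0<..} g}"])
  fix h assume "h \<in> {\<lambda>x::real. (k::real) * (g::real \<Rightarrow> real) (c * x) |g k. smooth_on {0<..} g}"
  then obtain g k where g: "smooth_on {0<..} g" "h = (\<lambda>x. k * g (c * x))" by blast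
  have "(h has_vector_derivative (k * c) * vderiv g (c * x)) (at x)" if "x \<in> {0<..}" for x
  proof -
    have "c * x \<in> {0<..}" using that assms by simp
    from smooth_on_has_derivative[OF g(1) this]
    have "(g has_real_derivative vderiv g (c * x)) (at (c * x))"
      by (simp add: has_real_derivative_iff_has_vector_derivative)
    from DERIV_cmult[OF DERIV_chain2[OF this DERIV_cmult[OF DERIV_ident, of c]], of k]
    show ?thesis unfolding g(2)
      by (simp add: has_real_derivative_iff_has_vector_derivative mult_ac)
  qed
  then have d: "\<forall>x\<in>{0<..}. (h has_vector_derivative (k * c) * vderiv g (c * x)) (at x)" by blast
  have mem: "(\<lambda>x. (k * c) * vderiv g (c * x)) \<in> {\<lambda>x::real. (k::real) * (g::real \<Rightarrow> real) (c * x) |g k. smooth_on {0<..} g}"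
    using smooth_on_vderiv[OF g(1)] by (intro CollectI exI[of _ "vderiv g"] exI[of _ "k * c"]) auto
  show "\<exists>g'\<in>{\<lambda>x::real. (k::real) * (g::real \<Rightarrow> real) (c * x) |g k. smooth_on {0<..} g}. \<forall>x\<in>{0<..}. (h has_vector_derivative g' x) (at x)"
    by (rule bexI[where x = "\<lambda>x. (k * c) * vderiv g (c * x)"]) (rule d, rule mem)
next
  show "(\<lambda>x. f (c * x)) \<in> {\<lambda>x::real. (k::real) * (g::real \<Rightarrow> real) (c * x) |g k. smooth_on {0<..} g}"
    using assms by (intro CollectI exI[of _ f] exI[of _ 1]) auto
qed auto

text \<open>
  Test functions are smooth on all of the real line, whereas the given cutoff is known to be smooth on the
  positive half line only.
\<close>

lemma smooth_on_zero_extension: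
  fixes f :: "real \<Rightarrow> real"
  assumes "smooth_on {0<..} f" "a > 0" "\<And>x. 0 < x \<Longrightarrow> x < a \<Longrightarrow> f x = 0"
  shows "smooth_on UNIV (\<lambda>x. if x > 0 then f x else 0)"
proof (rule smooth_on_coinduct[where C = "{\<lambda>x. if x > 0 then g x else 0 |g. smooth_on {0<..} g \<and> (\<forall>x. 0 < x \<longrightarrow> x < a \<longrightarrow> g x = 0)}"])
  fix h :: "real \<Rightarrow> real" assume "h \<in> {\<lambda>x. if x > 0 then g x else 0 |g. smooth_on {0<..} g \<and> (\<forall>x. 0 < x \<longrightarrow> x < a \<longrightarrow> g x = 0)}"
  then obtain g where g: "smooth_on {0<..} g" "\<forall>x. 0 < x \<longrightarrow> x < a \<longrightarrow> g x = 0" and h: "h = (\<lambda>x. if x > 0 then g x else 0)" by blast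
  have pos: "(h has_vector_derivative vderiv g x) (at x)" if "x > 0" for x
    by (rule has_vector_derivative_transform_within_open[OF smooth_on_has_derivative[OF g(1)], of x "{0<..}"])
       (use that in \<open>auto simp: h\<close>)
  have neg: "(h has_vector_derivative 0) (at x)" if "x < a" for x
    by (rule has_vector_derivative_transform_within_open[where f = "\<lambda>_. 0" and S = "{..<a}"])
       (use that g(2) in \<open>auto simp: h\<close>)
  have z: "vderiv g x = 0" if "0 < x" "x < a" for x
    using vector_derivative_unique_at[OF pos[OF that(1)] neg[OF that(2)]] .
  have "(h has_vector_derivative (if x > 0 then vderiv g x else 0)) (at x)" for x
    using pos[of x] neg[of x] \<open>a > 0\<close> by auto
  then have d: "\<forall>x\<in>UNIV. (h has_vector_derivative (if x > 0 then vderiv g x else 0)) (at x)" by blast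
  have mem: "(\<lambda>x. if x > 0 then vderiv g x else 0) \<in> {\<lambda>x. if x > 0 then g x else 0 |g. smooth_on {0<..} g \<and> (\<forall>x. 0 < x \<longrightarrow> x < a \<longrightarrow> g x = 0)}"
    using smooth_on_vderiv[OF g(1)] z by (intro CollectI exI[of _ "vderiv g"]) auto
  show "\<exists>g'\<in>{\<lambda>x. if x > 0 then g x else 0 |g. smooth_on {0<..} g \<and> (\<forall>x. 0 < x \<longrightarrow> x < a \<longrightarrow> g x = 0)}.
      \<forall>x\<in>UNIV. (h has_vector_derivative g' x) (at x)" 
    by (rule bexI[where x = "\<lambda>x. if x > 0 then vderiv g x else 0"]) (rule d, rule mem)
next
  show "(\<lambda>x. if x > 0 then f x else 0) \<in> {\<lambda>x. if x > 0 then g x else 0 |g. smooth_on {0<..} g \<and> (\<forall>x. 0 < x \<longrightarrow> x < a \<longrightarrow> g x = 0)}"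
    using assms by blast
qed auto

lemma smooth_on_polynomial:
  fixes p :: "real \<Rightarrow> real"
  assumes "open S" "real_polynomial_function p"
  shows "smooth_on S p"
proof (rule smooth_on_coinduct[OF \<open>open S\<close>, where C = "Collect real_polynomial_function"])
  fix g :: "real \<Rightarrow> real" assume "g \<in> Collect real_polynomial_function"
  then show "\<exists>g'\<in>Collect real_polynomial_function. \<forall>x\<in>S. (g has_vector_derivative g' x) (at x)"
    using has_real_derivative_polynomial_function[of g]
    by (auto simp: has_real_derivative_iff_has_vector_derivative)
qed (use assms in simp)

lemma polynomial_primitive:
  fixes p :: "real \<Rightarrow> real"
  assumes "real_polynomial_function p"
  obtains P where "real_polynomial_function P" "\<And>x. (P has_real_derivative p x) (at x)" "P a = 0"
proof -
  obtain c n where p: "p = (\<lambda>x. \<Sum>i\<le>n. c i * x ^ i)"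
    using assms by (auto simp: real_polynomial_function_iff_sum)
  define Q where "Q = (\<lambda>x::real. \<Sum>i\<le>n. c i / real (Suc i) * x ^ Suc i)"
  have "real_polynomial_function Q"
    unfolding Q_def
    by (intro real_polynomial_function_sum finite_atMost
        real_polynomial_function.intros(4)[OF real_polynomial_function.intros(2)
          real_polynomial_function_power[OF real_polynomial_function.intros(1)[OF bounded_linear_ident]]])
  then have 1: "real_polynomial_function (\<lambda>x. Q x - Q a)"
    by (intro real_polynomial_function_diff real_polynomial_function.intros(2))
  have "(Q has_real_derivative p x) (at x)" for x
    unfolding Q_def p by (auto intro!: derivative_eq_intros sum.cong simp del: power_Suc of_nat_Suc)
  then have "((\<lambda>x. Q x - Q a) has_real_derivative p x) (at x)" for x
    by (auto intro!: derivative_eq_intros)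
  with 1 show ?thesis using that[of "\<lambda>x. Q x - Q a"] by simp
qed

text \<open>
  A substitute for mollification: the derivative of \<open>w\<close> is approximated by a polynomial (Weierstrass), and a
  primitive of the polynomial is multiplied by a smooth cutoff that is built from the given \<open>chi\<close> by scaling.
\<close>

lemma test_function_C1_approximation:
  fixes chi w w' :: "real \<Rightarrow> real"
  assumes chi: "smooth_on {0<..} chi" "\<And>r. 0 < r \<Longrightarrow> r \<le> 1 \<Longrightarrow> chi r = 0" "\<And>r. r \<ge> 2 \<Longrightarrow> chi r = 1"
    and ab: "0 < a" "a < b"
    and w: "\<And>r. r > 0 \<Longrightarrow> (w has_real_derivative w' r) (at r)" and w': "continuous_on {0<..} w'"
    and supp: "\<And>r. r > 0 \<Longrightarrow> r \<notin> {a..b} \<Longrightarrow> w r = 0" and "e > 0"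
  obtains \<phi> where "smooth_on UNIV \<phi>" "\<And>r. r \<notin> {a / 2..2 * b} \<Longrightarrow> \<phi> r = 0"
    "\<And>r. r > 0 \<Longrightarrow> \<bar>\<phi> r - w r\<bar> \<le> e" "\<And>r. r > 0 \<Longrightarrow> \<bar>deriv \<phi> r - w' r\<bar> \<le> e"
proof -
  (* equal to 1 on [a, b], supported in [a/2, 2b] *)
  define \<theta>0 where "\<theta>0 = (\<lambda>r. chi (2 / a * r) * (1 - 1 * chi (1 / b * r)))"
  define \<theta> where "\<theta> = (\<lambda>r. if r > 0 then \<theta>0 r else 0)"
  have b: "b > 0" using ab by simp
  have "smooth_on {0<..} \<theta>0"
    unfolding \<theta>0_def using ab b
    by (intro smooth_on_mult[OF open_greaterThan smooth_on_scale[OF chi(1)] smooth_on_lincomb[OF open_greaterThan smooth_on_const[OF open_greaterThan] smooth_on_scale[OF chi(1)]]]) auto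
  then have \<theta>s: "smooth_on UNIV \<theta>"
    unfolding \<theta>_def
  proof (rule smooth_on_zero_extension[of _ "a / 2"])
    fix x assume "0 < x" "x < a / 2"
    then show "\<theta>0 x = 0" using ab chi(2)[of "2 / a * x"] by (simp add: \<theta>0_def field_simps)
  qed (use ab in simp)
  have \<theta>1: "\<theta> r = 1" if "r \<in> {a..b}" for r
  proof -
    have "chi (2 / a * r) = 1" using that ab by (intro chi(3)) (simp add: field_simps)
    moreover have "chi (1 / b * r) = 0" using that ab by (intro chi(2)) (auto simp: field_simps)
    ultimately show ?thesis using that ab by (simp add: \<theta>_def \<theta>0_def)
  qed
  have \<theta>0: "\<theta> r = 0" if "r \<notin> {a / 2<..<2 * b}" for r
  proof (cases "r > 0 \<and> r \<ge> 2 * b")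
    case True
    then have "chi (1 / b * r) = 1" using b by (intro chi(3)) (simp add: field_simps)
    then show ?thesis by (simp add: \<theta>_def \<theta>0_def)
  next
    case False
    then have "r > 0 \<Longrightarrow> chi (2 / a * r) = 0" using that ab by (intro chi(2)) (auto simp: field_simps)
    then show ?thesis by (simp add: \<theta>_def \<theta>0_def)
  qed
  define \<theta>' where "\<theta>' = vderiv \<theta>"
  have d\<theta>: "(\<theta> has_real_derivative \<theta>' r) (at r)" for r
    using smooth_on_has_derivative[OF \<theta>s] by (simp add: \<theta>'_def has_real_derivative_iff_has_vector_derivative)
  have "continuous_on {a / 2..2 * b} \<theta>" "continuous_on {a / 2..2 * b} \<theta>'"
    using smooth_on_continuous[OF \<theta>s] smooth_on_continuous[OF smooth_on_vderiv[OF \<theta>s]]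
    unfolding \<theta>'_def by (auto intro: continuous_on_subset)
  then have "bounded (\<theta> ` {a / 2..2 * b})" "bounded (\<theta>' ` {a / 2..2 * b})"
    using compact_Icc by (blast intro: compact_imp_bounded compact_continuous_image)+
  then obtain T1 T2 where T12: "\<forall>r\<in>{a / 2..2 * b}. \<bar>\<theta> r\<bar> \<le> T1" "\<forall>r\<in>{a / 2..2 * b}. \<bar>\<theta>' r\<bar> \<le> T2"
    unfolding bounded_iff by (auto simp: real_norm_def)
  define T where "T = max 1 (max T1 T2)"
  have T: "\<bar>\<theta> r\<bar> \<le> T" "\<bar>\<theta>' r\<bar> \<le> T" if "r \<in> {a / 2..2 * b}" for r
    using T12(1)[rule_format, OF that] T12(2)[rule_format, OF that] by (auto simp: T_def)
  have T1: "T \<ge> 1" by (simp add: T_def)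
  (* the primitive of the polynomial is within 2 b delta of w, and the cutoff costs a factor T *)
  define \<delta> where "\<delta> = e / (T * (2 * b + 1))"
  have \<delta>: "\<delta> > 0" using \<open>e > 0\<close> T1 b by (simp add: \<delta>_def)
  have \<delta>e: "T * (2 * b * \<delta>) + T * \<delta> = e"
  proof -
    have "T * (2 * b + 1) \<noteq> 0" using T1 b by simp
    then have "\<delta> * (T * (2 * b + 1)) = e" using \<delta>_def by (intro nonzero_eq_divide_eq[THEN iffD1]) auto
    then show ?thesis by (simp add: algebra_simps)
  qed
  have "continuous_on {a / 2..2 * b} w'" by (rule continuous_on_subset[OF w']) (use ab in auto)
  then obtain p where p: "real_polynomial_function p" "\<And>x. x \<in> {a / 2..2 * b} \<Longrightarrow> \<bar>w' x - p x\<bar> < \<delta>"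
    using Stone_Weierstrass_real_polynomial_function[of "{a / 2..2 * b}" w' \<delta>] \<delta> compact_Icc by metis
  obtain P where P: "real_polynomial_function P" "\<And>x. (P has_real_derivative p x) (at x)" "P (a / 2) = 0"
    using polynomial_primitive[OF p(1)] by blast
  have Pw: "\<bar>P r - w r\<bar> \<le> 2 * b * \<delta>" if r: "r \<in> {a / 2..2 * b}" for r
  proof -
    have "norm ((P r - w r) - (P (a / 2) - w (a / 2))) \<le> \<delta> * r - \<delta> * (a / 2)"
    proof (rule increment_le_of_derivative_le[where f = "\<lambda>x. p x - w' x" and g' = "\<lambda>_. \<delta>"
          and F = "\<lambda>x. P x - w x" and g = "\<lambda>x. \<delta> * x"])
      fix x assume x: "a / 2 \<le> x" "x \<le> r"
      show "((\<lambda>x. P x - w x) has_vector_derivative p x - w' x) (at x)"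
        unfolding has_real_derivative_iff_has_vector_derivative[symmetric]
        using x ab by (intro DERIV_diff P w) simp
      show "((*) \<delta> has_real_derivative \<delta>) (at x)" by (auto intro!: derivative_eq_intros)
      show "norm (p x - w' x) \<le> \<delta>" using p(2)[of x] x r by (simp add: abs_minus_commute less_imp_le)
    qed (use r in simp)
    moreover have "w (a / 2) = 0" using ab by (intro supp) auto
    moreover have "\<delta> * r - \<delta> * (a / 2) \<le> 2 * b * \<delta>"
    proof -
      have "\<delta> * (r - a / 2) \<le> \<delta> * (2 * b)" using r \<delta> ab by (intro mult_left_mono) auto
      then show ?thesis by (simp only: right_diff_distrib mult_ac)
    qed
    ultimately show ?thesis using P(3) by simp
  qed
  have w\<theta>: "w r = \<theta> r * w r" if "r > 0" for r
    using that \<theta>1 supp by (cases "r \<in> {a..b}") auto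
  have w'\<theta>: "w' r = \<theta>' r * w r + w' r * \<theta> r" if r: "r > 0" for r
  proof -
    have "(w has_real_derivative \<theta>' r * w r + w' r * \<theta> r) (at r)"
      by (rule has_field_derivative_transform_within_open[OF DERIV_mult[OF d\<theta> w[OF r]] open_greaterThan, of 0])
         (use r w\<theta> in auto)
    then show ?thesis using w[OF r] DERIV_unique by blast
  qed
  have \<theta>'0: "\<theta>' r = 0" if "r \<notin> {a / 2..2 * b}" for r
  proof -
    have "open (- {a / 2..2 * b})" by (intro open_Compl) simp
    then have "(\<theta> has_real_derivative 0) (at r)"
      by (rule has_field_derivative_transform_within_open[where f = "\<lambda>_. 0", rotated]) (use that \<theta>0 in auto)
    then show ?thesis using d\<theta> DERIV_unique by blast
  qed
  define \<phi> where "\<phi> = (\<lambda>r. \<theta> r * P r)"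
  have d\<phi>: "deriv \<phi> r = \<theta>' r * P r + p r * \<theta> r" for r
    unfolding \<phi>_def by (intro DERIV_imp_deriv DERIV_mult d\<theta> P)
  show ?thesis
  proof (rule that[of \<phi>])
    show "smooth_on UNIV \<phi>"
      unfolding \<phi>_def by (rule smooth_on_mult[OF open_UNIV \<theta>s smooth_on_polynomial[OF open_UNIV P(1)]])
    show "\<phi> r = 0" if "r \<notin> {a / 2..2 * b}" for r
    proof -
      have "\<theta> r = 0" using that by (intro \<theta>0) auto
      then show ?thesis by (simp add: \<phi>_def)
    qed
  next
    fix r :: real assume r: "r > 0"
    have eq: "\<phi> r - w r = \<theta> r * (P r - w r)" "deriv \<phi> r - w' r = \<theta>' r * (P r - w r) + \<theta> r * (p r - w' r)"
      using w\<theta>[OF r] w'\<theta>[OF r] unfolding d\<phi> by (auto simp: \<phi>_def algebra_simps)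
    have "\<bar>\<theta> r * (P r - w r)\<bar> \<le> T * (2 * b * \<delta>) \<and> \<bar>\<theta>' r * (P r - w r)\<bar> \<le> T * (2 * b * \<delta>) \<and> \<bar>\<theta> r * (p r - w' r)\<bar> \<le> T * \<delta>"
    proof (cases "r \<in> {a / 2..2 * b}")
      case True
      then show ?thesis
        unfolding abs_mult using T[OF True] Pw[OF True] p(2)[OF True] T1 \<delta> b
        by (intro conjI mult_mono) (auto simp: abs_minus_commute)
    next
      case False
      then have "r \<notin> {a / 2<..<2 * b}" by auto
      from \<theta>0[OF this] \<theta>'0[OF False] show ?thesis using T1 \<delta> b by simp
    qed
    then show "\<bar>\<phi> r - w r\<bar> \<le> e" "\<bar>deriv \<phi> r - w' r\<bar> \<le> e"
      unfolding eq using \<delta>e mult_pos_pos[of T \<delta>] T1 \<delta> by linarith+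
  qed
qed

section \<open>The radial operator on the half line\<close>

abbreviation half_line :: "real measure" where
  "half_line \<equiv> lebesgue_on {0<..}"

text \<open>
  Continuity on the open half line gives integrability only together with a support away from \<open>0\<close>; the
  integral is then one over a compact interval.
\<close>

lemma half_line_compact_support:
  fixes f :: "real \<Rightarrow> 'a::euclidean_space"
  assumes "continuous_on {0<..} f" "0 < a" "\<And>r. r > 0 \<Longrightarrow> r \<notin> {a..b} \<Longrightarrow> f r = 0"
  shows "integrable half_line f" "(LINT r|half_line. f r) = integral {a..b} f"
proof -
  have "continuous_on {a..b} f" by (rule continuous_on_subset[OF assms(1)]) (use \<open>0 < a\<close> in auto)
  then have ai: "f absolutely_integrable_on {a..b}"
    by (rule absolutely_integrable_continuous_real)
  have eq: "indicator {0<..} r *\<^sub>R f r = indicator {a..b} r *\<^sub>R f r" for r :: real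
    using assms(2) assms(3)[of r] by (auto simp: indicator_def)
  have m: "{0<..} \<inter> space lebesgue \<in> sets (lebesgue :: real measure)" by simp
  have 1: "set_integrable lebesgue {0<..} f"
    using ai unfolding set_integrable_def eq .
  then show "integrable half_line f"
    unfolding set_integrable_def by (subst integrable_restrict_space[OF m]) simp
  have "(LINT r|half_line. f r) = (LINT r:{0<..}|lebesgue. f r)"
    unfolding set_lebesgue_integral_def by (subst integral_restrict_space[OF m]) simp
  also have "\<dots> = (LINT r:{a..b}|lebesgue. f r)"
    unfolding set_lebesgue_integral_def eq ..
  also have "\<dots> = integral {a..b} f"
    by (rule set_lebesgue_integral_eq_integral(2)[OF ai])
  finally show "(LINT r|half_line. f r) = integral {a..b} f" .
qed

lemma continuous_measurable_half_line:
  fixes f :: "real \<Rightarrow> 'a::euclidean_space"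
  shows "continuous_on {0<..} f \<Longrightarrow> f \<in> borel_measurable half_line"
  by (rule continuous_imp_measurable_on_sets_lebesgue) auto

lemma half_line_integral_derivative:
  fixes F :: "real \<Rightarrow> 'a::euclidean_space"
  assumes F: "\<And>r. r > 0 \<Longrightarrow> (F has_vector_derivative F' r) (at r)" and F': "continuous_on {0<..} F'"
    and "0 < a" "a < b" and supp: "\<And>r. r > 0 \<Longrightarrow> r \<notin> {a..b} \<Longrightarrow> F r = 0"
  shows "integrable half_line F'" "(LINT r|half_line. F' r) = 0"
proof -
  have F'0: "F' r = 0" if r: "r > 0" "r \<notin> {a..b}" for r
  proof -
    have "(F has_vector_derivative 0) (at r)"
      by (rule has_vector_derivative_transform_within_open[where f = "\<lambda>_. 0" and S = "{0<..} - {a..b}"])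
         (use r supp in \<open>auto intro: open_Diff\<close>)
    then show ?thesis using F[OF r(1)] vector_derivative_unique_at by blast
  qed
  then have supp': "F' r = 0" if "r > 0" "r \<notin> {a / 2..2 * b}" for r
    using that \<open>0 < a\<close> \<open>a < b\<close> by auto
  have a2: "a / 2 > 0" using \<open>0 < a\<close> by simp
  note H = half_line_compact_support[OF F' a2 supp']
  show "integrable half_line F'" by (rule H(1))
  have "(F' has_integral (F (2 * b) - F (a / 2))) {a / 2..2 * b}"
    by (rule fundamental_theorem_of_calculus)
       (use F assms(3,4) in \<open>auto intro: has_vector_derivative_at_within\<close>)
  moreover have "F (2 * b) = 0" "F (a / 2) = 0" using assms(3,4) by (auto intro!: supp)
  ultimately show "(LINT r|half_line. F' r) = 0"
    using H(2) by (simp add: integral_unique)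
qed

lemma test_function_support:
  assumes "\<phi> \<in> test_functions"
  obtains a b where "0 < a" "a < b" "\<And>x. x \<notin> {a..b} \<Longrightarrow> \<phi> x = 0"
proof -
  obtain K where K: "compact K" "K \<subseteq> {0<..}" "\<And>x. x \<notin> K \<Longrightarrow> \<phi> x = 0"
    using assms unfolding test_functions_def by blast
  show ?thesis
  proof (cases "K = {}")
    case True
    then show ?thesis using K that[of 1 2] by auto
  next
    case False
    obtain a where a: "a \<in> K" "\<forall>y\<in>K. a \<le> y" using compact_attains_inf[OF K(1) False] by blast
    obtain b where b: "b \<in> K" "\<forall>y\<in>K. y \<le> b" using compact_attains_sup[OF K(1) False] by blast
    have "K \<subseteq> {a..b + 1}" using a b by force
    moreover have "0 < a" "a < b + 1" using a b K by force+
    ultimately show ?thesis using K that[of a "b + 1"] by blast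
  qed
qed

lemma test_functionI:
  assumes "smooth_on UNIV \<phi>" "0 < a" "\<And>x. x \<notin> {a..b} \<Longrightarrow> \<phi> x = 0"
  shows "\<phi> \<in> test_functions"
  unfolding test_functions_def using assms by (auto intro!: exI[of _ "{a..b}"])

lemma test_function_derivs:
  assumes "\<phi> \<in> test_functions"
  shows "(\<phi> has_vector_derivative vderiv \<phi> r) (at r)" "(vderiv \<phi> has_vector_derivative vderiv (vderiv \<phi>) r) (at r)"
    "continuous_on UNIV \<phi>" "continuous_on UNIV (vderiv \<phi>)" "continuous_on UNIV (vderiv (vderiv \<phi>))"
proof -
  have s: "smooth_on UNIV \<phi>" using assms by (simp add: test_functions_def)
  note s1 = smooth_on_vderiv[OF s] and s2 = smooth_on_vderiv[OF smooth_on_vderiv[OF s]]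
  show "(\<phi> has_vector_derivative vderiv \<phi> r) (at r)" by (rule smooth_on_has_derivative[OF s UNIV_I])
  show "(vderiv \<phi> has_vector_derivative vderiv (vderiv \<phi>) r) (at r)" by (rule smooth_on_has_derivative[OF s1 UNIV_I])
  show "continuous_on UNIV \<phi>" "continuous_on UNIV (vderiv \<phi>)" "continuous_on UNIV (vderiv (vderiv \<phi>))"
    using smooth_on_continuous s s1 s2 by blast+
qed

lemma vderiv_zero_outside:
  fixes f :: "real \<Rightarrow> complex"
  assumes "\<And>x. x \<notin> {a..b} \<Longrightarrow> f x = 0" "x \<notin> {a..b}"
  shows "vderiv f x = 0"
proof -
  have "open (- {a..b})" by (intro open_Compl) simp
  then have "(f has_vector_derivative 0) (at x)"
    by (rule has_vector_derivative_transform_within_open[where f = "\<lambda>_. 0", rotated]) (use assms in auto)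
  then show ?thesis by (rule vector_derivative_at)
qed

lemma test_function_lincomb:
  assumes "\<phi> \<in> test_functions" "\<psi> \<in> test_functions"
  shows "(\<lambda>x. \<phi> x - c * \<psi> x) \<in> test_functions"
proof -
  obtain a1 b1 where 1: "0 < a1" "\<And>x. x \<notin> {a1..b1} \<Longrightarrow> \<phi> x = 0" using test_function_support[OF assms(1)] by metis
  obtain a2 b2 where 2: "0 < a2" "\<And>x. x \<notin> {a2..b2} \<Longrightarrow> \<psi> x = 0" using test_function_support[OF assms(2)] by metis
  show ?thesis
  proof (rule test_functionI)
    show "smooth_on UNIV (\<lambda>x. \<phi> x - c * \<psi> x)"
      using assms by (intro smooth_on_lincomb) (auto simp: test_functions_def)
    show "0 < min a1 a2" using 1 2 by simp
    show "\<phi> x - c * \<psi> x = 0" if "x \<notin> {min a1 a2..max b1 b2}" for x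
    proof -
      have "x \<notin> {a1..b1}" "x \<notin> {a2..b2}" using that by auto
      then show ?thesis using 1 2 by simp
    qed
  qed
qed

lemma L2_continuous_compact:
  assumes "continuous_on {0<..} f" "0 < a" "\<And>r. r > 0 \<Longrightarrow> r \<notin> {a..b} \<Longrightarrow> f r = 0"
  shows "f \<in> L2 half_line"
  unfolding L2_def
proof (intro CollectI conjI)
  show "f \<in> borel_measurable half_line" by (rule continuous_measurable_half_line[OF assms(1)])
  show "integrable half_line (\<lambda>x. (cmod (f x))\<^sup>2)"
    by (rule half_line_compact_support[of _ a b]) (use assms in \<open>auto intro!: continuous_intros\<close>)
qed

text \<open>
  The expression \<open>- u'' + U u\<close>.
\<close>

definition sturm :: "(real \<Rightarrow> real) \<Rightarrow> (real \<Rightarrow> complex) \<Rightarrow> real \<Rightarrow> complex" where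
  "sturm U \<phi> r = - vderiv (vderiv \<phi>) r + of_real (U r) * \<phi> r"

lemma sturm_test_function:
  assumes U: "continuous_on {0<..} U" and \<phi>: "\<phi> \<in> test_functions"
  shows "continuous_on {0<..} (sturm U \<phi>)" "sturm U \<phi> \<in> L2 half_line" "\<phi> \<in> L2 half_line"
proof -
  obtain a b where ab: "0 < a" "a < b" "\<And>x. x \<notin> {a..b} \<Longrightarrow> \<phi> x = 0" using test_function_support[OF \<phi>] by blast
  show c: "continuous_on {0<..} (sturm U \<phi>)"
    unfolding sturm_def
    by (intro continuous_intros U) (auto intro: continuous_on_subset[OF test_function_derivs(5)[OF \<phi>]] continuous_on_subset[OF test_function_derivs(3)[OF \<phi>]])
  have z: "vderiv (vderiv \<phi>) x = 0" if "x \<notin> {a..b}" for x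
    by (rule vderiv_zero_outside[OF vderiv_zero_outside[OF ab(3)] that])
  show "sturm U \<phi> \<in> L2 half_line"
    by (rule L2_continuous_compact[OF c ab(1), of b]) (use ab(3) z in \<open>auto simp: sturm_def\<close>)
  show "\<phi> \<in> L2 half_line"
    by (rule L2_continuous_compact[OF continuous_on_subset[OF test_function_derivs(3)[OF \<phi>]] ab(1), of b]) (use ab(3) in auto)
qed

text \<open>
  Two integrations by parts. There are no boundary terms, since \<open>w\<close> has compact support in the open half line.
\<close>

lemma green_identity:
  assumes U: "continuous_on {0<..} U" and w: "w \<in> test_functions"
    and u: "\<And>r. r > 0 \<Longrightarrow> (u has_vector_derivative u' r) (at r)"
    and u': "\<And>r. r > 0 \<Longrightarrow> (u' has_vector_derivative u'' r) (at r)" and u'': "continuous_on {0<..} u''"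
  shows "L2_inner half_line (sturm U w) u = L2_inner half_line w (\<lambda>r. - u'' r + of_real (U r) * u r)"
proof -
  obtain a b where ab: "0 < a" "a < b" "\<And>x. x \<notin> {a..b} \<Longrightarrow> w x = 0" using test_function_support[OF w] by blast
  note d = test_function_derivs[OF w]
  have cu: "continuous_on {0<..} u" "continuous_on {0<..} u'"
    using u u' by (auto intro!: continuous_at_imp_continuous_on intro: has_vector_derivative_continuous)
  have cw: "continuous_on {0<..} w" "continuous_on {0<..} (vderiv w)" "continuous_on {0<..} (vderiv (vderiv w))"
    using d(3-5) by (auto intro: continuous_on_subset)
  have z1: "vderiv w x = 0" if "x \<notin> {a..b}" for x by (rule vderiv_zero_outside[OF ab(3) that])
  have z2: "vderiv (vderiv w) x = 0" if "x \<notin> {a..b}" for x by (rule vderiv_zero_outside[OF z1 that])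
  define F where "F = (\<lambda>r. cnj (w r) * u' r - cnj (vderiv w r) * u r)"
  define F' where "F' = (\<lambda>r. cnj (w r) * u'' r - cnj (vderiv (vderiv w) r) * u r)"
  have F: "(F has_vector_derivative F' r) (at r)" if "r > 0" for r
  proof -
    have "(F has_vector_derivative (cnj (w r) * u'' r + cnj (vderiv w r) * u' r) -
        (cnj (vderiv w r) * u' r + cnj (vderiv (vderiv w) r) * u r)) (at r)"
      unfolding F_def
      by (intro has_vector_derivative_diff has_vector_derivative_mult has_vector_derivative_cnj d u u' that)
    then show ?thesis by (simp add: F'_def)
  qed
  have F'c: "continuous_on {0<..} F'" unfolding F'_def by (intro continuous_intros cu cw u'')
  have int0: "(LINT r|half_line. F' r) = 0"
    by (rule half_line_integral_derivative(2)[OF F F'c ab(1,2)]) (use ab(3) z1 in \<open>auto simp: F_def\<close>)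
  have cs: "continuous_on {0<..} (sturm U w)" by (rule sturm_test_function[OF U w])
  have s0: "sturm U w x = 0" if "x \<notin> {a..b}" for x
    using z2[OF that] ab(3)[OF that] by (simp add: sturm_def)
  have i1: "integrable half_line (\<lambda>r. cnj (sturm U w r) * u r)"
    by (rule half_line_compact_support[OF _ ab(1), of _ b])
       (use s0 in \<open>auto intro!: continuous_intros cu cs\<close>)
  have i2: "integrable half_line (\<lambda>r. cnj (w r) * (- u'' r + of_real (U r) * u r))"
    by (rule half_line_compact_support[OF _ ab(1), of _ b])
       (use ab(3) in \<open>auto intro!: continuous_intros cu cw u'' U\<close>)
  have "L2_inner half_line (sturm U w) u - L2_inner half_line w (\<lambda>r. - u'' r + of_real (U r) * u r) =
    (LINT r|half_line. cnj (sturm U w r) * u r - cnj (w r) * (- u'' r + of_real (U r) * u r))"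
    unfolding L2_inner_def by (rule Bochner_Integration.integral_diff[OF i1 i2, symmetric])
  also have "\<dots> = (LINT r|half_line. F' r)"
    by (rule arg_cong[of _ _ "integral\<^sup>L half_line"]) (auto simp: F'_def sturm_def algebra_simps)
  finally show ?thesis using int0 by simp
qed

lemma half_line_integral_le_primitive:
  fixes f G :: "real \<Rightarrow> real"
  assumes "continuous_on {0<..} f" "0 < a" "a \<le> b" "\<And>r. r > 0 \<Longrightarrow> r \<notin> {a..b} \<Longrightarrow> f r = 0"
    and "\<And>r. r \<in> {a..b} \<Longrightarrow> (G has_real_derivative G' r) (at r)" "\<And>r. r \<in> {a..b} \<Longrightarrow> f r \<le> G' r"
  shows "(LINT r|half_line. f r) \<le> G b - G a"
proof -
  have "continuous_on {a..b} f" by (rule continuous_on_subset[OF assms(1)]) (use \<open>0 < a\<close> in auto)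
  then have 1: "(f has_integral (integral {a..b} f)) {a..b}"
    by (intro integrable_integral integrable_continuous_real)
  have 2: "(G' has_integral (G b - G a)) {a..b}"
    by (rule fundamental_theorem_of_calculus[OF assms(3)])
       (use assms(5) in \<open>auto simp: has_real_derivative_iff_has_vector_derivative intro: has_vector_derivative_at_within\<close>)
  have "integral {a..b} f \<le> G b - G a"
    by (rule has_integral_le[OF 1 2]) (use assms(6) in auto)
  then show ?thesis using half_line_compact_support(2)[OF assms(1,2,4)] by simp
qed

lemma half_line_bounded_support:
  fixes f :: "real \<Rightarrow> real"
  assumes m: "f \<in> borel_measurable half_line" and "c \<ge> 0" "b \<ge> 0"
    and bound: "\<And>r. 0 < r \<Longrightarrow> r \<le> b \<Longrightarrow> \<bar>f r\<bar> \<le> c" and zero: "\<And>r. r > b \<Longrightarrow> f r = 0"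
  shows "integrable half_line f" "(LINT r|half_line. f r) \<le> c * b"
proof -
  let ?g = "\<lambda>r. c * indicator {0<..b} r :: real"
  have e: "emeasure half_line {0<..b} = ennreal b"
  proof -
    have "emeasure half_line {0<..b} = emeasure lebesgue {0<..b}"
      by (rule emeasure_restrict_space) auto
    then show ?thesis using \<open>b \<ge> 0\<close> by simp
  qed
  have s: "{0<..b} \<in> sets half_line"
  proof -
    have "{0<..b} \<in> sets lebesgue" by simp
    then show ?thesis by (subst sets_restrict_space_iff) auto
  qed
  have gi: "integrable half_line ?g"
    using s e by (intro integrable_mult_right integrable_real_indicator) auto
  have le: "\<bar>f r\<bar> \<le> ?g r" if "r \<in> space half_line" for r
    using that bound[of r] zero[of r] by (cases "r \<le> b") (auto simp: space_restrict_space)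
  show i: "integrable half_line f"
    by (rule Bochner_Integration.integrable_bound[OF gi m])
       (use le in \<open>auto intro!: AE_I2 order_trans[OF _ abs_ge_self]\<close>)
  have "(LINT r|half_line. f r) \<le> (LINT r|half_line. ?g r)"
    by (rule integral_mono[OF i gi]) (use le abs_ge_self order_trans in blast)
  also have "\<dots> = c * measure half_line {0<..b}"
  proof -
    have "{0<..b} \<inter> {0<..} = {0<..b}" by auto
    then show ?thesis using s by (simp add: space_restrict_space)
  qed
  also have "measure half_line {0<..b} = b" using e \<open>b \<ge> 0\<close> by (simp add: measure_def)
  finally show "(LINT r|half_line. f r) \<le> c * b" .
qed

text \<open>
  The derivative is a parameter, which avoids differentiability side conditions when the two are estimated together.
\<close>

definition compact_C1 :: "(real \<Rightarrow> complex) \<Rightarrow> (real \<Rightarrow> complex) \<Rightarrow> bool" where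
  "compact_C1 g g' \<longleftrightarrow> (\<forall>r>0. (g has_vector_derivative g' r) (at r)) \<and> continuous_on {0<..} g' \<and>
     (\<exists>a b. 0 < a \<and> a < b \<and> (\<forall>r>0. r \<notin> {a..b} \<longrightarrow> g r = 0))"

lemma compact_C1_derivative_zero:
  assumes "\<And>r. r > 0 \<Longrightarrow> (g has_vector_derivative g' r) (at r)" "\<And>r. r > 0 \<Longrightarrow> r \<notin> {a..b} \<Longrightarrow> g r = (0::complex)"
    and "r > 0" "r \<notin> {a..b}"
  shows "g' r = 0"
proof -
  have "(g has_vector_derivative 0) (at r)"
    by (rule has_vector_derivative_transform_within_open[where f = "\<lambda>_. 0" and S = "{0<..} - {a..b}"])
       (use assms in \<open>auto intro: open_Diff\<close>)
  then show ?thesis using assms(1)[OF assms(3)] vector_derivative_unique_at by blast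
qed

lemma compact_C1_facts:
  assumes "compact_C1 g g'"
  shows "continuous_on {0<..} g" "continuous_on {0<..} g'"
    "\<exists>a b. 0 < a \<and> a < b \<and> (\<forall>r>0. r \<notin> {a..b} \<longrightarrow> g r = 0 \<and> g' r = 0)"
proof -
  have d: "\<And>r. r > 0 \<Longrightarrow> (g has_vector_derivative g' r) (at r)" using assms by (simp add: compact_C1_def)
  show "continuous_on {0<..} g" "continuous_on {0<..} g'"
    using assms d by (auto simp: compact_C1_def intro!: continuous_at_imp_continuous_on intro: has_vector_derivative_continuous)
  obtain a b where ab: "0 < a" "a < b" "\<And>r. r > 0 \<Longrightarrow> r \<notin> {a..b} \<Longrightarrow> g r = 0"
    using assms unfolding compact_C1_def by blast
  show "\<exists>a b. 0 < a \<and> a < b \<and> (\<forall>r>0. r \<notin> {a..b} \<longrightarrow> g r = 0 \<and> g' r = 0)"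
    using ab compact_C1_derivative_zero[OF d ab(3)] by blast
qed

lemma compact_C1_lincomb:
  assumes f: "compact_C1 f f'" and g: "compact_C1 g g'"
  shows "compact_C1 (\<lambda>r. f r - c * g r) (\<lambda>r. f' r - c * g' r)"
  unfolding compact_C1_def
proof (intro conjI allI impI)
  fix r :: real assume "r > 0"
  then show "((\<lambda>r. f r - c * g r) has_vector_derivative f' r - c * g' r) (at r)"
    using assms unfolding compact_C1_def by (intro has_vector_derivative_diff has_vector_derivative_mult_right) auto
next
  show "continuous_on {0<..} (\<lambda>r. f' r - c * g' r)"
    by (intro continuous_intros compact_C1_facts[OF f] compact_C1_facts[OF g])
  obtain a1 b1 where 1: "0 < a1" "a1 < b1" "\<forall>r>0. r \<notin> {a1..b1} \<longrightarrow> f r = 0" using f unfolding compact_C1_def by blast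
  obtain a2 b2 where 2: "0 < a2" "a2 < b2" "\<forall>r>0. r \<notin> {a2..b2} \<longrightarrow> g r = 0" using g unfolding compact_C1_def by blast
  show "\<exists>a b. 0 < a \<and> a < b \<and> (\<forall>r>0. r \<notin> {a..b} \<longrightarrow> f r - c * g r = 0)"
  proof (rule exI[of _ "min a1 a2"], rule exI[of _ "max b1 b2"], intro conjI allI impI)
    fix r :: real assume "r > 0" "r \<notin> {min a1 a2..max b1 b2}"
    then have "r \<notin> {a1..b1}" "r \<notin> {a2..b2}" by auto
    then show "f r - c * g r = 0" using 1 2 \<open>r > 0\<close> by simp
  qed (use 1 2 in auto)
qed

lemma compact_C1_test_function:
  assumes "\<phi> \<in> test_functions"
  shows "compact_C1 \<phi> (vderiv \<phi>)"
proof -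
  obtain a b where "0 < a" "a < b" "\<And>x. x \<notin> {a..b} \<Longrightarrow> \<phi> x = 0" using test_function_support[OF assms] by blast
  then show ?thesis
    unfolding compact_C1_def using test_function_derivs(1,4)[OF assms] by (blast intro: continuous_on_subset)
qed

text \<open>
  The function \<open>h\<close> is the logarithmic derivative of a positive supersolution: if \<open>h = \<phi>'/\<phi>\<close>, then the
  Riccati inequality says \<open>\<phi>'' \<le> (U + K) \<phi>\<close>. It provides the lower bound of the operator even where the
  Hardy inequality is critical.
\<close>

locale radial_operator =
  fixes U h h' :: "real \<Rightarrow> real" and K :: real
  assumes U: "continuous_on {0<..} U"
    and h: "r > 0 \<Longrightarrow> (h has_real_derivative h' r) (at r)" and h': "continuous_on {0<..} h'"
    and riccati: "r > 0 \<Longrightarrow> h' r + (h r)\<^sup>2 \<le> U r + K" and K: "K \<ge> 0"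
begin

definition energy :: "(real \<Rightarrow> complex) \<Rightarrow> (real \<Rightarrow> complex) \<Rightarrow> real" where
  "energy g g' = (LINT r|half_line. (cmod (g' r))\<^sup>2 + (U r + K) * (cmod (g r))\<^sup>2)"

lemma energy_integrable:
  assumes "compact_C1 g g'"
  shows "integrable half_line (\<lambda>r. (cmod (g' r))\<^sup>2 + (U r + K) * (cmod (g r))\<^sup>2)"
proof -
  obtain a b where ab: "0 < a" "a < b" "\<forall>r>0. r \<notin> {a..b} \<longrightarrow> g r = 0 \<and> g' r = 0"
    using compact_C1_facts(3)[OF assms] by blast
  show ?thesis
    by (rule half_line_compact_support(1)[of _ a b])
       (use ab in \<open>auto intro!: continuous_intros U compact_C1_facts[OF assms]\<close>)
qed

text \<open>
  Jacobi's factorization: \<open>\<bar>g' - h g\<bar>\<^sup>2 \<ge> 0\<close> integrates to the claim, as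
  \<open>2 h Re (cnj g g') = (h \<bar>g\<bar>\<^sup>2)' - h' \<bar>g\<bar>\<^sup>2\<close>.
\<close>

lemma energy_nonneg:
  assumes g: "compact_C1 g g'"
  shows "energy g g' \<ge> 0"
proof -
  obtain a b where ab: "0 < a" "a < b" "\<forall>r>0. r \<notin> {a..b} \<longrightarrow> g r = 0 \<and> g' r = 0"
    using compact_C1_facts(3)[OF g] by blast
  note gc = compact_C1_facts(1,2)[OF g]
  have hc: "continuous_on {0<..} h"
    using h by (auto intro!: continuous_at_imp_continuous_on intro: DERIV_isCont)
  define F where "F = (\<lambda>r. h r * (cmod (g r))\<^sup>2)"
  define F' where "F' = (\<lambda>r. h' r * (cmod (g r))\<^sup>2 + 2 * Re (cnj (g r) * g' r) * h r)"
  have F: "(F has_vector_derivative F' r) (at r)" if "r > 0" for r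
    unfolding F_def F'_def has_real_derivative_iff_has_vector_derivative[symmetric]
    using g that unfolding compact_C1_def by (intro DERIV_mult h has_real_derivative_cmod_power2) auto
  have F'c: "continuous_on {0<..} F'"
    unfolding F'_def by (intro continuous_intros h' hc gc)
  have F0: "F r = 0" if "r > 0" "r \<notin> {a..b}" for r using ab that by (simp add: F_def)
  note I = half_line_integral_derivative[OF F F'c ab(1,2) F0]
  have "(LINT r|half_line. F' r) \<le> energy g g'"
    unfolding energy_def
  proof (rule integral_mono[OF I(1) energy_integrable[OF g]])
    fix r assume "r \<in> space half_line"
    then have r: "r > 0" by (simp add: space_restrict_space)
    have "0 \<le> (cmod (g' r - of_real (h r) * g r))\<^sup>2" by simp
    also have "(cmod (g' r - of_real (h r) * g r))\<^sup>2 = (cmod (g' r))\<^sup>2 - 2 * Re (cnj (g r) * g' r) * h r + (h r)\<^sup>2 * (cmod (g r))\<^sup>2"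
      unfolding cmod_power2 by (simp add: power2_eq_square algebra_simps)
    finally have "F' r \<le> (cmod (g' r))\<^sup>2 + (h' r + (h r)\<^sup>2) * (cmod (g r))\<^sup>2"
      unfolding F'_def by (simp add: algebra_simps)
    also have "\<dots> \<le> (cmod (g' r))\<^sup>2 + (U r + K) * (cmod (g r))\<^sup>2"
      using riccati[OF r] by (intro add_left_mono mult_right_mono) auto
    finally show "F' r \<le> (cmod (g' r))\<^sup>2 + (U r + K) * (cmod (g r))\<^sup>2" .
  qed
  then show ?thesis using I(2) by simp
qed

lemma energy_diff_le:
  assumes f: "compact_C1 f f'" and g: "compact_C1 g g'"
  shows "energy (\<lambda>r. f r - g r) (\<lambda>r. f' r - g' r) \<le> 2 * energy f f' + 2 * energy g g'"
proof -
  have m: "compact_C1 (\<lambda>r. f r - g r) (\<lambda>r. f' r - g' r)" using compact_C1_lincomb[OF f g, of 1] by simp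
  have p: "compact_C1 (\<lambda>r. f r + g r) (\<lambda>r. f' r + g' r)" using compact_C1_lincomb[OF f g, of "-1"] by simp
  have par: "(cmod (x - y))\<^sup>2 + (cmod (x + y))\<^sup>2 = 2 * (cmod x)\<^sup>2 + 2 * (cmod y)\<^sup>2" for x y
    unfolding cmod_power2 by (simp add: power2_eq_square algebra_simps)
  have "energy (\<lambda>r. f r - g r) (\<lambda>r. f' r - g' r) + energy (\<lambda>r. f r + g r) (\<lambda>r. f' r + g' r)
    = (LINT r|half_line. ((cmod (f' r - g' r))\<^sup>2 + (U r + K) * (cmod (f r - g r))\<^sup>2) + ((cmod (f' r + g' r))\<^sup>2 + (U r + K) * (cmod (f r + g r))\<^sup>2))"
    unfolding energy_def by (rule Bochner_Integration.integral_add[OF energy_integrable[OF m] energy_integrable[OF p], symmetric])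
  also have "\<dots> = (LINT r|half_line. 2 * ((cmod (f' r))\<^sup>2 + (U r + K) * (cmod (f r))\<^sup>2) + 2 * ((cmod (g' r))\<^sup>2 + (U r + K) * (cmod (g r))\<^sup>2))"
  proof (rule arg_cong[of _ _ "integral\<^sup>L half_line"], rule ext)
    fix r
    have "((cmod (f' r - g' r))\<^sup>2 + (U r + K) * (cmod (f r - g r))\<^sup>2) + ((cmod (f' r + g' r))\<^sup>2 + (U r + K) * (cmod (f r + g r))\<^sup>2)
      = ((cmod (f' r - g' r))\<^sup>2 + (cmod (f' r + g' r))\<^sup>2) + (U r + K) * ((cmod (f r - g r))\<^sup>2 + (cmod (f r + g r))\<^sup>2)"
      by (simp add: algebra_simps)
    then show "((cmod (f' r - g' r))\<^sup>2 + (U r + K) * (cmod (f r - g r))\<^sup>2) + ((cmod (f' r + g' r))\<^sup>2 + (U r + K) * (cmod (f r + g r))\<^sup>2)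
      = 2 * ((cmod (f' r))\<^sup>2 + (U r + K) * (cmod (f r))\<^sup>2) + 2 * ((cmod (g' r))\<^sup>2 + (U r + K) * (cmod (g r))\<^sup>2)"
      unfolding par by (simp add: algebra_simps)
  qed
  also have "\<dots> = 2 * energy f f' + 2 * energy g g'"
    unfolding energy_def
    using Bochner_Integration.integral_add[OF integrable_mult_right[OF energy_integrable[OF f], of 2]
        integrable_mult_right[OF energy_integrable[OF g], of 2]]
    by (simp only: integral_mult_right_zero)
  finally show ?thesis using energy_nonneg[OF p] by simp
qed

lemma energy_test_function:
  assumes \<phi>: "\<phi> \<in> test_functions"
  shows "L2_inner half_line \<phi> (sturm U \<phi>) = of_real (energy \<phi> (vderiv \<phi>) - K * (L2_norm half_line \<phi>)\<^sup>2)"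
proof -
  note g = compact_C1_test_function[OF \<phi>]
  obtain a b where ab: "0 < a" "a < b" "\<forall>r>0. r \<notin> {a..b} \<longrightarrow> \<phi> r = 0 \<and> vderiv \<phi> r = 0"
    using compact_C1_facts(3)[OF g] by blast
  note d = test_function_derivs[OF \<phi>]
  have cw: "continuous_on {0<..} \<phi>" "continuous_on {0<..} (vderiv \<phi>)" "continuous_on {0<..} (vderiv (vderiv \<phi>))"
    using d(3-5) by (auto intro: continuous_on_subset)
  define F where "F = (\<lambda>r. cnj (\<phi> r) * vderiv \<phi> r)"
  define F' where "F' = (\<lambda>r. cnj (\<phi> r) * vderiv (vderiv \<phi>) r + cnj (vderiv \<phi> r) * vderiv \<phi> r)"
  have F: "(F has_vector_derivative F' r) (at r)" for r
    unfolding F_def F'_def by (intro has_vector_derivative_mult has_vector_derivative_cnj d)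
  have F'c: "continuous_on {0<..} F'" unfolding F'_def by (intro continuous_intros cw)
  have F0: "F r = 0" if "r > 0" "r \<notin> {a..b}" for r using ab that by (simp add: F_def)
  note I = half_line_integral_derivative[OF F F'c ab(1,2) F0]
  have L: "integrable half_line (\<lambda>r. (cmod (\<phi> r))\<^sup>2)" using sturm_test_function(3)[OF U \<phi>] by (simp add: L2_def)
  have "L2_inner half_line \<phi> (sturm U \<phi>) =
    (LINT r|half_line. of_real (((cmod (vderiv \<phi> r))\<^sup>2 + (U r + K) * (cmod (\<phi> r))\<^sup>2) - K * (cmod (\<phi> r))\<^sup>2) - F' r)"
    unfolding L2_inner_def
  proof (rule arg_cong[of _ _ "integral\<^sup>L half_line"], rule ext)
    fix r
    have "of_real (((cmod (vderiv \<phi> r))\<^sup>2 + (U r + K) * (cmod (\<phi> r))\<^sup>2) - K * (cmod (\<phi> r))\<^sup>2)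
      = of_real ((cmod (vderiv \<phi> r))\<^sup>2) + of_real (U r) * of_real ((cmod (\<phi> r))\<^sup>2)"
      by (simp add: algebra_simps)
    also have "\<dots> = vderiv \<phi> r * cnj (vderiv \<phi> r) + of_real (U r) * (\<phi> r * cnj (\<phi> r))"
      by (simp only: complex_norm_square)
    finally show "cnj (\<phi> r) * sturm U \<phi> r =
      of_real (((cmod (vderiv \<phi> r))\<^sup>2 + (U r + K) * (cmod (\<phi> r))\<^sup>2) - K * (cmod (\<phi> r))\<^sup>2) - F' r"
      by (simp only: F'_def sturm_def) (simp add: algebra_simps)
  qed
  also have "\<dots> = (LINT r|half_line. complex_of_real (((cmod (vderiv \<phi> r))\<^sup>2 + (U r + K) * (cmod (\<phi> r))\<^sup>2) - K * (cmod (\<phi> r))\<^sup>2)) - (LINT r|half_line. F' r)"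
    by (intro Bochner_Integration.integral_diff I(1) integrable_of_real Bochner_Integration.integrable_diff energy_integrable[OF g] integrable_mult_right L)
  also have "(LINT r|half_line. complex_of_real (((cmod (vderiv \<phi> r))\<^sup>2 + (U r + K) * (cmod (\<phi> r))\<^sup>2) - K * (cmod (\<phi> r))\<^sup>2))
    = of_real (energy \<phi> (vderiv \<phi>) - (LINT r|half_line. K * (cmod (\<phi> r))\<^sup>2))"
    unfolding integral_complex_of_real energy_def
    by (subst Bochner_Integration.integral_diff[OF energy_integrable[OF g] integrable_mult_right[OF L]]) (rule refl)
  also have "(LINT r|half_line. K * (cmod (\<phi> r))\<^sup>2) = K * (L2_norm half_line \<phi>)\<^sup>2"
    by (simp add: L2_norm_def)
  finally show ?thesis using I(2) by simp
qed

sublocale semibounded_operator half_line test_functions "sturm U" K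
proof
  fix \<phi> \<psi> :: "real \<Rightarrow> complex" and c x
  assume \<phi>: "\<phi> \<in> test_functions"
  show "\<phi> \<in> L2 half_line" "sturm U \<phi> \<in> L2 half_line" by (rule sturm_test_function[OF U \<phi>])+
  show "- K * (L2_norm half_line \<phi>)\<^sup>2 \<le> Re (L2_inner half_line \<phi> (sturm U \<phi>))"
    unfolding energy_test_function[OF \<phi>] Re_complex_of_real
    using energy_nonneg[OF compact_C1_test_function[OF \<phi>]] by simp
  assume \<psi>: "\<psi> \<in> test_functions"
  show "(\<lambda>x. \<phi> x - c * \<psi> x) \<in> test_functions" by (rule test_function_lincomb[OF \<phi> \<psi>])
  have "L2_inner half_line (sturm U \<phi>) \<psi> = L2_inner half_line \<phi> (\<lambda>r. - vderiv (vderiv \<psi>) r + of_real (U r) * \<psi> r)"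
    by (rule green_identity[OF U \<phi> test_function_derivs(1)[OF \<psi>] test_function_derivs(2)[OF \<psi>]])
       (rule continuous_on_subset[OF test_function_derivs(5)[OF \<psi>]], simp)
  then show "L2_inner half_line \<phi> (sturm U \<psi>) = L2_inner half_line (sturm U \<phi>) \<psi>"
    unfolding sturm_def by simp
  assume x: "x \<in> space half_line"
  have "vderiv (\<lambda>x. \<phi> x - c * \<psi> x) = (\<lambda>r. vderiv \<phi> r - c * vderiv \<psi> r)"
    using test_function_derivs(1)[OF \<phi>] test_function_derivs(1)[OF \<psi>]
    by (intro ext vector_derivative_at has_vector_derivative_diff has_vector_derivative_mult_right)
  moreover have "vderiv (\<lambda>r. vderiv \<phi> r - c * vderiv \<psi> r) x = vderiv (vderiv \<phi>) x - c * vderiv (vderiv \<psi>) x"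
    using test_function_derivs(2)[OF \<phi>] test_function_derivs(2)[OF \<psi>]
    by (intro vector_derivative_at has_vector_derivative_diff has_vector_derivative_mult_right)
  ultimately show "sturm U (\<lambda>x. \<phi> x - c * \<psi> x) x = sturm U \<phi> x - c * sturm U \<psi> x"
    unfolding sturm_def by (simp add: algebra_simps)
qed (rule K)

end

section \<open>Logarithmic cutoffs and the domain near the origin\<close>

locale radial_operator_cutoff = radial_operator +
  fixes chi :: "real \<Rightarrow> real"
  assumes chi_smooth: "smooth_on {0<..} chi" and chi_0: "0 < r \<Longrightarrow> r \<le> 1 \<Longrightarrow> chi r = 0" and chi_1: "r \<ge> 2 \<Longrightarrow> chi r = 1"
    and chi_le: "r > 0 \<Longrightarrow> \<bar>chi r\<bar> \<le> 1"
begin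

lemma test_function_energy_approximation:
  fixes w w' :: "real \<Rightarrow> real"
  assumes w: "\<And>r. r > 0 \<Longrightarrow> (w has_real_derivative w' r) (at r)" and w': "continuous_on {0<..} w'"
    and ab: "0 < a" "a < b" and supp: "\<And>r. r > 0 \<Longrightarrow> r \<notin> {a..b} \<Longrightarrow> w r = 0" and "e > 0"
  obtains \<phi> where "\<phi> \<in> test_functions" "\<And>r. r > 0 \<Longrightarrow> r \<notin> {a / 2..2 * b} \<Longrightarrow> \<phi> r = 0"
    "energy (\<lambda>r. \<phi> r - of_real (w r)) (\<lambda>r. vderiv \<phi> r - of_real (w' r)) \<le> e"
    "(L2_norm half_line (\<lambda>r. \<phi> r - of_real (w r)))\<^sup>2 \<le> e"
proof -
  have "continuous_on {a / 2..2 * b} (\<lambda>r. U r + K)"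
    by (intro continuous_intros continuous_on_subset[OF U]) (use ab in auto)
  from compact_imp_bounded[OF compact_continuous_image[OF this compact_Icc]]
  obtain T where T: "\<forall>r\<in>{a / 2..2 * b}. \<bar>U r + K\<bar> \<le> T" unfolding bounded_iff by auto
  have T0: "T \<ge> 0" using T[rule_format, of a] ab by (simp add: order_trans[OF abs_ge_zero])
  (* a pointwise error delta costs at most (1 + T) delta^2 per unit length in the energy, on an interval of length at most 2 b *)
  define \<delta> where "\<delta> = sqrt (e / ((1 + T) * (2 * b)))"
  have pos: "(1 + T) * (2 * b) > 0" using T0 ab by simp
  have \<delta>: "\<delta> > 0" "\<delta>\<^sup>2 = e / ((1 + T) * (2 * b))" using pos \<open>e > 0\<close> by (simp_all add: \<delta>_def)
  have \<delta>e: "\<delta>\<^sup>2 * ((1 + T) * (2 * b)) = e"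
    using \<delta>(2) pos by (intro nonzero_eq_divide_eq[THEN iffD1]) auto
  obtain f where f: "smooth_on UNIV f" "\<And>r. r \<notin> {a / 2..2 * b} \<Longrightarrow> f r = 0"
    "\<And>r. r > 0 \<Longrightarrow> \<bar>f r - w r\<bar> \<le> \<delta>" "\<And>r. r > 0 \<Longrightarrow> \<bar>deriv f r - w' r\<bar> \<le> \<delta>"
    using test_function_C1_approximation[OF chi_smooth chi_0 chi_1 ab w w' supp \<delta>(1)] by metis
  define \<phi> where "\<phi> = (\<lambda>r. complex_of_real (f r))"
  have \<phi>: "\<phi> \<in> test_functions"
    by (rule test_functionI[of _ "a / 2" "2 * b"])
       (use ab f(2) in \<open>auto simp: \<phi>_def intro!: smooth_on_of_real f(1)\<close>)
  have df: "vderiv \<phi> r = of_real (deriv f r)" for r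
  proof -
    have "(f has_real_derivative vderiv f r) (at r)"
      using smooth_on_has_derivative[OF f(1) UNIV_I] by (simp add: has_real_derivative_iff_has_vector_derivative)
    then have "(f has_real_derivative deriv f r) (at r)" using DERIV_imp_deriv by metis
    then show ?thesis unfolding \<phi>_def by (intro vector_derivative_at has_vector_derivative_of_real)
  qed
  have a2: "0 < a / 2" "a / 2 \<le> 2 * b" using ab by auto
  have cw: "continuous_on {0<..} w" using w by (auto intro!: continuous_at_imp_continuous_on intro: DERIV_isCont)
  have C1w: "compact_C1 (\<lambda>r. of_real (w r)) (\<lambda>r. of_real (w' r))"
    unfolding compact_C1_def using w w' ab supp
    by (intro conjI exI[of _ a] exI[of _ b]) (auto intro!: has_vector_derivative_of_real continuous_intros)
  have C1: "compact_C1 (\<lambda>r. \<phi> r - of_real (w r)) (\<lambda>r. vderiv \<phi> r - of_real (w' r))"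
    using compact_C1_lincomb[OF compact_C1_test_function[OF \<phi>] C1w, of 1] by simp
  note C = compact_C1_facts(1,2)[OF C1]
  have zero: "\<phi> r - of_real (w r) = 0" "vderiv \<phi> r - of_real (w' r) = 0" if r: "r > 0" "r \<notin> {a / 2..2 * b}" for r
  proof -
    have z: "\<phi> r - of_real (w r) = 0" if "r > 0" "r \<notin> {a / 2..2 * b}" for r
      using f(2)[OF that(2)] supp[of r] that ab by (auto simp: \<phi>_def)
    show "\<phi> r - of_real (w r) = 0" by (rule z[OF r])
    show "vderiv \<phi> r - of_real (w' r) = 0"
      by (rule compact_C1_derivative_zero[where g = "\<lambda>r. \<phi> r - of_real (w r)", OF _ z r])
         (use C1 in \<open>auto simp: compact_C1_def\<close>)
  qed
  have small: "(cmod (\<phi> r - of_real (w r)))\<^sup>2 \<le> \<delta>\<^sup>2" "(cmod (vderiv \<phi> r - of_real (w' r)))\<^sup>2 \<le> \<delta>\<^sup>2" if "r > 0" for r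
  proof -
    have "cmod (\<phi> r - of_real (w r)) = \<bar>f r - w r\<bar>" unfolding \<phi>_def of_real_diff[symmetric] norm_of_real ..
    then show "(cmod (\<phi> r - of_real (w r)))\<^sup>2 \<le> \<delta>\<^sup>2" using f(3)[OF that] by (intro power_mono) auto
    have "cmod (vderiv \<phi> r - of_real (w' r)) = \<bar>deriv f r - w' r\<bar>" unfolding df of_real_diff[symmetric] norm_of_real ..
    then show "(cmod (vderiv \<phi> r - of_real (w' r)))\<^sup>2 \<le> \<delta>\<^sup>2" using f(4)[OF that] by (intro power_mono) auto
  qed
  have "energy (\<lambda>r. \<phi> r - of_real (w r)) (\<lambda>r. vderiv \<phi> r - of_real (w' r)) \<le> \<delta>\<^sup>2 * (1 + T) * (2 * b) - \<delta>\<^sup>2 * (1 + T) * (a / 2)"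
    unfolding energy_def
  proof (rule half_line_integral_le_primitive[OF _ a2, where G' = "\<lambda>_. \<delta>\<^sup>2 * (1 + T)"])
    fix r assume r: "r \<in> {a / 2..2 * b}"
    then have "r > 0" using ab by auto
    have "(U r + K) * (cmod (\<phi> r - of_real (w r)))\<^sup>2 \<le> T * \<delta>\<^sup>2"
    proof -
      have "(U r + K) * (cmod (\<phi> r - of_real (w r)))\<^sup>2 \<le> \<bar>U r + K\<bar> * (cmod (\<phi> r - of_real (w r)))\<^sup>2"
        by (intro mult_right_mono) auto
      also have "\<dots> \<le> T * \<delta>\<^sup>2" using T r small(1)[OF \<open>r > 0\<close>] T0 by (intro mult_mono) auto
      finally show ?thesis .
    qed
    then show "(cmod (vderiv \<phi> r - of_real (w' r)))\<^sup>2 + (U r + K) * (cmod (\<phi> r - of_real (w r)))\<^sup>2 \<le> \<delta>\<^sup>2 * (1 + T)"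
      using small(2)[OF \<open>r > 0\<close>] by (simp add: algebra_simps)
  qed (use zero in \<open>auto intro!: continuous_intros U C derivative_eq_intros\<close>)
  also have "\<dots> \<le> e" using \<delta>e T0 ab by (simp add: algebra_simps)
  finally have 1: "energy (\<lambda>r. \<phi> r - of_real (w r)) (\<lambda>r. vderiv \<phi> r - of_real (w' r)) \<le> e" .
  have "(L2_norm half_line (\<lambda>r. \<phi> r - of_real (w r)))\<^sup>2 = (LINT r|half_line. (cmod (\<phi> r - of_real (w r)))\<^sup>2)"
    unfolding L2_norm_def by simp
  also have "\<dots> \<le> \<delta>\<^sup>2 * (2 * b) - \<delta>\<^sup>2 * (a / 2)"
    by (rule half_line_integral_le_primitive[OF _ a2, where G' = "\<lambda>_. \<delta>\<^sup>2"])
       (use zero small a2 in \<open>auto intro!: continuous_intros C derivative_eq_intros\<close>)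
  also have "\<dots> \<le> \<delta>\<^sup>2 * (2 * b)" using ab by simp
  also have "\<dots> \<le> \<delta>\<^sup>2 * ((1 + T) * (2 * b))" using T0 ab by (intro mult_left_mono) (auto simp: algebra_simps)
  finally have 2: "(L2_norm half_line (\<lambda>r. \<phi> r - of_real (w r)))\<^sup>2 \<le> e" unfolding \<delta>e .
  show ?thesis
    by (rule that[OF \<phi> _ 1 2]) (use f(2) in \<open>simp add: \<phi>_def\<close>)
qed

text \<open>
  Equal to 0 for \<open>r \<le> exp(- 2n)\<close> and to 1 for \<open>r \<ge> exp(- n)\<close>. The transition is linear in \<open>ln r\<close>, which makes the
  gradient energy of a function of size \<open>sqrt r\<close> of order \<open>1/n\<close>. A cutoff in \<open>r\<close> itself would leave an energy
  of order one, because \<open>sqrt r\<close> is the borderline behaviour when the angular momentum vanishes.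
\<close>

definition log_cutoff :: "nat \<Rightarrow> real \<Rightarrow> real" where
  "log_cutoff n r = chi (exp (ln r / real n + 2))"

definition log_cutoff' :: "nat \<Rightarrow> real \<Rightarrow> real" where
  "log_cutoff' n r = vderiv chi (exp (ln r / real n + 2)) * (exp (ln r / real n + 2) / (real n * r))"

lemma log_cutoff_deriv:
  assumes "n > 0" "r > 0"
  shows "(log_cutoff n has_real_derivative log_cutoff' n r) (at r)"
proof -
  have 1: "((\<lambda>r. exp (ln r / real n + 2)) has_real_derivative exp (ln r / real n + 2) / (real n * r)) (at r)"
    using assms by (auto intro!: derivative_eq_intros simp: field_simps)
  have "(chi has_real_derivative vderiv chi (exp (ln r / real n + 2))) (at (exp (ln r / real n + 2)))"
    using smooth_on_has_derivative[OF chi_smooth, of "exp (ln r / real n + 2)"]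
    by (simp add: has_real_derivative_iff_has_vector_derivative)
  from DERIV_chain2[OF this 1] show ?thesis unfolding log_cutoff_def[abs_def] log_cutoff'_def .
qed

lemma log_cutoff_continuous:
  assumes "n > 0"
  shows "continuous_on {0<..} (log_cutoff n)" "continuous_on {0<..} (log_cutoff' n)"
proof -
  show "continuous_on {0<..} (log_cutoff n)"
    using log_cutoff_deriv[OF assms] by (auto intro!: continuous_at_imp_continuous_on intro: DERIV_isCont)
  have c: "continuous_on {0<..} (\<lambda>r. exp (ln r / real n + 2))"
    using assms by (intro continuous_intros) auto
  have "continuous_on {0<..} (\<lambda>r. vderiv chi (exp (ln r / real n + 2)))"
    by (rule continuous_on_compose2[OF smooth_on_continuous[OF smooth_on_vderiv[OF chi_smooth]] c]) auto
  then show "continuous_on {0<..} (log_cutoff' n)"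
    unfolding log_cutoff'_def using assms by (intro continuous_intros) auto
qed

lemma log_cutoff_values:
  assumes "n > 0" "r > 0"
  shows "r \<le> exp (- 2 * real n) \<Longrightarrow> log_cutoff n r = 0" "r \<ge> exp (- real n) \<Longrightarrow> log_cutoff n r = 1" "\<bar>log_cutoff n r\<bar> \<le> 1"
proof -
  have n: "real n > 0" using assms by simp
  show "log_cutoff n r = 0" if "r \<le> exp (- 2 * real n)"
  proof -
    have "ln r \<le> ln (exp (- 2 * real n))" using that assms by (subst ln_le_cancel_iff) auto
    then have "ln r \<le> - 2 * real n" by simp
    then have "ln r / real n + 2 \<le> 0" using n by (simp add: field_simps)
    then show ?thesis unfolding log_cutoff_def by (intro chi_0) auto
  qed
  show "log_cutoff n r = 1" if "r \<ge> exp (- real n)"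
  proof -
    have "ln r \<ge> - real n" using that assms by (simp add: ln_ge_iff)
    then have "ln r / real n + 2 \<ge> 1" using n by (simp add: field_simps)
    then have "exp 1 \<le> exp (ln r / real n + 2)" by simp
    moreover have "2 \<le> exp (1::real)" using exp_ge_add_one_self[of 1] by simp
    ultimately show ?thesis unfolding log_cutoff_def by (intro chi_1) linarith
  qed
  show "\<bar>log_cutoff n r\<bar> \<le> 1" unfolding log_cutoff_def by (rule chi_le) simp
qed

lemma log_cutoff_derivative_bound:
  obtains L where "L \<ge> 0" "\<And>n r. n > 0 \<Longrightarrow> r > 0 \<Longrightarrow> \<bar>log_cutoff' n r\<bar> \<le> L / (real n * r)"
proof -
  have "continuous_on {1..2} (\<lambda>x. vderiv chi x * x)"
    by (intro continuous_intros continuous_on_subset[OF smooth_on_continuous[OF smooth_on_vderiv[OF chi_smooth]]]) auto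
  from compact_imp_bounded[OF compact_continuous_image[OF this compact_Icc]]
  obtain L where L: "\<forall>x\<in>{1..2}. \<bar>vderiv chi x * x\<bar> \<le> L" unfolding bounded_iff by auto
  have L0: "L \<ge> 0" using L[rule_format, of 1] by (simp add: order_trans[OF abs_ge_zero])
  have all: "\<bar>vderiv chi x * x\<bar> \<le> L" if "x > 0" for x
  proof -
    consider "x < 1" | "x \<in> {1..2}" | "x > 2" by fastforce
    then show ?thesis
    proof cases
      case 1
      have "(chi has_vector_derivative 0) (at x)"
        by (rule has_vector_derivative_transform_within_open[where f = "\<lambda>_. 0" and S = "{0<..<1}"])
           (use 1 that chi_0 in auto)
      then show ?thesis using L0 by (simp add: vector_derivative_at)
    next
      case 2
      then show ?thesis using L by blast
    next
      case 3
      have "(chi has_vector_derivative 0) (at x)"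
        by (rule has_vector_derivative_transform_within_open[where f = "\<lambda>_. 1" and S = "{2<..}"])
           (use 3 chi_1 in auto)
      then show ?thesis using L0 by (simp add: vector_derivative_at)
    qed
  qed
  have "\<bar>log_cutoff' n r\<bar> \<le> L / (real n * r)" if "n > 0" "r > 0" for n r
  proof -
    define x where "x = exp (ln r / real n + 2)"
    have "\<bar>log_cutoff' n r\<bar> = \<bar>vderiv chi x * x\<bar> / (real n * r)"
      using that by (simp add: log_cutoff'_def x_def abs_mult)
    also have "\<dots> \<le> L / (real n * r)"
      using all[of x] that by (intro divide_right_mono) (auto simp: x_def)
    finally show ?thesis .
  qed
  then show ?thesis using that L0 by blast
qed

end

context radial_operator_cutoff
begin

text \<open>
  The localization formula. Integration by parts moves the derivative of \<open>Y\<close> onto the equation for \<open>Y\<close>,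
  and only the gradient of the cutoff \<open>\<eta>\<close> is left.
\<close>

lemma energy_of_cutoff_product:
  fixes Y Y' Y'' \<eta> \<eta>' :: "real \<Rightarrow> real"
  assumes Y: "\<And>r. r > 0 \<Longrightarrow> (Y has_real_derivative Y' r) (at r)" "\<And>r. r > 0 \<Longrightarrow> (Y' has_real_derivative Y'' r) (at r)"
    and Y'': "continuous_on {0<..} Y''"
    and \<eta>: "\<And>r. r > 0 \<Longrightarrow> (\<eta> has_real_derivative \<eta>' r) (at r)" and \<eta>': "continuous_on {0<..} \<eta>'"
    and ab: "0 < a" "a < b" and supp: "\<And>r. r > 0 \<Longrightarrow> r \<notin> {a..b} \<Longrightarrow> \<eta> r = 0"
  shows "energy (\<lambda>r. of_real (\<eta> r * Y r)) (\<lambda>r. of_real (\<eta>' r * Y r + \<eta> r * Y' r)) =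
    (LINT r|half_line. (\<eta>' r)\<^sup>2 * (Y r)\<^sup>2 + (\<eta> r)\<^sup>2 * (Y r * (- Y'' r + U r * Y r + K * Y r)))"
proof -
  have c: "continuous_on {0<..} Y" "continuous_on {0<..} Y'" "continuous_on {0<..} \<eta>"
    using Y \<eta> by (auto intro!: continuous_at_imp_continuous_on intro: DERIV_isCont)
  define F where "F = (\<lambda>r. (\<eta> r)\<^sup>2 * (Y r * Y' r))"
  define F' where "F' = (\<lambda>r. 2 * \<eta> r * \<eta>' r * (Y r * Y' r) + (\<eta> r)\<^sup>2 * ((Y' r)\<^sup>2 + Y r * Y'' r))"
  have F: "(F has_vector_derivative F' r) (at r)" if "r > 0" for r
    unfolding F_def F'_def has_real_derivative_iff_has_vector_derivative[symmetric]
    by (auto intro!: derivative_eq_intros Y \<eta> that simp: algebra_simps power2_eq_square)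
  have F'c: "continuous_on {0<..} F'" unfolding F'_def by (intro continuous_intros c Y'' \<eta>')
  have F0: "F r = 0" if "r > 0" "r \<notin> {a..b}" for r using supp[OF that] by (simp add: F_def)
  note I = half_line_integral_derivative[OF F F'c ab F0]
  have \<eta>'0: "\<eta>' r = 0" if r: "r > 0" "r \<notin> {a..b}" for r
  proof -
    have "(\<eta> has_vector_derivative 0) (at r)"
      by (rule has_vector_derivative_transform_within_open[where f = "\<lambda>_. 0" and S = "{0<..} - {a..b}"])
         (use r supp in \<open>auto intro: open_Diff\<close>)
    then show ?thesis using \<eta>[OF r(1)] DERIV_unique has_real_derivative_iff_has_vector_derivative by blast
  qed
  let ?G = "\<lambda>r. (\<eta>' r)\<^sup>2 * (Y r)\<^sup>2 + (\<eta> r)\<^sup>2 * (Y r * (- Y'' r + U r * Y r + K * Y r))"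
  have G: "integrable half_line ?G"
    by (rule half_line_compact_support(1)[of _ a b])
       (use ab supp \<eta>'0 in \<open>auto intro!: continuous_intros c Y'' \<eta>' U\<close>)
  have "energy (\<lambda>r. of_real (\<eta> r * Y r)) (\<lambda>r. of_real (\<eta>' r * Y r + \<eta> r * Y' r)) = (LINT r|half_line. ?G r + F' r)"
    unfolding energy_def norm_of_real power2_abs
    by (rule arg_cong[of _ _ "integral\<^sup>L half_line"]) (auto simp: F'_def algebra_simps power2_eq_square)
  also have "\<dots> = (LINT r|half_line. ?G r) + (LINT r|half_line. F' r)"
    by (rule Bochner_Integration.integral_add[OF G I(1)])
  finally show ?thesis using I(2) by simp
qed

lemma half_line_L2_of_real:
  fixes Y :: "real \<Rightarrow> real"
  assumes "continuous_on {0<..} Y" "c \<ge> 0" "b \<ge> 0" "\<And>r. 0 < r \<Longrightarrow> r \<le> b \<Longrightarrow> \<bar>Y r\<bar> \<le> c" "\<And>r. r > b \<Longrightarrow> Y r = 0"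
  shows "(\<lambda>r. complex_of_real (Y r)) \<in> L2 half_line" "(L2_norm half_line (\<lambda>r. complex_of_real (Y r)))\<^sup>2 \<le> c\<^sup>2 * b"
proof -
  have m: "(\<lambda>r. (Y r)\<^sup>2) \<in> borel_measurable half_line"
    by (intro continuous_measurable_half_line continuous_intros assms(1))
  have B: "\<bar>(Y r)\<^sup>2\<bar> \<le> c\<^sup>2" if "0 < r" "r \<le> b" for r
    using power_mono[OF assms(4)[OF that], of 2] by simp
  note H = half_line_bounded_support[OF m _ assms(3) B]
  have "integrable half_line (\<lambda>r. (Y r)\<^sup>2)" by (rule H(1)) (use assms(5) in auto)
  then show "(\<lambda>r. complex_of_real (Y r)) \<in> L2 half_line"
    unfolding L2_def
    by (auto intro!: continuous_measurable_half_line continuous_intros assms(1))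
  have "(LINT r|half_line. (Y r)\<^sup>2) \<le> c\<^sup>2 * b" by (rule H(2)) (use assms(5) in auto)
  then show "(L2_norm half_line (\<lambda>r. complex_of_real (Y r)))\<^sup>2 \<le> c\<^sup>2 * b"
    unfolding L2_norm_def by simp
qed

lemma L2_inner_of_real:
  "L2_inner half_line (\<lambda>r. complex_of_real (p r)) (\<lambda>r. complex_of_real (q r)) = complex_of_real (LINT r|half_line. p r * q r)"
  by (simp add: L2_inner_def flip: of_real_mult integral_complex_of_real)

context
  fixes Y Y' Y'' :: "real \<Rightarrow> real" and b C E :: real
  assumes Y: "\<And>r. r > 0 \<Longrightarrow> (Y has_real_derivative Y' r) (at r)" "\<And>r. r > 0 \<Longrightarrow> (Y' has_real_derivative Y'' r) (at r)"
    and Y'': "continuous_on {0<..} Y''"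
    and supp: "\<And>r. r > b \<Longrightarrow> Y r = 0" and b: "b \<ge> 1"
    and near_0: "\<And>r. 0 < r \<Longrightarrow> r \<le> 1 \<Longrightarrow> \<bar>Y r\<bar> \<le> C * sqrt r"
    and eq: "\<And>r. 0 < r \<Longrightarrow> r < 1 \<Longrightarrow> - Y'' r + U r * Y r = E * Y r"
begin

lemma Y_continuous: "continuous_on {0<..} Y" "continuous_on {0<..} Y'"
  using Y by (auto intro!: continuous_at_imp_continuous_on intro: DERIV_isCont)

lemma C_nonneg: "C \<ge> 0"
  using near_0[of 1] order_trans[OF abs_ge_zero] by simp

lemma Y_square: "0 < r \<Longrightarrow> r \<le> 1 \<Longrightarrow> (Y r)\<^sup>2 \<le> C\<^sup>2 * r"
  using power_mono[OF near_0, of r 2] by (simp add: power_mult_distrib)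

lemma Y_L2: "(\<lambda>r. complex_of_real (Y r)) \<in> L2 half_line"
proof -
  have "continuous_on {1..b} Y" by (rule continuous_on_subset[OF Y_continuous(1)]) auto
  from compact_imp_bounded[OF compact_continuous_image[OF this compact_Icc]]
  obtain T where T: "\<forall>r\<in>{1..b}. \<bar>Y r\<bar> \<le> T" unfolding bounded_iff by auto
  show ?thesis
  proof (rule half_line_L2_of_real(1)[OF Y_continuous(1), of "max C T" b])
    fix r assume r: "0 < r" "r \<le> b"
    show "\<bar>Y r\<bar> \<le> max C T"
    proof (cases "r \<le> 1")
      case True
      have "\<bar>Y r\<bar> \<le> C * sqrt r" by (rule near_0) (use r True in auto)
      also have "\<dots> \<le> C * 1" using True C_nonneg by (intro mult_left_mono) auto
      finally show ?thesis by simp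
    next
      case False
      then show ?thesis using T r by (auto simp: le_max_iff_disj)
    qed
  qed (use C_nonneg b supp in auto)
qed

definition cut :: "nat \<Rightarrow> real \<Rightarrow> real" where "cut n r = log_cutoff n r * Y r"
definition cut' :: "nat \<Rightarrow> real \<Rightarrow> real" where "cut' n r = log_cutoff' n r * Y r + log_cutoff n r * Y' r"

lemma cut_deriv:
  assumes "n > 0" "r > 0"
  shows "(cut n has_real_derivative cut' n r) (at r)"
proof -
  have "(cut n has_real_derivative log_cutoff' n r * Y r + Y' r * log_cutoff n r) (at r)"
    unfolding cut_def[abs_def] by (intro DERIV_mult log_cutoff_deriv assms Y)
  then show ?thesis by (simp add: cut'_def mult.commute)
qed

lemma cut_continuous: "n > 0 \<Longrightarrow> continuous_on {0<..} (cut' n)" "n > 0 \<Longrightarrow> continuous_on {0<..} (cut n)"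
  unfolding cut'_def[abs_def] cut_def[abs_def] by (intro continuous_intros log_cutoff_continuous Y_continuous; assumption)+

lemma cut_support:
  assumes "n > 0" "r > 0" "r \<notin> {exp (- 2 * real n)..b + 1}"
  shows "cut n r = 0"
  using assms log_cutoff_values(1)[of n r] supp[of r] by (cases "r < exp (- 2 * real n)") (auto simp: cut_def)

lemma cut_range: "n > 0 \<Longrightarrow> 0 < exp (- 2 * real n)" "n > 0 \<Longrightarrow> exp (- 2 * real n) < b + 1"
proof -
  assume "n > 0"
  then have "exp (- 2 * real n) \<le> 1" by simp
  then show "exp (- 2 * real n) < b + 1" using b by linarith
qed simp

lemma cut_compact_C1: "n > 0 \<Longrightarrow> compact_C1 (\<lambda>r. of_real (cut n r)) (\<lambda>r. of_real (cut' n r))"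
  unfolding compact_C1_def using cut_deriv cut_continuous cut_support cut_range
  by (intro conjI exI[of _ "exp (- 2 * real n)"] exI[of _ "b + 1"])
     (auto intro!: has_vector_derivative_of_real continuous_intros)

lemma exp_neg_le: "n > 0 \<Longrightarrow> exp (- real n) \<le> 1 / real n"
proof -
  assume n: "n > 0"
  have "real n \<le> exp (real n)" using exp_ge_add_one_self[of "real n"] by linarith
  then show ?thesis using n by (simp add: exp_minus field_simps)
qed

lemma cut_L2_distance:
  assumes n: "n > 0"
  shows "(L2_norm half_line (\<lambda>r. of_real (cut n r) - of_real (Y r)))\<^sup>2 \<le> 4 * C\<^sup>2 / real n"
proof -
  have "(L2_norm half_line (\<lambda>r. complex_of_real (cut n r - Y r)))\<^sup>2 \<le> (2 * C)\<^sup>2 * exp (- real n)"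
  proof (rule half_line_L2_of_real(2))
    show "continuous_on {0<..} (\<lambda>r. cut n r - Y r)"
      unfolding cut_def by (intro continuous_intros log_cutoff_continuous n Y_continuous)
    fix r :: real
    show "cut n r - Y r = 0" if "r > exp (- real n)"
      using log_cutoff_values(2)[OF n, of r] that exp_gt_zero[of "- real n"] by (auto simp: cut_def)
    assume r: "0 < r" "r \<le> exp (- real n)"
    have r1: "r \<le> 1" using r n by (meson exp_le_one_iff le_minus_iff neg_le_0_iff_le of_nat_0_le_iff order_trans)
    have "\<bar>cut n r - Y r\<bar> = \<bar>log_cutoff n r - 1\<bar> * \<bar>Y r\<bar>"
      unfolding abs_mult[symmetric] by (simp add: cut_def algebra_simps)
    also have "\<dots> \<le> 2 * (C * 1)"
    proof (rule mult_mono)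
      show "\<bar>log_cutoff n r - 1\<bar> \<le> 2" using log_cutoff_values(3)[OF n r(1)] by linarith
      have "\<bar>Y r\<bar> \<le> C * sqrt r" by (rule near_0) (use r r1 in auto)
      also have "\<dots> \<le> C * 1" using r1 C_nonneg by (intro mult_left_mono) auto
      finally show "\<bar>Y r\<bar> \<le> C * 1" .
    qed auto
    finally show "\<bar>cut n r - Y r\<bar> \<le> 2 * C" by simp
  qed (use C_nonneg in auto)
  also have "\<dots> \<le> (2 * C)\<^sup>2 * (1 / real n)" by (intro mult_left_mono exp_neg_le n) auto
  finally show ?thesis by (simp add: power_mult_distrib)
qed

text \<open>
  The integrand is at most \<open>L / (n\<^sup>2 r)\<close> on an interval of logarithmic length \<open>n\<close>.
\<close>

lemma cut_gradient_bound:
  obtains L where "L \<ge> 0" "\<And>n. n > 0 \<Longrightarrow> integrable half_line (\<lambda>r. (log_cutoff' n r)\<^sup>2 * (Y r)\<^sup>2)"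
    "\<And>n. n > 0 \<Longrightarrow> (LINT r|half_line. (log_cutoff' n r)\<^sup>2 * (Y r)\<^sup>2) \<le> L / real n"
proof -
  obtain L0 where L0: "L0 \<ge> 0" "\<And>n r. n > 0 \<Longrightarrow> r > 0 \<Longrightarrow> \<bar>log_cutoff' n r\<bar> \<le> L0 / (real n * r)"
    using log_cutoff_derivative_bound by blast
  define L where "L = L0\<^sup>2 * C\<^sup>2"
  have zero: "log_cutoff' n r = 0" if r: "n > 0" "r > 0" "r \<notin> {exp (- 2 * real n)..exp (- real n)}" for n r
  proof -
    have "(log_cutoff n has_vector_derivative 0) (at r)"
    proof (cases "r < exp (- 2 * real n)")
      case True
      show ?thesis
        by (rule has_vector_derivative_transform_within_open[where f = "\<lambda>_. 0" and S = "{0<..<exp (- 2 * real n)}"])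
           (use True r log_cutoff_values(1) in auto)
    next
      case False
      then have "r > exp (- real n)" using r by auto
      show ?thesis
      proof (rule has_vector_derivative_transform_within_open[where f = "\<lambda>_. 1" and S = "{exp (- real n)<..}"])
        fix y assume "y \<in> {exp (- real n)<..}"
        then have y: "y > exp (- real n)" by simp
        show "1 = log_cutoff n y"
          using log_cutoff_values(2)[OF r(1), of y] less_trans[OF exp_gt_zero y] y by simp
      qed (use \<open>r > exp (- real n)\<close> in auto)
    qed
    then show ?thesis
      using log_cutoff_deriv[OF r(1,2)] DERIV_unique has_real_derivative_iff_has_vector_derivative by blast
  qed
  have c: "continuous_on {0<..} (\<lambda>r. (log_cutoff' n r)\<^sup>2 * (Y r)\<^sup>2)" if "n > 0" for n
    by (intro continuous_intros log_cutoff_continuous Y_continuous that)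
  have i: "integrable half_line (\<lambda>r. (log_cutoff' n r)\<^sup>2 * (Y r)\<^sup>2)" if n: "n > 0" for n
    by (rule half_line_compact_support(1)[OF c[OF n], of "exp (- 2 * real n)" "exp (- real n)"])
       (use zero[OF n] in auto)
  have "(LINT r|half_line. (log_cutoff' n r)\<^sup>2 * (Y r)\<^sup>2) \<le> L / real n" if n: "n > 0" for n
  proof -
    have "(LINT r|half_line. (log_cutoff' n r)\<^sup>2 * (Y r)\<^sup>2) \<le>
      L / (real n)\<^sup>2 * ln (exp (- real n)) - L / (real n)\<^sup>2 * ln (exp (- 2 * real n))"
    proof (rule half_line_integral_le_primitive[OF c[OF n], where G = "\<lambda>r. L / (real n)\<^sup>2 * ln r" and G' = "\<lambda>r. L / (real n)\<^sup>2 * (1 / r)"])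
      fix r assume r: "r \<in> {exp (- 2 * real n)..exp (- real n)}"
      then have r0: "r > 0" using exp_gt_zero[of "- 2 * real n"] by (simp only: atLeastAtMost_iff) linarith
      have "exp (- real n) \<le> 1" by simp
      then have r1: "r \<le> 1" using r by (simp only: atLeastAtMost_iff) linarith
      show "((\<lambda>r. L / (real n)\<^sup>2 * ln r) has_real_derivative L / (real n)\<^sup>2 * (1 / r)) (at r)"
        by (rule DERIV_cmult[OF DERIV_ln_divide[OF r0]])
      have "(log_cutoff' n r)\<^sup>2 \<le> (L0 / (real n * r))\<^sup>2"
        using power_mono[OF L0(2)[OF n r0], of 2] by simp
      then have "(log_cutoff' n r)\<^sup>2 * (Y r)\<^sup>2 \<le> (L0 / (real n * r))\<^sup>2 * (C\<^sup>2 * r)"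
        using Y_square[OF r0 r1] by (intro mult_mono) auto
      also have "\<dots> = L / (real n)\<^sup>2 * (1 / r)"
        using r0 n by (simp add: L_def power_divide power_mult_distrib power2_eq_square)
      finally show "(log_cutoff' n r)\<^sup>2 * (Y r)\<^sup>2 \<le> L / (real n)\<^sup>2 * (1 / r)" .
    qed (use zero[OF n] in auto)
    also have "\<dots> = L / (real n)\<^sup>2 * real n" by (simp add: algebra_simps)
    also have "\<dots> = L / real n" using n by (simp add: power2_eq_square)
    finally show ?thesis .
  qed
  then show ?thesis using that[of L] i by (simp add: L_def)
qed

text \<open>
  The localization formula for the difference of two cutoffs, supported in \<open>(0, 1)\<close>, where \<open>Y\<close>
  satisfies the eigenvalue equation. The remaining zero-order term is supported below \<open>exp(- min m n)\<close>.
\<close>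

lemma cut_energy_distance:
  obtains D where "D \<ge> 0" "\<And>m n. m > 0 \<Longrightarrow> n > 0 \<Longrightarrow>
    energy (\<lambda>r. of_real (cut m r) - of_real (cut n r)) (\<lambda>r. of_real (cut' m r) - of_real (cut' n r)) \<le> D * (1 / real m + 1 / real n)"
proof -
  obtain L where L: "L \<ge> 0" "\<And>n. n > 0 \<Longrightarrow> integrable half_line (\<lambda>r. (log_cutoff' n r)\<^sup>2 * (Y r)\<^sup>2)"
    "\<And>n. n > 0 \<Longrightarrow> (LINT r|half_line. (log_cutoff' n r)\<^sup>2 * (Y r)\<^sup>2) \<le> L / real n"
    using cut_gradient_bound by blast
  define D where "D = 2 * L + (\<bar>E\<bar> + K) * (4 * C\<^sup>2)"
  have D0: "D \<ge> 0" using L(1) K by (simp add: D_def)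
  have "energy (\<lambda>r. of_real (cut m r) - of_real (cut n r)) (\<lambda>r. of_real (cut' m r) - of_real (cut' n r)) \<le> D * (1 / real m + 1 / real n)"
    if m: "m > 0" and n: "n > 0" for m n
  proof -
    define \<eta> where "\<eta> = (\<lambda>r. log_cutoff m r - log_cutoff n r)"
    define \<eta>' where "\<eta>' = (\<lambda>r. log_cutoff' m r - log_cutoff' n r)"
    define a where "a = min (exp (- 2 * real m)) (exp (- 2 * real n))"
    define s where "s = max (exp (- real m)) (exp (- real n))"
    have a: "0 < a" "a < 1" using m n by (simp_all add: a_def min_less_iff_disj)
    have s: "0 < s" "s < 1" "s \<le> 1 / real m + 1 / real n"
    proof -
      have "s \<le> exp (- real m) + exp (- real n)" by (simp add: s_def)
      then show "s \<le> 1 / real m + 1 / real n" using exp_neg_le[OF m] exp_neg_le[OF n] by linarith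
    qed (use m n in \<open>simp_all add: s_def less_max_iff_disj\<close>)
    have \<eta>0: "\<eta> r = 0" if "r > s" for r
    proof -
      have "r > 0" "r \<ge> exp (- real m)" "r \<ge> exp (- real n)" using that s by (auto simp: s_def)
      then show ?thesis using log_cutoff_values(2)[OF m] log_cutoff_values(2)[OF n] by (simp add: \<eta>_def)
    qed
    have \<eta>1: "\<eta> r = 0" if "r > 0" "r < a" for r
    proof -
      have "r \<le> exp (- 2 * real m)" "r \<le> exp (- 2 * real n)" using that by (auto simp: a_def)
      then show ?thesis using log_cutoff_values(1)[OF m] log_cutoff_values(1)[OF n] that by (simp add: \<eta>_def)
    qed
    have supp\<eta>: "\<eta> r = 0" if "r > 0" "r \<notin> {a..1}" for r
      using that \<eta>0[of r] \<eta>1[of r] s by (cases "r < a") auto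
    have \<eta>d: "(\<eta> has_real_derivative \<eta>' r) (at r)" if "r > 0" for r
      unfolding \<eta>_def \<eta>'_def by (intro DERIV_diff log_cutoff_deriv m n that)
    have \<eta>c: "continuous_on {0<..} \<eta>" "continuous_on {0<..} \<eta>'"
      unfolding \<eta>_def \<eta>'_def by (intro continuous_intros log_cutoff_continuous m n)+
    have \<eta>le: "\<bar>\<eta> r\<bar> \<le> 2" if "r > 0" for r
      unfolding \<eta>_def using log_cutoff_values(3)[OF m that] log_cutoff_values(3)[OF n that] by linarith
    let ?f = "\<lambda>r. (\<eta>' r)\<^sup>2 * (Y r)\<^sup>2 + (\<eta> r)\<^sup>2 * (Y r * (- Y'' r + U r * Y r + K * Y r))"
    let ?g = "\<lambda>n r. (log_cutoff' n r)\<^sup>2 * (Y r)\<^sup>2"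
    let ?k = "\<lambda>r. (\<eta> r)\<^sup>2 * (Y r)\<^sup>2"
    have "(\<lambda>r. of_real (cut m r) - of_real (cut n r)) = (\<lambda>r. complex_of_real (\<eta> r * Y r))"
      "(\<lambda>r. of_real (cut' m r) - of_real (cut' n r)) = (\<lambda>r. complex_of_real (\<eta>' r * Y r + \<eta> r * Y' r))"
      by (auto simp: cut_def cut'_def \<eta>_def \<eta>'_def algebra_simps)
    then have E1: "energy (\<lambda>r. of_real (cut m r) - of_real (cut n r)) (\<lambda>r. of_real (cut' m r) - of_real (cut' n r)) = (LINT r|half_line. ?f r)"
      using energy_of_cutoff_product[OF Y Y'' \<eta>d \<eta>c(2) a supp\<eta>] by simp
    have \<eta>'0: "\<eta>' r = 0" if r: "r > 0" "r \<notin> {a..1}" for r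
    proof -
      have "(\<eta> has_vector_derivative 0) (at r)"
        by (rule has_vector_derivative_transform_within_open[where f = "\<lambda>_. 0" and S = "{0<..} - {a..1}"])
           (use r supp\<eta> in \<open>auto intro: open_Diff\<close>)
      then show ?thesis using \<eta>d[OF r(1)] DERIV_unique has_real_derivative_iff_has_vector_derivative by blast
    qed
    have fi: "integrable half_line ?f"
      by (rule half_line_compact_support(1)[of _ a 1])
         (use a supp\<eta> \<eta>'0 in \<open>auto intro!: continuous_intros Y_continuous Y'' \<eta>c U\<close>)
    have kb: "\<bar>?k r\<bar> \<le> 4 * C\<^sup>2" if r: "0 < r" "r \<le> s" for r
    proof -
      have r1: "r \<le> 1" using r s by simp
      have "(\<eta> r)\<^sup>2 \<le> 2\<^sup>2" using power_mono[OF \<eta>le[OF r(1)], of 2] by simp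
      moreover have "(Y r)\<^sup>2 \<le> C\<^sup>2 * 1"
        using order_trans[OF Y_square[OF r(1) r1] mult_left_mono[OF r1, of "C\<^sup>2"]] by simp
      ultimately have "?k r \<le> 2\<^sup>2 * (C\<^sup>2 * 1)" by (intro mult_mono) auto
      then show ?thesis by simp
    qed
    have km: "?k \<in> borel_measurable half_line"
      by (intro continuous_measurable_half_line continuous_intros \<eta>c Y_continuous)
    have k: "integrable half_line ?k" "(LINT r|half_line. ?k r) \<le> 4 * C\<^sup>2 * s"
      by (rule half_line_bounded_support[OF km _ _ kb, where b = s]; use \<eta>0 s in simp)+
    have gi: "integrable half_line (\<lambda>r. 2 * ?g m r + 2 * ?g n r + (\<bar>E\<bar> + K) * ?k r)"
      by (intro Bochner_Integration.integrable_add integrable_mult_right L m n k)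
    have "(LINT r|half_line. ?f r) \<le> (LINT r|half_line. 2 * ?g m r + 2 * ?g n r + (\<bar>E\<bar> + K) * ?k r)"
    proof (rule integral_mono[OF fi gi])
      fix r assume "r \<in> space half_line"
      then have r: "r > 0" by (simp add: space_restrict_space)
      have "(\<eta>' r)\<^sup>2 \<le> 2 * (log_cutoff' m r)\<^sup>2 + 2 * (log_cutoff' n r)\<^sup>2"
        unfolding \<eta>'_def using sum_squares_ge_zero[of "log_cutoff' m r + log_cutoff' n r" 0]
        by (simp add: power2_eq_square algebra_simps)
      then have 1: "(\<eta>' r)\<^sup>2 * (Y r)\<^sup>2 \<le> 2 * ?g m r + 2 * ?g n r"
        using mult_right_mono[of "(\<eta>' r)\<^sup>2" _ "(Y r)\<^sup>2"] by (force simp: algebra_simps)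
      have 2: "(\<eta> r)\<^sup>2 * (Y r * (- Y'' r + U r * Y r + K * Y r)) \<le> (\<bar>E\<bar> + K) * ?k r"
      proof (cases "r < 1")
        case True
        then have "(\<eta> r)\<^sup>2 * (Y r * (- Y'' r + U r * Y r + K * Y r)) = (E + K) * ?k r"
          using eq[OF r] by (simp add: algebra_simps power2_eq_square)
        also have "\<dots> \<le> (\<bar>E\<bar> + K) * ?k r" by (intro mult_right_mono) auto
        finally show ?thesis .
      next
        case False
        then have "\<eta> r = 0" using \<eta>0 s by simp
        then show ?thesis by simp
      qed
      show "?f r \<le> 2 * ?g m r + 2 * ?g n r + (\<bar>E\<bar> + K) * ?k r" using 1 2 by linarith
    qed
    also have "\<dots> = 2 * (LINT r|half_line. ?g m r) + 2 * (LINT r|half_line. ?g n r) + (\<bar>E\<bar> + K) * (LINT r|half_line. ?k r)"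
      using L(2)[OF m] L(2)[OF n] k(1) by simp
    also have "\<dots> \<le> 2 * (L / real m) + 2 * (L / real n) + (\<bar>E\<bar> + K) * (4 * C\<^sup>2 * (1 / real m + 1 / real n))"
    proof (intro add_mono mult_left_mono L m n)
      have "4 * C\<^sup>2 * s \<le> 4 * C\<^sup>2 * (1 / real m + 1 / real n)" using s(3) by (intro mult_left_mono) auto
      then show "(LINT r|half_line. ?k r) \<le> 4 * C\<^sup>2 * (1 / real m + 1 / real n)" using k(2) by linarith
    qed (use K in auto)
    also have "\<dots> = D * (1 / real m + 1 / real n)"
    proof -
      have "2 * (L * p) + 2 * (L * q) + (\<bar>E\<bar> + K) * (4 * C\<^sup>2 * (p + q)) = D * (p + q)" for p q
        by (simp add: D_def algebra_simps)
      from this[of "1 / real m" "1 / real n"] show ?thesis by simp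
    qed
    finally show ?thesis unfolding E1 .
  qed
  then show ?thesis using that D0 by blast
qed

text \<open>
  The cut functions are Cauchy in energy, and each of them is replaced by a test function that is close to
  it in energy and in \<open>L2\<close>.
\<close>

lemma converging_test_functions:
  obtains \<phi> where "converges \<phi> (\<lambda>r. complex_of_real (Y r))"
proof -
  have ex: "\<exists>\<phi>. \<phi> \<in> test_functions \<and>
    energy (\<lambda>r. \<phi> r - of_real (cut (Suc n) r)) (\<lambda>r. vderiv \<phi> r - of_real (cut' (Suc n) r)) \<le> 1 / real (Suc n) \<and>
    (L2_norm half_line (\<lambda>r. \<phi> r - of_real (cut (Suc n) r)))\<^sup>2 \<le> 1 / real (Suc n)" for n
  proof -
    have p: "Suc n > 0" "1 / real (Suc n) > 0" by simp_all
    show ?thesis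
      by (rule test_function_energy_approximation[OF cut_deriv[OF p(1)] cut_continuous(1)[OF p(1)] cut_range[OF p(1)] cut_support[OF p(1)] p(2)])
         blast+
  qed
  from choice[OF allI[OF ex]] obtain \<phi> where all: "\<forall>n. \<phi> n \<in> test_functions \<and>
    energy (\<lambda>r. \<phi> n r - of_real (cut (Suc n) r)) (\<lambda>r. vderiv (\<phi> n) r - of_real (cut' (Suc n) r)) \<le> 1 / real (Suc n) \<and>
    (L2_norm half_line (\<lambda>r. \<phi> n r - of_real (cut (Suc n) r)))\<^sup>2 \<le> 1 / real (Suc n)" ..
  have \<phi>: "\<phi> n \<in> test_functions"
    and \<phi>e: "energy (\<lambda>r. \<phi> n r - of_real (cut (Suc n) r)) (\<lambda>r. vderiv (\<phi> n) r - of_real (cut' (Suc n) r)) \<le> 1 / real (Suc n)"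
    and \<phi>l: "(L2_norm half_line (\<lambda>r. \<phi> n r - of_real (cut (Suc n) r)))\<^sup>2 \<le> 1 / real (Suc n)" for n
    using all by blast+
  obtain D where D: "D \<ge> 0" "\<And>m n. m > 0 \<Longrightarrow> n > 0 \<Longrightarrow>
    energy (\<lambda>r. of_real (cut m r) - of_real (cut n r)) (\<lambda>r. of_real (cut' m r) - of_real (cut' n r)) \<le> D * (1 / real m + 1 / real n)"
    using cut_energy_distance by blast
  define d where "d = (\<lambda>n. 1 / real (Suc n))"
  have d0: "d n \<ge> 0" for n by (simp add: d_def)
  have dlim: "d \<longlonglongrightarrow> 0" unfolding d_def by (rule LIMSEQ_Suc[OF lim_1_over_n])
  have cutL: "(\<lambda>r. complex_of_real (cut n r)) \<in> L2 half_line" if "n > 0" for n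
    by (rule L2_continuous_compact[of _ "exp (- 2 * real n)" "b + 1"])
       (use that cut_support[OF that] in \<open>auto intro!: continuous_intros cut_continuous\<close>)
  have Yd: "(L2_norm half_line (\<lambda>r. \<phi> n r - of_real (Y r)))\<^sup>2 \<le> (2 + 8 * C\<^sup>2) * d n" for n
  proof -
    have "(\<lambda>r. \<phi> n r - of_real (Y r)) = (\<lambda>r. (\<phi> n r - of_real (cut (Suc n) r)) - (of_real (Y r) - of_real (cut (Suc n) r)))"
      by auto
    then have "(L2_norm half_line (\<lambda>r. \<phi> n r - of_real (Y r)))\<^sup>2 \<le>
      2 * (L2_norm half_line (\<lambda>r. \<phi> n r - of_real (cut (Suc n) r)))\<^sup>2 + 2 * (L2_norm half_line (\<lambda>r. of_real (Y r) - of_real (cut (Suc n) r)))\<^sup>2"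
      using L2_norm_sq_triangle[OF L2_diff[OF D_L2[OF \<phi>] cutL] L2_diff[OF Y_L2 cutL], of "Suc n" "Suc n" n] by simp
    also have "L2_norm half_line (\<lambda>r. of_real (Y r) - of_real (cut (Suc n) r)) = L2_norm half_line (\<lambda>r. of_real (cut (Suc n) r) - of_real (Y r))"
      unfolding L2_norm_def by (simp only: norm_minus_commute)
    also have "2 * (L2_norm half_line (\<lambda>r. \<phi> n r - of_real (cut (Suc n) r)))\<^sup>2 + 2 * (L2_norm half_line (\<lambda>r. of_real (cut (Suc n) r) - of_real (Y r)))\<^sup>2
      \<le> 2 * (1 / real (Suc n)) + 2 * (4 * C\<^sup>2 / real (Suc n))"
      by (intro add_mono mult_left_mono \<phi>l cut_L2_distance) auto
    also have "\<dots> = (2 + 8 * C\<^sup>2) * d n" by (simp add: d_def add_divide_distrib ring_distribs)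
    finally show ?thesis .
  qed
  have "(\<lambda>n. (L2_norm half_line (\<lambda>r. \<phi> n r - of_real (Y r)))\<^sup>2) \<longlonglongrightarrow> 0"
  proof (rule Lim_null_comparison[OF always_eventually[OF allI]])
    show "norm ((L2_norm half_line (\<lambda>r. \<phi> n r - of_real (Y r)))\<^sup>2) \<le> (2 + 8 * C\<^sup>2) * d n" for n
      using Yd[of n] by simp
    show "(\<lambda>n. (2 + 8 * C\<^sup>2) * d n) \<longlonglongrightarrow> 0"
      using tendsto_mult_left[OF dlim, of "2 + 8 * C\<^sup>2"] by simp
  qed
  from tendsto_real_sqrt[OF this]
  have lim: "(\<lambda>n. L2_norm half_line (\<lambda>r. \<phi> n r - of_real (Y r))) \<longlonglongrightarrow> 0"
    by (simp add: L2_norm_nonneg)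
  define B where "B = 4 + 4 * D + K * (4 + 16 * C\<^sup>2)"
  have B0: "B > 0" using D(1) K by (simp add: B_def add_pos_nonneg)
  have q: "cmod (L2_inner half_line (\<lambda>x. \<phi> m x - \<phi> n x) (sturm U (\<lambda>x. \<phi> m x - \<phi> n x))) \<le> B * (d m + d n)" for m n
  proof -
    let ?f = "\<lambda>x. \<phi> m x - \<phi> n x"
    have f: "?f \<in> test_functions" by (rule D_diff[OF \<phi> \<phi>])
    have vd: "vderiv ?f = (\<lambda>r. vderiv (\<phi> m) r - vderiv (\<phi> n) r)"
      using test_function_derivs(1)[OF \<phi>] by (intro ext vector_derivative_at has_vector_derivative_diff)
    let ?c = "\<lambda>k r. complex_of_real (cut (Suc k) r)" and ?c' = "\<lambda>k r. complex_of_real (cut' (Suc k) r)"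
    have c: "compact_C1 (?c k) (?c' k)" for k by (rule cut_compact_C1) simp
    have cd: "compact_C1 (\<lambda>r. \<phi> k r - ?c k r) (\<lambda>r. vderiv (\<phi> k) r - ?c' k r)" for k
      using compact_C1_lincomb[OF compact_C1_test_function[OF \<phi>[of k]] c[of k], of 1] by simp
    have cc: "compact_C1 (\<lambda>r. ?c m r - ?c n r) (\<lambda>r. ?c' m r - ?c' n r)"
      using compact_C1_lincomb[OF c[of m] c[of n], of 1] by simp
    have cdd: "compact_C1 (\<lambda>r. (\<phi> n r - ?c n r) - (?c m r - ?c n r)) (\<lambda>r. (vderiv (\<phi> n) r - ?c' n r) - (?c' m r - ?c' n r))"
      using compact_C1_lincomb[OF cd[of n] cc, of 1] by simp
    have "energy ?f (vderiv ?f) = energy (\<lambda>r. (\<phi> m r - ?c m r) - ((\<phi> n r - ?c n r) - (?c m r - ?c n r)))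
       (\<lambda>r. (vderiv (\<phi> m) r - ?c' m r) - ((vderiv (\<phi> n) r - ?c' n r) - (?c' m r - ?c' n r)))"
      unfolding vd by (simp add: algebra_simps)
    also have "\<dots> \<le> 2 * energy (\<lambda>r. \<phi> m r - ?c m r) (\<lambda>r. vderiv (\<phi> m) r - ?c' m r)
      + 2 * energy (\<lambda>r. (\<phi> n r - ?c n r) - (?c m r - ?c n r)) (\<lambda>r. (vderiv (\<phi> n) r - ?c' n r) - (?c' m r - ?c' n r))"
      by (rule energy_diff_le[OF cd cdd])
    also have "\<dots> \<le> 2 * d m + 2 * (2 * d n + 2 * (D * (d m + d n)))"
    proof (intro add_mono mult_left_mono)
      show "energy (\<lambda>r. \<phi> m r - ?c m r) (\<lambda>r. vderiv (\<phi> m) r - ?c' m r) \<le> d m" unfolding d_def by (rule \<phi>e)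
      have "energy (\<lambda>r. (\<phi> n r - ?c n r) - (?c m r - ?c n r)) (\<lambda>r. (vderiv (\<phi> n) r - ?c' n r) - (?c' m r - ?c' n r))
        \<le> 2 * energy (\<lambda>r. \<phi> n r - ?c n r) (\<lambda>r. vderiv (\<phi> n) r - ?c' n r) + 2 * energy (\<lambda>r. ?c m r - ?c n r) (\<lambda>r. ?c' m r - ?c' n r)"
        by (rule energy_diff_le[OF cd cc])
      also have "\<dots> \<le> 2 * d n + 2 * (D * (d m + d n))"
        unfolding d_def by (intro add_mono mult_left_mono \<phi>e D(2)) auto
      finally show "energy (\<lambda>r. (\<phi> n r - ?c n r) - (?c m r - ?c n r)) (\<lambda>r. (vderiv (\<phi> n) r - ?c' n r) - (?c' m r - ?c' n r))
        \<le> 2 * d n + 2 * (D * (d m + d n))" .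
    qed auto
    also have "\<dots> \<le> (4 + 4 * D) * (d m + d n)" using d0[of m] d0[of n] by (simp add: algebra_simps)
    finally have e: "energy ?f (vderiv ?f) \<le> (4 + 4 * D) * (d m + d n)" .
    have "?f = (\<lambda>r. (\<phi> m r - of_real (Y r)) - (\<phi> n r - of_real (Y r)))" by auto
    then have "(L2_norm half_line ?f)\<^sup>2 \<le> 2 * (L2_norm half_line (\<lambda>r. \<phi> m r - of_real (Y r)))\<^sup>2 + 2 * (L2_norm half_line (\<lambda>r. \<phi> n r - of_real (Y r)))\<^sup>2"
      using L2_norm_sq_triangle[OF L2_diff[OF D_L2[OF \<phi>] Y_L2] L2_diff[OF D_L2[OF \<phi>] Y_L2], of m n] by simp
    also have "\<dots> \<le> 2 * ((2 + 8 * C\<^sup>2) * d m) + 2 * ((2 + 8 * C\<^sup>2) * d n)"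
      by (intro add_mono mult_left_mono Yd) auto
    also have "\<dots> = (4 + 16 * C\<^sup>2) * (d m + d n)" by (simp add: algebra_simps)
    finally have l: "(L2_norm half_line ?f)\<^sup>2 \<le> (4 + 16 * C\<^sup>2) * (d m + d n)" .
    have "cmod (L2_inner half_line ?f (sturm U ?f)) = \<bar>energy ?f (vderiv ?f) - K * (L2_norm half_line ?f)\<^sup>2\<bar>"
      unfolding energy_test_function[OF f] norm_of_real ..
    also have "\<dots> \<le> energy ?f (vderiv ?f) + K * (L2_norm half_line ?f)\<^sup>2"
      using energy_nonneg[OF compact_C1_test_function[OF f]] mult_nonneg_nonneg[OF K zero_le_power2[of "L2_norm half_line ?f"]] by linarith
    also have "\<dots> \<le> (4 + 4 * D) * (d m + d n) + K * ((4 + 16 * C\<^sup>2) * (d m + d n))"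
      using e l K by (intro add_mono mult_left_mono) auto
    also have "\<dots> = B * (d m + d n)" unfolding B_def by (simp only: ring_distribs mult.assoc)
    finally show ?thesis .
  qed
  have "converges \<phi> (\<lambda>r. complex_of_real (Y r))"
    unfolding form_converges_def
  proof (intro conjI allI impI)
    fix e :: real assume e: "e > 0"
    have "\<forall>\<^sub>F n in sequentially. d n < e / (2 * B)" using e B0 by (intro order_tendstoD(2)[OF dlim]) simp
    then obtain N where N: "\<forall>n\<ge>N. d n < e / (2 * B)" unfolding eventually_sequentially by blast
    show "\<exists>N. \<forall>m\<ge>N. \<forall>n\<ge>N. cmod (L2_inner half_line (\<lambda>x. \<phi> m x - \<phi> n x) (sturm U (\<lambda>x. \<phi> m x - \<phi> n x))) < e"
    proof (intro exI[of _ N] allI impI)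
      fix m n assume "m \<ge> N" "n \<ge> N"
      then have "d m + d n < e / B" using N[rule_format, of m] N[rule_format, of n] B0 by (simp add: field_simps)
      then have "B * (d m + d n) < e" using B0 by (simp add: field_simps)
      then show "cmod (L2_inner half_line (\<lambda>x. \<phi> m x - \<phi> n x) (sturm U (\<lambda>x. \<phi> m x - \<phi> n x))) < e"
        using q[of m n] by linarith
    qed
  qed (use \<phi> lim in auto)
  then show ?thesis using that by blast
qed

lemma bounded_solution_in_friedrichs_domain:
  "((\<lambda>r. complex_of_real (Y r)), (\<lambda>r. complex_of_real (- Y'' r + U r * Y r))) \<in> friedrichs_extension half_line test_functions (sturm U)"
proof (rule friedrichsI)
  show "(\<lambda>r. complex_of_real (Y r)) \<in> form_domain half_line test_functions (sturm U)"
    using converging_test_functions Y_L2 unfolding form_domain_def by blast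
  have d2: "Y'' r = 0" if r: "r > b" for r
  proof -
    have r0: "r > 0" using r b by simp
    have Y'0: "Y' x = 0" if x: "x > b" for x
    proof -
      have "(Y has_vector_derivative 0) (at x)"
        by (rule has_vector_derivative_transform_within_open[where f = "\<lambda>_. 0" and S = "{b<..}"]) (use x supp in auto)
      then show ?thesis
        using Y(1)[of x] x b DERIV_unique has_real_derivative_iff_has_vector_derivative by (metis less_le_trans less_trans zero_less_one)
    qed
    have "(Y' has_vector_derivative 0) (at r)"
      by (rule has_vector_derivative_transform_within_open[where f = "\<lambda>_. 0" and S = "{b<..}"]) (use r Y'0 in auto)
    then show ?thesis using Y(2)[OF r0] DERIV_unique has_real_derivative_iff_has_vector_derivative by blast
  qed
  have c: "continuous_on {0<..} (\<lambda>r. - Y'' r + U r * Y r)" by (intro continuous_intros Y'' U Y_continuous)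
  have "continuous_on {1..b} (\<lambda>r. - Y'' r + U r * Y r)" by (rule continuous_on_subset[OF c]) auto
  from compact_imp_bounded[OF compact_continuous_image[OF this compact_Icc]]
  obtain T where T: "\<forall>r\<in>{1..b}. \<bar>- Y'' r + U r * Y r\<bar> \<le> T" unfolding bounded_iff by auto
  show "(\<lambda>r. complex_of_real (- Y'' r + U r * Y r)) \<in> L2 half_line"
  proof (rule half_line_L2_of_real(1)[OF c, of "max (\<bar>E\<bar> * C) T" b])
    fix r assume r: "0 < r" "r \<le> b"
    show "\<bar>- Y'' r + U r * Y r\<bar> \<le> max (\<bar>E\<bar> * C) T"
    proof (cases "r < 1")
      case True
      have "\<bar>Y r\<bar> \<le> C * sqrt r" by (rule near_0) (use r True in auto)
      also have "\<dots> \<le> C * 1" using True C_nonneg by (intro mult_left_mono) auto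
      finally have "\<bar>E * Y r\<bar> \<le> \<bar>E\<bar> * C" unfolding abs_mult by (intro mult_left_mono) auto
      then show ?thesis using eq[OF r(1) True] by simp
    next
      case False
      then have "\<bar>- Y'' r + U r * Y r\<bar> \<le> T" using T r by auto
      then show ?thesis by simp
    qed
  next
    show "0 \<le> max (\<bar>E\<bar> * C) T" using C_nonneg by (simp add: le_max_iff_disj)
  next
    show "- Y'' r + U r * Y r = 0" if "r > b" for r using d2[OF that] supp[OF that] by simp
  qed (use b in simp)
  show "L2_inner half_line (sturm U w) (\<lambda>r. complex_of_real (Y r)) = L2_inner half_line w (\<lambda>r. complex_of_real (- Y'' r + U r * Y r))"
    if w: "w \<in> test_functions" for w
    using green_identity[OF U w, of "\<lambda>r. of_real (Y r)" "\<lambda>r. of_real (Y' r)" "\<lambda>r. of_real (Y'' r)"] Y Y''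
    by (simp add: has_vector_derivative_of_real continuous_on_of_real)
qed

text \<open>
  The cut functions are limits in \<open>L2\<close> of test functions with supports in a common compact set. On that set
  the expression \<open>- X'' + U X\<close> may be replaced by the square integrable function \<open>G\<close>.
\<close>

lemma weak_identity_on_cut:
  fixes X X' X'' :: "real \<Rightarrow> real"
  assumes X: "\<And>r. r > 0 \<Longrightarrow> (X has_real_derivative X' r) (at r)" "\<And>r. r > 0 \<Longrightarrow> (X' has_real_derivative X'' r) (at r)"
    and X'': "continuous_on {0<..} X''"
    and dom: "((\<lambda>r. complex_of_real (X r)), f) \<in> friedrichs_extension half_line test_functions (sturm U)"
    and n: "n > 0"
  shows "L2_inner half_line (\<lambda>r. complex_of_real (cut n r)) f =
    L2_inner half_line (\<lambda>r. complex_of_real (cut n r)) (\<lambda>r. complex_of_real (- X'' r + U r * X r))"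
proof -
  define a where "a = exp (- 2 * real n)"
  define b' where "b' = b + 1"
  have ab: "0 < a" "a < b'" using cut_range[OF n] by (simp_all add: a_def b'_def)
  have f: "f \<in> L2 half_line" using dom by (simp add: friedrichs_extension_def)
  have cX: "continuous_on {0<..} X" using X by (auto intro!: continuous_at_imp_continuous_on intro: DERIV_isCont)
  define g where "g = (\<lambda>r. - X'' r + U r * X r)"
  have cg: "continuous_on {0<..} g" unfolding g_def by (intro continuous_intros X'' U cX)
  (* a trapezoid: 1 on [a/2, 2b'] and 0 outside [a/4, 3b']; continuity suffices here *)
  define \<zeta> where "\<zeta> = (\<lambda>r::real. max 0 (min 1 (min (4 / a * r - 1) (3 - r / b'))))"
  have \<zeta>1: "\<zeta> r = 1" if "r \<in> {a / 2..2 * b'}" for r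
  proof -
    have "1 \<le> 4 / a * r - 1" "1 \<le> 3 - r / b'" using that ab by (auto simp: field_simps)
    then show ?thesis by (simp add: \<zeta>_def)
  qed
  have \<zeta>0: "\<zeta> r = 0" if "r \<notin> {a / 4..3 * b'}" for r
  proof -
    have "4 / a * r - 1 \<le> 0 \<or> 3 - r / b' \<le> 0" using that ab by (auto simp: field_simps)
    then show ?thesis by (auto simp: \<zeta>_def)
  qed
  have c\<zeta>: "continuous_on {0<..} \<zeta>" unfolding \<zeta>_def using ab by (intro continuous_intros) auto
  define G where "G = (\<lambda>r. complex_of_real (\<zeta> r * g r))"
  have GL: "G \<in> L2 half_line"
    unfolding G_def by (rule L2_continuous_compact[of _ "a / 4" "3 * b'"]) (use ab \<zeta>0 in \<open>auto intro!: continuous_intros c\<zeta> cg\<close>)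
  have swap: "L2_inner half_line w (\<lambda>r. complex_of_real (g r)) = L2_inner half_line w G"
    if "\<And>r. r > 0 \<Longrightarrow> r \<notin> {a / 2..2 * b'} \<Longrightarrow> w r = 0" for w
    unfolding L2_inner_def
  proof (rule Bochner_Integration.integral_cong[OF refl])
    fix r assume "r \<in> space half_line"
    then have "r > 0" by (simp add: space_restrict_space)
    then show "cnj (w r) * complex_of_real (g r) = cnj (w r) * G r"
      using that[of r] \<zeta>1[of r] by (cases "r \<in> {a / 2..2 * b'}") (auto simp: G_def)
  qed
  have ex: "\<exists>\<phi>. \<phi> \<in> test_functions \<and> (\<forall>r>0. r \<notin> {a / 2..2 * b'} \<longrightarrow> \<phi> r = 0) \<and>
    (L2_norm half_line (\<lambda>r. \<phi> r - of_real (cut n r)))\<^sup>2 \<le> 1 / real (Suc k)" for k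
  proof -
    have p: "1 / real (Suc k) > 0" by simp
    show ?thesis
      by (rule test_function_energy_approximation[OF cut_deriv[OF n] cut_continuous(1)[OF n] ab _ p])
         (use cut_support[OF n] in \<open>unfold a_def b'_def, blast+\<close>)
  qed
  from choice[OF allI[OF ex]] obtain \<phi> where all: "\<forall>k. \<phi> k \<in> test_functions \<and> (\<forall>r>0. r \<notin> {a / 2..2 * b'} \<longrightarrow> \<phi> k r = 0) \<and>
    (L2_norm half_line (\<lambda>r. \<phi> k r - of_real (cut n r)))\<^sup>2 \<le> 1 / real (Suc k)" ..
  have \<phi>: "\<phi> k \<in> test_functions" and \<phi>0: "\<And>r. r > 0 \<Longrightarrow> r \<notin> {a / 2..2 * b'} \<Longrightarrow> \<phi> k r = 0"
    and \<phi>l: "(L2_norm half_line (\<lambda>r. \<phi> k r - of_real (cut n r)))\<^sup>2 \<le> 1 / real (Suc k)" for k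
    using all by blast+
  have "(\<lambda>k. (L2_norm half_line (\<lambda>r. \<phi> k r - of_real (cut n r)))\<^sup>2) \<longlonglongrightarrow> 0"
  proof (rule Lim_null_comparison[OF always_eventually[OF allI]])
    show "norm ((L2_norm half_line (\<lambda>r. \<phi> k r - of_real (cut n r)))\<^sup>2) \<le> 1 / real (Suc k)" for k using \<phi>l[of k] by simp
    show "(\<lambda>k. 1 / real (Suc k)) \<longlonglongrightarrow> 0" by (rule LIMSEQ_Suc[OF lim_1_over_n])
  qed
  from tendsto_real_sqrt[OF this]
  have lim: "(\<lambda>k. L2_norm half_line (\<lambda>r. \<phi> k r - of_real (cut n r))) \<longlonglongrightarrow> 0" by (simp add: L2_norm_nonneg)
  have cutL: "(\<lambda>r. complex_of_real (cut n r)) \<in> L2 half_line"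
    by (rule L2_continuous_compact[of _ "exp (- 2 * real n)" "b + 1"])
       (use n cut_support[OF n] in \<open>auto intro!: continuous_intros cut_continuous\<close>)
  have "(\<lambda>k. L2_inner half_line (\<phi> k) f) \<longlonglongrightarrow> L2_inner half_line (\<lambda>r. complex_of_real (cut n r)) f"
    by (rule L2_inner_tendsto(1)[OF D_L2[OF \<phi>] cutL f lim])
  moreover have "L2_inner half_line (\<phi> k) f = L2_inner half_line (\<phi> k) G" for k
  proof -
    have "L2_inner half_line (\<phi> k) f = L2_inner half_line (sturm U (\<phi> k)) (\<lambda>r. complex_of_real (X r))"
      by (rule friedrichs_weak[OF dom \<phi>, symmetric])
    also have "\<dots> = L2_inner half_line (\<phi> k) (\<lambda>r. - complex_of_real (X'' r) + of_real (U r) * of_real (X r))"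
      by (rule green_identity[OF U \<phi>, of "\<lambda>r. of_real (X r)" "\<lambda>r. of_real (X' r)"])
         (use X X'' in \<open>auto intro: has_vector_derivative_of_real continuous_on_of_real\<close>)
    also have "(\<lambda>r. - complex_of_real (X'' r) + of_real (U r) * of_real (X r)) = (\<lambda>r. complex_of_real (g r))"
      by (simp add: g_def)
    also have "L2_inner half_line (\<phi> k) (\<lambda>r. complex_of_real (g r)) = L2_inner half_line (\<phi> k) G"
      by (rule swap[OF \<phi>0])
    finally show ?thesis .
  qed
  moreover have "(\<lambda>k. L2_inner half_line (\<phi> k) G) \<longlonglongrightarrow> L2_inner half_line (\<lambda>r. complex_of_real (cut n r)) G"
    by (rule L2_inner_tendsto(1)[OF D_L2[OF \<phi>] cutL GL lim])
  ultimately have "L2_inner half_line (\<lambda>r. complex_of_real (cut n r)) f = L2_inner half_line (\<lambda>r. complex_of_real (cut n r)) G"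
    using LIMSEQ_unique by simp
  also have "\<dots> = L2_inner half_line (\<lambda>r. complex_of_real (cut n r)) (\<lambda>r. complex_of_real (g r))"
  proof (rule swap[symmetric])
    fix r :: real assume r: "r > 0" "r \<notin> {a / 2..2 * b'}"
    have "r \<notin> {a..b'}" using r(2) ab by auto
    then have "r \<notin> {exp (- 2 * real n)..b + 1}" unfolding a_def b'_def .
    from cut_support[OF n r(1) this] show "complex_of_real (cut n r) = 0" by simp
  qed
  finally show ?thesis unfolding g_def .
qed

text \<open>
  Symmetry of the Friedrichs extension gives \<open>(Y, f) = (X, - Y'' + U Y)\<close>. The left side is the limit of the
  integrals of the cut functions against \<open>- X'' + U X\<close>. The integrands on both sides differ by the
  derivative of the Wronskian, which vanishes on \<open>(0, 1)\<close> because the energies agree and is the derivative of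
  a function that is zero beyond \<open>b\<close>; its integral is minus the Wronskian at 1.
\<close>

lemma wronskian_vanishes:
  fixes X X' X'' :: "real \<Rightarrow> real"
  assumes X: "\<And>r. r > 0 \<Longrightarrow> (X has_real_derivative X' r) (at r)" "\<And>r. r > 0 \<Longrightarrow> (X' has_real_derivative X'' r) (at r)"
    and X'': "continuous_on {0<..} X''" and suppX: "\<And>r. r > b \<Longrightarrow> X r = 0"
    and eqX: "\<And>r. 0 < r \<Longrightarrow> r < 1 \<Longrightarrow> - X'' r + U r * X r = E * X r"
    and dom: "((\<lambda>r. complex_of_real (X r)), f) \<in> friedrichs_extension half_line test_functions (sturm U)"
  shows "X 1 * Y' 1 - X' 1 * Y 1 = 0"
proof -
  define gX where "gX = (\<lambda>r. - X'' r + U r * X r)"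
  define gY where "gY = (\<lambda>r. - Y'' r + U r * Y r)"
  define w where "w = (\<lambda>r. Y r * gX r - X r * gY r)"
  have cX: "continuous_on {0<..} X" "continuous_on {0<..} X'"
    using X by (auto intro!: continuous_at_imp_continuous_on intro: DERIV_isCont)
  note domY = bounded_solution_in_friedrichs_domain[folded gY_def]
  have f: "f \<in> L2 half_line" and XL: "(\<lambda>r. complex_of_real (X r)) \<in> L2 half_line"
    and gYL: "(\<lambda>r. complex_of_real (gY r)) \<in> L2 half_line"
    using dom domY form_domain_L2 by (auto simp: friedrichs_extension_def gY_def)
  have XgY: "integrable half_line (\<lambda>r. X r * gY r)"
  proof -
    have "integrable half_line (\<lambda>r. Re (cnj (complex_of_real (X r)) * complex_of_real (gY r)))"
      by (rule integrable_Re[OF L2_inner_integrable[OF XL gYL]])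
    then show ?thesis by simp
  qed
  have w0: "w r = 0" if "r > 0" "r < 1" for r
  proof -
    have "gX r = E * X r" "gY r = E * Y r" using eq[OF that] eqX[OF that] by (simp_all only: gX_def gY_def)
    then show ?thesis by (simp add: w_def)
  qed
  have cw: "continuous_on {0<..} w"
    unfolding w_def gX_def gY_def by (intro continuous_intros Y_continuous cX X'' Y'' U)
  have wsupp: "w r = 0" if "r > 0" "r \<notin> {1..b + 1}" for r
    using that w0[of r] supp[of r] suppX[of r] by (cases "r < 1") (auto simp: w_def)
  note Wi = half_line_compact_support[OF cw zero_less_one wsupp]
  (* Green's formula on [1, b + 1], with a boundary term at 1 only *)
  have wint: "(LINT r|half_line. w r) = - (X 1 * Y' 1 - X' 1 * Y 1)"
  proof -
    define F where "F = (\<lambda>r. X r * Y' r - X' r * Y r)"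
    have "(w has_integral (F (b + 1) - F 1)) {1..b + 1}"
    proof (rule fundamental_theorem_of_calculus)
      fix r assume "r \<in> {1..b + 1}"
      then have r: "r > 0" by auto
      have "(F has_real_derivative (X' r * Y' r + Y'' r * X r) - (X'' r * Y r + Y' r * X' r)) (at r)"
        unfolding F_def by (intro DERIV_diff DERIV_mult X Y r)
      moreover have "(X' r * Y' r + Y'' r * X r) - (X'' r * Y r + Y' r * X' r) = w r"
        by (simp add: w_def gX_def gY_def algebra_simps)
      ultimately show "(F has_vector_derivative w r) (at r within {1..b + 1})"
        by (simp add: has_real_derivative_iff_has_vector_derivative has_vector_derivative_at_within)
    qed (use b in simp)
    moreover have "F (b + 1) = 0"
      using supp[of "b + 1"] suppX[of "b + 1"] by (simp add: F_def)
    ultimately show ?thesis using Wi(2) by (simp add: integral_unique F_def)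
  qed
  define I where "I = (LINT r|half_line. X r * gY r)"
  have cuti: "integrable half_line (\<lambda>r. cut (Suc n) r * gX r)" for n
    by (rule half_line_compact_support(1)[of _ "exp (- 2 * real (Suc n))" "b + 1"])
       (use cut_support[of "Suc n"] in \<open>auto intro!: continuous_intros cut_continuous X'' U cX simp: gX_def simp del: of_nat_Suc\<close>)
  have etai: "integrable half_line (\<lambda>r. log_cutoff (Suc n) r * (X r * gY r))" for n
  proof (rule Bochner_Integration.integrable_bound[OF XgY])
    show "(\<lambda>r. log_cutoff (Suc n) r * (X r * gY r)) \<in> borel_measurable half_line"
      unfolding gY_def by (intro continuous_measurable_half_line continuous_intros log_cutoff_continuous cX Y'' U Y_continuous) simp
    show "AE r in half_line. norm (log_cutoff (Suc n) r * (X r * gY r)) \<le> norm (X r * gY r)"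
    proof (rule AE_I2)
      fix r assume "r \<in> space half_line"
      then have "\<bar>log_cutoff (Suc n) r\<bar> \<le> 1" by (intro log_cutoff_values(3)) (auto simp: space_restrict_space)
      then show "norm (log_cutoff (Suc n) r * (X r * gY r)) \<le> norm (X r * gY r)"
        using mult_right_mono[of "\<bar>log_cutoff (Suc n) r\<bar>" 1 "\<bar>X r * gY r\<bar>"] by (simp add: abs_mult)
    qed
  qed
  have lim1: "(\<lambda>n. LINT r|half_line. log_cutoff (Suc n) r * (X r * gY r)) \<longlonglongrightarrow> I"
    unfolding I_def
  proof (rule integral_dominated_convergence[where w = "\<lambda>r. \<bar>X r * gY r\<bar>"])
    show "(\<lambda>r. X r * gY r) \<in> borel_measurable half_line" using XgY by (rule borel_measurable_integrable)
    show "(\<lambda>r. log_cutoff (Suc n) r * (X r * gY r)) \<in> borel_measurable half_line" for n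
      using etai by (rule borel_measurable_integrable)
    show "integrable half_line (\<lambda>r. \<bar>X r * gY r\<bar>)" using XgY by simp
    show "AE r in half_line. (\<lambda>n. log_cutoff (Suc n) r * (X r * gY r)) \<longlonglongrightarrow> X r * gY r"
    proof (rule AE_I2)
      fix r assume "r \<in> space half_line"
      then have r: "r > 0" by (simp add: space_restrict_space)
      have "(\<lambda>n. 1 / real (Suc n)) \<longlonglongrightarrow> 0" by (rule LIMSEQ_Suc[OF lim_1_over_n])
      then have "\<forall>\<^sub>F n in sequentially. 1 / real (Suc n) < r" by (rule order_tendstoD(2)) (rule r)
      then have "\<forall>\<^sub>F n in sequentially. log_cutoff (Suc n) r * (X r * gY r) = X r * gY r"
      proof eventually_elim
        case (elim n)
        then have "r \<ge> exp (- real (Suc n))" using exp_neg_le[of "Suc n"] by simp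
        then show ?case using log_cutoff_values(2)[of "Suc n" r] r by simp
      qed
      then show "(\<lambda>n. log_cutoff (Suc n) r * (X r * gY r)) \<longlonglongrightarrow> X r * gY r" by (rule tendsto_eventually)
    qed
    show "AE r in half_line. norm (log_cutoff (Suc n) r * (X r * gY r)) \<le> \<bar>X r * gY r\<bar>" for n
    proof (rule AE_I2)
      fix r assume "r \<in> space half_line"
      then have "\<bar>log_cutoff (Suc n) r\<bar> \<le> 1" by (intro log_cutoff_values(3)) (auto simp: space_restrict_space)
      then show "norm (log_cutoff (Suc n) r * (X r * gY r)) \<le> \<bar>X r * gY r\<bar>"
        using mult_right_mono[of "\<bar>log_cutoff (Suc n) r\<bar>" 1 "\<bar>X r * gY r\<bar>"] by (simp add: abs_mult)
    qed
  qed
  have diff: "(LINT r|half_line. cut (Suc n) r * gX r) - (LINT r|half_line. log_cutoff (Suc n) r * (X r * gY r)) = (LINT r|half_line. w r)" for n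
  proof -
    have "(LINT r|half_line. cut (Suc n) r * gX r) - (LINT r|half_line. log_cutoff (Suc n) r * (X r * gY r))
      = (LINT r|half_line. cut (Suc n) r * gX r - log_cutoff (Suc n) r * (X r * gY r))"
      by (rule Bochner_Integration.integral_diff[OF cuti etai, symmetric])
    also have "\<dots> = (LINT r|half_line. w r)"
    proof (rule Bochner_Integration.integral_cong[OF refl])
      fix r assume "r \<in> space half_line"
      then have r: "r > 0" by (simp add: space_restrict_space)
      have e: "cut (Suc n) r * gX r - log_cutoff (Suc n) r * (X r * gY r) = log_cutoff (Suc n) r * w r"
        by (simp add: cut_def w_def algebra_simps)
      have le1: "exp (- real (Suc n)) \<le> 1" by simp
      show "cut (Suc n) r * gX r - log_cutoff (Suc n) r * (X r * gY r) = w r"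
      proof (cases "r < 1")
        case True
        then show ?thesis unfolding e using w0[OF r] by simp
      next
        case False
        then have "exp (- real (Suc n)) \<le> r" using le1 by linarith
        then have "log_cutoff (Suc n) r = 1" by (rule log_cutoff_values(2)[OF zero_less_Suc r])
        then show ?thesis unfolding e by simp
      qed
    qed
    finally show ?thesis .
  qed
  have lim2: "(\<lambda>n. complex_of_real (LINT r|half_line. cut (Suc n) r * gX r)) \<longlonglongrightarrow> complex_of_real I"
  proof -
    have cutL: "(\<lambda>r. complex_of_real (cut (Suc n) r)) \<in> L2 half_line" for n
      by (rule L2_continuous_compact[of _ "exp (- 2 * real (Suc n))" "b + 1"])
         (use cut_support[of "Suc n"] in \<open>auto intro!: continuous_intros cut_continuous simp del: of_nat_Suc\<close>)
    have "(\<lambda>n. (L2_norm half_line (\<lambda>r. of_real (cut (Suc n) r) - of_real (Y r)))\<^sup>2) \<longlonglongrightarrow> 0"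
    proof (rule Lim_null_comparison[OF always_eventually[OF allI]])
      show "norm ((L2_norm half_line (\<lambda>r. of_real (cut (Suc n) r) - of_real (Y r)))\<^sup>2) \<le> 4 * C\<^sup>2 * (1 / real (Suc n))" for n
        using cut_L2_distance[of "Suc n"] by simp
      show "(\<lambda>n. 4 * C\<^sup>2 * (1 / real (Suc n))) \<longlonglongrightarrow> 0"
        using tendsto_mult_left[OF LIMSEQ_Suc[OF lim_1_over_n], of "4 * C\<^sup>2"] by simp
    qed
    from tendsto_real_sqrt[OF this]
    have lim: "(\<lambda>n. L2_norm half_line (\<lambda>r. of_real (cut (Suc n) r) - of_real (Y r))) \<longlonglongrightarrow> 0"
      by (simp add: L2_norm_nonneg)
    have "(\<lambda>n. L2_inner half_line (\<lambda>r. complex_of_real (cut (Suc n) r)) f) \<longlonglongrightarrow> L2_inner half_line (\<lambda>r. complex_of_real (Y r)) f"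
      by (rule L2_inner_tendsto(1)[OF cutL Y_L2 f lim])
    moreover have "L2_inner half_line (\<lambda>r. complex_of_real (cut (Suc n) r)) f = complex_of_real (LINT r|half_line. cut (Suc n) r * gX r)" for n
    proof -
      have "L2_inner half_line (\<lambda>r. complex_of_real (cut (Suc n) r)) f =
        L2_inner half_line (\<lambda>r. complex_of_real (cut (Suc n) r)) (\<lambda>r. complex_of_real (gX r))"
        unfolding gX_def by (rule weak_identity_on_cut[OF X X'' dom zero_less_Suc])
      then show ?thesis by (simp only: L2_inner_of_real)
    qed
    moreover have "L2_inner half_line (\<lambda>r. complex_of_real (Y r)) f = complex_of_real I"
    proof -
      have "L2_inner half_line (\<lambda>r. complex_of_real (Y r)) f = cnj (L2_inner half_line f (\<lambda>r. complex_of_real (Y r)))"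
        by (rule L2_inner_cnj[OF f Y_L2])
      also have "L2_inner half_line f (\<lambda>r. complex_of_real (Y r)) = L2_inner half_line (\<lambda>r. complex_of_real (X r)) (\<lambda>r. complex_of_real (gY r))"
        unfolding gY_def by (rule friedrichs_symmetric[OF dom bounded_solution_in_friedrichs_domain, symmetric])
      also have "\<dots> = complex_of_real I"
        by (simp only: L2_inner_of_real I_def)
      finally show ?thesis by simp
    qed
    ultimately show ?thesis by simp
  qed
  have "(\<lambda>n. (LINT r|half_line. cut (Suc n) r * gX r)) \<longlonglongrightarrow> I"
    using tendsto_Re[OF lim2] by simp
  from tendsto_diff[OF this lim1] have "(\<lambda>n::nat. LINT r|half_line. w r) \<longlonglongrightarrow> 0"
    unfolding diff by simp
  then have "(LINT r|half_line. w r) = 0" by (simp add: LIMSEQ_const_iff)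
  then show ?thesis using wint by simp
qed

end

end

section \<open>Phases on the circle\<close>

text \<open>
  As \<open>exp(\<pi>\<sigma>) exp(- i t) - exp(i t) = exp(\<pi>\<sigma>) exp(- i t) (1 - exp(- \<pi>\<sigma>) exp(2 i t))\<close>, the phase is the argument of
  the last factor. This factor moves in the disc of radius \<open>exp(- \<pi>\<sigma>) < 1\<close> around 1, on which the principal argument is continuous.
\<close>

definition circle_phase :: "real \<Rightarrow> real \<Rightarrow> real" where
  "circle_phase \<sigma> t = Arg (1 - of_real (exp (- pi * \<sigma>)) * exp (2 * \<i> * of_real t))"

lemma circle_phase_Re_pos:
  assumes "\<sigma> > 0"
  shows "Re (1 - of_real (exp (- pi * \<sigma>)) * exp (2 * \<i> * of_real t)) > 0"
proof -
  have "Re (of_real (exp (- pi * \<sigma>)) * exp (2 * \<i> * of_real t)) \<le> cmod (of_real (exp (- pi * \<sigma>)) * exp (2 * \<i> * of_real t))"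
    by (rule complex_Re_le_cmod)
  also have "\<dots> = exp (- pi * \<sigma>)" unfolding norm_mult norm_of_real by simp
  also have "\<dots> < 1" using assms by simp
  finally show ?thesis by (simp only: minus_complex.simps one_complex.simps diff_gt_0_iff_gt)
qed

lemma circle_phase_equation:
  assumes "\<sigma> > 0"
  obtains \<rho> where "\<And>t. \<rho> t > 0" "\<And>t. exp (of_real (pi * \<sigma>)) * exp (- \<i> * of_real t) - exp (\<i> * of_real t)
     = of_real (\<rho> t) * exp (\<i> * of_real (circle_phase \<sigma> t - t))"
proof -
  define g where "g = (\<lambda>t. 1 - of_real (exp (- pi * \<sigma>)) * exp (2 * \<i> * of_real t) :: complex)"
  have nz: "g t \<noteq> 0" for t
    using circle_phase_Re_pos[OF assms, of t] unfolding g_def by (metis zero_complex.simps(1) less_irrefl)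
  have eqn: "exp (of_real (pi * \<sigma>)) * exp (- \<i> * of_real t) - exp (\<i> * of_real t)
     = of_real (exp (pi * \<sigma>) * cmod (g t)) * exp (\<i> * of_real (circle_phase \<sigma> t - t))" for t
  proof -
    have e1: "of_real (exp (pi * \<sigma>)) * of_real (exp (- pi * \<sigma>)) = (1 :: complex)"
      by (simp flip: of_real_mult exp_add)
    have e2: "exp (- \<i> * of_real t) * exp (2 * \<i> * of_real t) = exp (\<i> * of_real t)"
      by (simp flip: exp_add)
    have "of_real (exp (pi * \<sigma>) * cmod (g t)) * exp (\<i> * of_real (circle_phase \<sigma> t - t))
      = of_real (exp (pi * \<sigma>)) * exp (- \<i> * of_real t) * (of_real (cmod (g t)) * exp (\<i> * of_real (Arg (g t))))"
      by (simp add: circle_phase_def g_def algebra_simps exp_diff exp_minus divide_inverse)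
    also have "of_real (cmod (g t)) * exp (\<i> * of_real (Arg (g t))) = g t"
      using Arg_eq[OF nz] by simp
    also have "of_real (exp (pi * \<sigma>)) * exp (- \<i> * of_real t) * g t =
      of_real (exp (pi * \<sigma>)) * exp (- \<i> * of_real t) - (of_real (exp (pi * \<sigma>)) * of_real (exp (- pi * \<sigma>))) * (exp (- \<i> * of_real t) * exp (2 * \<i> * of_real t))"
      by (simp add: g_def algebra_simps)
    finally have "of_real (exp (pi * \<sigma>) * cmod (g t)) * exp (\<i> * of_real (circle_phase \<sigma> t - t)) =
      of_real (exp (pi * \<sigma>)) * exp (- \<i> * of_real t) - exp (\<i> * of_real t)"
      unfolding e1 e2 by (simp only: mult_1_left)
    then show ?thesis unfolding exp_of_real by (rule sym)
  qed
  have pos: "exp (pi * \<sigma>) * cmod (g t) > 0" for t using nz by simp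
  show ?thesis by (rule that[of "\<lambda>t. exp (pi * \<sigma>) * cmod (g t)", OF pos eqn])
qed

lemma circle_phase_continuous:
  assumes "\<sigma> > 0"
  shows "continuous_on UNIV (circle_phase \<sigma>)"
proof (rule continuous_at_imp_continuous_on, rule ballI)
  fix t :: real
  let ?g = "\<lambda>t::real. 1 - of_real (exp (- pi * \<sigma>)) * exp (2 * \<i> * of_real t) :: complex"
  have "?g t \<notin> \<real>\<^sub>\<le>\<^sub>0"
    using circle_phase_Re_pos[OF assms, of t] by (auto simp: complex_nonpos_Reals_iff)
  then have "isCont Arg (?g t)" by (rule continuous_at_Arg)
  moreover have "isCont ?g t" by (intro continuous_intros)
  ultimately show "isCont (circle_phase \<sigma>) t"
    unfolding circle_phase_def[abs_def] by (rule isCont_o2[rotated])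
qed

text \<open>
  Two continuous solutions of the equation differ by a continuous function with values in \<open>2\<pi>\<int>\<close>,
  so the value at 0 fixes the solution.
\<close>

lemma sigma_per_eq_circle_phase:
  assumes "\<sigma> > 0"
  shows "sigma_per \<sigma> = circle_phase \<sigma>"
  unfolding sigma_per_def
proof (rule the_equality)
  obtain \<rho> where \<rho>: "\<And>t. \<rho> t > 0" "\<And>t. exp (of_real (pi * \<sigma>)) * exp (- \<i> * of_real t) - exp (\<i> * of_real t)
     = of_real (\<rho> t) * exp (\<i> * of_real (circle_phase \<sigma> t - t))"
    using circle_phase_equation[OF assms] by blast
  have per: "circle_phase \<sigma> (t + 2 * pi) = circle_phase \<sigma> t" for t
  proof -
    have "2 * \<i> * of_real (t + 2 * pi) = 2 * \<i> * of_real t + (2 * of_real pi * \<i> + 2 * of_real pi * \<i>)"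
      by (simp add: algebra_simps)
    then have "exp (2 * \<i> * of_real (t + 2 * pi)) = exp (2 * \<i> * of_real t)"
      by (simp only: exp_add exp_two_pi_i mult_1_right)
    then show ?thesis unfolding circle_phase_def by simp
  qed
  have zero: "circle_phase \<sigma> 0 = 0"
  proof -
    have "circle_phase \<sigma> 0 = Arg (of_real (1 - exp (- pi * \<sigma>)))" by (simp add: circle_phase_def)
    also have "\<dots> = 0"
    proof -
      have "exp (- pi * \<sigma>) \<le> 1" using assms by simp
      then show ?thesis unfolding Arg_of_real by simp
    qed
    finally show ?thesis .
  qed
  show "continuous_on UNIV (circle_phase \<sigma>) \<and> (\<forall>t. circle_phase \<sigma> (t + 2 * pi) = circle_phase \<sigma> t) \<and> circle_phase \<sigma> 0 = 0 \<and>
        (\<exists>\<rho>::real \<Rightarrow> real. \<forall>t. \<rho> t > 0 \<and>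
           exp (of_real (pi * \<sigma>)) * exp (- \<i> * of_real t) - exp (\<i> * of_real t)
             = of_real (\<rho> t) * exp (\<i> * of_real (circle_phase \<sigma> t - t)))"
    using circle_phase_continuous[OF assms] per zero \<rho> by blast
  fix p
  assume p: "continuous_on UNIV p \<and> (\<forall>t. p (t + 2 * pi) = p t) \<and> p 0 = 0 \<and>
        (\<exists>\<rho>::real \<Rightarrow> real. \<forall>t. \<rho> t > 0 \<and>
           exp (of_real (pi * \<sigma>)) * exp (- \<i> * of_real t) - exp (\<i> * of_real t)
             = of_real (\<rho> t) * exp (\<i> * of_real (p t - t)))"
  then obtain \<rho>' where \<rho>': "\<And>t. \<rho>' t > 0" "\<And>t. exp (of_real (pi * \<sigma>)) * exp (- \<i> * of_real t) - exp (\<i> * of_real t)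
             = of_real (\<rho>' t) * exp (\<i> * of_real (p t - t))" by blast
  have E: "exp (\<i> * of_real (p t - circle_phase \<sigma> t)) = 1" for t
  proof -
    have eq: "of_real (\<rho>' t) * exp (\<i> * of_real (p t - t)) = of_real (\<rho> t) * exp (\<i> * of_real (circle_phase \<sigma> t - t))"
      using \<rho>(2)[of t] \<rho>'(2)[of t] by simp
    from arg_cong[OF eq, of cmod] have "\<rho>' t = \<rho> t"
      using \<rho>(1)[of t] \<rho>'(1)[of t] unfolding norm_mult norm_of_real by simp
    then have "exp (\<i> * of_real (p t - t)) = exp (\<i> * of_real (circle_phase \<sigma> t - t))"
      using eq \<rho>(1)[of t] by simp
    moreover have "exp (\<i> * of_real (p t - circle_phase \<sigma> t)) = exp (\<i> * of_real (p t - t)) / exp (\<i> * of_real (circle_phase \<sigma> t - t))"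
      by (simp add: algebra_simps flip: exp_diff)
    ultimately show ?thesis by simp
  qed
  define d where "d = (\<lambda>t. (p t - circle_phase \<sigma> t) / (2 * pi))"
  have dc: "continuous_on UNIV d" unfolding d_def using p circle_phase_continuous[OF assms] by (auto intro!: continuous_intros)
  have dZ: "d t \<in> \<int>" for t
  proof -
    obtain n :: int where "\<i> * of_real (p t - circle_phase \<sigma> t) = of_int (2 * n) * of_real pi * \<i>"
      using E[of t] exp_eq_1[of "\<i> * of_real (p t - circle_phase \<sigma> t)"] by (auto simp: complex_eq_iff)
    then have "p t - circle_phase \<sigma> t = of_int (2 * n) * pi" by (simp add: complex_eq_iff)
    then have "d t = of_int n" by (simp add: d_def)
    then show ?thesis by simp
  qed
  have "d constant_on UNIV"
  proof (rule continuous_discrete_range_constant[OF connected_UNIV dc])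
    fix x :: real
    show "\<exists>e>0. \<forall>y. y \<in> UNIV \<and> d y \<noteq> d x \<longrightarrow> e \<le> norm (d y - d x)"
    proof (intro exI[of _ 1] conjI allI impI)
      fix y assume "y \<in> UNIV \<and> d y \<noteq> d x"
      moreover have "d y - d x \<in> \<int>" by (intro Ints_diff dZ)
      ultimately show "1 \<le> norm (d y - d x)" by (auto intro: Ints_nonzero_abs_ge1)
    qed simp
  qed
  then obtain k where "\<And>t. d t = k" unfolding constant_on_def by blast
  moreover have "d 0 = 0" using p zero by (simp add: d_def)
  ultimately have "d t = 0" for t by metis
  then show "p = circle_phase \<sigma>" by (auto simp: d_def)
qed

text \<open>
  Once \<open>exp(2 i \<psi>)\<close> is close to 1, the quotient of \<open>\<psi> - Arg (exp(2 i \<psi>)) / 2\<close> by \<open>\<pi>\<close> is a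
  continuous integer, hence constant.
\<close>

lemma continuous_phase_converges:
  fixes \<psi> :: "real \<Rightarrow> real"
  assumes c: "continuous_on {0<..} \<psi>" and lim: "((\<lambda>E. exp (2 * \<i> * of_real (\<psi> E))) \<longlongrightarrow> 1) (at_right 0)"
  obtains l where "(\<psi> \<longlongrightarrow> l) (at_right 0)"
proof -
  have "\<forall>\<^sub>F E in at_right 0. dist (exp (2 * \<i> * of_real (\<psi> E))) 1 < 1"
    by (rule tendstoD[OF lim]) simp
  then obtain E0 where E0: "E0 > 0" "\<And>E. 0 < E \<Longrightarrow> E < E0 \<Longrightarrow> dist (exp (2 * \<i> * of_real (\<psi> E))) 1 < 1"
    unfolding eventually_at_right_field by auto
  have npos: "exp (2 * \<i> * of_real (\<psi> E)) \<notin> \<real>\<^sub>\<le>\<^sub>0" if "0 < E" "E < E0" for E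
  proof -
    have "Re (1 - exp (2 * \<i> * of_real (\<psi> E))) < 1"
      using E0(2)[OF that] complex_Re_le_cmod[of "1 - exp (2 * \<i> * of_real (\<psi> E))"]
      by (simp add: dist_norm norm_minus_commute)
    then show ?thesis by (auto simp: complex_nonpos_Reals_iff)
  qed
  define q where "q = (\<lambda>E. (\<psi> E - Arg (exp (2 * \<i> * of_real (\<psi> E))) / 2) / pi)"
  have qc: "continuous_on {0<..<E0} q"
  proof -
    have 1: "continuous_on {0<..<E0} \<psi>" by (rule continuous_on_subset[OF c]) auto
    have 2: "continuous_on {0<..<E0} (\<lambda>E. exp (2 * \<i> * of_real (\<psi> E)))"
      by (intro continuous_intros continuous_on_of_real 1)
    have 3: "continuous_on (- \<real>\<^sub>\<le>\<^sub>0) Arg" by (intro continuous_at_imp_continuous_on ballI continuous_at_Arg) auto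
    have 4: "continuous_on {0<..<E0} (\<lambda>E. Arg (exp (2 * \<i> * of_real (\<psi> E))))"
      by (rule continuous_on_compose2[OF 3 2]) (auto simp: npos)
    show ?thesis unfolding q_def
      by (intro continuous_on_divide continuous_on_diff continuous_on_const 1 4) auto
  qed
  have qZ: "q E \<in> \<int>" for E
  proof -
    let ?z = "exp (2 * \<i> * of_real (\<psi> E))"
    have "?z = exp (\<i> * of_real (Arg ?z))" using Arg_eq[of ?z] by simp
    then obtain n :: int where "2 * \<i> * of_real (\<psi> E) = \<i> * of_real (Arg ?z) + of_int (2 * n) * pi * \<i>"
      unfolding exp_eq by blast
    then have "2 * \<psi> E = Arg ?z + of_int (2 * n) * pi" by (simp add: complex_eq_iff)
    then have "q E = of_int n" by (simp add: q_def field_simps)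
    then show ?thesis by simp
  qed
  have "q constant_on {0<..<E0}"
  proof (rule continuous_discrete_range_constant[OF _ qc])
    fix x assume "x \<in> {0<..<E0}"
    show "\<exists>e>0. \<forall>y. y \<in> {0<..<E0} \<and> q y \<noteq> q x \<longrightarrow> e \<le> norm (q y - q x)"
    proof (intro exI[of _ 1] conjI allI impI)
      fix y assume "y \<in> {0<..<E0} \<and> q y \<noteq> q x"
      moreover have "q y - q x \<in> \<int>" by (intro Ints_diff qZ)
      ultimately show "1 \<le> norm (q y - q x)" by (auto intro: Ints_nonzero_abs_ge1)
    qed simp
  qed simp
  then obtain k where k: "\<And>E. E \<in> {0<..<E0} \<Longrightarrow> q E = k" unfolding constant_on_def by blast
  have "((\<lambda>E. pi * k + Arg (exp (2 * \<i> * of_real (\<psi> E))) / 2) \<longlongrightarrow> pi * k + Arg 1 / 2) (at_right 0)"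
    by (intro tendsto_intros isCont_tendsto_compose[OF continuous_at_Arg lim]) (auto simp: complex_nonpos_Reals_iff)
  moreover have "\<forall>\<^sub>F E in at_right 0. pi * k + Arg (exp (2 * \<i> * of_real (\<psi> E))) / 2 = \<psi> E"
    unfolding eventually_at_right_field
  proof (intro exI[of _ E0] conjI allI impI)
    fix E assume "0 < E" "E < E0"
    then have "q E = k" by (intro k) auto
    then show "pi * k + Arg (exp (2 * \<i> * of_real (\<psi> E))) / 2 = \<psi> E" by (auto simp: q_def)
  qed (rule E0(1))
  ultimately have "(\<psi> \<longlongrightarrow> pi * k + Arg 1 / 2) (at_right 0)" by (rule Lim_transform_eventually)
  then show ?thesis using that by blast
qed

text \<open>
  Two sequences on which the phase is \<open>0\<close> and \<open>\<pi>/2\<close> modulo \<open>2\<pi>\<close> recover the real and the imaginary part.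
\<close>

lemma oscillation_determines_amplitude:
  assumes k: "k > 0" and lim: "((\<lambda>r::real. Re (z * exp (\<i> * of_real (k * r)))) \<longlongrightarrow> 0) at_top"
  shows "z = 0"
proof -
  have seq: "filterlim (\<lambda>n::nat. (2 * pi * real n + c) / k) at_top sequentially" for c
    using k by real_asymp
  have e: "exp (\<i> * of_real (k * ((2 * pi * real n + c) / k))) = exp (\<i> * of_real c)" for n :: nat and c
  proof -
    have "exp (\<i> * of_real (k * ((2 * pi * real n + c) / k))) = exp (\<i> * of_real c + of_nat n * (2 * of_real pi * \<i>))"
    proof -
      have "k * ((2 * pi * real n + c) / k) = c + real n * (2 * pi)" using k by simp
      then show ?thesis by (simp only:) (simp add: algebra_simps)
    qed
    also have "\<dots> = exp (\<i> * of_real c) * exp (2 * of_real pi * \<i>) ^ n"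
      by (simp only: exp_add exp_of_nat_mult)
    finally show ?thesis by (simp only: exp_two_pi_i power_one mult_1_right)
  qed
  have R: "Re (z * exp (\<i> * of_real c)) = 0" for c
    using filterlim_compose[OF lim seq[of c]] unfolding e by (simp add: LIMSEQ_const_iff)
  have "Re z = 0" using R[of 0] by simp
  moreover have "Im z = 0" using R[of "pi / 2"] cis_conv_exp[of "pi / 2"] by simp
  ultimately show ?thesis by (simp add: complex_eq_iff)
qed

section \<open>The effective potential\<close>

text \<open>
  The logarithmic derivative of \<open>sqrt r * exp(- k r\<^sup>\<epsilon> / \<epsilon>)\<close>. The first factor saturates the critical Hardy
  potential \<open>- 1 / (4 r\<^sup>2)\<close>; the second one, with \<open>k \<epsilon> = c + 1\<close>, absorbs the less singular
  perturbation and leaves room for the quadratic term near 0.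
\<close>

lemma riccati_supersolution:
  fixes U :: "real \<Rightarrow> real"
  assumes \<epsilon>: "0 < \<epsilon>" "\<epsilon> \<le> 1" and "c \<ge> 0"
    and near: "\<And>r. 0 < r \<Longrightarrow> r \<le> 1 \<Longrightarrow> - (1 / (4 * r\<^sup>2)) - c * r powr (\<epsilon> - 2) \<le> U r"
    and far: "\<And>r. r \<ge> 1 \<Longrightarrow> - B \<le> U r"
  obtains h h' K where "\<And>r. r > 0 \<Longrightarrow> (h has_real_derivative h' r) (at r)" "continuous_on {0<..} h'"
    "\<And>r. r > 0 \<Longrightarrow> h' r + (h r)\<^sup>2 \<le> U r + K" "K \<ge> 0"
proof -
  define k where "k = (c + 1) / \<epsilon>"
  have k: "k > 0" "k * \<epsilon> = c + 1" using \<epsilon> \<open>c \<ge> 0\<close> by (simp_all add: k_def)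
  (* k is chosen so that the term of order r^(epsilon - 2) has the coefficient - (c + 1) *)
  define h where "h = (\<lambda>r::real. 1 / (2 * r) - k * r powr (\<epsilon> - 1))"
  define h' where "h' = (\<lambda>r::real. - (1 / (2 * r\<^sup>2)) - k * (\<epsilon> - 1) * r powr (\<epsilon> - 2))"
  have h: "(h has_real_derivative h' r) (at r)" if "r > 0" for r
  proof -
    have 1: "((\<lambda>r. 1 / (2 * r)) has_real_derivative - (1 / (2 * r\<^sup>2))) (at r)"
      using that by (auto intro!: derivative_eq_intros simp: power2_eq_square)
    have 2: "((\<lambda>r. r powr (\<epsilon> - 1)) has_real_derivative (\<epsilon> - 1) * r powr (\<epsilon> - 1 - 1)) (at r)"
      by (rule has_real_derivative_powr[OF that])
    show ?thesis
      unfolding h_def h'_def using DERIV_diff[OF 1 DERIV_cmult[OF 2, of k]] by (simp add: mult.assoc)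
  qed
  have sum: "h' r + (h r)\<^sup>2 = - (1 / (4 * r\<^sup>2)) - k * \<epsilon> * r powr (\<epsilon> - 2) + k\<^sup>2 * r powr (2 * \<epsilon> - 2)" if r: "r > 0" for r
  proof -
    have p1: "r powr (\<epsilon> - 1) * (1 / r) = r powr (\<epsilon> - 2)"
    proof -
      have "r powr (\<epsilon> - 1) * (1 / r) = r powr (\<epsilon> - 1) * r powr (- 1)" using r by (simp add: powr_minus_divide)
      also have "\<dots> = r powr (\<epsilon> - 2)" unfolding powr_add[symmetric] by simp
      finally show ?thesis .
    qed
    have p2: "r powr (\<epsilon> - 1) * r powr (\<epsilon> - 1) = r powr (2 * \<epsilon> - 2)"
      unfolding powr_add[symmetric] by (simp add: algebra_simps)
    have "(h r)\<^sup>2 = 1 / (4 * r\<^sup>2) - k * (r powr (\<epsilon> - 1) * (1 / r)) + k\<^sup>2 * (r powr (\<epsilon> - 1) * r powr (\<epsilon> - 1))"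
      unfolding h_def using r by (simp add: power2_eq_square field_simps)
    then have H: "(h r)\<^sup>2 = 1 / (4 * r\<^sup>2) - k * r powr (\<epsilon> - 2) + k\<^sup>2 * r powr (2 * \<epsilon> - 2)" unfolding p1 p2 .
    have q: "1 / (2 * r\<^sup>2) = 2 * (1 / (4 * r\<^sup>2))" by simp
    have gen: "- (2 * x) - k * (\<epsilon> - 1) * y + (x - k * y + k\<^sup>2 * z) = - x - k * \<epsilon> * y + k\<^sup>2 * z" for x y z
      by (simp add: algebra_simps)
    show ?thesis unfolding h'_def H q by (rule gen)
  qed
  (* below r0 the quadratic term k^2 r^(2 epsilon - 2) is at most r^(epsilon - 2) *)
  define r0 where "r0 = (1 + k\<^sup>2) powr (- (1 / \<epsilon>))"
  have k2: "1 + k\<^sup>2 \<ge> 1" by simp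
  have r0: "r0 > 0" unfolding r0_def using k2 by (simp add: powr_gt_zero) (smt (verit) zero_le_power2)
  have r01: "r0 \<le> 1"
  proof -
    have "(1 + k\<^sup>2) powr (- (1 / \<epsilon>)) \<le> (1 + k\<^sup>2) powr 0" using k2 \<epsilon> by (intro powr_mono) auto
    then show ?thesis using k2 by (simp add: r0_def)
  qed
  have r0\<epsilon>: "r0 powr \<epsilon> = 1 / (1 + k\<^sup>2)"
  proof -
    have "r0 powr \<epsilon> = (1 + k\<^sup>2) powr (- 1)" unfolding r0_def powr_powr using \<epsilon> by simp
    also have "\<dots> = 1 / (1 + k\<^sup>2)" using k2 by (subst powr_minus_divide) (simp add: add_nonneg_nonneg)
    finally show ?thesis .
  qed
  define B' where "B' = max \<bar>B\<bar> (1 / (4 * r0\<^sup>2) + c * r0 powr (\<epsilon> - 2))"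
  define K where "K = B' + k\<^sup>2 * r0 powr (2 * \<epsilon> - 2)"
  have B'0: "B' \<ge> 0" by (simp add: B'_def le_max_iff_disj)
  have K: "K \<ge> 0" using B'0 by (simp add: K_def)
  have ric: "h' r + (h r)\<^sup>2 \<le> U r + K" if r: "r > 0" for r
  proof (cases "r < r0")
    case True
    have "k\<^sup>2 * r powr (2 * \<epsilon> - 2) = (k\<^sup>2 * r powr \<epsilon>) * r powr (\<epsilon> - 2)"
      unfolding mult.assoc powr_add[symmetric] by simp
    also have "\<dots> \<le> 1 * r powr (\<epsilon> - 2)"
    proof (rule mult_right_mono)
      have "r powr \<epsilon> \<le> r0 powr \<epsilon>" using True r \<epsilon> by (intro powr_mono2) auto
      then have "k\<^sup>2 * r powr \<epsilon> \<le> k\<^sup>2 * (1 / (1 + k\<^sup>2))" unfolding r0\<epsilon> by (intro mult_left_mono) auto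
      also have "\<dots> \<le> 1" using k2 by (simp add: divide_simps) (smt (verit) zero_le_power2)
      finally show "k\<^sup>2 * r powr \<epsilon> \<le> 1" .
    qed simp
    finally have "h' r + (h r)\<^sup>2 \<le> - (1 / (4 * r\<^sup>2)) - (k * \<epsilon> - 1) * r powr (\<epsilon> - 2)"
      unfolding sum[OF r] by (simp add: algebra_simps)
    also have "\<dots> = - (1 / (4 * r\<^sup>2)) - c * r powr (\<epsilon> - 2)" unfolding k(2) by simp
    also have "\<dots> \<le> U r" using True r r01 by (intro near) auto
    finally show ?thesis using K by linarith
  next
    case False
    then have rr: "r \<ge> r0" by simp
    have "- B' \<le> U r"
    proof (cases "r \<le> 1")
      case True
      have "r0\<^sup>2 \<le> r\<^sup>2" using rr r0 by (intro power_mono) auto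
      then have 1: "1 / (4 * r\<^sup>2) \<le> 1 / (4 * r0\<^sup>2)" using r0 r by (intro divide_left_mono) auto
      have "r powr (\<epsilon> - 2) \<le> r0 powr (\<epsilon> - 2)" using rr r0 \<epsilon> by (intro powr_mono2') auto
      then have 2: "c * r powr (\<epsilon> - 2) \<le> c * r0 powr (\<epsilon> - 2)" using \<open>c \<ge> 0\<close> by (rule mult_left_mono)
      have "1 / (4 * r0\<^sup>2) + c * r0 powr (\<epsilon> - 2) \<le> B'" by (simp add: B'_def)
      then show ?thesis using near[OF r True] 1 2 by linarith
    next
      case False
      then have "- B \<le> U r" by (intro far) simp
      moreover have "\<bar>B\<bar> \<le> B'" by (simp add: B'_def)
      ultimately show ?thesis by linarith
    qed
    moreover have "h' r + (h r)\<^sup>2 \<le> k\<^sup>2 * r0 powr (2 * \<epsilon> - 2)"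
    proof -
      have "k\<^sup>2 * r powr (2 * \<epsilon> - 2) \<le> k\<^sup>2 * r0 powr (2 * \<epsilon> - 2)"
        using rr r0 \<epsilon> by (intro mult_left_mono powr_mono2') auto
      moreover have "0 \<le> k * \<epsilon> * r powr (\<epsilon> - 2)" "0 \<le> 1 / (4 * r\<^sup>2)" using k \<epsilon> \<open>c \<ge> 0\<close> by auto
      ultimately show ?thesis unfolding sum[OF r] by linarith
    qed
    ultimately show ?thesis unfolding K_def by linarith
  qed
  have "continuous_on {0<..} h'" unfolding h'_def by (intro continuous_intros) auto
  then show ?thesis using that h ric K by blast
qed

definition effective_potential :: "nat \<Rightarrow> nat \<Rightarrow> real \<Rightarrow> (real \<Rightarrow> real) \<Rightarrow> (real \<Rightarrow> real) \<Rightarrow> real \<Rightarrow> real" where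
  "effective_potential d l \<gamma> chi W2 r = V_inf d l \<gamma> chi r + V_rem d l chi W2 r"

text \<open>
  The factor \<open>exp(2t)\<close> comes from the change of variables \<open>r = exp t\<close>, and the constant \<open>1/4\<close> from
  the factor \<open>sqrt r\<close> that removes the first-order term.
\<close>

definition log_potential :: "nat \<Rightarrow> nat \<Rightarrow> real \<Rightarrow> (real \<Rightarrow> real) \<Rightarrow> (real \<Rightarrow> real) \<Rightarrow> real \<Rightarrow> real" where
  "log_potential d l \<gamma> chi W2 t = exp (2 * t) * effective_potential d l \<gamma> chi W2 (exp t) + 1 / 4"

lemma effective_potential_continuous:
  assumes "cutoff_pair chi chi'" "admissible_potential \<gamma> chi W W2"
  shows "continuous_on {0<..} (effective_potential d l \<gamma> chi W2)"
proof -
  have "continuous_on {0<..} chi" using assms by (intro smooth_on_continuous) (simp add: cutoff_pair_def)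
  moreover have "continuous_on {0<..} W2" using assms by (simp add: admissible_potential_def)
  ultimately show ?thesis
    unfolding effective_potential_def V_inf_def V_rem_def by (intro continuous_intros) auto
qed

lemma effective_potential_near_0:
  assumes "cutoff_pair chi chi'" "0 < r" "r \<le> 1"
  shows "effective_potential d l \<gamma> chi W2 r = ((ang d l)\<^sup>2 - 1 / 4) / r\<^sup>2 + W2 r"
proof -
  have "chi r = 0" using assms unfolding cutoff_pair_def by blast
  then show ?thesis by (simp add: effective_potential_def V_inf_def V_rem_def)
qed

lemma effective_potential_far:
  assumes "cutoff_pair chi chi'" "r \<ge> 2"
  shows "effective_potential d l \<gamma> chi W2 r = ((ang d l)\<^sup>2 - \<gamma> - 1 / 4) / r\<^sup>2 + W2 r"
proof -
  have "chi r = 1" using assms unfolding cutoff_pair_def by blast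
  then show ?thesis by (simp add: effective_potential_def V_inf_def V_rem_def nu_sq_def)
qed

text \<open>
  For \<open>t \<le> 0\<close> and for \<open>t \<ge> 1\<close> (where \<open>exp t \<ge> 2\<close>) the cutoffs are constant and only \<open>W2\<close>
  contributes. The compact interval in between is absorbed into the constant.
\<close>

lemma log_potential_bounds:
  assumes cut: "cutoff_pair chi chi'" and adm: "admissible_potential \<gamma> chi W W2"
    and \<sigma>: "\<sigma>\<^sup>2 = \<gamma> - (ang d l)\<^sup>2"
  obtains \<epsilon> c where "0 < \<epsilon>" "\<epsilon> \<le> 1" "c \<ge> 0"
    "\<And>t. t \<le> 0 \<Longrightarrow> \<bar>log_potential d l \<gamma> chi W2 t - (ang d l)\<^sup>2\<bar> \<le> c * exp (\<epsilon> * t)"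
    "\<And>t. t \<ge> 0 \<Longrightarrow> \<bar>log_potential d l \<gamma> chi W2 t + \<sigma>\<^sup>2\<bar> \<le> c * exp (- \<epsilon> * t)"
    "continuous_on UNIV (log_potential d l \<gamma> chi W2)"
proof -
  let ?P = "log_potential d l \<gamma> chi W2"
  obtain \<epsilon>1 c1 where 1: "\<epsilon>1 > 0" "c1 > 0" "\<forall>r>1. \<bar>W2 r\<bar> \<le> c1 * r powr (- 2 - \<epsilon>1)"
    using adm unfolding admissible_potential_def by blast
  obtain \<epsilon>2 c2 where 2: "\<epsilon>2 > 0" "c2 > 0" "\<forall>r. 0 < r \<and> r \<le> 1 \<longrightarrow> \<bar>W2 r\<bar> \<le> c2 * r powr (\<epsilon>2 - 2)"
    using adm unfolding admissible_potential_def by blast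
  have cont: "continuous_on UNIV ?P"
    unfolding log_potential_def[abs_def]
    by (intro continuous_intros continuous_on_compose2[OF effective_potential_continuous[OF cut adm]]) auto
  define \<epsilon> where "\<epsilon> = min 1 (min \<epsilon>1 \<epsilon>2)"
  have \<epsilon>: "\<epsilon> > 0" "\<epsilon> \<le> 1" "\<epsilon> \<le> \<epsilon>1" "\<epsilon> \<le> \<epsilon>2" using 1 2 by (auto simp: \<epsilon>_def)
  have pw: "exp t powr a = exp (a * t)" for t a :: real by (simp add: powr_def)
  have e2: "exp (2 * t) = (exp t)\<^sup>2" for t :: real by (simp add: exp_double)
  have near: "\<bar>?P t - (ang d l)\<^sup>2\<bar> \<le> c2 * exp (\<epsilon> * t)" if t: "t \<le> 0" for t
  proof -
    have r: "0 < exp t" "exp t \<le> 1" using t by auto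
    have "?P t - (ang d l)\<^sup>2 = exp (2 * t) * W2 (exp t)"
      unfolding log_potential_def effective_potential_near_0[OF cut r] e2 by (simp add: field_simps)
    then have "\<bar>?P t - (ang d l)\<^sup>2\<bar> = exp (2 * t) * \<bar>W2 (exp t)\<bar>" by (simp add: abs_mult)
    also have "\<dots> \<le> exp (2 * t) * (c2 * exp t powr (\<epsilon>2 - 2))" using 2(3) r by (intro mult_left_mono) auto
    also have "\<dots> = c2 * exp (\<epsilon>2 * t)" unfolding pw by (simp add: algebra_simps flip: exp_add)
    also have "\<dots> \<le> c2 * exp (\<epsilon> * t)" using 2(2) \<epsilon>(4) t by (intro mult_left_mono) (auto intro: mult_right_mono_neg)
    finally show ?thesis .
  qed
  have far: "\<bar>?P t + \<sigma>\<^sup>2\<bar> \<le> c1 * exp (- \<epsilon> * t)" if t: "t \<ge> 1" for t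
  proof -
    have "2 \<le> exp (1::real)" using exp_ge_add_one_self[of 1] by simp
    also have "\<dots> \<le> exp t" using t by simp
    finally have r: "exp t \<ge> 2" .
    have "?P t + \<sigma>\<^sup>2 = exp (2 * t) * W2 (exp t)"
      unfolding log_potential_def effective_potential_far[OF cut r] \<sigma> e2 by (simp add: field_simps)
    then have "\<bar>?P t + \<sigma>\<^sup>2\<bar> = exp (2 * t) * \<bar>W2 (exp t)\<bar>" by (simp add: abs_mult)
    also have "\<dots> \<le> exp (2 * t) * (c1 * exp t powr (- 2 - \<epsilon>1))" using 1(3)[rule_format, of "exp t"] r t by (intro mult_left_mono) auto
    also have "\<dots> = c1 * exp (- \<epsilon>1 * t)" unfolding pw by (simp add: algebra_simps flip: exp_add)
    also have "\<dots> \<le> c1 * exp (- \<epsilon> * t)" using 1(2) \<epsilon>(3) t by (intro mult_left_mono) (auto intro: mult_right_mono)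
    finally show ?thesis .
  qed
  have "continuous_on {0..1} (\<lambda>t. ?P t + \<sigma>\<^sup>2)" by (intro continuous_intros continuous_on_subset[OF cont]) auto
  from compact_imp_bounded[OF compact_continuous_image[OF this compact_Icc]]
  obtain T where T: "\<forall>t\<in>{0..1}. \<bar>?P t + \<sigma>\<^sup>2\<bar> \<le> T" unfolding bounded_iff by auto
  have T0: "T \<ge> 0" using T[rule_format, of 0] order_trans[OF abs_ge_zero] by simp
  define c where "c = c1 + c2 + T * exp 1"
  have c: "c1 \<le> c" "c2 \<le> c" "T * exp 1 \<le> c" "c \<ge> 0" using 1(2) 2(2) T0 by (simp_all add: c_def)
  have far': "\<bar>?P t + \<sigma>\<^sup>2\<bar> \<le> c * exp (- \<epsilon> * t)" if t: "t \<ge> 0" for t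
  proof (cases "t \<ge> 1")
    case True
    then show ?thesis using far[OF True] c(1) by (auto intro: order_trans mult_right_mono)
  next
    case False
    then have t1: "t \<in> {0..1}" using t by simp
    have "\<epsilon> * t \<le> 1 * 1" using \<epsilon> t1 by (intro mult_mono) auto
    then have "1 \<le> exp 1 * exp (- \<epsilon> * t)" by (simp flip: exp_add)
    then have "T * 1 \<le> T * (exp 1 * exp (- \<epsilon> * t))" using T0 by (rule mult_left_mono)
    also have "\<dots> \<le> c * exp (- \<epsilon> * t)" unfolding mult.assoc[symmetric] using c(3) by (intro mult_right_mono) auto
    finally show ?thesis using T t1 by force
  qed
  have near': "\<bar>?P t - (ang d l)\<^sup>2\<bar> \<le> c * exp (\<epsilon> * t)" if t: "t \<le> 0" for t
    using near[OF t] c(2) by (auto intro: order_trans mult_right_mono)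
  show ?thesis by (rule that[OF \<epsilon>(1,2) c(4) near' far' cont])
qed

section \<open>Regular solutions of the radial equation\<close>

locale radial_problem =
  fixes d l :: nat and \<gamma> \<sigma> :: real and chi chi' W W2 :: "real \<Rightarrow> real"
  assumes d: "d \<ge> 2" and cut: "cutoff_pair chi chi'" and adm: "admissible_potential \<gamma> chi W W2"
    and \<sigma>: "\<sigma> > 0" and \<sigma>2: "\<sigma>\<^sup>2 = \<gamma> - (ang d l)\<^sup>2"
begin

abbreviation U :: "real \<Rightarrow> real" where "U \<equiv> effective_potential d l \<gamma> chi W2"
abbreviation P :: "real \<Rightarrow> real" where "P \<equiv> log_potential d l \<gamma> chi W2"
abbreviation regular :: "real \<Rightarrow> (real \<Rightarrow> real) \<Rightarrow> bool" where "regular \<equiv> regular_solution d l \<gamma> chi chi' W2"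

lemma angular_momentum_nonneg: "ang d l \<ge> 0"
  using d by (simp add: ang_def)

lemma U_log: "r > 0 \<Longrightarrow> U r = (P (ln r) - 1 / 4) / r\<^sup>2"
proof -
  assume r: "r > 0"
  then have "exp (2 * ln r) = r\<^sup>2" by (simp add: exp_double)
  then show ?thesis using r by (simp add: log_potential_def)
qed

lemma H_op_sturm: "H_op d l \<gamma> chi W2 = friedrichs_extension half_line test_functions (sturm U)"
proof -
  have "H_expr d l \<gamma> chi W2 = sturm U"
    by (simp add: fun_eq_iff H_expr_def sturm_def effective_potential_def)
  then show ?thesis by (simp add: H_op_def)
qed

lemma P_global_bounds:
  obtains \<epsilon> c where "0 < \<epsilon>" "\<epsilon> \<le> 1" "c \<ge> 0" "continuous_on UNIV P"
    "\<And>t. \<bar>P t - (ang d l)\<^sup>2\<bar> \<le> c * (exp (\<epsilon> * t) + exp (2 * t))"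
    "\<And>t. \<bar>P t + \<sigma>\<^sup>2\<bar> \<le> c * exp (- \<epsilon> * t)"
    "\<And>t. t \<le> 0 \<Longrightarrow> \<bar>P t - (ang d l)\<^sup>2\<bar> \<le> c * exp (\<epsilon> * t)"
proof -
  obtain \<epsilon> c where \<epsilon>: "0 < \<epsilon>" "\<epsilon> \<le> 1" and c: "c \<ge> 0"
    and near: "\<And>t. t \<le> 0 \<Longrightarrow> \<bar>P t - (ang d l)\<^sup>2\<bar> \<le> c * exp (\<epsilon> * t)"
    and far: "\<And>t. t \<ge> 0 \<Longrightarrow> \<bar>P t + \<sigma>\<^sup>2\<bar> \<le> c * exp (- \<epsilon> * t)"
    and cont: "continuous_on UNIV P"
    using log_potential_bounds[OF cut adm \<sigma>2] by blast
  define c' where "c' = c + (ang d l)\<^sup>2 + \<sigma>\<^sup>2"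
  have sq: "0 \<le> (ang d l)\<^sup>2" "0 \<le> \<sigma>\<^sup>2" by simp_all
  have shift: "\<bar>x - m\<bar> \<le> c + m + s" if "\<bar>x + s\<bar> \<le> c" "0 \<le> s" "0 \<le> m" for x s m :: real
    using that unfolding abs_le_iff by auto
  have shift': "\<bar>x + s\<bar> \<le> c + m + s" if "\<bar>x - m\<bar> \<le> c" "0 \<le> s" "0 \<le> m" for x s m :: real
    using that unfolding abs_le_iff by auto
  have c': "c \<le> c'" "c' \<ge> 0" using c sq by (simp_all add: c'_def)
  have near': "\<bar>P t - (ang d l)\<^sup>2\<bar> \<le> c' * exp (\<epsilon> * t)" for t
  proof (cases "t \<le> 0")
    case True
    have "c * exp (\<epsilon> * t) \<le> c' * exp (\<epsilon> * t)" using c' by (intro mult_right_mono) auto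
    then show ?thesis using near[OF True] by linarith
  next
    case False
    then have t: "t \<ge> 0" by simp
    have "c * exp (- \<epsilon> * t) \<le> c * 1" using c \<epsilon> t by (intro mult_left_mono) auto
    then have "\<bar>P t + \<sigma>\<^sup>2\<bar> \<le> c" using far[OF t] by linarith
    then have "\<bar>P t - (ang d l)\<^sup>2\<bar> \<le> c' * 1" using shift sq by (simp add: c'_def)
    also have "\<dots> \<le> c' * exp (\<epsilon> * t)" using c' \<epsilon> t by (intro mult_left_mono) auto
    finally show ?thesis .
  qed
  have far': "\<bar>P t + \<sigma>\<^sup>2\<bar> \<le> c' * exp (- \<epsilon> * t)" for t
  proof (cases "t \<ge> 0")
    case True
    have "c * exp (- \<epsilon> * t) \<le> c' * exp (- \<epsilon> * t)" using c' by (intro mult_right_mono) auto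
    then show ?thesis using far[OF True] by linarith
  next
    case False
    then have t: "t \<le> 0" by simp
    have "\<epsilon> * t \<le> 0" using \<epsilon> t by (simp add: mult_nonneg_nonpos)
    then have "c * exp (\<epsilon> * t) \<le> c * 1" using c by (intro mult_left_mono) auto
    then have "\<bar>P t - (ang d l)\<^sup>2\<bar> \<le> c" using near[OF t] by linarith
    then have "\<bar>P t + \<sigma>\<^sup>2\<bar> \<le> c' * 1" using shift' sq by (simp add: c'_def)
    also have "\<dots> \<le> c' * exp (- \<epsilon> * t)" using c' \<open>\<epsilon> * t \<le> 0\<close> by (intro mult_left_mono) auto
    finally show ?thesis .
  qed
  have "\<bar>P t - (ang d l)\<^sup>2\<bar> \<le> c' * (exp (\<epsilon> * t) + exp (2 * t))" for t
  proof -
    have "c' * exp (\<epsilon> * t) \<le> c' * (exp (\<epsilon> * t) + exp (2 * t))" using c' by (intro mult_left_mono) auto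
    then show ?thesis using near'[of t] by linarith
  qed
  then show ?thesis using that[OF \<epsilon> c'(2) cont _ far' near'] by blast
qed

text \<open>
  The centrifugal term is nonnegative, so that near the origin the potential is bounded below by the
  critical Hardy potential up to a perturbation.
\<close>

lemma radial_operator_exists:
  obtains h h' K where "radial_operator_cutoff U h h' K chi"
proof -
  obtain \<epsilon> c where \<epsilon>: "0 < \<epsilon>" "\<epsilon> \<le> 1" and c: "c \<ge> 0"
    and P1: "\<And>t. \<bar>P t - (ang d l)\<^sup>2\<bar> \<le> c * (exp (\<epsilon> * t) + exp (2 * t))"
    and P2: "\<And>t. \<bar>P t + \<sigma>\<^sup>2\<bar> \<le> c * exp (- \<epsilon> * t)"
    and P0: "\<And>t. t \<le> 0 \<Longrightarrow> \<bar>P t - (ang d l)\<^sup>2\<bar> \<le> c * exp (\<epsilon> * t)"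
    by (rule P_global_bounds) blast
  have near: "- (1 / (4 * r\<^sup>2)) - c * r powr (\<epsilon> - 2) \<le> U r" if r: "0 < r" "r \<le> 1" for r
  proof -
    have "ln r \<le> 0" using r by simp
    moreover have "exp (\<epsilon> * ln r) = r powr \<epsilon>" using r by (simp add: powr_def)
    ultimately have "\<bar>P (ln r) - (ang d l)\<^sup>2\<bar> \<le> c * r powr \<epsilon>" using P0[of "ln r"] by simp
    moreover have "0 \<le> (ang d l)\<^sup>2" by simp
    ultimately have "- (c * r powr \<epsilon>) - 1 / 4 \<le> P (ln r) - 1 / 4" by linarith
    then have "(- (c * r powr \<epsilon>) - 1 / 4) / r\<^sup>2 \<le> (P (ln r) - 1 / 4) / r\<^sup>2"
      by (rule divide_right_mono) simp
    moreover have "(- (c * r powr \<epsilon>) - 1 / 4) / r\<^sup>2 = - (1 / (4 * r\<^sup>2)) - c * (r powr \<epsilon> / r\<^sup>2)"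
      using r by (simp add: field_simps)
    moreover have "r powr \<epsilon> / r\<^sup>2 = r powr (\<epsilon> - 2)" using r by (simp add: powr_diff)
    ultimately show ?thesis using U_log[OF r(1)] by simp
  qed
  have far: "- (c + \<sigma>\<^sup>2 + 1 / 4) \<le> U r" if r: "r \<ge> 1" for r
  proof -
    have r2: "r\<^sup>2 \<ge> 1" using r by simp
    have "ln r \<ge> 0" using r by simp
    then have "c * exp (- \<epsilon> * ln r) \<le> c * 1" using c \<epsilon> by (intro mult_left_mono) auto
    define X where "X = c + \<sigma>\<^sup>2 + 1 / 4"
    have X: "X \<ge> 0" using c by (simp add: X_def)
    have "- X \<le> P (ln r) - 1 / 4"
      using P2[of "ln r"] \<open>c * exp (- \<epsilon> * ln r) \<le> c * 1\<close> unfolding X_def by linarith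
    then have "(- X) / r\<^sup>2 \<le> (P (ln r) - 1 / 4) / r\<^sup>2" by (rule divide_right_mono) simp
    moreover have "X / r\<^sup>2 \<le> X / 1" using X r2 by (intro divide_left_mono) auto
    moreover have "U r = (P (ln r) - 1 / 4) / r\<^sup>2" using r by (intro U_log) simp
    ultimately show ?thesis unfolding X_def[symmetric] minus_divide_left[symmetric] by linarith
  qed
  obtain h h' K where h: "\<And>r. r > 0 \<Longrightarrow> (h has_real_derivative h' r) (at r)" "continuous_on {0<..} h'"
    "\<And>r. r > 0 \<Longrightarrow> h' r + (h r)\<^sup>2 \<le> U r + K" "K \<ge> 0"
    using riccati_supersolution[OF \<epsilon> c near far] by blast
  have chi: "smooth_on {0<..} chi" "\<And>r. 0 < r \<Longrightarrow> r \<le> 1 \<Longrightarrow> chi r = 0" "\<And>r. r \<ge> 2 \<Longrightarrow> chi r = 1"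
    "\<And>r. r > 0 \<Longrightarrow> (chi r)\<^sup>2 + (chi' r)\<^sup>2 = 1"
    using cut unfolding cutoff_pair_def by blast+
  have "\<bar>chi r\<bar> \<le> 1" if "r > 0" for r
  proof -
    have "(chi r)\<^sup>2 \<le> 1" using chi(4)[OF that] zero_le_power2[of "chi' r"] by linarith
    then show ?thesis by (simp add: abs_square_le_1)
  qed
  then have "radial_operator_cutoff U h h' K chi"
    using h chi effective_potential_continuous[OF cut adm] by unfold_locales auto
  then show ?thesis by (rule that)
qed

text \<open>
  On \<open>(0, 1)\<close> the square of \<open>chi'\<close> is 1. This leaves the sign open, but the derivatives vanish there.
\<close>

lemma inner_cutoff:
  shows "\<And>r. r > 0 \<Longrightarrow> (chi' has_real_derivative vderiv chi' r) (at r)"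
    and "\<And>r. r > 0 \<Longrightarrow> (vderiv chi' has_real_derivative vderiv (vderiv chi') r) (at r)"
    and "continuous_on {0<..} (vderiv (vderiv chi'))"
    and "\<And>r. r > 2 \<Longrightarrow> chi' r = 0" and "\<And>r. r > 0 \<Longrightarrow> \<bar>chi' r\<bar> \<le> 1" and "(chi' 1)\<^sup>2 = 1"
    and "\<And>r. 0 < r \<Longrightarrow> r < 1 \<Longrightarrow> vderiv chi' r = 0" and "\<And>r. 0 < r \<Longrightarrow> r < 1 \<Longrightarrow> vderiv (vderiv chi') r = 0"
proof -
  have s: "smooth_on {0<..} chi'" and c: "\<And>r. r > 0 \<Longrightarrow> (chi r)\<^sup>2 + (chi' r)\<^sup>2 = 1"
    "\<And>r. 0 < r \<Longrightarrow> r \<le> 1 \<Longrightarrow> chi r = 0" "\<And>r. r \<ge> 2 \<Longrightarrow> chi r = 1"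
    using cut unfolding cutoff_pair_def by blast+
  show d1: "(chi' has_real_derivative vderiv chi' r) (at r)" if "r > 0" for r
    using smooth_on_has_derivative[OF s, of r] that by (simp add: has_real_derivative_iff_has_vector_derivative)
  show d2: "(vderiv chi' has_real_derivative vderiv (vderiv chi') r) (at r)" if "r > 0" for r
    using smooth_on_has_derivative[OF smooth_on_vderiv[OF s], of r] that
    by (simp add: has_real_derivative_iff_has_vector_derivative)
  show "continuous_on {0<..} (vderiv (vderiv chi'))"
    by (rule smooth_on_continuous[OF smooth_on_vderiv[OF smooth_on_vderiv[OF s]]])
  show "chi' r = 0" if "r > 2" for r using c(1)[of r] c(3)[of r] that by simp
  show "\<bar>chi' r\<bar> \<le> 1" if "r > 0" for r
  proof -
    have "(chi' r)\<^sup>2 \<le> 1" using c(1)[OF that] zero_le_power2[of "chi r"] by linarith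
    then show ?thesis by (simp add: abs_square_le_1)
  qed
  have one: "(chi' r)\<^sup>2 = 1" if "0 < r" "r \<le> 1" for r using c(1)[OF that(1)] c(2)[OF that] by simp
  show "(chi' 1)\<^sup>2 = 1" by (rule one) auto
  show z1: "vderiv chi' r = 0" if r: "0 < r" "r < 1" for r
  proof -
    have "((\<lambda>r. (chi' r)\<^sup>2) has_real_derivative 2 * chi' r * vderiv chi' r) (at r)"
      by (auto intro!: derivative_eq_intros d1 r)
    moreover have "((\<lambda>r. (chi' r)\<^sup>2) has_real_derivative 0) (at r)"
      by (rule has_field_derivative_transform_within_open[where f = "\<lambda>_. 1" and S = "{0<..<1}"])
         (use r one in auto)
    ultimately have "2 * chi' r * vderiv chi' r = 0" by (rule DERIV_unique)
    then show ?thesis using one[of r] r by auto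
  qed
  show "vderiv (vderiv chi') r = 0" if r: "0 < r" "r < 1" for r
  proof -
    have "(vderiv chi' has_real_derivative 0) (at r)"
      by (rule has_field_derivative_transform_within_open[where f = "\<lambda>_. 0" and S = "{0<..<1}"])
         (use r z1 in auto)
    with d2[OF r(1)] show ?thesis by (rule DERIV_unique)
  qed
qed

definition solves :: "real \<Rightarrow> (real \<Rightarrow> real) \<Rightarrow> (real \<Rightarrow> real) \<Rightarrow> bool" where
  "solves E u u' \<longleftrightarrow> (\<forall>r>0. (u has_real_derivative u' r) (at r) \<and> (u' has_real_derivative (U r - E) * u r) (at r))"

lemma solves_radial_solution:
  assumes "solves E u u'"
  shows "radial_solution d l \<gamma> chi W2 E u"
  unfolding radial_solution_def
proof (intro allI impI conjI)
  fix r :: real assume r: "r > 0"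
  have u: "(u has_real_derivative u' r) (at r)" "(u' has_real_derivative (U r - E) * u r) (at r)" if "r > 0" for r
    using assms that by (auto simp: solves_def)
  have D: "deriv u s = u' s" if "s > 0" for s using u(1)[OF that] by (rule DERIV_imp_deriv)
  have d2: "(deriv u has_real_derivative (U r - E) * u r) (at r)"
    by (rule has_field_derivative_transform_within_open[OF u(2)[OF r], where S = "{0<..}"]) (use r D in auto)
  show "u differentiable at r" using u(1)[OF r] real_differentiable_def by blast
  show "deriv u differentiable at r" using d2 real_differentiable_def by blast
  have "deriv (deriv u) r = (U r - E) * u r" using d2 by (rule DERIV_imp_deriv)
  then show "- deriv (deriv u) r + (V_inf d l \<gamma> chi r + V_rem d l chi W2 r) * u r = E * u r"
    by (simp add: effective_potential_def algebra_simps)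
qed

lemma radial_solution_solves:
  assumes "radial_solution d l \<gamma> chi W2 E u"
  shows "solves E u (deriv u)"
  unfolding solves_def
proof (intro allI impI conjI)
  fix r :: real assume "r > 0"
  then have u: "u differentiable (at r)" "deriv u differentiable (at r)"
    "- deriv (deriv u) r + (V_inf d l \<gamma> chi r + V_rem d l chi W2 r) * u r = E * u r"
    using assms by (auto simp: radial_solution_def)
  show "(u has_real_derivative deriv u r) (at r)"
    using u(1) by (metis DERIV_imp_deriv real_differentiable_def)
  have "(deriv u has_real_derivative deriv (deriv u) r) (at r)"
    using u(2) by (metis DERIV_imp_deriv real_differentiable_def)
  moreover have "deriv (deriv u) r = (U r - E) * u r"
    using u(3) by (simp add: effective_potential_def algebra_simps)
  ultimately show "(deriv u has_real_derivative (U r - E) * u r) (at r)" by simp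
qed

text \<open>
  Multiplication by \<open>chi'\<close> changes neither the equation on \<open>(0, 1)\<close> nor, up to the factor \<open>(chi' 1)\<^sup>2 = 1\<close>,
  Wronskians at 1.
\<close>

lemma solution_cutoff:
  assumes u: "solves E u u'"
  defines "Y \<equiv> \<lambda>r. chi' r * u r" and "Y' \<equiv> \<lambda>r. vderiv chi' r * u r + chi' r * u' r"
    and "Y'' \<equiv> \<lambda>r. vderiv (vderiv chi') r * u r + 2 * (vderiv chi' r * u' r) + chi' r * ((U r - E) * u r)"
  shows "\<And>r. r > 0 \<Longrightarrow> (Y has_real_derivative Y' r) (at r)" "\<And>r. r > 0 \<Longrightarrow> (Y' has_real_derivative Y'' r) (at r)"
    "continuous_on {0<..} Y''" "\<And>r. r > 2 \<Longrightarrow> Y r = 0"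
    "\<And>r. 0 < r \<Longrightarrow> r < 1 \<Longrightarrow> - Y'' r + U r * Y r = E * Y r"
proof -
  have u: "(u has_real_derivative u' r) (at r)" "(u' has_real_derivative (U r - E) * u r) (at r)" if "r > 0" for r
    using u that by (auto simp: solves_def)
  show "(Y has_real_derivative Y' r) (at r)" if "r > 0" for r
    unfolding Y_def Y'_def
    using DERIV_mult[OF inner_cutoff(1)[OF that] u(1)[OF that]] by (simp add: algebra_simps)
  show "(Y' has_real_derivative Y'' r) (at r)" if "r > 0" for r
    unfolding Y'_def Y''_def
    using DERIV_add[OF DERIV_mult[OF inner_cutoff(2)[OF that] u(1)[OF that]] DERIV_mult[OF inner_cutoff(1)[OF that] u(2)[OF that]]]
    by (simp add: algebra_simps)
  have c: "continuous_on {0<..} u" "continuous_on {0<..} u'" "continuous_on {0<..} chi'" "continuous_on {0<..} (vderiv chi')"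
    by (auto intro!: continuous_at_imp_continuous_on
          intro: DERIV_isCont[OF u(1)] DERIV_isCont[OF u(2)] DERIV_isCont[OF inner_cutoff(1)] DERIV_isCont[OF inner_cutoff(2)])
  show "continuous_on {0<..} Y''"
    unfolding Y''_def by (intro continuous_intros c inner_cutoff(3) effective_potential_continuous[OF cut adm])
  show "Y r = 0" if "r > 2" for r using inner_cutoff(4)[OF that] by (simp add: Y_def)
  show "- Y'' r + U r * Y r = E * Y r" if "0 < r" "r < 1" for r
    using inner_cutoff(7,8)[OF that] by (simp add: Y_def Y''_def algebra_simps)
qed

text \<open>
  A solution of size \<open>sqrt r\<close> is regular and determines every regular solution up to a factor.
\<close>

lemma small_solution_regular:
  assumes u: "solves E u u'" and small: "\<And>r. 0 < r \<Longrightarrow> r \<le> 1 \<Longrightarrow> \<bar>u r\<bar> \<le> C * sqrt r"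
  shows "regular E u" "solves E w w' \<Longrightarrow> regular E w \<Longrightarrow> w 1 * u' 1 - w' 1 * u 1 = 0"
proof -
  obtain h h' K where "radial_operator_cutoff U h h' K chi" by (rule radial_operator_exists)
  then interpret op: radial_operator_cutoff U h h' K chi .
  have smallY: "\<bar>chi' r * u r\<bar> \<le> C * sqrt r" if "0 < r" "r \<le> 1" for r
  proof -
    have "\<bar>chi' r * u r\<bar> \<le> 1 * \<bar>u r\<bar>"
      unfolding abs_mult using inner_cutoff(5)[OF that(1)] by (intro mult_right_mono) auto
    then show ?thesis using small[OF that] by simp
  qed
  note Y = solution_cutoff[OF u]
  have b: "(2::real) \<ge> 1" by simp
  note op.bounded_solution_in_friedrichs_domain[OF Y(1,2,3,4) b smallY Y(5)]
  then have "(\<lambda>r. complex_of_real (chi' r * u r)) \<in> Domain (H_op d l \<gamma> chi W2)"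
    unfolding H_op_sturm by (rule DomainI)
  then show "regular E u" unfolding regular_solution_def using solves_radial_solution[OF u] by simp
  assume w: "solves E w w'" and reg: "regular E w"
  note X = solution_cutoff[OF w]
  from reg obtain f where f: "((\<lambda>r. complex_of_real (chi' r * w r)), f) \<in> friedrichs_extension half_line test_functions (sturm U)"
    unfolding regular_solution_def H_op_sturm by blast
  have "chi' 1 * w 1 * (vderiv chi' 1 * u 1 + chi' 1 * u' 1) - (vderiv chi' 1 * w 1 + chi' 1 * w' 1) * (chi' 1 * u 1) = 0"
    by (rule op.wronskian_vanishes[OF Y(1,2,3,4) b smallY Y(5) X f])
  then have "(chi' 1)\<^sup>2 * (w 1 * u' 1 - w' 1 * u 1) = 0" by (simp add: algebra_simps power2_eq_square)
  then show "w 1 * u' 1 - w' 1 * u 1 = 0" unfolding inner_cutoff(6) by simp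
qed

definition solves_log :: "real \<Rightarrow> (real \<Rightarrow> real) \<Rightarrow> (real \<Rightarrow> real) \<Rightarrow> bool" where
  "solves_log E v v' \<longleftrightarrow> (\<forall>t. (v has_real_derivative v' t) (at t) \<and> (v' has_real_derivative (P t - E * exp (2 * t)) * v t) (at t))"

lemma solves_from_log:
  assumes "solves_log E v v'"
  shows "solves E (\<lambda>r. sqrt r * v (ln r)) (\<lambda>r. (v' (ln r) + v (ln r) / 2) / sqrt r)"
  unfolding solves_def
proof (intro allI impI conjI)
  fix r :: real assume r: "r > 0"
  have dv: "(v has_real_derivative v' t) (at t)" "(v' has_real_derivative (P t - E * exp (2 * t)) * v t) (at t)" for t
    using assms by (auto simp: solves_log_def)
  have l: "(ln has_real_derivative 1 / r) (at r)" by (rule DERIV_ln_divide[OF r])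
  note v = DERIV_chain2[OF dv(1) l]
  note v' = DERIV_chain2[OF dv(2) l]
  define q where "q = sqrt r"
  have q: "q > 0" "r = q\<^sup>2" using r by (simp_all add: q_def)
  have s: "(sqrt has_real_derivative 1 / (2 * q)) (at r)"
  proof -
    have "inverse (sqrt r) / 2 = 1 / (2 * q)" by (simp add: q_def inverse_eq_divide)
    then show ?thesis using DERIV_real_sqrt[OF r] by (simp only:)
  qed
  have e: "exp (2 * ln r) = r\<^sup>2" using r by (simp add: exp_double)
  have "((\<lambda>r. sqrt r * v (ln r)) has_real_derivative 1 / (2 * q) * v (ln r) + (v' (ln r) * (1 / r)) * sqrt r) (at r)"
    by (rule DERIV_mult[OF s v])
  moreover have "1 / (2 * q) * v (ln r) + (v' (ln r) * (1 / r)) * sqrt r = (v' (ln r) + v (ln r) / 2) / sqrt r"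
  proof -
    have gen: "1 / (2 * q) * a + (b * (1 / q\<^sup>2)) * q = (b + a / 2) / q" for a b
      using q(1) by (simp add: field_simps power2_eq_square)
    show ?thesis using gen[of "v (ln r)" "v' (ln r)"] unfolding q_def[symmetric] q(2)[symmetric] .
  qed
  ultimately show "((\<lambda>r. sqrt r * v (ln r)) has_real_derivative (v' (ln r) + v (ln r) / 2) / sqrt r) (at r)" by simp
  have "((\<lambda>r. (v' (ln r) + v (ln r) / 2) / sqrt r) has_real_derivative
    (((P (ln r) - E * exp (2 * ln r)) * v (ln r) * (1 / r) + v' (ln r) * (1 / r) / 2) * sqrt r - (v' (ln r) + v (ln r) / 2) * (1 / (2 * q))) / (sqrt r * sqrt r)) (at r)"
    using r by (intro DERIV_divide DERIV_add DERIV_cdivide v v' s) simp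
  moreover have "(((P (ln r) - E * exp (2 * ln r)) * v (ln r) * (1 / r) + v' (ln r) * (1 / r) / 2) * sqrt r - (v' (ln r) + v (ln r) / 2) * (1 / (2 * q))) / (sqrt r * sqrt r)
    = (U r - E) * (sqrt r * v (ln r))"
  proof -
    have gen: "(((p - E * (q\<^sup>2)\<^sup>2) * a * (1 / q\<^sup>2) + b * (1 / q\<^sup>2) / 2) * q - (b + a / 2) * (1 / (2 * q))) / (q * q)
      = ((p - 1 / 4) / (q\<^sup>2)\<^sup>2 - E) * (q * a)" for p a b
      using q(1) by (simp add: field_simps power2_eq_square)
    show ?thesis
      using gen[of "P (ln r)" "v (ln r)" "v' (ln r)"] unfolding e U_log[OF r] q_def[symmetric] q(2)[symmetric] .
  qed
  ultimately show "((\<lambda>r. (v' (ln r) + v (ln r) / 2) / sqrt r) has_real_derivative (U r - E) * (sqrt r * v (ln r))) (at r)" by simp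
qed

lemma solves_to_log:
  assumes "solves E u u'"
  shows "solves_log E (\<lambda>t. exp (- t / 2) * u (exp t)) (\<lambda>t. exp (t / 2) * u' (exp t) - exp (- t / 2) * u (exp t) / 2)"
  unfolding solves_log_def
proof (intro allI conjI)
  fix t :: real
  have du: "(u has_real_derivative u' r) (at r)" "(u' has_real_derivative (U r - E) * u r) (at r)" if "r > 0" for r
    using assms that by (auto simp: solves_def)
  define q where "q = exp (t / 2)"
  have q1: "q > 0" by (simp add: q_def)
  have q2: "exp t = q\<^sup>2" by (simp add: q_def flip: exp_double)
  have q3: "exp (- t / 2) = 1 / q" by (simp add: q_def exp_minus inverse_eq_divide)
  have q4: "exp (2 * t) = (q\<^sup>2)\<^sup>2" by (simp only: exp_double q2)
  note q = q1 q2 q3 q4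
  have u: "((\<lambda>t. u (exp t)) has_real_derivative u' (exp t) * exp t) (at t)"
    "((\<lambda>t. u' (exp t)) has_real_derivative (U (exp t) - E) * u (exp t) * exp t) (at t)"
    by (rule DERIV_chain2[OF du(1)] DERIV_chain2[OF du(2)], auto)+
  have e: "((\<lambda>t. exp (t / 2)) has_real_derivative q / 2) (at t)" "((\<lambda>t. exp (- t / 2)) has_real_derivative - (1 / q / 2)) (at t)"
    unfolding q(3)[symmetric] unfolding q_def by (auto intro!: derivative_eq_intros)
  have v: "((\<lambda>t. exp (- t / 2) * u (exp t)) has_real_derivative - (1 / q / 2) * u (exp t) + u' (exp t) * exp t * exp (- t / 2)) (at t)"
    by (rule DERIV_mult[OF e(2) u(1)])
  have v': "((\<lambda>t. exp (t / 2) * u' (exp t)) has_real_derivative q / 2 * u' (exp t) + (U (exp t) - E) * u (exp t) * exp t * exp (t / 2)) (at t)"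
    by (rule DERIV_mult[OF e(1) u(2)])
  have "- (1 / q / 2) * u (exp t) + u' (exp t) * exp t * exp (- t / 2) = exp (t / 2) * u' (exp t) - exp (- t / 2) * u (exp t) / 2"
    unfolding q unfolding q_def[symmetric] using q(1) by (simp add: field_simps power2_eq_square)
  with v show "((\<lambda>t. exp (- t / 2) * u (exp t)) has_real_derivative exp (t / 2) * u' (exp t) - exp (- t / 2) * u (exp t) / 2) (at t)"
    by simp
  have "((\<lambda>t. exp (t / 2) * u' (exp t) - exp (- t / 2) * u (exp t) / 2) has_real_derivative
    (q / 2 * u' (exp t) + (U (exp t) - E) * u (exp t) * exp t * exp (t / 2)) - (- (1 / q / 2) * u (exp t) + u' (exp t) * exp t * exp (- t / 2)) / 2) (at t)"
    by (intro DERIV_diff DERIV_cdivide v v')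
  moreover have "(q / 2 * u' (exp t) + (U (exp t) - E) * u (exp t) * exp t * exp (t / 2)) - (- (1 / q / 2) * u (exp t) + u' (exp t) * exp t * exp (- t / 2)) / 2
    = (P t - E * exp (2 * t)) * (exp (- t / 2) * u (exp t))"
    unfolding log_potential_def q unfolding q_def[symmetric] using q(1) by (simp add: field_simps power2_eq_square)
  ultimately show "((\<lambda>t. exp (t / 2) * u' (exp t) - exp (- t / 2) * u (exp t) / 2) has_real_derivative
    (P t - E * exp (2 * t)) * (exp (- t / 2) * u (exp t))) (at t)" by simp
qed

lemma log_wronskian_constant:
  assumes "solves_log E v v'" "solves_log E w w'"
  shows "v t * w' t - v' t * w t = v 0 * w' 0 - v' 0 * w 0"
proof -
  have "((\<lambda>t. v t * w' t - v' t * w t) has_real_derivative 0) (at s)" for s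
  proof -
    have "((\<lambda>t. v t * w' t - v' t * w t) has_real_derivative
      (v' s * w' s + (P s - E * exp (2 * s)) * w s * v s) - ((P s - E * exp (2 * s)) * v s * w s + w' s * v' s)) (at s)"
      using assms unfolding solves_log_def by (intro DERIV_diff DERIV_mult) auto
    then show ?thesis by (simp add: mult_ac)
  qed
  then show ?thesis using DERIV_isconst_all[of "\<lambda>t. v t * w' t - v' t * w t" t 0] by blast
qed

end

section \<open>The phase shift at low energy\<close>

lemma far_amplitude_scale: "far_amplitude \<sigma> (of_real \<kappa> * b) E = of_real \<kappa> * far_amplitude \<sigma> b E"
  by (simp add: far_amplitude_def algebra_simps)

lemma far_amplitude_continuous:
  assumes "continuous_on {0<..} b"
  shows "continuous_on {0<..} (\<lambda>E. far_amplitude \<sigma> (b E) E)"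
  unfolding far_amplitude_def by (intro continuous_intros assms) auto

lemma real_multiple_if_aligned:
  fixes z w :: complex
  assumes "w \<noteq> 0" "Im (z * cnj w) = 0"
  obtains \<kappa> :: real where "z = of_real \<kappa> * w"
proof -
  have "z / w = z * cnj w / of_real ((cmod w)\<^sup>2)"
    using assms(1) by (simp add: complex_norm_square field_simps del: of_real_power)
  then have "Im (z / w) = 0" using assms(2) by (simp only: Im_divide_of_real)
  then have "z / w = of_real (Re (z / w))" by (simp add: complex_eq_iff)
  then show ?thesis using that[of "Re (z / w)"] assms(1) by (simp add: field_simps)
qed

context radial_problem
begin

text \<open>
  The solutions constructed in the logarithmic variable are regular. Since any other regular solution
  has zero Wronskian with them, \<open>amplitude_wronskian\<close> forces its amplitude to be a real multiple of \<open>b(E)\<close>.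
\<close>

lemma regular_solutions:
  obtains b :: "real \<Rightarrow> complex" and y :: "real \<Rightarrow> real \<Rightarrow> real" where
    "continuous_on {0..} b" "\<And>E. E \<ge> 0 \<Longrightarrow> b E \<noteq> 0"
    "\<And>E. E > 0 \<Longrightarrow> regular E (y E)" "\<And>E. E > 0 \<Longrightarrow> \<exists>r>0. y E r \<noteq> 0"
    "\<And>E. E > 0 \<Longrightarrow> ((\<lambda>r. y E r - 2 / sqrt (sqrt E) * Re (far_amplitude \<sigma> (b E) E * exp (\<i> * of_real (sqrt E * r)))) \<longlongrightarrow> 0) at_top"
    "\<And>E u. E > 0 \<Longrightarrow> regular E u \<Longrightarrow> \<exists>\<kappa>. ((\<lambda>r. u r - 2 / sqrt (sqrt E) * Re (of_real \<kappa> * far_amplitude \<sigma> (b E) E * exp (\<i> * of_real (sqrt E * r)))) \<longlongrightarrow> 0) at_top"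
proof -
  obtain \<epsilon> c where \<epsilon>: "0 < \<epsilon>" "\<epsilon> \<le> 1" and c: "c \<ge> 0" and cont: "continuous_on UNIV P"
    and P1: "\<And>t. \<bar>P t - (ang d l)\<^sup>2\<bar> \<le> c * (exp (\<epsilon> * t) + exp (2 * t))"
    and P2: "\<And>t. \<bar>P t + \<sigma>\<^sup>2\<bar> \<le> c * exp (- \<epsilon> * t)"
    by (rule P_global_bounds) blast
  have \<epsilon>2: "\<epsilon> \<le> 2" using \<epsilon> by simp
  obtain v v' where v: "\<And>E t. E \<ge> 0 \<Longrightarrow> (v E has_real_derivative v' E t) (at t)"
    "\<And>E t. E \<ge> 0 \<Longrightarrow> (v' E has_real_derivative (P t - E * exp (2 * t)) * v E t) (at t)"
    and vb: "\<And>E. E \<ge> 0 \<Longrightarrow> \<exists>M. \<forall>t\<le>0. \<bar>v E t\<bar> \<le> M"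
    and v0: "\<And>E. E \<ge> 0 \<Longrightarrow> \<exists>t. v E t \<noteq> 0"
    and cv: "\<And>t. continuous_on {0..} (\<lambda>E. v E t)" "\<And>t. continuous_on {0..} (\<lambda>E. v' E t)"
    by (rule regular_solution_family[OF angular_momentum_nonneg \<epsilon>(1) \<epsilon>2 c cont P1]) (rule that, assumption+)
  have sl: "solves_log E (v E) (v' E)" if "E \<ge> 0" for E using v[OF that] by (simp add: solves_log_def)
  have lim: "\<exists>l. (amplitude \<sigma> E w w' \<longlongrightarrow> l) at_top \<and> (w T \<noteq> 0 \<longrightarrow> l \<noteq> 0)" if E: "E \<ge> 0" and w: "solves_log E w w'" for E w w' T
  proof -
    have w: "(w has_real_derivative w' t) (at t)" "(w' has_real_derivative (P t - E * exp (2 * t)) * w t) (at t)" for t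
      using w by (auto simp: solves_log_def)
    show ?thesis by (rule amplitude_limit[OF \<sigma> E \<epsilon>(1) c w, of T]) (use P2 in blast)+
  qed
  have "\<exists>l. (amplitude \<sigma> E (v E) (v' E) \<longlongrightarrow> l) at_top \<and> l \<noteq> 0" if E: "E \<ge> 0" for E
  proof -
    obtain T where "v E T \<noteq> 0" using v0[OF E] by blast
    then show ?thesis using lim[OF E sl[OF E], of T] by blast
  qed
  then have "\<forall>E. \<exists>l. E \<ge> 0 \<longrightarrow> (amplitude \<sigma> E (v E) (v' E) \<longlongrightarrow> l) at_top \<and> l \<noteq> 0" by blast
  from choice[OF this] obtain b where "\<forall>E. E \<ge> 0 \<longrightarrow> (amplitude \<sigma> E (v E) (v' E) \<longlongrightarrow> b E) at_top \<and> b E \<noteq> 0" ..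
  then have bl: "\<And>E. E \<ge> 0 \<Longrightarrow> (amplitude \<sigma> E (v E) (v' E) \<longlongrightarrow> b E) at_top" and b0: "\<And>E. E \<ge> 0 \<Longrightarrow> b E \<noteq> 0" by blast+
  have bc: "continuous_on {0..} b"
    by (rule amplitude_limit_continuous[OF \<sigma> \<epsilon>(1) c v P2 cv bl])
  define y where "y = (\<lambda>E r. sqrt r * v E (ln r))"
  define y' where "y' = (\<lambda>E r. (v' E (ln r) + v E (ln r) / 2) / sqrt r)"
  have sy: "solves E (y E) (y' E)" if "E \<ge> 0" for E
    unfolding y_def y'_def by (rule solves_from_log[OF sl[OF that]])
  have small: "\<exists>C. \<forall>r. 0 < r \<and> r \<le> 1 \<longrightarrow> \<bar>y E r\<bar> \<le> C * sqrt r" if E: "E \<ge> 0" for E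
  proof -
    obtain M where M: "\<forall>t\<le>0. \<bar>v E t\<bar> \<le> M" using vb[OF E] by blast
    have "\<bar>y E r\<bar> \<le> M * sqrt r" if r: "0 < r" "r \<le> 1" for r
    proof -
      have "sqrt r * \<bar>v E (ln r)\<bar> \<le> sqrt r * M" using M r by (intro mult_left_mono) auto
      then show ?thesis using r by (simp add: y_def abs_mult mult.commute)
    qed
    then show ?thesis by blast
  qed
  show ?thesis
  proof (rule that[OF bc b0])
    fix E :: real assume "E > 0"
    then have E: "E \<ge> 0" by simp
    obtain C where C: "\<forall>r. 0 < r \<and> r \<le> 1 \<longrightarrow> \<bar>y E r\<bar> \<le> C * sqrt r" using small[OF E] by blast
    have C': "\<bar>y E r\<bar> \<le> C * sqrt r" if "0 < r" "r \<le> 1" for r using C that by blast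
    show "regular E (y E)" by (rule small_solution_regular(1)[OF sy[OF E] C'])
    obtain t where "v E t \<noteq> 0" using v0[OF E] by blast
    then have "y E (exp t) \<noteq> 0" by (simp add: y_def)
    then show "\<exists>r>0. y E r \<noteq> 0" using exp_gt_zero[of t] by blast
    show "((\<lambda>r. y E r - 2 / sqrt (sqrt E) * Re (far_amplitude \<sigma> (b E) E * exp (\<i> * of_real (sqrt E * r)))) \<longlongrightarrow> 0) at_top"
      unfolding y_def by (rule solution_asymptotics[OF \<sigma> \<open>E > 0\<close> bl[OF E]])
    fix u assume reg: "regular E u"
    then have u: "solves E u (deriv u)" unfolding regular_solution_def by (intro radial_solution_solves) simp
    define w where "w = (\<lambda>t. exp (- t / 2) * u (exp t))"
    define w' where "w' = (\<lambda>t. exp (t / 2) * deriv u (exp t) - exp (- t / 2) * u (exp t) / 2)"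
    have w: "solves_log E w w'" unfolding w_def w'_def by (rule solves_to_log[OF u])
    obtain l where l: "(amplitude \<sigma> E w w' \<longlongrightarrow> l) at_top" using lim[OF E w] by blast
    have "u 1 * y' E 1 - deriv u 1 * y E 1 = 0"
      by (rule small_solution_regular(2)[OF sy[OF E] C' u reg])
    then have "w 0 * v' E 0 - w' 0 * v E 0 = 0" by (simp add: w_def w'_def y_def y'_def algebra_simps)
    then have W: "w t * v' E t - w' t * v E t = 0" for t
      using log_wronskian_constant[OF w sl[OF E], of t] by simp
    have "((\<lambda>t. Im (amplitude \<sigma> E w w' t * cnj (amplitude \<sigma> E (v E) (v' E) t))) \<longlongrightarrow> Im (l * cnj (b E))) at_top"
      by (intro tendsto_intros l bl E)
    then have "((\<lambda>t::real. 0::real) \<longlongrightarrow> Im (l * cnj (b E))) at_top"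
      unfolding amplitude_wronskian[OF \<sigma>] W by simp
    then have "Im (l * cnj (b E)) = 0" by (simp add: tendsto_const_iff)
    then obtain \<kappa> where \<kappa>: "l = of_real \<kappa> * b E" by (rule real_multiple_if_aligned[OF b0[OF E]])
    have "((\<lambda>r. sqrt r * w (ln r) - 2 / sqrt (sqrt E) * Re (of_real \<kappa> * far_amplitude \<sigma> (b E) E * exp (\<i> * of_real (sqrt E * r)))) \<longlongrightarrow> 0) at_top"
      using solution_asymptotics[OF \<sigma> \<open>E > 0\<close> l] unfolding \<kappa> far_amplitude_scale .
    then have "((\<lambda>r. u r - 2 / sqrt (sqrt E) * Re (of_real \<kappa> * far_amplitude \<sigma> (b E) E * exp (\<i> * of_real (sqrt E * r)))) \<longlongrightarrow> 0) at_top"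
    proof (rule Lim_transform_eventually)
      show "\<forall>\<^sub>F r in at_top. sqrt r * w (ln r) - 2 / sqrt (sqrt E) * Re (of_real \<kappa> * far_amplitude \<sigma> (b E) E * exp (\<i> * of_real (sqrt E * r)))
        = u r - 2 / sqrt (sqrt E) * Re (of_real \<kappa> * far_amplitude \<sigma> (b E) E * exp (\<i> * of_real (sqrt E * r)))"
        using eventually_gt_at_top[of 0]
      proof eventually_elim
        case (elim r)
        define q where "q = exp (ln r / 2)"
        have "q * q = r" using elim by (simp add: q_def flip: exp_add)
        then have "sqrt r = q" using real_sqrt_unique[of q r] by (simp add: q_def power2_eq_square)
        then have "sqrt r * exp (- ln r / 2) = 1" by (simp add: q_def flip: exp_add)
        then have "sqrt r * w (ln r) = u r" using elim by (simp add: w_def flip: mult.assoc)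
        then show ?case by simp
      qed
    qed
    then show "\<exists>\<kappa>. ((\<lambda>r. u r - 2 / sqrt (sqrt E) * Re (of_real \<kappa> * far_amplitude \<sigma> (b E) E * exp (\<i> * of_real (sqrt E * r)))) \<longlongrightarrow> 0) at_top" by blast
  qed
qed

end

lemma sin_as_amplitude:
  "C * sin (k * r + D) = Re (- \<i> * of_real C * exp (\<i> * of_real D) * exp (\<i> * of_real (k * r)))"
proof -
  have "exp (\<i> * of_real D) * exp (\<i> * of_real (k * r)) = cis (k * r + D)"
    by (simp add: cis_conv_exp algebra_simps flip: exp_add)
  then have "- \<i> * of_real C * exp (\<i> * of_real D) * exp (\<i> * of_real (k * r)) = - \<i> * of_real C * cis (k * r + D)"
    by (simp only: mult.assoc)
  then show ?thesis by (simp only:) simp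
qed

text \<open>
  The quotient \<open>z / cnj z\<close> is insensitive to real factors of either sign. It thus captures exactly the
  information modulo \<open>\<pi>\<close> contained in an admissible value of the phase shift.
\<close>

lemma amplitude_phase:
  fixes z :: complex
  assumes k: "k > 0" and \<alpha>: "\<alpha> \<noteq> 0" and C: "C \<noteq> 0"
    and u: "((\<lambda>r. u r - \<alpha> * Re (of_real \<kappa> * z * exp (\<i> * of_real (k * r)))) \<longlongrightarrow> 0) at_top"
    and uC: "((\<lambda>r. u r - C * sin (k * r + D)) \<longlongrightarrow> 0) at_top"
  shows "exp (2 * \<i> * of_real D) = - (z / cnj z)"
proof -
  have "((\<lambda>r. (u r - \<alpha> * Re (of_real \<kappa> * z * exp (\<i> * of_real (k * r)))) - (u r - C * sin (k * r + D))) \<longlongrightarrow> 0 - 0) at_top"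
    by (rule tendsto_diff[OF u uC])
  moreover have "(u r - \<alpha> * Re (of_real \<kappa> * z * exp (\<i> * of_real (k * r)))) - (u r - C * sin (k * r + D))
    = Re ((- \<i> * of_real C * exp (\<i> * of_real D) - of_real (\<alpha> * \<kappa>) * z) * exp (\<i> * of_real (k * r)))" for r
  proof -
    have "\<alpha> * Re (of_real \<kappa> * z * exp (\<i> * of_real (k * r))) = Re (of_real (\<alpha> * \<kappa>) * z * exp (\<i> * of_real (k * r)))"
      by (simp add: algebra_simps)
    then show ?thesis unfolding sin_as_amplitude left_diff_distrib minus_complex.sel by simp
  qed
  ultimately have "((\<lambda>r. Re ((- \<i> * of_real C * exp (\<i> * of_real D) - of_real (\<alpha> * \<kappa>) * z) * exp (\<i> * of_real (k * r)))) \<longlongrightarrow> 0) at_top"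
    by simp
  then have "- \<i> * of_real C * exp (\<i> * of_real D) - of_real (\<alpha> * \<kappa>) * z = 0"
    by (rule oscillation_determines_amplitude[OF k])
  then have Z: "of_real (\<alpha> * \<kappa>) * z = - \<i> * of_real C * exp (\<i> * of_real D)" by simp
  then have \<kappa>: "\<alpha> * \<kappa> \<noteq> 0" using C by auto
  have "z / cnj z = (of_real (\<alpha> * \<kappa>) * z) / cnj (of_real (\<alpha> * \<kappa>) * z)" using \<kappa> by simp
  also have "\<dots> = - (exp (\<i> * of_real D) / exp (- \<i> * of_real D))"
    unfolding Z using C by (simp add: exp_cnj)
  also have "\<dots> = - exp (2 * \<i> * of_real D)" by (simp add: mult.assoc flip: exp_diff)
  finally show ?thesis by simp
qed

text \<open>
  With \<open>X = \<rho>0 exp(i\<pi>/4) exp(- i \<tau>)\<close> and \<open>i cnj (exp(i\<pi>/4)) = exp(i\<pi>/4)\<close>, the far amplitude takes the form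
  \<open>\<rho>0 exp(i\<pi>/4) (exp(- i \<tau>) - exp(- \<pi>\<sigma>) exp(i \<tau>))\<close>. The shift by \<open>\<pi>/4\<close> in \<open>\<tau>\<close> is chosen for this purpose.
\<close>

lemma far_amplitude_oscillation:
  assumes \<sigma>: "\<sigma> > 0" and A: "c * jost_A \<sigma> = of_real \<rho>0 * exp (\<i> * of_real \<alpha>)" "\<rho>0 > 0"
  defines "\<tau> \<equiv> \<lambda>E. \<sigma> * ln (sqrt E) + (pi / 4 - \<alpha>)"
  obtains \<rho> where "\<And>E. \<rho> E > 0"
    "\<And>E. far_amplitude \<sigma> c E = of_real (\<rho> E) * exp (\<i> * of_real (pi / 4 + (circle_phase \<sigma> (\<tau> E) - \<tau> E)))"
proof -
  obtain \<rho> where \<rho>: "\<And>t. \<rho> t > 0" "\<And>t. exp (of_real (pi * \<sigma>)) * exp (- \<i> * of_real t) - exp (\<i> * of_real t)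
     = of_real (\<rho> t) * exp (\<i> * of_real (circle_phase \<sigma> t - t))"
    using circle_phase_equation[OF \<sigma>] by blast
  have eq: "far_amplitude \<sigma> c E = of_real (\<rho>0 * exp (- pi * \<sigma>) * \<rho> (\<tau> E)) * exp (\<i> * of_real (pi / 4 + (circle_phase \<sigma> (\<tau> E) - \<tau> E)))" for E
  proof -
    define X where "X = c * exp (- \<i> * of_real (\<sigma> * ln (sqrt E))) * jost_A \<sigma>"
    define q where "q = exp (\<i> * of_real (pi / 4))"
    define t where "t = \<tau> E"
    have "X = of_real \<rho>0 * (exp (\<i> * of_real \<alpha>) * exp (- \<i> * of_real (\<sigma> * ln (sqrt E))))"
      using A(1) by (simp add: X_def mult_ac)
    also have "exp (\<i> * of_real \<alpha>) * exp (- \<i> * of_real (\<sigma> * ln (sqrt E))) = q * exp (- \<i> * of_real t)"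
      unfolding q_def exp_add[symmetric] by (rule arg_cong[of _ _ exp]) (simp add: t_def \<tau>_def algebra_simps)
    finally have X: "X = of_real \<rho>0 * (q * exp (- \<i> * of_real t))" .
    have q: "\<i> * cnj q = q"
    proof -
      have "q = cis (pi / 4)" by (simp add: q_def cis_conv_exp)
      then show ?thesis by (simp add: complex_eq_iff cos_45 sin_45)
    qed
    have "\<i> * cnj X = of_real \<rho>0 * (\<i> * cnj q * exp (\<i> * of_real t))"
      unfolding X by (simp add: exp_cnj)
    then have X': "\<i> * cnj X = of_real \<rho>0 * (q * exp (\<i> * of_real t))" unfolding q .
    have e: "of_real (exp (- pi * \<sigma>)) * exp (of_real (pi * \<sigma>)) = (1::complex)"
      by (simp add: exp_of_real[symmetric] flip: of_real_mult exp_add)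
    have "far_amplitude \<sigma> c E = X - of_real (exp (- pi * \<sigma>)) * (\<i> * cnj X)"
      unfolding far_amplitude_alt X_def by (simp add: mult_ac)
    also have "\<dots> = of_real \<rho>0 * q * (exp (- \<i> * of_real t) - of_real (exp (- pi * \<sigma>)) * exp (\<i> * of_real t))"
      unfolding X' unfolding X by (simp add: algebra_simps)
    also have "\<dots> = of_real \<rho>0 * q * (of_real (exp (- pi * \<sigma>)) * (exp (of_real (pi * \<sigma>)) * exp (- \<i> * of_real t) - exp (\<i> * of_real t)))"
      unfolding right_diff_distrib mult.assoc[symmetric] mult.assoc[of "of_real \<rho>0 * q" _ "exp (of_real (pi * \<sigma>))"] e by simp
    also have "\<dots> = of_real (\<rho>0 * exp (- pi * \<sigma>) * \<rho> t) * (q * exp (\<i> * of_real (circle_phase \<sigma> t - t)))"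
      unfolding \<rho>(2) by (simp add: mult_ac)
    also have "q * exp (\<i> * of_real (circle_phase \<sigma> t - t)) = exp (\<i> * of_real (pi / 4 + (circle_phase \<sigma> t - t)))"
      unfolding q_def exp_add[symmetric] by (rule arg_cong[of _ _ exp]) (simp add: algebra_simps)
    finally show ?thesis unfolding t_def .
  qed
  have pos: "\<rho>0 * exp (- pi * \<sigma>) * \<rho> (\<tau> E) > 0" for E using A(2) \<rho>(1) by simp
  show ?thesis by (rule that[OF pos eq])
qed

text \<open>
  The denominator is bounded away from zero uniformly in \<open>E\<close>, although it does not converge as \<open>E\<close> tends to 0.
\<close>

lemma far_amplitude_ratio:
  assumes \<sigma>: "\<sigma> > 0" and b: "continuous_on {0..} b" "b 0 \<noteq> 0"
  shows "((\<lambda>E. far_amplitude \<sigma> (b E) E / far_amplitude \<sigma> (b 0) E) \<longlongrightarrow> 1) (at_right 0)"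
proof -
  define m where "m = cmod (b 0 * jost_A \<sigma>) * (1 - exp (- pi * \<sigma>))"
  have m: "m > 0" using b(2) jost_A_nonzero[OF \<sigma>] \<sigma> by (simp add: m_def)
  have X: "cmod (x * exp (- \<i> * of_real (\<sigma> * ln (sqrt E))) * jost_A \<sigma>) = cmod (x * jost_A \<sigma>)" for x E
  proof -
    have "cmod (exp (- \<i> * of_real (\<sigma> * ln (sqrt E)))) = 1" by simp
    then show ?thesis by (simp only: norm_mult mult_1_right)
  qed
  have low: "m \<le> cmod (far_amplitude \<sigma> (b 0) E)" for E
  proof -
    define x where "x = b 0 * exp (- \<i> * of_real (\<sigma> * ln (sqrt E))) * jost_A \<sigma>"
    have "cmod (\<i> * of_real (exp (- pi * \<sigma>)) * cnj x) = exp (- pi * \<sigma>) * cmod x" by (simp add: norm_mult)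
    then have "cmod x - exp (- pi * \<sigma>) * cmod x \<le> cmod (x - \<i> * of_real (exp (- pi * \<sigma>)) * cnj x)"
      using norm_triangle_ineq2[of x "\<i> * of_real (exp (- pi * \<sigma>)) * cnj x"] by simp
    moreover have "cmod x - exp (- pi * \<sigma>) * cmod x = m" unfolding m_def x_def X by (simp add: algebra_simps)
    ultimately show ?thesis unfolding far_amplitude_alt x_def by simp
  qed
  have up: "cmod (far_amplitude \<sigma> (b E) E - far_amplitude \<sigma> (b 0) E) \<le> 2 * cmod ((b E - b 0) * jost_A \<sigma>)" for E
  proof -
    define x where "x = (b E - b 0) * exp (- \<i> * of_real (\<sigma> * ln (sqrt E))) * jost_A \<sigma>"
    have "far_amplitude \<sigma> (b E) E - far_amplitude \<sigma> (b 0) E = x - \<i> * of_real (exp (- pi * \<sigma>)) * cnj x"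
      unfolding far_amplitude_alt x_def by (simp add: algebra_simps)
    also have "cmod \<dots> \<le> cmod x + cmod (\<i> * of_real (exp (- pi * \<sigma>)) * cnj x)" by (rule norm_triangle_ineq4)
    also have "cmod (\<i> * of_real (exp (- pi * \<sigma>)) * cnj x) = exp (- pi * \<sigma>) * cmod x" by (simp add: norm_mult)
    also have "\<dots> \<le> 1 * cmod x" using \<sigma> by (intro mult_right_mono) auto
    finally show ?thesis unfolding x_def X by simp
  qed
  have nz: "far_amplitude \<sigma> (b 0) E \<noteq> 0" for E using low[of E] m by auto
  have "(b \<longlongrightarrow> b 0) (at 0 within {0..})" using b(1) by (simp add: continuous_on_def)
  then have "(b \<longlongrightarrow> b 0) (at_right 0)" by (rule tendsto_within_subset) auto
  then have "((\<lambda>E. 2 * cmod ((b E - b 0) * jost_A \<sigma>) / m) \<longlongrightarrow> 2 * cmod ((b 0 - b 0) * jost_A \<sigma>) / m) (at_right 0)"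
    using m by (intro tendsto_intros) auto
  then have lim: "((\<lambda>E. 2 * cmod ((b E - b 0) * jost_A \<sigma>) / m) \<longlongrightarrow> 0) (at_right 0)" by simp
  have "((\<lambda>E. far_amplitude \<sigma> (b E) E / far_amplitude \<sigma> (b 0) E - 1) \<longlongrightarrow> 0) (at_right 0)"
  proof (rule Lim_null_comparison[OF always_eventually[OF allI] lim])
    fix E
    have "far_amplitude \<sigma> (b E) E / far_amplitude \<sigma> (b 0) E - 1 = (far_amplitude \<sigma> (b E) E - far_amplitude \<sigma> (b 0) E) / far_amplitude \<sigma> (b 0) E"
      using nz[of E] by (simp add: diff_divide_distrib)
    also have "norm \<dots> \<le> 2 * cmod ((b E - b 0) * jost_A \<sigma>) / m"
      unfolding norm_divide by (rule frac_le[OF _ up m low]) simp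
    finally show "norm (far_amplitude \<sigma> (b E) E / far_amplitude \<sigma> (b 0) E - 1) \<le> 2 * cmod ((b E - b 0) * jost_A \<sigma>) / m" .
  qed
  then show ?thesis by (rule LIM_zero_cancel)
qed

theorem theorem1p3:
  fixes d l :: nat and \<gamma> \<sigma> :: real and chi chi' W W2 :: "real \<Rightarrow> real"
  assumes "d \<ge> 2"
    and "cutoff_pair chi chi'"
    and "admissible_potential \<gamma> chi W W2"
    and "\<gamma> > (real l + real d / 2 - 1)\<^sup>2"
    and "\<sigma> = sqrt (\<gamma> - (real l + real d / 2 - 1)\<^sup>2)"
  shows "(\<exists>\<sigma>phy. continuous_on {0<..} \<sigma>phy \<and> phase_shift d l \<gamma> chi chi' W2 \<sigma>phy) \<and>
    (\<forall>\<sigma>phy. continuous_on {0<..} \<sigma>phy \<and> phase_shift d l \<gamma> chi chi' W2 \<sigma>phy \<longrightarrow>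
      (\<exists>C\<^sub>1 C\<^sub>2. ((\<lambda>E. \<sigma>phy E + \<sigma> * ln (sqrt E) - sigma_per \<sigma> (\<sigma> * ln (sqrt E) + C\<^sub>1))
          \<longlongrightarrow> C\<^sub>2) (at_right 0)))"
proof -
  have \<sigma>: "\<sigma> > 0" "\<sigma>\<^sup>2 = \<gamma> - (ang d l)\<^sup>2" using assms(4,5) by (simp_all add: ang_def)
  interpret radial_problem d l \<gamma> \<sigma> chi chi' W W2 using assms \<sigma> by unfold_locales
  obtain b y where bc: "continuous_on {0..} b" and b0: "\<And>E. E \<ge> 0 \<Longrightarrow> b E \<noteq> 0"
    and y: "\<And>E. E > 0 \<Longrightarrow> regular E (y E)" "\<And>E. E > 0 \<Longrightarrow> \<exists>r>0. y E r \<noteq> 0"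
    and ya: "\<And>E. E > 0 \<Longrightarrow> ((\<lambda>r. y E r - 2 / sqrt (sqrt E) * Re (far_amplitude \<sigma> (b E) E * exp (\<i> * of_real (sqrt E * r)))) \<longlongrightarrow> 0) at_top"
    and reg: "\<And>E u. E > 0 \<Longrightarrow> regular E u \<Longrightarrow> \<exists>\<kappa>. ((\<lambda>r. u r - 2 / sqrt (sqrt E) * Re (of_real \<kappa> * far_amplitude \<sigma> (b E) E * exp (\<i> * of_real (sqrt E * r)))) \<longlongrightarrow> 0) at_top"
    by (rule regular_solutions) (rule that, assumption+)
  (* the admissible phase shifts at energy E are the arguments of z E and - z E, shifted by pi/2 + c0 *)
  define z where "z = (\<lambda>E. far_amplitude \<sigma> (b E) E)"
  have z0: "z E \<noteq> 0" if "E > 0" for E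
    unfolding z_def using that by (intro far_amplitude_nonzero \<sigma> b0) simp
  define c0 where "c0 = (real d - 3 + 2 * real l) / 4 * pi"
  show ?thesis
  proof (intro conjI allI impI)
    have "continuous_on {0<..} b" by (rule continuous_on_subset[OF bc]) auto
    then have zc: "continuous_on {0<..} z" unfolding z_def by (rule far_amplitude_continuous)
    have "contractible ({0<..}::real set)" by (intro convex_imp_contractible) simp
    with zc obtain g where gc: "continuous_on {0<..} g" and g: "\<And>E. E \<in> {0<..} \<Longrightarrow> z E = exp (g E)"
      using z0 by (rule continuous_logarithm_on_contractible) auto
    show "\<exists>\<sigma>phy. continuous_on {0<..} \<sigma>phy \<and> phase_shift d l \<gamma> chi chi' W2 \<sigma>phy"
    proof (intro exI conjI)
      show "continuous_on {0<..} (\<lambda>E. Im (g E) + pi / 2 + c0)" by (intro continuous_intros gc)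
      show "phase_shift d l \<gamma> chi chi' W2 (\<lambda>E. Im (g E) + pi / 2 + c0)"
        unfolding phase_shift_def
      proof (intro allI impI)
        fix E :: real assume E: "E > 0"
        (* the sine is turned into the cosine of the amplitude by the shift pi/2 *)
        define C where "C = 2 / sqrt (sqrt E) * exp (Re (g E))"
        have C: "C \<noteq> 0" using E by (simp add: C_def)
        have "C * sin (sqrt E * r + (Im (g E) + pi / 2)) = 2 / sqrt (sqrt E) * Re (z E * exp (\<i> * of_real (sqrt E * r)))" for r
        proof -
          have "Re (z E * exp (\<i> * of_real (sqrt E * r))) = Re (exp (g E + \<i> * of_real (sqrt E * r)))"
            using g[of E] E by (simp only: exp_add greaterThan_iff)
          also have "\<dots> = exp (Re (g E)) * cos (Im (g E) + sqrt E * r)" unfolding Re_exp by simp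
          finally have "Re (z E * exp (\<i> * of_real (sqrt E * r))) = exp (Re (g E)) * cos (Im (g E) + sqrt E * r)" .
          moreover have "sin (sqrt E * r + (Im (g E) + pi / 2)) = cos (Im (g E) + sqrt E * r)"
          proof -
            have "sqrt E * r + (Im (g E) + pi / 2) = (Im (g E) + sqrt E * r) + pi / 2" by simp
            then show ?thesis by (simp only: sin_add sin_pi_half cos_pi_half mult_zero_right mult_1_right add_0_left)
          qed
          ultimately show ?thesis by (simp add: C_def)
        qed
        then have lim: "((\<lambda>r. y E r - C * sin (sqrt E * r + (Im (g E) + pi / 2))) \<longlongrightarrow> 0) at_top"
          using ya[OF E] by (simp only: z_def)
        have s: "Im (g E) + pi / 2 + c0 = Im (g E) + pi / 2 + (real d - 3 + 2 * real l) / 4 * pi" by (simp only: c0_def)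
        show "phase_shift_value d l \<gamma> chi chi' W2 E (Im (g E) + pi / 2 + c0)"
          unfolding phase_shift_value_def
          by (rule exI[of _ "y E"], rule exI[of _ C], rule exI[of _ "Im (g E) + pi / 2"])
             (rule conjI[OF y(1)[OF E] conjI[OF y(2)[OF E] conjI[OF C conjI[OF lim s]]]])
      qed
    qed
  next
    fix \<sigma>phy assume asm: "continuous_on {0<..} \<sigma>phy \<and> phase_shift d l \<gamma> chi chi' W2 \<sigma>phy"
    have ph: "exp (2 * \<i> * of_real (\<sigma>phy E - c0)) = - (z E / cnj (z E))" if E: "E > 0" for E
    proof -
      obtain u C D where u: "regular E u" and C: "C \<noteq> 0"
        and uC: "((\<lambda>r. u r - C * sin (sqrt E * r + D)) \<longlongrightarrow> 0) at_top" and D: "\<sigma>phy E = D + c0"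
        using asm E unfolding phase_shift_def phase_shift_value_def c0_def by blast
      obtain \<kappa> where \<kappa>: "((\<lambda>r. u r - 2 / sqrt (sqrt E) * Re (of_real \<kappa> * z E * exp (\<i> * of_real (sqrt E * r)))) \<longlongrightarrow> 0) at_top"
        using reg[OF E u] unfolding z_def by blast
      have "exp (2 * \<i> * of_real D) = - (z E / cnj (z E))"
        by (rule amplitude_phase[OF _ _ C \<kappa> uC]) (use E in auto)
      then show ?thesis using D by simp
    qed
    define \<alpha> where "\<alpha> = Arg (b 0 * jost_A \<sigma>)"
    have bA: "b 0 * jost_A \<sigma> \<noteq> 0" using b0[of 0] jost_A_nonzero[OF \<sigma>(1)] by simp
    have A: "b 0 * jost_A \<sigma> = of_real (cmod (b 0 * jost_A \<sigma>)) * exp (\<i> * of_real \<alpha>)"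
      using bA unfolding \<alpha>_def by (intro Arg_eq)
    have A': "cmod (b 0 * jost_A \<sigma>) > 0" using bA by simp
    define C1 where "C1 = pi / 4 - \<alpha>"
    define \<tau> where "\<tau> = (\<lambda>E. \<sigma> * ln (sqrt E) + C1)"
    define p where "p = circle_phase \<sigma>"
    obtain \<rho> where \<rho>: "\<And>E. \<rho> E > 0" and Z: "\<And>E. far_amplitude \<sigma> (b 0) E = of_real (\<rho> E) * exp (\<i> * of_real (pi / 4 + (p (\<tau> E) - \<tau> E)))"
      using far_amplitude_oscillation[OF \<sigma>(1) A A'] unfolding \<tau>_def C1_def p_def by blast
    (* chosen such that the comparison amplitude contributes exactly the phase of sigma_per *)
    define C2 where "C2 = c0 - C1 - pi / 4"
    define \<psi> where "\<psi> = (\<lambda>E. \<sigma>phy E + \<sigma> * ln (sqrt E) - p (\<tau> E) - C2)"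
    (* compare with the solution whose amplitude is frozen at zero energy *)
    define q where "q = (\<lambda>E. z E / far_amplitude \<sigma> (b 0) E)"
    have q: "(q \<longlongrightarrow> 1) (at_right 0)"
      unfolding q_def z_def by (rule far_amplitude_ratio[OF \<sigma>(1) bc b0]) simp
    have \<psi>q: "exp (2 * \<i> * of_real (\<psi> E)) = q E / cnj (q E)" if E: "E > 0" for E
    proof -
      define \<theta> where "\<theta> = pi / 4 + (p (\<tau> E) - \<tau> E)"
      have \<psi>: "\<psi> E = (\<sigma>phy E - c0) + (pi / 2 - \<theta>)"
        by (simp add: \<psi>_def C2_def \<theta>_def \<tau>_def)
      have split: "2 * \<i> * of_real (a + (pi / 2 - \<theta>)) = 2 * \<i> * of_real a + (of_real pi * \<i> - 2 * \<i> * of_real \<theta>)" for a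
        by (simp add: field_simps)
      have "exp (2 * \<i> * of_real (\<psi> E)) = exp (2 * \<i> * of_real (\<sigma>phy E - c0) + (of_real pi * \<i> - 2 * \<i> * of_real \<theta>))"
        by (simp only: \<psi> split)
      also have "\<dots> = exp (2 * \<i> * of_real (\<sigma>phy E - c0)) * (exp (of_real pi * \<i>) / exp (2 * \<i> * of_real \<theta>))"
        by (simp only: exp_add exp_diff)
      also have "\<dots> = (z E / cnj (z E)) / exp (2 * \<i> * of_real \<theta>)" unfolding ph[OF E] exp_pi_i by simp
      also have "exp (2 * \<i> * of_real \<theta>) = far_amplitude \<sigma> (b 0) E / cnj (far_amplitude \<sigma> (b 0) E)"
      proof -
        have "far_amplitude \<sigma> (b 0) E / cnj (far_amplitude \<sigma> (b 0) E) = exp (\<i> * of_real \<theta>) / exp (- \<i> * of_real \<theta>)"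
          unfolding Z \<theta>_def[symmetric] using \<rho>[of E] by (simp add: exp_cnj)
        also have "\<dots> = exp (2 * \<i> * of_real \<theta>)" by (simp add: mult.assoc flip: exp_diff)
        finally show ?thesis by simp
      qed
      finally show ?thesis by (simp add: q_def)
    qed
    have "((\<lambda>E. q E / cnj (q E)) \<longlongrightarrow> 1 / cnj 1) (at_right 0)" by (intro tendsto_intros q) simp
    then have "((\<lambda>E. q E / cnj (q E)) \<longlongrightarrow> 1) (at_right 0)" by simp
    then have "((\<lambda>E. exp (2 * \<i> * of_real (\<psi> E))) \<longlongrightarrow> 1) (at_right 0)"
    proof (rule Lim_transform_eventually)
      show "\<forall>\<^sub>F E in at_right 0. q E / cnj (q E) = exp (2 * \<i> * of_real (\<psi> E))"
        using eventually_at_right_less[of "0::real"] by eventually_elim (simp add: \<psi>q)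
    qed
    moreover have "continuous_on {0<..} \<psi>"
    proof -
      have 1: "continuous_on {0<..} \<tau>" unfolding \<tau>_def by (intro continuous_intros) auto
      have 2: "continuous_on {0<..} (\<lambda>E. p (\<tau> E))"
        unfolding p_def by (rule continuous_on_compose2[OF circle_phase_continuous[OF \<sigma>(1)] 1]) auto
      show ?thesis unfolding \<psi>_def using asm by (intro continuous_intros 2) auto
    qed
    ultimately obtain L where L: "(\<psi> \<longlongrightarrow> L) (at_right 0)" using continuous_phase_converges by blast
    have "((\<lambda>E. \<psi> E + C2) \<longlongrightarrow> L + C2) (at_right 0)" by (intro tendsto_intros L)
    then have "((\<lambda>E. \<sigma>phy E + \<sigma> * ln (sqrt E) - sigma_per \<sigma> (\<sigma> * ln (sqrt E) + C1)) \<longlongrightarrow> L + C2) (at_right 0)"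
      unfolding \<psi>_def sigma_per_eq_circle_phase[OF \<sigma>(1)] p_def \<tau>_def by simp
    then show "\<exists>C\<^sub>1 C\<^sub>2. ((\<lambda>E. \<sigma>phy E + \<sigma> * ln (sqrt E) - sigma_per \<sigma> (\<sigma> * ln (sqrt E) + C\<^sub>1)) \<longlongrightarrow> C\<^sub>2) (at_right 0)"
      by blast
  qed
qed

end
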